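(* Let $n>0$ and let $B_0$ be a base hierarchy such that there is no $k\ge2$ for which $B_0$ satisfies all of: (i) $S_{B_0}(b)\le b^2$ for every $b\in B_0$, (ii) there is no chain of elements $b_0<\dots<b_{n+1}$ of $B_0$ with $S_{B_0}(b_i)>b_i\cdots b_0$ for all $0\le i\le n+1$, and (iii) $\min B_0\le k$. Define $B_{i+1}=(B_i)_{+(i+1)}$ for every $i$ and $\mathcal B=(B_i)_{i\in\mathbb N}$. Then $\mathsf{RCA}_0+(\Sigma^0_{2n+2})\text{-}\mathrm{IND}$ does not prove that for every $m$ there is some $i$ such that $\mathbb G^{\mathcal B}_i(m)=0$.
   Context: Let $\mathbb N=\{0,1,2,\dots\}$; $\infty$ is regarded as greater than, and divisible by, every positive integer. For $b\ge 2$ and $n>0$, the $b$-decomposition of $n$ is the unique $n=b^e a+r$ with $b^e\le n<b^{e+1}$, $0<a<b$, $r<b^e$. For nonempty $B\subseteq\mathbb N\setminus\{0,1\}$: $\mathrm{base}_B(n)=\max\{b\in B: b\le n\}$ if $n\ge\min B$, else $\min B$; $S_B(n)=\min\{b\in B:b>n\}$ if this exists, else $\infty$. A base hierarchy is a nonempty $B\subseteq\mathbb N\setminus\{0,1\}$ with $b\mid S_B(b)$ for all $b\in B$. $n$ is $B$-critical if $\mathrm{base}_B(n)\mid n$. Upgrade: for base hierarchies $B,C$ with $\min B\le\min C$, define ${\uparrow}n={\uparrow}_B^C n\in\mathbb N\cup\{\infty\}$ recursively. If $n<\min B$, ${\uparrow}n=n$. Otherwise $b=\mathrm{base}_B(n)$;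 for an integer $c\ge2$ define $\langle b\to c\rangle m={\uparrow}m$ if $m<b$, and $\langle b\to c\rangle m=c^{\langle b\to c\rangle e}\cdot{\uparrow}a+\langle b\to c\rangle r$ if $m\ge b$ has $b$-decomposition $m=b^ea+r$. Then ${\uparrow}n=\langle b\to c\rangle n$ where $c$ is the least element of $C$ with ${\uparrow}(n-1)<\langle b\to c\rangle n<S_C(c)$; ${\uparrow}n=\infty$ if none exists. Ouroboros successor: for a base hierarchy $B$ and integer $i\ge1$, $B_{+i}=\bigcup_{n}B^n_{+i}$, where recursively $B^n_{+i}=\{\min B+1\}$ for $n\le\min B$, and for $n>\min B$, with $c=\max B^{n-1}_{+i}$ and operators $\langle\cdot\to\cdot\rangle$ taken with respect to ${\uparrow}_B^{B^{n-1}_{+i}}$: (a) if $n$ is not $B$-critical, $B^n_{+i}=B^{n-1}_{+i}$; (b) if $n\in B$, let $b=\mathrm{base}_B(n-1)$ and $B^n_{+i}=B^{n-1}_{+i}\cup\{ca\}$ with $a$ least such that $\langle b\to c\rangle(n-1)<ca$; (c) if $n\notin B$ is $B$-critical, let $b=\mathrm{base}_B(n)$, $d_0=c$, $d_{j+1}=\langle b\to d_j\rangle n$, and $B^n_{+i}=B^{n-1}_{+i}\cup\{d_1,\dots,d_i\}$. Goodstein sequence: $\mathbb G^{\mathcal B}_0(m)=m$, $\mathbb G^{\mathcal B}_{i+1}(m)={\uparrow}_{B_i}^{B_{i+1}}\mathbb G^{\mathcal B}_i(m)-1$ if $\mathbb G^{\mathcal B}_i(m)>0$, else $0$. *)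

theory Defs
  imports Main "HOL-Library.Extended_Nat"
begin

section \<open>Base hierarchies\<close>

definition next_base :: "nat set \<Rightarrow> nat \<Rightarrow> enat" where
  "next_base B n = (if \<exists>b\<in>B. n < b then enat (LEAST b. b \<in> B \<and> n < b) else \<infinity>)"

definition base_hierarchy :: "nat set \<Rightarrow> bool" where
  "base_hierarchy B \<longleftrightarrow> B \<noteq> {} \<and> 0 \<notin> B \<and> 1 \<notin> B \<and>
     (\<forall>b\<in>B. case next_base B b of enat s \<Rightarrow> b dvd s | \<infinity> \<Rightarrow> True)"

definition bounded_hierarchy :: "nat \<Rightarrow> nat \<Rightarrow> nat set \<Rightarrow> bool" where
  "bounded_hierarchy n k B \<longleftrightarrow>
     (\<forall>b\<in>B. next_base B b \<le> enat (b ^ 2)) \<and>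
     (\<nexists>c :: nat \<Rightarrow> nat. (\<forall>i \<le> n + 1. c i \<in> B) \<and> (\<forall>i \<le> n. c i < c (i + 1)) \<and>
        (\<forall>i \<le> n + 1. next_base B (c i) > enat (\<Prod>j\<le>i. c j))) \<and>
     (LEAST b. b \<in> B) \<le> k"


section \<open>Second-order arithmetic\<close>

text \<open>
  De Bruijn indices, separately for number variables and set variables. \<open>Name\<close> is a set constant
  added to the language of second-order arithmetic, in order to speak about an arbitrary, possibly
  non-computable, set of natural numbers. RCA0 itself says nothing specific about it (see \<open>naming\<close>).
\<close>

datatype tm = Var nat | Zero | One | Add tm tm | Mul tm tm

datatype st = SVar nat | Name

datatype fm = Eq tm tm | Less tm tm | Mem tm st | Fls | Imp fm fm | Forall fm | ForallS fm

abbreviation Neg :: "fm \<Rightarrow> fm" where "Neg p \<equiv> Imp p Fls"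
abbreviation Conj :: "fm \<Rightarrow> fm \<Rightarrow> fm" where "Conj p q \<equiv> Neg (Imp p (Neg q))"
abbreviation Disj :: "fm \<Rightarrow> fm \<Rightarrow> fm" where "Disj p q \<equiv> Imp (Neg p) q"
abbreviation Iff :: "fm \<Rightarrow> fm \<Rightarrow> fm" where "Iff p q \<equiv> Conj (Imp p q) (Imp q p)"
abbreviation Exists :: "fm \<Rightarrow> fm" where "Exists p \<equiv> Neg (Forall (Neg p))"
abbreviation ExistsS :: "fm \<Rightarrow> fm" where "ExistsS p \<equiv> Neg (ForallS (Neg p))"

primrec subst_tm :: "(nat \<Rightarrow> tm) \<Rightarrow> tm \<Rightarrow> tm" where
  "subst_tm f (Var k) = f k"
| "subst_tm f Zero = Zero"
| "subst_tm f One = One"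
| "subst_tm f (Add s t) = Add (subst_tm f s) (subst_tm f t)"
| "subst_tm f (Mul s t) = Mul (subst_tm f s) (subst_tm f t)"

primrec subst_st :: "(nat \<Rightarrow> st) \<Rightarrow> st \<Rightarrow> st" where
  "subst_st g (SVar k) = g k"
| "subst_st g Name = Name"

primrec subst :: "(nat \<Rightarrow> tm) \<Rightarrow> (nat \<Rightarrow> st) \<Rightarrow> fm \<Rightarrow> fm" where
  "subst f g (Eq s t) = Eq (subst_tm f s) (subst_tm f t)"
| "subst f g (Less s t) = Less (subst_tm f s) (subst_tm f t)"
| "subst f g (Mem t X) = Mem (subst_tm f t) (subst_st g X)"
| "subst f g Fls = Fls"
| "subst f g (Imp p q) = Imp (subst f g p) (subst f g q)"
| "subst f g (Forall p) =
     Forall (subst (case_nat (Var 0) (\<lambda>k. subst_tm (\<lambda>l. Var (Suc l)) (f k))) g p)"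
| "subst f g (ForallS p) =
     ForallS (subst f (case_nat (SVar 0) (\<lambda>k. subst_st (\<lambda>l. SVar (Suc l)) (g k))) p)"

abbreviation lift_tm :: "tm \<Rightarrow> tm" where "lift_tm \<equiv> subst_tm (\<lambda>k. Var (Suc k))"
abbreviation lift :: "fm \<Rightarrow> fm" where "lift \<equiv> subst (\<lambda>k. Var (Suc k)) SVar"
abbreviation liftS :: "fm \<Rightarrow> fm" where "liftS \<equiv> subst Var (\<lambda>k. SVar (Suc k))"
abbreviation inst :: "fm \<Rightarrow> tm \<Rightarrow> fm" where "inst p t \<equiv> subst (case_nat t Var) SVar p"
abbreviation instS :: "fm \<Rightarrow> st \<Rightarrow> fm" where "instS p X \<equiv> subst Var (case_nat X SVar) p"

primrec num :: "nat \<Rightarrow> tm" where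
  "num 0 = Zero"
| "num (Suc k) = Add (num k) One"

text \<open>
  Classical two-sorted logic with equality for numbers. The generalisation rules are unrestricted,
  so an axiom with free variables has the same consequences as its universal closure.
\<close>

inductive proves :: "fm set \<Rightarrow> fm \<Rightarrow> bool" (infix "\<turnstile>" 50) for T :: "fm set" where
  axiom: "p \<in> T \<Longrightarrow> T \<turnstile> p"
| K: "T \<turnstile> Imp p (Imp q p)"
| S: "T \<turnstile> Imp (Imp p (Imp q r)) (Imp (Imp p q) (Imp p r))"
| DN: "T \<turnstile> Imp (Neg (Neg p)) p"
| MP: "T \<turnstile> Imp p q \<Longrightarrow> T \<turnstile> p \<Longrightarrow> T \<turnstile> q"
| spec: "T \<turnstile> Imp (Forall p) (inst p t)"
| distr: "T \<turnstile> Imp (Forall (Imp (lift p) q)) (Imp p (Forall q))"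
| gen: "T \<turnstile> p \<Longrightarrow> T \<turnstile> Forall p"
| specS: "T \<turnstile> Imp (ForallS p) (instS p X)"
| distrS: "T \<turnstile> Imp (ForallS (Imp (liftS p) q)) (Imp p (ForallS q))"
| genS: "T \<turnstile> p \<Longrightarrow> T \<turnstile> ForallS p"
| refl: "T \<turnstile> Eq t t"
| leibniz: "T \<turnstile> Imp (Eq s t) (Imp (inst p s) (inst p t))"

text \<open>The arithmetical hierarchy; set variables may occur free as parameters.\<close>

inductive_set bounded_fms :: "fm set" where
  "Eq s t \<in> bounded_fms"
| "Less s t \<in> bounded_fms"
| "Mem t X \<in> bounded_fms"
| "Fls \<in> bounded_fms"
| "p \<in> bounded_fms \<Longrightarrow> q \<in> bounded_fms \<Longrightarrow> Imp p q \<in> bounded_fms"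
| "p \<in> bounded_fms \<Longrightarrow> Forall (Imp (Less (Var 0) (lift_tm t)) p) \<in> bounded_fms"
| "p \<in> bounded_fms \<Longrightarrow> Exists (Conj (Less (Var 0) (lift_tm t)) p) \<in> bounded_fms"

fun Sigma0 :: "nat \<Rightarrow> fm set" and Pi0 :: "nat \<Rightarrow> fm set" where
  "Sigma0 0 = bounded_fms"
| "Sigma0 (Suc k) = Exists ` Pi0 k"
| "Pi0 0 = bounded_fms"
| "Pi0 (Suc k) = Forall ` Sigma0 k"

definition basic_axioms :: "fm set" where
  "basic_axioms = (let m = Var 0; n = Var 1 in
    {Neg (Eq (Add n One) Zero),
     Imp (Eq (Add m One) (Add n One)) (Eq m n),
     Eq (Add m Zero) m,
     Eq (Add m (Add n One)) (Add (Add m n) One),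
     Eq (Mul m Zero) Zero,
     Eq (Mul m (Add n One)) (Add (Mul m n) m),
     Neg (Less m Zero),
     Iff (Less m (Add n One)) (Disj (Less m n) (Eq m n))})"

definition IND :: "fm set \<Rightarrow> fm set" where
  "IND F = {Imp (Conj (inst p Zero)
                   (Forall (Imp p (subst (case_nat (Add (Var 0) One) (\<lambda>k. Var (Suc k))) SVar p))))
              (Forall p) | p. p \<in> F}"

definition Delta1_CA :: "fm set" where
  "Delta1_CA = {Imp (Forall (Iff p q)) (ExistsS (Forall (Iff (Mem (Var 0) (SVar 0)) (liftS p)))) |
                 p q. p \<in> Sigma0 1 \<and> q \<in> Pi0 1}"

definition RCA0 :: "fm set" where
  "RCA0 = basic_axioms \<union> IND (Sigma0 1) \<union> Delta1_CA"


section \<open>Notation for building formulas\<close>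

text \<open>
  To write formulas with ordinary bound variables, terms and formulas are represented as functions
  of the number of enclosing quantifiers (for number and for set variables). A variable bound at
  depth \<open>d\<close> and used at depth \<open>d'\<close> has de Bruijn index \<open>d' - d - 1\<close>. A formula \<open>A\<close> so represented
  denotes the formula \<open>A 0 0\<close>.
\<close>

type_synonym TM = "nat \<Rightarrow> tm"
type_synonym ST = "nat \<Rightarrow> st"
type_synonym FM = "nat \<Rightarrow> nat \<Rightarrow> fm"

definition all :: "(TM \<Rightarrow> FM) \<Rightarrow> FM" (binder "\<^bold>\<forall>" 10) where
  "all A = (\<lambda>d s. Forall (A (\<lambda>d'. Var (d' - d - 1)) (d + 1) s))"
definition allS :: "(ST \<Rightarrow> FM) \<Rightarrow> FM" (binder "\<^bold>\<forall>\<^sub>S" 10) where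
  "allS A = (\<lambda>d s. ForallS (A (\<lambda>s'. SVar (s' - s - 1)) d (s + 1)))"
definition neg :: "FM \<Rightarrow> FM" ("\<^bold>\<not> _" [40] 40) where "(\<^bold>\<not> A) = (\<lambda>d s. Neg (A d s))"
definition ex :: "(TM \<Rightarrow> FM) \<Rightarrow> FM" (binder "\<^bold>\<exists>" 10) where
  "ex A = (\<^bold>\<not> (\<^bold>\<forall>x. \<^bold>\<not> A x))"
definition exS :: "(ST \<Rightarrow> FM) \<Rightarrow> FM" (binder "\<^bold>\<exists>\<^sub>S" 10) where
  "exS A = (\<^bold>\<not> (\<^bold>\<forall>\<^sub>SX. \<^bold>\<not> A X))"
definition conj :: "FM \<Rightarrow> FM \<Rightarrow> FM" (infixr "\<^bold>\<and>" 35) where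
  "(A \<^bold>\<and> B) = (\<lambda>d s. Conj (A d s) (B d s))"
definition disj :: "FM \<Rightarrow> FM \<Rightarrow> FM" (infixr "\<^bold>\<or>" 30) where
  "(A \<^bold>\<or> B) = (\<lambda>d s. Disj (A d s) (B d s))"
definition imp :: "FM \<Rightarrow> FM \<Rightarrow> FM" (infixr "\<^bold>\<longrightarrow>" 25) where
  "(A \<^bold>\<longrightarrow> B) = (\<lambda>d s. Imp (A d s) (B d s))"
definition iff :: "FM \<Rightarrow> FM \<Rightarrow> FM" (infixr "\<^bold>\<longleftrightarrow>" 25) where
  "(A \<^bold>\<longleftrightarrow> B) = (\<lambda>d s. Iff (A d s) (B d s))"

definition zero :: TM ("\<^bold>0") where "\<^bold>0 = (\<lambda>d. Zero)"
definition one :: TM ("\<^bold>1") where "\<^bold>1 = (\<lambda>d. One)"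
definition add :: "TM \<Rightarrow> TM \<Rightarrow> TM" (infixl "\<^bold>+" 65) where "x \<^bold>+ y = (\<lambda>d. Add (x d) (y d))"
definition mul :: "TM \<Rightarrow> TM \<Rightarrow> TM" (infixl "\<^bold>*" 70) where "x \<^bold>* y = (\<lambda>d. Mul (x d) (y d))"

definition eq :: "TM \<Rightarrow> TM \<Rightarrow> FM" (infix "\<^bold>=" 50) where "(x \<^bold>= y) = (\<lambda>d s. Eq (x d) (y d))"
definition less :: "TM \<Rightarrow> TM \<Rightarrow> FM" (infix "\<^bold><" 50) where "(x \<^bold>< y) = (\<lambda>d s. Less (x d) (y d))"
definition leq :: "TM \<Rightarrow> TM \<Rightarrow> FM" (infix "\<^bold>\<le>" 50) where "(x \<^bold>\<le> y) = (x \<^bold>< y \<^bold>\<or> x \<^bold>= y)"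
definition dvds :: "TM \<Rightarrow> TM \<Rightarrow> FM" (infix "\<^bold>|" 50) where "(x \<^bold>| y) = (\<^bold>\<exists>z. y \<^bold>= x \<^bold>* z)"

text \<open>Sets of pairs, triples etc. as relations, with the usual pairing function.\<close>

definition pair :: "TM \<Rightarrow> TM \<Rightarrow> TM" where
  "pair x y = (x \<^bold>+ y) \<^bold>* (x \<^bold>+ y) \<^bold>+ x"

definition rel1 :: "ST \<Rightarrow> TM \<Rightarrow> FM" where "rel1 X x = (\<lambda>d s. Mem (x d) (X s))"
definition rel2 :: "ST \<Rightarrow> TM \<Rightarrow> TM \<Rightarrow> FM" where "rel2 X x y = rel1 X (pair x y)"
definition rel3 :: "ST \<Rightarrow> TM \<Rightarrow> TM \<Rightarrow> TM \<Rightarrow> FM" where "rel3 X x y z = rel2 X x (pair y z)"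
definition rel4 :: "ST \<Rightarrow> TM \<Rightarrow> TM \<Rightarrow> TM \<Rightarrow> TM \<Rightarrow> FM" where
  "rel4 X x y z u = rel3 X x y (pair z u)"
definition rel5 :: "ST \<Rightarrow> TM \<Rightarrow> TM \<Rightarrow> TM \<Rightarrow> TM \<Rightarrow> TM \<Rightarrow> FM" where
  "rel5 X x y z u v = rel4 X x y z (pair u v)"

text \<open>
  The class defined by a formula \<open>\<beta>\<close> whose number variable 0 is the argument; the remaining free
  variables of \<open>\<beta>\<close> are parameters, kept free.
\<close>

definition class_of :: "fm \<Rightarrow> TM \<Rightarrow> FM" where
  "class_of \<beta> x = (\<lambda>d s. subst (case_nat (x d) (\<lambda>k. Var (k + d))) (\<lambda>k. SVar (k + s)) \<beta>)"


section \<open>The Goodstein process inside second-order arithmetic\<close>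

type_synonym CLASS = "TM \<Rightarrow> FM"

definition is_min :: "CLASS \<Rightarrow> TM \<Rightarrow> FM" where
  "is_min B b = (B b \<^bold>\<and> (\<^bold>\<forall>y. B y \<^bold>\<longrightarrow> b \<^bold>\<le> y))"

definition is_max :: "CLASS \<Rightarrow> TM \<Rightarrow> FM" where
  "is_max B b = (B b \<^bold>\<and> (\<^bold>\<forall>y. B y \<^bold>\<longrightarrow> y \<^bold>\<le> b))"

definition is_base :: "CLASS \<Rightarrow> TM \<Rightarrow> TM \<Rightarrow> FM" where
  "is_base B n b =
     (is_max (\<lambda>y. B y \<^bold>\<and> y \<^bold>\<le> n) b \<^bold>\<or> (n \<^bold>< b \<^bold>\<and> is_min B b))"

text \<open>\<open>v < S\<^sub>B(c)\<close>, including the case that the latter is infinite.\<close>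

definition less_next :: "CLASS \<Rightarrow> TM \<Rightarrow> TM \<Rightarrow> FM" where
  "less_next B v c = (\<^bold>\<forall>y. B y \<^bold>\<and> c \<^bold>< y \<^bold>\<longrightarrow> v \<^bold>< y)"

definition hierarchy :: "CLASS \<Rightarrow> FM" where
  "hierarchy B = ((\<^bold>\<exists>b. B b) \<^bold>\<and> \<^bold>\<not> B \<^bold>0 \<^bold>\<and> \<^bold>\<not> B \<^bold>1 \<^bold>\<and>
     (\<^bold>\<forall>b. B b \<^bold>\<longrightarrow> (\<^bold>\<forall>s. is_min (\<lambda>y. B y \<^bold>\<and> b \<^bold>< y) s \<^bold>\<longrightarrow> b \<^bold>| s)))"

definition critical :: "CLASS \<Rightarrow> TM \<Rightarrow> FM" where
  "critical B n = (\<^bold>\<exists>b. is_base B n b \<^bold>\<and> b \<^bold>| n)"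

text \<open>
  In the following, a partial function is represented by its graph, the last argument of which is
  the value, and the value \<open>\<infinity>\<close> by being undefined. Each graph is pinned down by the recursion
  equations of the function it stands for.
\<close>

text \<open>\<open>E b e v\<close>: \<open>b\<^sup>e = v\<close>.\<close>

definition is_exp :: "(TM \<Rightarrow> TM \<Rightarrow> TM \<Rightarrow> FM) \<Rightarrow> FM" where
  "is_exp E = (\<^bold>\<forall>b e v. E b e v \<^bold>\<longleftrightarrow>
     (e \<^bold>= \<^bold>0 \<^bold>\<and> v \<^bold>= \<^bold>1) \<^bold>\<or> (\<^bold>\<exists>e' v'. e \<^bold>= e' \<^bold>+ \<^bold>1 \<^bold>\<and> E b e' v' \<^bold>\<and> v \<^bold>= v' \<^bold>* b))"

definition decomposition ::
    "(TM \<Rightarrow> TM \<Rightarrow> TM \<Rightarrow> FM) \<Rightarrow> TM \<Rightarrow> TM \<Rightarrow> TM \<Rightarrow> TM \<Rightarrow> TM \<Rightarrow> FM" where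
  "decomposition E b m e a r = (\<^bold>\<exists>p q. E b e p \<^bold>\<and> E b (e \<^bold>+ \<^bold>1) q \<^bold>\<and>
     m \<^bold>= p \<^bold>* a \<^bold>+ r \<^bold>\<and> p \<^bold>\<le> m \<^bold>\<and> m \<^bold>< q \<^bold>\<and> \<^bold>0 \<^bold>< a \<^bold>\<and> a \<^bold>< b \<^bold>\<and> r \<^bold>< p)"

text \<open>
  \<open>U n v\<close>: \<open>v\<close> is the upgrade of \<open>n\<close> from \<open>B\<close> to \<open>C\<close>; and \<open>A b c m v\<close>: \<open>\<langle>b \<rightarrow> c\<rangle> m = v\<close>. If the
  upgrade is infinite at some number, it is so at all larger ones; so evaluating an expression that
  contains an infinite value to \<open>\<infinity>\<close> (undefined) agrees with the definition.
\<close>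

definition is_upgrade ::
    "(TM \<Rightarrow> TM \<Rightarrow> TM \<Rightarrow> FM) \<Rightarrow> CLASS \<Rightarrow> CLASS \<Rightarrow>
     (TM \<Rightarrow> TM \<Rightarrow> FM) \<Rightarrow> (TM \<Rightarrow> TM \<Rightarrow> TM \<Rightarrow> TM \<Rightarrow> FM) \<Rightarrow> FM" where
  "is_upgrade E B C U A =
    ((\<^bold>\<forall>b c m v. A b c m v \<^bold>\<longleftrightarrow>
        (m \<^bold>< b \<^bold>\<and> U m v) \<^bold>\<or>
        (b \<^bold>\<le> m \<^bold>\<and> (\<^bold>\<exists>e a r e' a' r' p. decomposition E b m e a r \<^bold>\<and>
            A b c e e' \<^bold>\<and> U a a' \<^bold>\<and> A b c r r' \<^bold>\<and> E c e' p \<^bold>\<and> v \<^bold>= p \<^bold>* a' \<^bold>+ r'))) \<^bold>\<and>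
     (\<^bold>\<forall>n v. U n v \<^bold>\<longleftrightarrow>
        ((\<^bold>\<forall>b. is_min B b \<^bold>\<longrightarrow> n \<^bold>< b) \<^bold>\<and> v \<^bold>= n) \<^bold>\<or>
        ((\<^bold>\<exists>b. is_min B b \<^bold>\<and> b \<^bold>\<le> n) \<^bold>\<and>
         (\<^bold>\<exists>b n' u. is_base B n b \<^bold>\<and> n \<^bold>= n' \<^bold>+ \<^bold>1 \<^bold>\<and> U n' u \<^bold>\<and>
           (\<^bold>\<exists>c. is_min (\<lambda>c. C c \<^bold>\<and> (\<^bold>\<exists>w. A b c n w \<^bold>\<and> u \<^bold>< w \<^bold>\<and> less_next C w c)) c \<^bold>\<and>
                A b c n v)))))"

definition upgrade ::
    "(TM \<Rightarrow> TM \<Rightarrow> TM \<Rightarrow> FM) \<Rightarrow> CLASS \<Rightarrow> CLASS \<Rightarrow> TM \<Rightarrow> TM \<Rightarrow> FM" where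
  "upgrade E B C n v = (\<^bold>\<exists>\<^sub>S U A. is_upgrade E B C (rel2 U) (rel4 A) \<^bold>\<and> rel2 U n v)"

text \<open>
  \<open>K n\<close> is the \<open>n\<close>-th stage of the construction of the Ouroboros successor of \<open>B\<close>, with \<open>U n\<close> and
  \<open>A n\<close> the operators with respect to the upgrade from \<open>B\<close> to \<open>K n\<close>; \<open>D n j\<close> is the number \<open>d\<^sub>j\<close>
  computed at stage \<open>n\<close>, for \<open>n > min B\<close>.
\<close>

definition is_ouroboros_construction ::
    "(TM \<Rightarrow> TM \<Rightarrow> TM \<Rightarrow> FM) \<Rightarrow> CLASS \<Rightarrow> TM \<Rightarrow> (TM \<Rightarrow> CLASS) \<Rightarrow>
     (TM \<Rightarrow> TM \<Rightarrow> TM \<Rightarrow> FM) \<Rightarrow> (TM \<Rightarrow> TM \<Rightarrow> TM \<Rightarrow> TM \<Rightarrow> TM \<Rightarrow> FM) \<Rightarrow>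
     (TM \<Rightarrow> TM \<Rightarrow> TM \<Rightarrow> FM) \<Rightarrow> FM" where
  "is_ouroboros_construction E B i K U A D =
    ((\<^bold>\<forall>n. is_upgrade E B (K n) (U n) (A n)) \<^bold>\<and>
     (\<^bold>\<forall>n j x. D n j x \<^bold>\<longleftrightarrow> (\<^bold>\<exists>n' l. n \<^bold>= n' \<^bold>+ \<^bold>1 \<^bold>\<and> is_min B l \<^bold>\<and> l \<^bold>< n \<^bold>\<and>
        ((j \<^bold>= \<^bold>0 \<^bold>\<and> is_max (K n') x) \<^bold>\<or>
         (\<^bold>\<exists>j' x' b. j \<^bold>= j' \<^bold>+ \<^bold>1 \<^bold>\<and> D n j' x' \<^bold>\<and> is_base B n b \<^bold>\<and> A n' b x' n x)))) \<^bold>\<and>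
     (\<^bold>\<forall>n x. K n x \<^bold>\<longleftrightarrow> (\<^bold>\<exists>l. is_min B l \<^bold>\<and>
        ((n \<^bold>\<le> l \<^bold>\<and> x \<^bold>= l \<^bold>+ \<^bold>1) \<^bold>\<or>
         (l \<^bold>< n \<^bold>\<and> (\<^bold>\<exists>n'. n \<^bold>= n' \<^bold>+ \<^bold>1 \<^bold>\<and>
           (K n' x \<^bold>\<or>
            (B n \<^bold>\<and> (\<^bold>\<exists>b c w a. is_base B n' b \<^bold>\<and> is_max (K n') c \<^bold>\<and> A n' b c n' w \<^bold>\<and>
                is_min (\<lambda>a. w \<^bold>< c \<^bold>* a) a \<^bold>\<and> x \<^bold>= c \<^bold>* a)) \<^bold>\<or>
            (\<^bold>\<not> B n \<^bold>\<and> critical B n \<^bold>\<and> (\<^bold>\<exists>j. \<^bold>1 \<^bold>\<le> j \<^bold>\<and> j \<^bold>\<le> i \<^bold>\<and> D n j x)))))))))"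

definition is_ouroboros ::
    "(TM \<Rightarrow> TM \<Rightarrow> TM \<Rightarrow> FM) \<Rightarrow> CLASS \<Rightarrow> TM \<Rightarrow> CLASS \<Rightarrow> FM" where
  "is_ouroboros E B i C =
    (\<^bold>\<exists>\<^sub>S K U A D. is_ouroboros_construction E B i (rel2 K) (rel3 U) (rel5 A) (rel3 D) \<^bold>\<and>
       (\<^bold>\<forall>x. C x \<^bold>\<longleftrightarrow> (\<^bold>\<exists>n. rel2 K n x)))"

text \<open>\<open>H i\<close> is the hierarchy \<open>B\<^sub>i\<close>, and \<open>G m i\<close> the \<open>i\<close>-th term of the Goodstein sequence of \<open>m\<close>.\<close>

definition is_hierarchy_sequence ::
    "(TM \<Rightarrow> TM \<Rightarrow> TM \<Rightarrow> FM) \<Rightarrow> CLASS \<Rightarrow> (TM \<Rightarrow> CLASS) \<Rightarrow> FM" where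
  "is_hierarchy_sequence E B H =
    ((\<^bold>\<forall>x. H \<^bold>0 x \<^bold>\<longleftrightarrow> B x) \<^bold>\<and> (\<^bold>\<forall>i. is_ouroboros E (H i) (i \<^bold>+ \<^bold>1) (H (i \<^bold>+ \<^bold>1))))"

definition is_goodstein ::
    "(TM \<Rightarrow> TM \<Rightarrow> TM \<Rightarrow> FM) \<Rightarrow> (TM \<Rightarrow> CLASS) \<Rightarrow> (TM \<Rightarrow> TM \<Rightarrow> TM \<Rightarrow> FM) \<Rightarrow> FM" where
  "is_goodstein E H G = (\<^bold>\<forall>m i v. G m i v \<^bold>\<longleftrightarrow>
     (i \<^bold>= \<^bold>0 \<^bold>\<and> v \<^bold>= m) \<^bold>\<or>
     (\<^bold>\<exists>i' g. i \<^bold>= i' \<^bold>+ \<^bold>1 \<^bold>\<and> G m i' g \<^bold>\<and>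
        ((\<^bold>0 \<^bold>< g \<^bold>\<and> upgrade E (H i') (H (i' \<^bold>+ \<^bold>1)) g (v \<^bold>+ \<^bold>1)) \<^bold>\<or> (g \<^bold>= \<^bold>0 \<^bold>\<and> v \<^bold>= \<^bold>0))))"

text \<open>
  For every \<open>m\<close> there is \<open>i\<close> such that the \<open>i\<close>-th term of the Goodstein sequence of \<open>m\<close> is 0, where
  the sequence is taken for the hierarchies obtained from the one defined by \<open>\<beta>\<close>. The equations
  determine \<open>E\<close>, \<open>H\<close> and \<open>G\<close> uniquely on tuples. They are quantified universally, so that
  unprovability of the formula does not come from unprovability of the existence of \<open>E\<close>, \<open>H\<close>, \<open>G\<close>.
\<close>

definition goodstein_termination :: "fm \<Rightarrow> fm" where
  "goodstein_termination \<beta> =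
    (\<^bold>\<forall>\<^sub>S E H G. is_exp (rel3 E) \<^bold>\<and> is_hierarchy_sequence (rel3 E) (class_of \<beta>) (rel2 H) \<^bold>\<and>
        is_goodstein (rel3 E) (rel2 H) (rel3 G) \<^bold>\<longrightarrow>
       (\<^bold>\<forall>m. \<^bold>\<exists>i. rel3 G m i \<^bold>0)) 0 0"


section \<open>Speaking about a given base hierarchy\<close>

text \<open>
  \<open>naming B\<close> makes the constant \<open>Name\<close> a name of \<open>B\<close>: it is a base hierarchy, and membership of
  each numeral is decided correctly.
\<close>

definition naming :: "nat set \<Rightarrow> fm set" where
  "naming B = {Mem (num k) Name | k. k \<in> B} \<union> {Neg (Mem (num k) Name) | k. k \<notin> B} \<union>
     {hierarchy (rel1 (\<lambda>s. Name)) 0 0}"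

text \<open>
  \<open>\<beta>\<close> is a definition of \<open>B\<close> in the theory \<open>T\<close>: it provably defines a set which is a base hierarchy,
  and membership of each numeral is decided correctly. Every base hierarchy has such a definition
  if \<open>naming B \<subseteq> T\<close>, namely \<open>Mem (Var 0) Name\<close>; specific ones such as \<open>{2}\<close> are also definable
  without \<open>Name\<close>, and then \<open>T\<close> knows more about them than the membership of each numeral.
\<close>

definition defines_hierarchy :: "fm set \<Rightarrow> fm \<Rightarrow> nat set \<Rightarrow> bool" where
  "defines_hierarchy T \<beta> B \<longleftrightarrow>
     (\<forall>k. k \<in> B \<longrightarrow> T \<turnstile> inst \<beta> (num k)) \<and>
     (\<forall>k. k \<notin> B \<longrightarrow> T \<turnstile> Neg (inst \<beta> (num k))) \<and>
     T \<turnstile> (\<^bold>\<exists>\<^sub>S X. \<^bold>\<forall>x. rel1 X x \<^bold>\<longleftrightarrow> class_of \<beta> x) 0 0 \<and>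
     T \<turnstile> hierarchy (class_of \<beta>) 0 0"

lemma proves_refl: "T \<turnstile> Imp p p"
  by (meson K S MP)
lemma proves_conj_self: "T \<turnstile> p \<Longrightarrow> T \<turnstile> Conj p p"
proof -
  let ?A = "Imp p (Neg p)"
  assume p: "T \<turnstile> p"
  have "T \<turnstile> Imp ?A p" using K MP p by blast
  moreover have "T \<turnstile> Imp (Imp ?A p) (Imp ?A (Neg p))" by (rule MP[OF S proves_refl])
  ultimately show ?thesis by (meson S MP)
qed
lemma defines_hierarchy_Name:
  assumes "naming B \<subseteq> T"
  shows "defines_hierarchy T (Mem (Var 0) Name) B"
proof -
  have cl: "class_of (Mem (Var 0) Name) = rel1 (\<lambda>s. Name)"
    by (simp add: fun_eq_iff class_of_def rel1_def)
  let ?b = "Mem (Var 0) Name"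
  let ?P = "Forall (Iff (Mem (Var 0) (SVar 0)) ?b)"
  have "T \<turnstile> Forall (Iff ?b ?b)" by (intro gen proves_conj_self proves_refl)
  moreover have "T \<turnstile> Imp (ForallS (Neg ?P)) (Neg (Forall (Iff ?b ?b)))"
    using specS[of T "Neg ?P" Name] by simp
  ultimately have "T \<turnstile> Neg (ForallS (Neg ?P))" by (meson K S MP)
  moreover have "(\<^bold>\<exists>\<^sub>S X. \<^bold>\<forall>x. rel1 X x \<^bold>\<longleftrightarrow> rel1 (\<lambda>s. Name) x) 0 0 = Neg (ForallS (Neg ?P))"
    by (simp add: exS_def allS_def all_def neg_def iff_def rel1_def)
  ultimately show ?thesis
    using assms unfolding defines_hierarchy_def cl by (auto simp: naming_def intro: axiom)
qed
end

theory Submission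
  imports Defs "HOL-Library.Countable"
begin

text \<open>
  The unprovability is shown by a model: an initial segment of an ultrapower of the natural numbers
  that satisfies \<open>\<Sigma>\<^sub>2\<^sub>n\<^sub>+\<^sub>2\<close> induction and lies below the first zero of a Goodstein sequence
  that starts inside it.

  If \<open>B\<^sub>0\<close> is not bounded by any \<open>k\<close>, some number \<open>y\<close> is built from a chain of \<open>n + 2\<close> bases, or is
  preceded by a base \<open>b\<close> with \<open>b\<^sup>2 < S(b)\<close>. This depends on \<open>B\<^sub>0\<close> only up to \<open>y\<close>, and the upgrades
  preserve it. So for every hierarchy \<open>X\<close> that agrees with \<open>B\<^sub>0\<close> up to \<open>y\<close>, the Goodstein sequence of
  \<open>y + t + 3\<close> for \<open>X\<close> dominates a descent through the fundamental sequences from a tower of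
  \<open>2n + 2\<close> exponentials over \<open>t\<close>.

  The indices of such a descent have a subset of size \<open>t\<close> whose members grow fast and decide \<open>2n + 2\<close>
  alternating quantifiers: an existential statement with parameters below one member has, if any, a
  witness below the next. This is the pigeonhole principle, which costs one exponential per
  quantifier. For nonstandard \<open>t\<close> the standard members of the subset therefore define a cut in which
  formulas with \<open>2n + 2\<close> quantifiers are equivalent to bounded ones, whence induction. The sets of the
  model are those with a name in the cut, and these are closed under \<open>\<Delta>\<^sub>1\<close> comprehension.

  In this model \<open>\<beta>\<close> defines a set that agrees in the cut with the ultraproduct of hierarchies \<open>X\<close> as
  above, and the recursion equations of \<open>E\<close>, \<open>H\<close> and \<open>G\<close> hold when these are interpreted pointwise,
  since all numbers needed to verify them are in the cut. A zero of the sequence in the cut would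
  thus be a zero before the end of the descent.
\<close>

section \<open>Ordinal descents and thinning\<close>

text \<open>The descent is thinned in the natural numbers, separately for each \<open>t\<close>,
  before any model exists. At that point only relations between numbers can be decided, so every
  parameter of a formula needs a numerical code, sets included. Hence the sets of the model are
  syntactic names with a code in the cut, and whatever the formulas require to exist, such as the
  interpretations of \<open>E\<close>, \<open>H\<close> and \<open>G\<close>, is provided in advance
  as an operation on names. The number of quantifiers comes from the chain: its least base yields a
  finite number, each of the other n + 1 bases two exponentials. A gap beyond the square of a base
  is reduced to this case, since a late Ouroboros successor turns it into a chain of the required
  length. In the formulas an upgrade is any value given by some pair of sets that satisfy the
  recursion equations. The model might contain unintended pairs, so the equations must also be shown
  to determine the value there.\<close>

text \<open>
  \<open>Ord [a\<^sub>1, \<dots>, a\<^sub>n]\<close> stands for \<open>\<omega>\<^bsup>a\<^sub>n\<^esup> + \<dots> + \<omega>\<^bsup>a\<^sub>1\<^esup>\<close>, and \<open>step s\<close> moves to a member of its fundamental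
  sequence. The multiplicity \<open>s div 2\<close> is what one step of the Goodstein process provides.
\<close>

datatype ord = Ord (terms: "ord list")

fun step :: "nat \<Rightarrow> ord \<Rightarrow> ord" where
  "step s (Ord []) = Ord []"
| "step s (Ord (a # as)) =
     Ord ((if a = Ord [] then [] else replicate (s div 2) (step s a)) @ as)"

primrec run :: "ord \<Rightarrow> nat list \<Rightarrow> ord" where
  "run a [] = a"
| "run a (w # ws) = run (step w a) ws"

primrec tower :: "nat \<Rightarrow> nat \<Rightarrow> ord" where
  "tower 0 N = Ord (replicate N (Ord []))"
| "tower (Suc k) N = Ord [tower k N]"

lemma run_append: "run a (U @ V) = run (run a U) V"
  by (induction U arbitrary: a) auto

lemma run_zero [simp]: "run (Ord []) W = Ord []"
  by (induction W) auto

lemma step_append: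
  "xs \<noteq> [] \<Longrightarrow> step s (Ord (xs @ ys)) = Ord (terms (step s (Ord xs)) @ ys)"
  by (cases xs) auto

text \<open>Summands are used up from the head of the list on, so a run to zero can be cut where the
  initial summands are exhausted.\<close>

lemma run_split:
  "run (Ord (xs @ ys)) W = Ord [] \<Longrightarrow>
     \<exists>U V. W = U @ V \<and> run (Ord xs) U = Ord [] \<and> run (Ord ys) V = Ord []"
proof (induction W arbitrary: xs)
  case Nil
  then show ?case by auto
next
  case (Cons w W)
  show ?case
  proof (cases "xs = []")
    case True
    then have "w # W = [] @ (w # W) \<and> run (Ord xs) [] = Ord [] \<and> run (Ord ys) (w # W) = Ord []"
      using Cons.prems by simp
    then show ?thesis by (rule exI[of _ "w # W", THEN exI[of _ "[]"]])
  next
    case False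
    then have "run (Ord (terms (step w (Ord xs)) @ ys)) W = Ord []"
      using Cons.prems by (simp add: step_append)
    then obtain U V where "W = U @ V" "run (step w (Ord xs)) U = Ord []" "run (Ord ys) V = Ord []"
      using Cons.IH[of "terms (step w (Ord xs))"] by auto
    then show ?thesis by (intro exI[of _ "w # U"] exI[of _ V]) auto
  qed
qed

text \<open>The \<open>last\<close> of the two-element list is its second entry: the blocks form an
  initial part of \<open>W\<close>, and the rest of \<open>W\<close> is left over.\<close>

lemma run_split_replicate:
  "run (Ord (replicate n a)) W = Ord [] \<Longrightarrow>
     \<exists>Us. length Us = n \<and> W = concat Us @ last (W # [drop (length (concat Us)) W]) \<and>
       (\<forall>U\<in>set Us. run (Ord [a]) U = Ord [])"
proof (induction n arbitrary: W)
  case 0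
  then show ?case by simp
next
  case (Suc n)
  have "run (Ord ([a] @ replicate n a)) W = Ord []" using Suc.prems by simp
  then obtain U V where UV: "W = U @ V" "run (Ord [a]) U = Ord []" "run (Ord (replicate n a)) V = Ord []"
    using run_split by blast
  obtain Us where "length Us = n" "V = concat Us @ drop (length (concat Us)) V"
    "\<forall>U\<in>set Us. run (Ord [a]) U = Ord []" using Suc.IH[OF UV(3)] by auto
  then show ?case using UV by (intro exI[of _ "U # Us"]) auto
qed

lemma run_tower_0: "run (tower 0 N) W = Ord [] \<Longrightarrow> N \<le> length W"
proof (induction W arbitrary: N)
  case (Cons w W)
  then show ?case by (cases N) auto
qed auto

text \<open>Accessibility takes the place of a well-ordering of the notations, whose summands may
  occur in any order.\<close>

inductive acc_ord :: "ord \<Rightarrow> bool" where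
  "(a \<noteq> Ord [] \<Longrightarrow> \<forall>s. acc_ord (step s a)) \<Longrightarrow> acc_ord a"

lemma acc_ord_Cons: "acc_ord a \<Longrightarrow> acc_ord (Ord as) \<Longrightarrow> acc_ord (Ord (a # as))"
proof (induction a arbitrary: as rule: acc_ord.induct)
  case (1 a)
  show ?case
  proof (rule acc_ord.intros, rule allI)
    fix s
    show "acc_ord (step s (Ord (a # as)))"
    proof (cases "a = Ord []")
      case True
      then show ?thesis using 1 by simp
    next
      case False
      have "acc_ord (Ord (replicate n (step s a) @ as))" for n
        using 1 False by (induction n) auto
      then show ?thesis using False by simp
    qed
  qed
qed

lemma acc_ord: "acc_ord a"
proof (induction a)
  case (Ord as)
  then show ?case
    by (induction as) (auto intro: acc_ord_Cons acc_ord.intros)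
qed

text \<open>Provides an end point for the descent; the cut will be placed below it.\<close>

lemma run_terminates: "\<exists>e\<ge>s. run a [s..<e] = Ord []"
proof -
  have "acc_ord a" by (rule acc_ord)
  then show ?thesis
  proof (induction a arbitrary: s rule: acc_ord.induct)
    case (1 a)
    show ?case
    proof (cases "a = Ord []")
      case False
      then obtain e where "e \<ge> Suc s" "run (step s a) [Suc s..<e] = Ord []" using 1 by blast
      then have "run a [s..<e] = Ord []" by (simp add: upt_rec)
      then show ?thesis using \<open>e \<ge> Suc s\<close> by (intro exI[of _ e]) auto
    qed auto
  qed
qed

text \<open>Exponent 0 is what consecutive numbers offer, and every thinning gains one. From
  exponent 3 on the gaps exceed squares, which closes the cut under multiplication.\<close>

definition spaced :: "nat \<Rightarrow> nat list \<Rightarrow> bool" where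
  "spaced j = sorted_wrt (\<lambda>x y. x < y \<and> x + (x div 4) ^ j \<le> y)"

lemma spaced_Cons:
  "spaced j (w # ws) \<longleftrightarrow> (\<forall>y\<in>set ws. w < y \<and> w + (w div 4) ^ j \<le> y) \<and> spaced j ws"
  by (auto simp: spaced_def)

lemma spaced_append:
  "spaced j (U @ V) \<longleftrightarrow> spaced j U \<and> spaced j V \<and>
     (\<forall>x\<in>set U. \<forall>y\<in>set V. x < y \<and> x + (x div 4) ^ j \<le> y)"
  by (auto simp: spaced_def sorted_wrt_append)

lemma spaced_nth:
  "spaced j W \<Longrightarrow> i < length W \<Longrightarrow> W \<noteq> [] \<Longrightarrow> hd W + i * (hd W div 4) ^ j \<le> W ! i"
proof (induction i)
  case 0
  then show ?case by (cases W) auto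
next
  case (Suc i)
  have "hd W \<le> W ! i"
    using Suc.prems by (cases i; cases W) (auto simp: spaced_Cons intro: less_imp_le)
  then have "(hd W div 4) ^ j \<le> (W ! i div 4) ^ j" by (intro power_mono div_le_mono) auto
  moreover have "W ! i + (W ! i div 4) ^ j \<le> W ! Suc i"
    using Suc.prems by (auto simp: spaced_def sorted_wrt_iff_nth_less)
  ultimately show ?case using Suc by simp
qed

lemma spaced_hd_last: "spaced j W \<Longrightarrow> x \<in> set W \<Longrightarrow> hd W \<le> x \<and> x \<le> last W"
proof (induction W)
  case (Cons w W)
  then show ?case
    by (auto simp: spaced_Cons intro: less_imp_le)
qed auto

text \<open>\<open>M\<close> plays the role of infinity: a witness below \<open>M\<close> must have
  a counterpart below the next member. The division by 8 keeps the parameters fewer than the blocks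
  in the pigeonhole argument.\<close>

definition decides :: "(nat \<Rightarrow> nat \<Rightarrow> bool) \<Rightarrow> nat \<Rightarrow> nat set \<Rightarrow> bool" where
  "decides R M Y \<longleftrightarrow> (\<forall>y\<in>Y. y \<le> M) \<and>
     (\<forall>y\<in>Y. \<forall>y'\<in>Y. y < y' \<longrightarrow> (\<forall>p\<le>y div 8. (\<exists>z\<le>M. R p z) \<longrightarrow> (\<exists>z\<le>y'. R p z)))"

lemma decides_subset: "decides R M Y \<Longrightarrow> Y' \<subseteq> Y \<Longrightarrow> decides R M Y'"
  unfolding decides_def by (meson in_mono)

lemma concat_nth_order:
  "spaced j (concat Us) \<Longrightarrow> i < k \<Longrightarrow> k < length Us \<Longrightarrow> x \<in> set (Us ! i) \<Longrightarrow> y \<in> set (Us ! k) \<Longrightarrow>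
    x < y"
proof (induction Us arbitrary: i k)
  case (Cons U Us)
  show ?case
  proof (cases i)
    case 0
    then have "y \<in> set (concat Us)" using Cons.prems by (cases k) auto
    then show ?thesis using Cons.prems 0 by (auto simp: spaced_append)
  next
    case (Suc i')
    then show ?thesis using Cons by (cases k) (auto simp: spaced_append)
  qed
qed auto

lemma concat_hd_nth:
  "k < length Us \<Longrightarrow> (\<forall>U\<in>set Us. U \<noteq> []) \<Longrightarrow>
    \<exists>i\<ge>k. i < length (concat Us) \<and> concat Us ! i = hd (Us ! k)"
proof (induction Us arbitrary: k)
  case (Cons U Us)
  show ?case
  proof (cases k)
    case 0
    then show ?thesis using Cons.prems by (intro exI[of _ 0]) (auto simp: nth_append hd_conv_nth)
  next
    case (Suc k')
    then obtain i where i: "i \<ge> k'" "i < length (concat Us)" "concat Us ! i = hd (Us ! k')"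
      using Cons by (metis length_Cons list.set_intros(2) not_less_eq)
    have "length U \<ge> 1" using Cons.prems by (cases U) auto
    then show ?thesis using i Suc
      by (intro exI[of _ "length U + i"]) (auto simp: nth_append)
  qed
qed auto

text \<open>
  The pigeonhole step: of the blocks into which a run of \<open>\<omega>\<^sup>\<alpha>\<close> splits after its first step, one
  contains none of the least witnesses for the parameters up to \<open>y div 8\<close>.
\<close>

lemma thin:
  assumes "spaced j W" and "\<forall>w\<in>set W. 64 \<le> w" and "run (Ord [a]) W = Ord []"
  shows "\<exists>Y M. set Y \<subseteq> set W \<and> run a Y = Ord [] \<and> spaced (Suc j) Y \<and> hd W \<le> M \<and> M \<le> last W \<and>
           decides R M (set Y)"
  using assms
proof (induction "length W" arbitrary: W a rule: less_induct)
  case less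
  have "W \<noteq> []" using less.prems(3) by auto
  then obtain w ws where W: "W = w # ws" by (cases W) auto
  show ?case
  proof (cases "a = Ord []")
    case True
    then show ?thesis using W less.prems(1) spaced_hd_last[of j W w]
      by (intro exI[of _ "[]"] exI[of _ "last W"]) (auto simp: decides_def spaced_def)
  next
    case False
    let ?a = "step w a"
    have "run (Ord (replicate (w div 2) ?a)) ws = Ord []" using less.prems(3) W False by simp
    from run_split_replicate[OF this] obtain Us V where Us: "length Us = w div 2"
      "ws = concat Us @ V" "\<forall>U\<in>set Us. run (Ord [?a]) U = Ord []" by auto
    have ne: "\<forall>U\<in>set Us. U \<noteq> []" using Us(3) by force
    have sp: "spaced j (concat Us)" using less.prems(1) W Us(2) by (auto simp: spaced_Cons spaced_append)
    have w64: "64 \<le> w" using less.prems(2) W by auto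
    \<comment> \<open>These are at least \<open>w div 4\<close> blocks, more than the
      \<open>w div 8 + 1\<close> parameters because 64 \<le> w. An index from \<open>w div 4\<close>
      on also leaves \<open>w div 4\<close> nonempty blocks in front, which raises the spacing
      exponent by one.\<close>
    let ?J = "{w div 4..<w div 2}"
    define witnesses where "witnesses p = (LEAST z. R p z)" for p
    \<comment> \<open>A block is spoilt by a parameter if the least witness comes after its first
      element but not after its last. The blocks are disjoint intervals in order, so a parameter
      spoils at most one.\<close>
    define kill where
      "kill p k \<longleftrightarrow> (\<exists>z. R p z) \<and> hd (Us ! k) < witnesses p \<and> witnesses p \<le> last (Us ! k)" for p k
    have kill_unique: "k = k'" if "kill p k" "kill p k'" "k \<in> ?J" "k' \<in> ?J" for p k k'
    proof -
      have *: False if "kill p k" "kill p k'" "k < k'" "k' \<in> ?J" for k k'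
      proof -
        have "k < length Us" "k' < length Us" using that Us(1) by auto
        then have "last (Us ! k) < hd (Us ! k')"
        proof -
          have "last (Us ! k) \<in> set (Us ! k)" "hd (Us ! k') \<in> set (Us ! k')"
            using ne \<open>k < length Us\<close> \<open>k' < length Us\<close> by (simp_all add: nth_mem)
          then show ?thesis
            by (rule concat_nth_order[OF sp \<open>k < k'\<close> \<open>k' < length Us\<close>])
        qed
        then show False using that unfolding kill_def by linarith
      qed
      show ?thesis using *[of k k'] *[of k' k] that by (meson linorder_neqE_nat)
    qed
    have "\<exists>k\<in>?J. \<forall>p\<le>w div 8. \<not> kill p k"
    proof (rule ccontr)
      assume "\<not> ?thesis"
      then obtain f where f: "\<forall>k\<in>?J. f k \<le> w div 8 \<and> kill (f k) k" by metis
      have "inj_on f ?J"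
      proof (rule inj_onI)
        fix x y assume xy: "x \<in> ?J" "y \<in> ?J" "f x = f y"
        have "kill (f x) x" using f xy(1) by blast
        moreover have "kill (f x) y" unfolding xy(3) using f xy(2) by blast
        ultimately show "x = y" using kill_unique xy by blast
      qed
      moreover have "f ` ?J \<subseteq> {..w div 8}" using f by auto
      ultimately have "card ?J \<le> card {..w div 8}" by (intro card_inj_on_le[of f]) auto
      then show False using w64 by simp
    qed
    then obtain k where k: "k \<in> ?J" "\<forall>p\<le>w div 8. \<not> kill p k" by blast
    let ?U = "Us ! k"
    have kl: "k < length Us" using k Us(1) by auto
    then have UUs: "?U \<in> set Us" by simp
    have Usub: "set ?U \<subseteq> set ws" using Us(2) UUs by auto
    obtain A B where AB: "Us = A @ ?U # B" using UUs by (metis split_list)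
    have cU: "concat Us = concat A @ ?U @ concat B" by (subst AB) simp
    have len: "length ?U < length W" using W Us(2) cU by simp
    have spU: "spaced j ?U" using sp cU by (auto simp: spaced_append)
    \<comment> \<open>The induction continues inside the chosen block with the exponent reached
      after the step at \<open>w\<close>; the bound \<open>M\<close> it returns stays within the
      block.\<close>
    obtain Y M where Y: "set Y \<subseteq> set ?U" "run ?a Y = Ord []" "spaced (Suc j) Y"
      "hd ?U \<le> M" "M \<le> last ?U" "decides R M (set Y)"
    proof -
      have "\<forall>x\<in>set ?U. 64 \<le> x" using less.prems(2) Usub W by auto
      moreover have "run (Ord [?a]) ?U = Ord []" using Us(3) UUs by blast
      ultimately show thesis using less.hyps[OF len spU, of ?a] that by blast
    qed
    have hdU: "w + (w div 4) ^ Suc j \<le> hd ?U" "w < hd ?U"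
    proof -
      obtain i where i: "k \<le> i" "i < length (concat Us)" "concat Us ! i = hd ?U"
        using concat_hd_nth[OF kl ne] by auto
      have "hd W + Suc i * (hd W div 4) ^ j \<le> W ! Suc i"
        using spaced_nth[OF less.prems(1), of "Suc i"] i(2) W Us(2) by simp
      also have "W ! Suc i = hd ?U" using i W Us(2) by (simp add: nth_append)
      finally have *: "w + Suc i * (w div 4) ^ j \<le> hd ?U" using W by simp
      have "w div 4 \<le> Suc i" using k(1) i(1) by auto
      then have "(w div 4) ^ Suc j \<le> Suc i * (w div 4) ^ j"
        unfolding power_Suc by (rule mult_le_mono1)
      then show "w + (w div 4) ^ Suc j \<le> hd ?U" using * by linarith
      moreover have "0 < (w div 4) ^ Suc j" using w64 by (intro zero_less_power) auto
      ultimately show "w < hd ?U" by linarith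
    qed
    have hdY: "hd ?U \<le> y" "y \<le> last ?U" if "y \<in> set Y" for y
      using that Y(1) spaced_hd_last[OF spU] by auto
    have last: "last ?U \<le> last W"
    proof -
      have "last ?U \<in> set ?U" using ne UUs by simp
      then have "last ?U \<in> set W" using Usub W by auto
      then show ?thesis using spaced_hd_last[OF less.prems(1)] by auto
    qed
    \<comment> \<open>A witness up to \<open>M\<close> is one up to the end of the block. As the
      least witness avoids the block, it is at most the first element, hence below all of
      \<open>Y\<close>.\<close>
    have dec: "(\<exists>z\<le>y'. R p z)" if "y' \<in> set Y" "p \<le> w div 8" "z \<le> M" "R p z" for y' p z
    proof -
      have "witnesses p \<le> z" unfolding witnesses_def using that by (intro Least_le)
      then have "witnesses p \<le> last ?U" using that Y(5) by linarith
      then have "witnesses p \<le> hd ?U" using k(2) that unfolding kill_def by (meson linorder_not_le)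
      moreover have "R p (witnesses p)" unfolding witnesses_def using that by (metis LeastI)
      moreover have "hd ?U \<le> y'" using hdY that by simp
      ultimately show ?thesis using order_trans by blast
    qed
    have "decides R M (set (w # Y))"
      unfolding decides_def
    proof (intro conjI ballI allI impI)
      fix y assume "y \<in> set (w # Y)"
      then show "y \<le> M" using Y(4,6) hdU unfolding decides_def by auto
    next
      fix y y' p assume *: "y \<in> set (w # Y)" "y' \<in> set (w # Y)" "y < y'" "p \<le> y div 8" "\<exists>z\<le>M. R p z"
      show "\<exists>z\<le>y'. R p z"
      proof (cases "y = w")
        case True
        then show ?thesis using * dec by auto
      next
        case False
        then have "y \<in> set Y" using * by auto
        moreover have "w < y" using hdY(1)[OF \<open>y \<in> set Y\<close>] hdU by linarith
        then have "y' \<in> set Y" using * by auto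
        ultimately show ?thesis using * Y(6) unfolding decides_def by blast
      qed
    qed
    moreover have "spaced (Suc j) (w # Y)"
      unfolding spaced_Cons
    proof (intro conjI ballI)
      fix y assume "y \<in> set Y"
      then have "hd ?U \<le> y" using hdY by simp
      then show "w < y" "w + (w div 4) ^ Suc j \<le> y" using hdU by linarith+
    qed (rule Y(3))
    moreover have "set (w # Y) \<subseteq> set W" using Y(1) Usub W by auto
    moreover have "run a (w # Y) = Ord []" using Y by simp
    moreover have "hd W \<le> M" "M \<le> last W" using Y hdU last W by auto
    ultimately show ?thesis by blast
  qed
qed

text \<open>
  Each exponential of the tower pays for deciding one more quantifier; the witnesses considered for
  one quantifier depend on the bounds chosen for the inner ones.
\<close>

lemma thin_tower:
  assumes "spaced j W" and "\<forall>w\<in>set W. 64 \<le> w" and "run (tower k N) W = Ord []"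
  shows "\<exists>Y Ms. length Ms = k \<and> set Y \<subseteq> set W \<and> N \<le> length Y \<and> spaced (j + k) Y \<and>
           (\<forall>i<k. decides (R (drop (Suc i) Ms @ Ms0)) (Ms ! i) (set Y))"
  using assms
proof (induction k arbitrary: j W Ms0)
  case 0
  then show ?case using run_tower_0 by (intro exI[of _ W] exI[of _ "[]"]) auto
next
  case (Suc k)
  obtain Y M where Y: "set Y \<subseteq> set W" "run (tower k N) Y = Ord []" "spaced (Suc j) Y"
    "decides (R Ms0) M (set Y)"
    using thin[OF Suc.prems(1,2), of "tower k N" "R Ms0"] Suc.prems(3) by auto
  have "\<forall>w\<in>set Y. 64 \<le> w" using Y Suc.prems by auto
  from Suc.IH[OF Y(3) this Y(2), of "M # Ms0"] obtain Y' Ms where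
    Y': "length Ms = k" "set Y' \<subseteq> set Y" "N \<le> length Y'" "spaced (Suc j + k) Y'"
    "\<forall>i<k. decides (R (drop (Suc i) Ms @ M # Ms0)) (Ms ! i) (set Y')" by blast
  \<comment> \<open>The bound chosen first belongs to the innermost quantifier and stands last in
    the list.\<close>
  have "decides (R (drop (Suc i) (Ms @ [M]) @ Ms0)) ((Ms @ [M]) ! i) (set Y')" if "i < Suc k" for i
  proof (cases "i = k")
    case True
    then show ?thesis using Y'(1,2) Y(4) by (simp add: decides_subset nth_append)
  next
    case False
    then show ?thesis using that Y' by (simp add: nth_append)
  qed
  then show ?case using Y' Y(1)
    by (intro exI[of _ Y'] exI[of _ "Ms @ [M]"]) auto
qed

lemma spaced_upt: "spaced 0 [s..<e]"
  by (auto simp: spaced_def sorted_wrt_iff_nth_less)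

section \<open>Bases and digits\<close>

definition hmin :: "nat set \<Rightarrow> nat" where "hmin B = (LEAST b. b \<in> B)"

definition base :: "nat set \<Rightarrow> nat \<Rightarrow> nat" where
  "base B n = (if \<exists>b\<in>B. b \<le> n then GREATEST b. b \<in> B \<and> b \<le> n else hmin B)"

definition below_next :: "nat set \<Rightarrow> nat \<Rightarrow> nat \<Rightarrow> bool" where
  "below_next C v c \<longleftrightarrow> (\<forall>y\<in>C. c < y \<longrightarrow> v < y)"

definition lg :: "nat \<Rightarrow> nat \<Rightarrow> nat" where "lg b m = (GREATEST e. b ^ e \<le> m)"

lemma lg_bound: "2 \<le> (b::nat) \<Longrightarrow> b ^ e \<le> m \<Longrightarrow> e < Suc m"
proof -
  assume "2 \<le> b" "b ^ e \<le> m"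
  moreover have "e < 2 ^ e" by (rule less_exp)
  moreover have "2 ^ e \<le> b ^ e" using \<open>2 \<le> b\<close> by (intro power_mono) auto
  ultimately show ?thesis by linarith
qed

lemma lg_props:
  assumes "2 \<le> b" "b \<le> m"
  shows "b ^ lg b m \<le> m" "m < b ^ Suc (lg b m)" "1 \<le> lg b m" "lg b m < m"
proof -
  have b: "\<And>e. b ^ e \<le> m \<Longrightarrow> e \<le> m" using lg_bound[OF assms(1)] by fastforce
  show 1: "b ^ lg b m \<le> m" unfolding lg_def
    by (rule GreatestI_nat[of _ 1 m]) (use assms b in auto)
  have le: "e \<le> lg b m" if "b ^ e \<le> m" for e
    unfolding lg_def by (rule Greatest_le_nat[of _ _ m]) (use that b in auto)
  show "m < b ^ Suc (lg b m)" using le[of "Suc (lg b m)"] by force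
  show "1 \<le> lg b m" using le[of 1] assms by simp
  have "lg b m < 2 ^ lg b m" by (rule less_exp)
  also have "2 ^ lg b m \<le> b ^ lg b m" using assms by (intro power_mono) auto
  finally show "lg b m < m" using 1 by linarith
qed

lemma lg_unique:
  assumes "2 \<le> b" "b ^ e \<le> m" "m < b ^ Suc e"
  shows "lg b m = e"
  unfolding lg_def
proof (rule Greatest_equality)
  fix y assume "b ^ y \<le> m"
  then have "b ^ y < b ^ Suc e" using assms by linarith
  then have "y < Suc e" using assms(1) by (meson le_trans one_le_numeral power_increasing not_le_imp_less linorder_not_le)
  then show "y \<le> e" by simp
qed (use assms in auto)

lemma lg_decomp:
  assumes "2 \<le> b" "b \<le> m"
  shows "m = b ^ lg b m * (m div b ^ lg b m) + m mod b ^ lg b m" "0 < m div b ^ lg b m"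
    "m div b ^ lg b m < b" "m mod b ^ lg b m < b ^ lg b m" "m mod b ^ lg b m < m"
proof -
  have p: "0 < b ^ lg b m" using assms by auto
  show "m = b ^ lg b m * (m div b ^ lg b m) + m mod b ^ lg b m" by simp
  show "0 < m div b ^ lg b m" using lg_props[OF assms] p by (simp add: div_greater_zero_iff)
  show "m div b ^ lg b m < b" using lg_props[OF assms] p
    by (simp add: less_mult_imp_div_less mult.commute)
  show *: "m mod b ^ lg b m < b ^ lg b m" using p by simp
  then show "m mod b ^ lg b m < m" using lg_props(1)[OF assms] by linarith
qed

lemma lg_decomp_unique:
  assumes "2 \<le> b" "m = b ^ e * a + r" "0 < a" "a < b" "r < b ^ e"
  shows "lg b m = e" "m div b ^ e = a" "m mod b ^ e = r"
proof -
  have "b ^ e * a + r < b ^ e * (a + 1)" using assms by simp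
  also have "\<dots> \<le> b ^ e * b" using assms by (intro mult_le_mono) auto
  finally have 1: "m < b ^ Suc e" using assms by (simp add: mult.commute)
  have "b ^ e * 1 \<le> b ^ e * a" using assms by (intro mult_le_mono) auto
  then have "b ^ e \<le> m" using assms by linarith
  then show "lg b m = e" using 1 assms by (intro lg_unique)
  show "m div b ^ e = a" "m mod b ^ e = r" using assms by auto
qed

section \<open>The operators in total and in partial form\<close>

text \<open>\<open>v\<close> is the upgrade on digits, that is, below \<open>b\<close>. The clause
  for \<open>b < 2\<close> makes the recursion terminate.\<close>

function ang :: "(nat \<Rightarrow> nat) \<Rightarrow> nat \<Rightarrow> nat \<Rightarrow> nat \<Rightarrow> nat" where
  "ang v b c m = (if m < b \<or> b < 2 then v m
     else c ^ ang v b c (lg b m) * v (m div b ^ lg b m) + ang v b c (m mod b ^ lg b m))"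
  by pat_completeness auto
termination
  by (relation "measure (\<lambda>(v, b, c, m). m)") (auto simp: lg_props lg_decomp not_less)

declare ang.simps [simp del]

text \<open>\<open>None\<close> stands for \<infinity>. For \<open>b < 2\<close> and
  \<open>b \<le> m\<close> there is no decomposition, so \<open>None\<close> is the value that the
  equation in \<open>is_upgrade\<close> prescribes.\<close>

function ango :: "(nat \<Rightarrow> nat option) \<Rightarrow> nat \<Rightarrow> nat \<Rightarrow> nat \<Rightarrow> nat option" where
  "ango u b c m = (if m < b then u m else if b < 2 then None
     else (case (ango u b c (lg b m), u (m div b ^ lg b m), ango u b c (m mod b ^ lg b m)) of
       (Some e, Some a, Some r) \<Rightarrow> Some (c ^ e * a + r) | _ \<Rightarrow> None))"
  by pat_completeness auto
termination
  by (relation "measure (\<lambda>(v, b, c, m). m)") (auto simp: lg_props lg_decomp not_less)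

declare ango.simps [simp del]

lemma ang_less: "m < b \<Longrightarrow> ang v b c m = v m" by (simp add: ang.simps)
lemma ango_less: "m < b \<Longrightarrow> ango u b c m = u m" by (simp add: ango.simps)

lemma ang_ge:
  "2 \<le> b \<Longrightarrow> b \<le> m \<Longrightarrow>
    ang v b c m = c ^ ang v b c (lg b m) * v (m div b ^ lg b m) + ang v b c (m mod b ^ lg b m)"
  by (subst ang.simps) auto

lemma ang_cong:
  assumes "\<And>x. x < b \<Longrightarrow> v x = v' x" "2 \<le> b"
  shows "ang v b c m = ang v' b c m"
proof (induction m rule: less_induct)
  case (less m)
  show ?case
  proof (cases "m < b")
    case False
    then have m: "b \<le> m" by simp
    show ?thesis
      unfolding ang_ge[OF assms(2) m]
      using less[of "lg b m"] less[of "m mod b ^ lg b m"] lg_props[OF assms(2) m] lg_decomp[OF assms(2) m]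
        assms(1) by simp
  qed (simp add: ang_less assms)
qed

lemma ango_cong:
  assumes "\<And>x. x < b \<Longrightarrow> u x = u' x"
  shows "ango u b c m = ango u' b c m"
proof (induction m rule: less_induct)
  case (less m)
  show ?case
  proof (cases "m < b")
    case False
    show ?thesis
    proof (cases "b < 2")
      case True
      then show ?thesis using False by (simp add: ango.simps)
    next
      case b: False
      then have m: "2 \<le> b" "b \<le> m" using False by auto
      show ?thesis
        using less[of "lg b m"] less[of "m mod b ^ lg b m"] lg_props[OF m] lg_decomp[OF m] assms
        by (subst (1 2) ango.simps) simp
    qed
  qed (simp add: ango_less assms)
qed

lemma ango_ang:
  assumes "\<And>x. x < b \<Longrightarrow> u x = Some (v x)" "2 \<le> b"
  shows "ango u b c m = Some (ang v b c m)"
proof (induction m rule: less_induct)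
  case (less m)
  show ?case
  proof (cases "m < b")
    case False
    then have m: "2 \<le> b" "b \<le> m" using assms by auto
    show ?thesis
      unfolding ang_ge[OF m]
      using less[of "lg b m"] less[of "m mod b ^ lg b m"] lg_props[OF m] lg_decomp[OF m] assms m
      by (subst ango.simps) simp
  qed (simp add: ango_less ang_less assms)
qed

text \<open>What makes a change of base well behaved: digits keep their order and stay below the new
  base.\<close>

locale digits =
  fixes v :: "nat \<Rightarrow> nat" and b c :: nat
  assumes b2: "2 \<le> b" and v0: "v 0 = 0" and v1: "v 1 = 1"
    and v_mono: "x < y \<Longrightarrow> y < b \<Longrightarrow> v x < v y" and v_less: "x < b \<Longrightarrow> v x < c"
begin

lemma v_ge: "x < b \<Longrightarrow> x \<le> v x"
proof (induction x)
  case (Suc x)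
  then show ?case using v_mono[of x "Suc x"] by simp
qed simp

lemma c_ge: "b \<le> c"
  using v_ge[of "b - 1"] v_less[of "b - 1"] b2 by simp

lemma ang_0 [simp]: "ang v b c 0 = 0" using b2 v0 by (simp add: ang_less)
lemma ang_1 [simp]: "ang v b c (Suc 0) = 1" using b2 v1 by (simp add: ang_less)

lemma ang_decomp:
  assumes "m = b ^ e * a + r" "0 < a" "a < b" "r < b ^ e" "0 < e"
  shows "ang v b c m = c ^ ang v b c e * v a + ang v b c r"
proof -
  have "b \<le> b ^ e" using b2 assms(5) by (cases e) auto
  also have "b ^ e * 1 \<le> b ^ e * a" using assms by (intro mult_le_mono) auto
  then have "b ^ e \<le> m" using assms by linarith
  finally show ?thesis using ang_ge[OF b2, of m] lg_decomp_unique[OF b2 assms(1-4)] by simp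
qed

lemma ang_pow: "0 < e \<Longrightarrow> ang v b c (b ^ e) = c ^ ang v b c e"
  using ang_decomp[of "b ^ e" e 1 0] b2 v1 by simp

text \<open>Numbers to base \<open>b\<close> compare lexicographically by exponent, leading digit
  and remainder, and so do their images. That the image of a remainder stays below the image of the
  power is the induction hypothesis for the power \<open>b ^ e0\<close> itself.\<close>

lemma ang_mono: "m0 < m \<Longrightarrow> ang v b c m0 < ang v b c m"
proof (induction m arbitrary: m0 rule: less_induct)
  case (less m)
  show ?case
  proof (cases "m < b")
    case True
    then show ?thesis using less v_mono by (simp add: ang_less)
  next
    case False
    then have m: "b \<le> m" by simp
    define e a r where "e = lg b m" and "a = m div b ^ e" and "r = m mod b ^ e"
    note d = lg_props[OF b2 m, folded e_def] lg_decomp[OF b2 m, folded e_def, folded a_def r_def]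
    have eq: "ang v b c m = c ^ ang v b c e * v a + ang v b c r"
      using ang_ge[OF b2 m] by (simp add: e_def a_def r_def)
    have e1: "1 \<le> ang v b c e" using less.IH[of e 0] d by simp
    have a1: "1 \<le> v a" using v_ge[of a] d by linarith
    have cpos: "0 < c" using c_ge b2 by simp
    show ?thesis
    proof (cases "m0 < b")
      case True
      then have "ang v b c m0 < c" using v_less by (simp add: ang_less)
      also have "c \<le> c ^ ang v b c e" using cpos e1 by (simp add: self_le_power)
      also have "\<dots> \<le> ang v b c m" using a1 eq by (simp add: trans_le_add1)
      finally show ?thesis .
    next
      case False
      then have m0: "b \<le> m0" by simp
      define e0 a0 r0 where "e0 = lg b m0" and "a0 = m0 div b ^ e0" and "r0 = m0 mod b ^ e0"
      note d0 = lg_props[OF b2 m0, folded e0_def] lg_decomp[OF b2 m0, folded e0_def, folded a0_def r0_def]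
      have eq0: "ang v b c m0 = c ^ ang v b c e0 * v a0 + ang v b c r0"
        using ang_ge[OF b2 m0] by (simp add: e0_def a0_def r0_def)
      have "ang v b c r0 < ang v b c (b ^ e0)"
        using less.IH[of "b ^ e0" r0] less.prems d0 by linarith
      then have r0: "ang v b c r0 < c ^ ang v b c e0" using ang_pow[of e0] d0 by simp
      have lt: "ang v b c m0 < c ^ ang v b c e0 * (v a0 + 1)" using eq0 r0 by simp
      consider "e0 < e" | "e0 = e" "a0 < a" | "e0 = e" "a0 = a" "r0 < r"
      proof -
        have "\<not> e < e0"
        proof
          assume "e < e0"
          then have "b ^ Suc e \<le> b ^ e0" using b2 by (intro power_increasing) auto
          then show False using d d0 less.prems by linarith
        qed
        moreover have "\<not> a < a0" if "e0 = e"
        proof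
          assume "a < a0"
          then have "b ^ e * (a + 1) \<le> b ^ e * a0" by (intro mult_le_mono) auto
          then have "m < m0" using d d0 that by (simp add: algebra_simps)
          then show False using less.prems by simp
        qed
        moreover have "r0 < r" if "e0 = e" "a0 = a" using d(5) d0(5) that less.prems by simp
        ultimately show ?thesis using that by linarith
      qed
      then show ?thesis
      proof cases
        case 1
        have "v a0 + 1 \<le> c" using v_less[of a0] d0 by simp
        then have "ang v b c m0 < c ^ Suc (ang v b c e0)"
          using lt by (metis mult.commute mult_le_mono1 order_less_le_trans power_Suc)
        also have "\<dots> \<le> c ^ ang v b c e"
          using less.IH[of e e0] 1 d cpos by (intro power_increasing) auto
        also have "\<dots> \<le> ang v b c m" using a1 eq by (simp add: trans_le_add1)
        finally show ?thesis .
      next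
        case 2
        have "v a0 + 1 \<le> v a" using v_mono[of a0 a] 2 d by simp
        then have "c ^ ang v b c e0 * (v a0 + 1) \<le> c ^ ang v b c e * v a"
          unfolding 2(1) by (rule mult_le_mono2)
        then show ?thesis using lt eq by linarith
      next
        case 3
        then show ?thesis using eq eq0 less.IH[of r r0] d by simp
      qed
    qed
  qed
qed

lemma ang_mono_le: "m0 \<le> m \<Longrightarrow> ang v b c m0 \<le> ang v b c m"
  using ang_mono by (metis le_less)

lemma ang_digits: "0 < q \<Longrightarrow> q < b \<Longrightarrow> r < b \<Longrightarrow> ang v b c (b * q + r) = c * v q + v r"
  using ang_decomp[of "b * q + r" 1 q r] by (simp add: ang_less)

lemma ang_base: "ang v b c b = c"
  using ang_digits[of 1 0] b2 v0 v1 by simp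

text \<open>The exponent 2 is rewritten as well, to a number that is at least 2.\<close>

lemma ang_square: "c ^ 2 \<le> ang v b c (b ^ 2)"
proof -
  have "2 \<le> ang v b c 2" using ang_mono[of 1 2] by simp
  then have "c ^ 2 \<le> c ^ ang v b c 2" using c_ge b2 by (intro power_increasing) auto
  then show ?thesis using ang_pow[of 2] by simp
qed

lemma ang_dvd: "b dvd m \<Longrightarrow> c dvd ang v b c m"
proof (induction m rule: less_induct)
  case (less m)
  show ?case
  proof (cases "m < b")
    case True
    then have "m = 0" using less.prems by (auto dest: dvd_imp_le)
    then show ?thesis by simp
  next
    case False
    then have m: "b \<le> m" by simp
    note d = lg_props[OF b2 m] lg_decomp[OF b2 m]
    have "b dvd b ^ lg b m" using d by (simp add: dvd_power)
    then have "b dvd m mod b ^ lg b m" using less.prems by (simp add: dvd_mod)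
    then have "c dvd ang v b c (m mod b ^ lg b m)" using less.IH d by simp
    moreover have "0 < ang v b c (lg b m)" using ang_mono[of 0 "lg b m"] d by simp
    ultimately show ?thesis using ang_ge[OF b2 m] by (simp add: dvd_power)
  qed
qed

end

section \<open>The upgrade as a partial function\<close>

definition upf :: "nat set \<Rightarrow> nat set \<Rightarrow> (nat \<Rightarrow> nat option) \<Rightarrow> nat \<Rightarrow> nat option" where
  "upf B C u n = (if n < hmin B then Some n else
     (case u (n - 1) of None \<Rightarrow> None | Some x \<Rightarrow>
       let P = (\<lambda>c. c \<in> C \<and> (\<exists>w. ango u (base B n) c n = Some w \<and> x < w \<and> below_next C w c)) in
       if \<exists>c. P c then ango u (base B n) (LEAST c. P c) n else None))"

text \<open>A table of the values below \<open>n\<close>, which reduces the course-of-values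
  recursion to primitive recursion.\<close>

primrec upl :: "nat set \<Rightarrow> nat set \<Rightarrow> nat \<Rightarrow> nat \<Rightarrow> nat option" where
  "upl B C 0 = (\<lambda>_. None)"
| "upl B C (Suc n) = (upl B C n)(n := upf B C (upl B C n) n)"

definition up :: "nat set \<Rightarrow> nat set \<Rightarrow> nat \<Rightarrow> nat option" where "up B C n = upl B C (Suc n) n"

lemma upl_up: "m < n \<Longrightarrow> upl B C n m = up B C m"
  by (induction n) (auto simp: up_def less_Suc_eq)

section \<open>Elementary facts on base hierarchies\<close>

lemma hier_ge2: "base_hierarchy B \<Longrightarrow> b \<in> B \<Longrightarrow> 2 \<le> b"
  unfolding base_hierarchy_def by (metis One_nat_def less_2_cases not_less)

lemma hier_ne: "base_hierarchy B \<Longrightarrow> B \<noteq> {}" unfolding base_hierarchy_def by simp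

lemma hmin_in: "B \<noteq> {} \<Longrightarrow> hmin B \<in> B" unfolding hmin_def by (metis LeastI equals0I)

lemma hmin_le: "b \<in> B \<Longrightarrow> hmin B \<le> b" unfolding hmin_def by (rule Least_le)

lemma base_in: "b \<in> B \<Longrightarrow> base B n \<in> B"
proof -
  assume b: "b \<in> B"
  show ?thesis
  proof (cases "\<exists>b\<in>B. b \<le> n")
    case True
    then obtain x where "x \<in> B \<and> x \<le> n" by auto
    then have "(GREATEST b. b \<in> B \<and> b \<le> n) \<in> B \<and> (GREATEST b. b \<in> B \<and> b \<le> n) \<le> n"
      by (rule GreatestI_nat[of _ _ n]) auto
    then show ?thesis using True by (simp add: base_def)
  next
    case False
    then show ?thesis using b hmin_in unfolding base_def by auto
  qed
qed

lemma base_le: "b \<in> B \<Longrightarrow> b \<le> n \<Longrightarrow> base B n \<le> n"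
proof -
  assume "b \<in> B" "b \<le> n"
  then have "(GREATEST b. b \<in> B \<and> b \<le> n) \<in> B \<and> (GREATEST b. b \<in> B \<and> b \<le> n) \<le> n"
    by (intro GreatestI_nat[of "\<lambda>b. b \<in> B \<and> b \<le> n" b n]) auto
  then show ?thesis using \<open>b \<in> B\<close> \<open>b \<le> n\<close> by (auto simp: base_def)
qed

lemma base_greatest: "b \<in> B \<Longrightarrow> b \<le> n \<Longrightarrow> b \<le> base B n"
proof -
  assume "b \<in> B" "b \<le> n"
  then have "b \<le> (GREATEST b. b \<in> B \<and> b \<le> n)"
    by (intro Greatest_le_nat[of "\<lambda>b. b \<in> B \<and> b \<le> n" b n]) auto
  then show ?thesis using \<open>b \<in> B\<close> \<open>b \<le> n\<close> by (auto simp: base_def)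
qed

lemma base_eqI: "b \<in> B \<Longrightarrow> b \<le> n \<Longrightarrow> (\<And>y. y \<in> B \<Longrightarrow> y \<le> n \<Longrightarrow> y \<le> b) \<Longrightarrow> base B n = b"
  by (meson base_greatest base_in base_le le_antisym)

lemma hier_next:
  assumes "base_hierarchy B" "b \<in> B" "y \<in> B" "b < y"
  obtains s where "s \<in> B" "b < s" "b dvd s" "2 * b \<le> s" "\<And>y. y \<in> B \<Longrightarrow> b < y \<Longrightarrow> s \<le> y"
proof -
  define s where "s = (LEAST s. s \<in> B \<and> b < s)"
  have s: "s \<in> B \<and> b < s" unfolding s_def by (rule LeastI[of _ y]) (use assms in auto)
  have "next_base B b = enat s" unfolding next_base_def s_def using assms by auto
  then have d: "b dvd s" using assms unfolding base_hierarchy_def by force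
  then obtain k where "s = b * k" by blast
  moreover have "k \<noteq> 0" "k \<noteq> 1" using s \<open>s = b * k\<close> by auto
  ultimately have "2 * b \<le> s" using mult_le_mono2[of 2 k b] by (simp add: mult.commute)
  moreover have "s \<le> y" if "y \<in> B" "b < y" for y
    unfolding s_def by (rule Least_le) (use that in auto)
  ultimately show ?thesis using that s d by blast
qed

lemma hierI:
  assumes "B \<noteq> {}" "\<And>b. b \<in> B \<Longrightarrow> 2 \<le> b"
    "\<And>b s. b \<in> B \<Longrightarrow> s \<in> B \<Longrightarrow> b < s \<Longrightarrow> (\<And>y. y \<in> B \<Longrightarrow> b < y \<Longrightarrow> s \<le> y) \<Longrightarrow> b dvd s"
  shows "base_hierarchy B"
  unfolding base_hierarchy_def
proof (intro conjI ballI)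
  show "B \<noteq> {}" by fact
  show "0 \<notin> B" "1 \<notin> B" using assms(2) by force+
  fix b assume b: "b \<in> B"
  show "case next_base B b of enat s \<Rightarrow> b dvd s | \<infinity> \<Rightarrow> True"
  proof (cases "\<exists>y\<in>B. b < y")
    case True
    let ?s = "LEAST s. s \<in> B \<and> b < s"
    from True have s: "?s \<in> B \<and> b < ?s" by (metis (mono_tags, lifting) LeastI)
    have "\<And>y. y \<in> B \<Longrightarrow> b < y \<Longrightarrow> ?s \<le> y" by (simp add: Least_le)
    then have "b dvd ?s" using assms(3)[OF b] s by blast
    then show ?thesis using True by (simp add: next_base_def)
  qed (simp add: next_base_def)
qed

lemma hmin_ge2: "base_hierarchy B \<Longrightarrow> 2 \<le> hmin B"
  by (rule hier_ge2[OF _ hmin_in[OF hier_ne]])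

text \<open>At \<open>n\<close> the table is consulted only below \<open>n\<close>: for digits below
  the base, which is at most \<open>n\<close>, and at the predecessor.\<close>

lemma up_upf:
  assumes "base_hierarchy B"
  shows "up B C n = upf B C (up B C) n"
proof -
  have *: "ango (upl B C n) (base B n) c n = ango (up B C) (base B n) c n" if "hmin B \<le> n" for c
  proof (rule ango_cong)
    fix x assume "x < base B n"
    moreover have "base B n \<le> n" by (rule base_le[OF hmin_in[OF hier_ne[OF assms]] that])
    ultimately show "upl B C n x = up B C x" by (simp add: upl_up)
  qed
  have **: "upl B C n (n - 1) = up B C (n - 1)" if "hmin B \<le> n"
    using hmin_ge2[OF assms] that by (intro upl_up) simp
  have "upf B C (upl B C n) n = upf B C (up B C) n"
  proof (cases "n < hmin B")
    case False
    then have n: "hmin B \<le> n" by simp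
    show ?thesis unfolding upf_def *[OF n] **[OF n] ..
  qed (simp add: upf_def)
  then show ?thesis by (simp add: up_def)
qed

lemma up_less: "base_hierarchy B \<Longrightarrow> n < hmin B \<Longrightarrow> up B C n = Some n"
  by (simp add: up_upf upf_def)

section \<open>Upgrading to the Ouroboros successor\<close>

text \<open>
  The maximum of \<open>B\<^sup>n\<^sub>+\<^sub>i\<close> and the upgrade from \<open>B\<close> to \<open>B\<^sub>+\<^sub>i\<close> below \<open>n + 1\<close>, by simultaneous recursion and
  without reference to the minimisation in the definition of the upgrade; \<open>up_C\<close> shows that it is the upgrade.
\<close>

primrec stage_pair :: "nat set \<Rightarrow> nat \<Rightarrow> nat \<Rightarrow> nat \<times> (nat \<Rightarrow> nat)" where
  "stage_pair B i 0 = (hmin B + 1, \<lambda>x. x)"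
| "stage_pair B i (Suc n) = (let c = fst (stage_pair B i n); v = snd (stage_pair B i n); m = Suc n;
     c' = (if m \<le> hmin B then c
           else if m \<in> B then c * (LEAST a. ang v (base B n) c n < c * a)
           else if base B m dvd m then ((\<lambda>d. ang v (base B m) d m) ^^ i) c else c)
   in (c', v(m := if m < hmin B then m else ang v (base B m) c' m)))"

definition stage_max :: "nat set \<Rightarrow> nat \<Rightarrow> nat \<Rightarrow> nat" where "stage_max B i n = fst (stage_pair B i n)"
definition upgr :: "nat set \<Rightarrow> nat \<Rightarrow> nat \<Rightarrow> nat" where "upgr B i n = snd (stage_pair B i n) n"
definition stage_d :: "nat set \<Rightarrow> nat \<Rightarrow> nat \<Rightarrow> nat \<Rightarrow> nat" where
  "stage_d B i n j = ((\<lambda>d. ang (upgr B i) (base B n) d n) ^^ j) (stage_max B i (n - 1))"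

text \<open>In case (b) the one new element is the new maximum, so it can be read off
  \<open>stage_max\<close>.\<close>

primrec stage :: "nat set \<Rightarrow> nat \<Rightarrow> nat \<Rightarrow> nat set" where
  "stage B i 0 = {hmin B + 1}"
| "stage B i (Suc n) = (if Suc n \<le> hmin B then {hmin B + 1} else stage B i n \<union>
     (if Suc n \<in> B then {stage_max B i (Suc n)}
      else if base B (Suc n) dvd Suc n then stage_d B i (Suc n) ` {1..i} else {}))"

definition ouro_succ :: "nat set \<Rightarrow> nat \<Rightarrow> nat set" where "ouro_succ B i = (\<Union>n. stage B i n)"

lemma snd_stage_pair: "m \<le> n \<Longrightarrow> snd (stage_pair B i n) m = upgr B i m"
proof (induction n)
  case (Suc n)
  then show ?case by (cases "m = Suc n") (auto simp: upgr_def Let_def)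
qed (simp add: upgr_def)

locale ouro =
  fixes B :: "nat set" and i :: nat
  assumes hier: "base_hierarchy B" and i1: "1 \<le> i"
begin

abbreviation l where "l \<equiv> hmin B"
abbreviation c where "c \<equiv> stage_max B i"
abbreviation v where "v \<equiv> upgr B i"
abbreviation bs where "bs \<equiv> base B"
abbreviation d where "d \<equiv> stage_d B i"
abbreviation K where "K \<equiv> stage B i"
abbreviation C where "C \<equiv> ouro_succ B i"

lemma l2: "2 \<le> l" by (rule hmin_ge2[OF hier])
lemma l_in: "l \<in> B" by (rule hmin_in[OF hier_ne[OF hier]])
lemma bs_in: "bs n \<in> B" by (rule base_in[OF l_in])
lemma bs2: "2 \<le> bs n" by (rule hier_ge2[OF hier bs_in])
lemma bs_le: "l \<le> n \<Longrightarrow> bs n \<le> n" by (rule base_le[OF l_in])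
lemma bs_mem: "n \<in> B \<Longrightarrow> bs n = n" by (rule base_eqI) auto
lemma bs_Suc: assumes "l \<le> n" "Suc n \<notin> B" shows "bs (Suc n) = bs n"
proof (rule base_eqI)
  show "bs n \<le> Suc n" using bs_le[OF assms(1)] by simp
  fix y assume "y \<in> B" "y \<le> Suc n"
  then have "y \<le> n" using assms(2) by (metis le_Suc_eq)
  then show "y \<le> bs n" using \<open>y \<in> B\<close> by (rule base_greatest[rotated])
qed (rule bs_in)

lemma c_small: "n \<le> l \<Longrightarrow> c n = l + 1"
  by (induction n) (auto simp: stage_max_def Let_def)

lemma v_small: "n < l \<Longrightarrow> v n = n"
  by (cases n) (auto simp: upgr_def Let_def)

lemma ang_stage_pair: "b \<le> Suc n \<Longrightarrow> 2 \<le> b \<Longrightarrow> ang (snd (stage_pair B i n)) b x m = ang v b x m"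
  by (rule ang_cong) (auto simp: snd_stage_pair)

lemma v_eq: assumes "l \<le> n" shows "v n = ang v (bs n) (c n) n"
proof (cases n)
  case 0
  then show ?thesis using assms l2 by simp
next
  case (Suc m)
  have "v n = ang (snd (stage_pair B i m)) (bs n) (c n) n"
    using assms unfolding Suc by (simp add: upgr_def[of _ _ "Suc m"] stage_max_def Let_def)
  also have "\<dots> = ang v (bs n) (c n) n" using bs_le[OF assms] bs2 Suc by (intro ang_stage_pair) auto
  finally show ?thesis .
qed

lemma c_Suc:
  assumes "l \<le> n"
  shows "c (Suc n) = (if Suc n \<in> B then c n * (LEAST a. ang v (bs n) (c n) n < c n * a)
           else if bs (Suc n) dvd Suc n then d (Suc n) i else c n)"
proof -
  have *: "ang (snd (stage_pair B i n)) (bs n) x m = ang v (bs n) x m" for x m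
    using bs_le[OF assms] bs2 by (intro ang_stage_pair) auto
  have **: "ang (snd (stage_pair B i n)) (bs (Suc n)) x m = ang v (bs (Suc n)) x m" if "Suc n \<notin> B" for x m
    using * bs_Suc[OF assms that] by simp
  show ?thesis using assms * ** by (auto simp: stage_max_def Let_def stage_d_def)
qed

lemma d_0: "d (Suc n) 0 = c n" by (simp add: stage_d_def)
lemma d_Suc: "d n (Suc j) = ang v (bs n) (d n j) n" by (simp add: stage_d_def)

lemma digits_mono:
  assumes "digits v b x" "x \<le> y" shows "digits v b y"
  using assms unfolding digits_def by (meson less_le_trans)

text \<open>The operator to a new base \<open>x\<close> sends the old base to \<open>x\<close>.
  Since \<open>Suc n\<close> lies above the old base, its image exceeds \<open>x\<close>.\<close>

lemma d_step:
  assumes "l \<le> n" "Suc n \<notin> B" "digits v (bs n) (c n)"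
  shows "c n \<le> d (Suc n) j" "d (Suc n) j < d (Suc n) (Suc j)" "digits v (bs n) (d (Suc n) j)"
proof -
  have lt: "x < ang v (bs (Suc n)) x (Suc n)" if "c n \<le> x" for x
  proof -
    interpret digits v "bs n" x using digits_mono[OF assms(3) that] .
    have "bs n < Suc n" using bs_le[OF assms(1)] by simp
    then have "ang v (bs n) x (bs n) < ang v (bs n) x (Suc n)" by (rule ang_mono)
    then show ?thesis using ang_base bs_Suc[OF assms(1,2)] by simp
  qed
  show 1: "c n \<le> d (Suc n) j" for j
  proof (induction j)
    case (Suc j)
    then show ?case using lt[of "d (Suc n) j"] by (simp add: d_Suc)
  qed (simp add: d_0)
  show "d (Suc n) j < d (Suc n) (Suc j)" using lt[OF 1[of j]] by (simp add: d_Suc)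
  show "digits v (bs n) (d (Suc n) j)" using digits_mono[OF assms(3) 1] .
qed

lemma c_Suc_mem:
  assumes "l \<le> n" "Suc n \<in> B" "0 < c n"
  shows "c n dvd c (Suc n)" "ang v (bs n) (c n) n < c (Suc n)"
proof -
  let ?a = "LEAST a. ang v (bs n) (c n) n < c n * a"
  have "1 * Suc (ang v (bs n) (c n) n) \<le> c n * Suc (ang v (bs n) (c n) n)"
    using assms(3) by (intro mult_le_mono) auto
  then have "ang v (bs n) (c n) n < c n * Suc (ang v (bs n) (c n) n)" by (simp only: mult_1 Suc_le_eq)
  then have "ang v (bs n) (c n) n < c n * ?a" by (rule LeastI)
  then show "c n dvd c (Suc n)" "ang v (bs n) (c n) n < c (Suc n)"
    using assms by (auto simp: c_Suc)
qed

text \<open>The two halves support each other: monotonicity up to \<open>n\<close> keeps all values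
  below a new base under the new \<open>c\<close>, and the digit condition makes the operator
  increase from \<open>n\<close> to \<open>Suc n\<close>.\<close>

lemma invariant:
  "(\<forall>x y. x < y \<longrightarrow> y \<le> n \<longrightarrow> v x < v y) \<and> (l \<le> n \<longrightarrow> digits v (bs n) (c n))"
proof (induction n)
  case 0
  then show ?case using l2 by simp
next
  case (Suc n)
  then have IH: "\<And>x y. x < y \<Longrightarrow> y \<le> n \<Longrightarrow> v x < v y" "l \<le> n \<Longrightarrow> digits v (bs n) (c n)" by auto
  have v0: "v 0 = 0" "v 1 = 1" using l2 by (auto simp: v_small)
  have mono_le: "v x \<le> v n" if "x \<le> n" for x using IH(1)[of x n] that by (cases "x = n") auto
  have main: "v n < v (Suc n) \<and> (l \<le> Suc n \<longrightarrow> digits v (bs (Suc n)) (c (Suc n)))"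
  proof -
    consider "Suc n < l" | "Suc n = l" | "l \<le> n" by linarith
    then show ?thesis
    proof cases
      case 1
      then show ?thesis by (simp add: v_small)
    next
      case 2
      have bl: "bs l = l" by (rule bs_mem[OF l_in])
      have D: "digits v l (l + 1)"
        using l2 v0 by unfold_locales (auto simp: v_small)
      have "v l = l + 1" using v_eq[of l] bl c_small[of l] digits.ang_base[OF D] by simp
      then show ?thesis using 2 D bl c_small[of l] v_small[of n] by simp
    next
      case 3
      then interpret D: digits v "bs n" "c n" using IH by simp
      have vn: "v n = ang v (bs n) (c n) n" using v_eq 3 by simp
      have cpos: "0 < c n" using D.c_ge D.b2 by linarith
      have vS: "v (Suc n) = ang v (bs (Suc n)) (c (Suc n)) (Suc n)" using v_eq 3 by simp
      show ?thesis
      proof (cases "Suc n \<in> B")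
        case True
        have lt: "v n < c (Suc n)" using c_Suc_mem(2)[OF 3 True cpos] vn by simp
        have b: "bs (Suc n) = Suc n" by (rule bs_mem[OF True])
        have "digits v (Suc n) (c (Suc n))"
        proof
          fix x assume "x < Suc n"
          then show "v x < c (Suc n)" using mono_le[of x] lt by simp
        qed (use v0 IH(1) 3 l2 in auto)
        then show ?thesis using digits.ang_base[of v "Suc n"] vS b lt by simp
      next
        case False
        have b: "bs (Suc n) = bs n" by (rule bs_Suc[OF 3 False])
        show ?thesis
        proof (cases "bs (Suc n) dvd Suc n")
          case True
          \<comment> \<open>The last iterate is the new maximum, so the upgrade of a critical number
            outside \<open>B\<close> is one iterate further, with index
            \<open>Suc i\<close>.\<close>
          then have cS: "c (Suc n) = d (Suc n) i" using c_Suc[OF 3] False by simp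
          note ds = d_step[OF 3 False D.digits_axioms]
          have "v n < d (Suc n) 1"
            using D.ang_mono[of n "Suc n"] vn b by (simp add: d_Suc d_0)
          also have "d (Suc n) 1 \<le> d (Suc n) i"
            using lift_Suc_mono_le[of "d (Suc n)" 1 i] ds(2) i1 by (simp add: less_imp_le)
          also have "\<dots> < d (Suc n) (Suc i)" by (rule ds(2))
          also have "\<dots> = v (Suc n)" using vS cS by (simp add: d_Suc)
          finally show ?thesis using ds(3) b cS by simp
        next
          case nc: False
          then have "c (Suc n) = c n" using c_Suc[OF 3] False by simp
          then show ?thesis using D.ang_mono[of n "Suc n"] vn vS b D.digits_axioms by simp
        qed
      qed
    qed
  qed
  have "v x < v y" if "x < y" "y \<le> Suc n" for x y
  proof (cases "y = Suc n")
    case True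
    then show ?thesis using mono_le[of x] that main by simp
  next
    case False
    then show ?thesis using IH(1) that by simp
  qed
  then show ?case using main by blast
qed

lemma v_mono: "x < y \<Longrightarrow> v x < v y" using invariant[of y] by auto
lemma v_mono_le: "x \<le> y \<Longrightarrow> v x \<le> v y" using v_mono[of x y] by (cases "x = y") auto
lemma digits_c: "l \<le> n \<Longrightarrow> digits v (bs n) (c n)" using invariant[of n] by auto
lemma v_0: "v 0 = 0" and v_1: "v 1 = 1" using l2 by (auto simp: v_small)

lemma v_ge: "x \<le> v x"
proof (induction x)
  case (Suc x)
  then show ?case using v_mono[of x "Suc x"] by simp
qed simp

lemma v_add: "v x + y \<le> v (x + y)"
proof (induction y)
  case (Suc y)
  then show ?case using v_mono[of "x + y" "x + Suc y"] by simp
qed simp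

lemma c_pos: "0 < c n"
proof (cases "l \<le> n")
  case True
  then show ?thesis using digits.c_ge[OF digits_c] bs2[of n] by (metis gr0I le_zero_eq not_numeral_le_zero)
qed (simp add: c_small)

lemma c_le_v: "l \<le> n \<Longrightarrow> c n \<le> v n"
  using digits.ang_base[OF digits_c] digits.ang_mono_le[OF digits_c bs_le] v_eq by metis

lemma v_mem: "e \<in> B \<Longrightarrow> v e = c e"
  using digits.ang_base[OF digits_c, of e] v_eq[of e] hmin_le[of e B] bs_mem[of e] by simp

lemma d_strict: "l \<le> n \<Longrightarrow> Suc n \<notin> B \<Longrightarrow> strict_mono (d (Suc n))"
  unfolding strict_mono_Suc_iff by (intro allI d_step(2) digits_c)

lemma d_digits: "l \<le> n \<Longrightarrow> Suc n \<notin> B \<Longrightarrow> digits v (bs (Suc n)) (d (Suc n) j)"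
  using d_step(3)[OF _ _ digits_c] bs_Suc by simp

lemma v_less_d1: "l \<le> n \<Longrightarrow> Suc n \<notin> B \<Longrightarrow> v n < d (Suc n) 1"
  using digits.ang_mono[OF digits_c, of n n "Suc n"] v_eq[of n] bs_Suc by (simp add: d_Suc d_0)

lemma v_crit: "l \<le> n \<Longrightarrow> Suc n \<notin> B \<Longrightarrow> bs (Suc n) dvd Suc n \<Longrightarrow> v (Suc n) = d (Suc n) (Suc i)"
  using v_eq[of "Suc n"] c_Suc[of n] by (simp add: d_Suc)

section \<open>The elements of the successor and the gaps between them\<close>

lemma new_props:
  assumes "l \<le> n" "y \<in> K (Suc n)" "y \<notin> K n"
  shows "v n < y" "y \<le> c (Suc n)"
proof -
  consider "Suc n \<in> B" "y = c (Suc n)" |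
    j where "Suc n \<notin> B" "bs (Suc n) dvd Suc n" "y = d (Suc n) j" "1 \<le> j" "j \<le> i"
    using assms by (auto split: if_splits)
  then have "v n < y \<and> y \<le> c (Suc n)"
  proof cases
    case 1
    then show ?thesis using c_Suc_mem(2)[OF assms(1) _ c_pos] v_eq[OF assms(1)] by simp
  next
    case 2
    note m = strict_mono_less_eq[OF d_strict[OF assms(1) 2(1)]]
    have "v n < d (Suc n) 1" by (rule v_less_d1[OF assms(1) 2(1)])
    moreover have "d (Suc n) 1 \<le> y" using m 2 by simp
    moreover have "y \<le> c (Suc n)" using m 2 c_Suc[OF assms(1)] by simp
    ultimately show ?thesis by simp
  qed
  then show "v n < y" "y \<le> c (Suc n)" by auto
qed

lemma K_small: "n \<le> l \<Longrightarrow> K n = {l + 1}" by (cases n) auto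

lemma K_mono_Suc: "K n \<subseteq> K (Suc n)"
  using K_small[of n] by (cases "Suc n \<le> l") auto

lemma K_mono: "m \<le> n \<Longrightarrow> K m \<subseteq> K n"
  by (rule lift_Suc_mono_le[of K, OF K_mono_Suc])

lemma c_mono_Suc: "c n \<le> c (Suc n)"
proof (cases "l \<le> n")
  case True
  show ?thesis
  proof (cases "Suc n \<in> B")
    case b: True
    have "c n \<le> v n" by (rule c_le_v[OF True])
    also have "\<dots> < c (Suc n)" using c_Suc_mem(2)[OF True b c_pos] v_eq[OF True] by simp
    finally show ?thesis by simp
  next
    case False
    then show ?thesis using c_Suc[OF True] d_step(1)[OF True False digits_c[OF True]] by simp
  qed
qed (simp add: c_small)

lemma c_mono: "m \<le> n \<Longrightarrow> c m \<le> c n"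
  by (rule lift_Suc_mono_le[of c, OF c_mono_Suc])

lemma K_le: "y \<in> K n \<Longrightarrow> y \<le> c n"
proof (induction n)
  case (Suc n)
  show ?case
  proof (cases "l \<le> n")
    case True
    then show ?thesis using Suc new_props[OF True Suc.prems] c_mono_Suc[of n] by (meson le_trans)
  next
    case False
    then show ?thesis using Suc.prems c_small[of "Suc n"] by simp
  qed
qed (simp add: c_small)

lemma c_in_K: "c n \<in> K n"
proof (induction n)
  case (Suc n)
  show ?case
  proof (cases "l \<le> n")
    case True
    then show ?thesis using Suc i1 c_Suc[OF True] by auto
  qed (simp add: c_small)
qed (simp add: c_small)

lemma K_sub_C: "K n \<subseteq> C" by (auto simp: ouro_succ_def)
lemma c_in: "c n \<in> C" using c_in_K K_sub_C by blast

text \<open>Stages after \<open>n\<close> add only elements above \<open>v n\<close>, so membership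
  up to \<open>v n\<close> is settled at stage \<open>n\<close>.\<close>

lemma C_cases: assumes "y \<in> C" "l \<le> n" shows "y \<in> K n \<or> v n < y"
proof -
  have *: "l \<le> n \<Longrightarrow> y \<in> K (n + k) \<Longrightarrow> y \<in> K n \<or> v n < y" for k
  proof (induction k)
    case (Suc k)
    show ?case
    proof (cases "y \<in> K (n + k)")
      case False
      then have "v (n + k) < y" using new_props(1)[of "n + k" y] Suc.prems by simp
      then show ?thesis using v_mono_le[of n "n + k"] by simp
    qed (use Suc in auto)
  qed simp
  obtain m where m: "y \<in> K m" using assms(1) by (auto simp: ouro_succ_def)
  then have "y \<in> K (n + (m - n))" 
    by (rule subsetD[OF K_mono, rotated]) simp
  then show ?thesis using * assms(2) by blast
qed

lemma C_le_K: "y \<in> C \<Longrightarrow> l \<le> n \<Longrightarrow> y \<le> n \<Longrightarrow> y \<in> K n"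
  using C_cases[of y n] v_ge[of n] by auto

lemma K_ge: "y \<in> K n \<Longrightarrow> l + 1 \<le> y"
proof (induction n)
  case (Suc n)
  show ?case
  proof (cases "l \<le> n \<and> y \<notin> K n")
    case True
    then have "v n < y" using new_props(1) Suc.prems by blast
    then show ?thesis using v_ge[of n] True by linarith
  next
    case False
    then show ?thesis using Suc K_small[of "Suc n"] by (cases "Suc n \<le> l") auto
  qed
qed simp

lemma hmin_C: "hmin C = l + 1"
proof -
  have "l + 1 \<in> C" using K_sub_C[of 0] by simp
  then show ?thesis unfolding hmin_def[of C] using K_ge
    by (intro Least_equality) (auto simp: ouro_succ_def)
qed

lemma d_in: "l \<le> n \<Longrightarrow> Suc n \<notin> B \<Longrightarrow> bs (Suc n) dvd Suc n \<Longrightarrow> j \<le> i \<Longrightarrow> d (Suc n) j \<in> C"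
proof -
  assume a: "l \<le> n" "Suc n \<notin> B" "bs (Suc n) dvd Suc n" "j \<le> i"
  show ?thesis
  proof (cases j)
    case 0
    then show ?thesis using c_in by (simp add: d_0)
  next
    case (Suc k)
    then have "d (Suc n) j \<in> K (Suc n)" using a by auto
    then show ?thesis using K_sub_C by blast
  qed
qed

text \<open>The source of all gaps used later: in the successor the iterates follow each other
  immediately, and after the last one comes nothing up to the upgrade of the critical
  number.\<close>

lemma d_next:
  assumes "l \<le> n" "Suc n \<notin> B" "bs (Suc n) dvd Suc n" "j \<le> i" "y \<in> C" "d (Suc n) j < y"
  shows "j < i \<Longrightarrow> d (Suc n) (Suc j) \<le> y" "j = i \<Longrightarrow> v (Suc n) < y"
proof -
  note m = strict_mono_less_eq[OF d_strict[OF assms(1,2)]] strict_mono_less[OF d_strict[OF assms(1,2)]]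
  have vd: "v (Suc n) = d (Suc n) (Suc i)" by (rule v_crit[OF assms(1-3)])
  consider "y \<in> K n" | k where "y = d (Suc n) k" "k \<le> i" | "v (Suc n) < y"
    using C_cases[OF assms(5), of "Suc n"] assms(1-3) by auto
  then have "(j < i \<longrightarrow> d (Suc n) (Suc j) \<le> y) \<and> (j = i \<longrightarrow> v (Suc n) < y)"
  proof cases
    case 1
    then have "y \<le> d (Suc n) 0" using K_le by (simp add: d_0)
    also have "\<dots> \<le> d (Suc n) j" using m by simp
    finally show ?thesis using assms(6) by simp
  next
    case 2
    then show ?thesis using m assms(6) by auto
  next
    case 3
    then show ?thesis using m(1)[of "Suc j" "Suc i"] assms(4) vd by simp
  qed
  then show "j < i \<Longrightarrow> d (Suc n) (Suc j) \<le> y" "j = i \<Longrightarrow> v (Suc n) < y" by auto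
qed

text \<open>A new element is a multiple of the old maximum, or it is the image of a critical number
  under the change to its predecessor as base, which by \<open>ang_dvd\<close> is a multiple of that
  predecessor.\<close>

lemma K_dvd:
  "b \<in> K n \<Longrightarrow> s \<in> K n \<Longrightarrow> b < s \<Longrightarrow> (\<And>y. y \<in> K n \<Longrightarrow> b < y \<Longrightarrow> s \<le> y) \<Longrightarrow> b dvd s"
proof (induction n)
  case (Suc n)
  show ?case
  proof (cases "l \<le> n")
    case True
    note KS = K_mono_Suc[of n]
    show ?thesis
    proof (cases "s \<in> K n")
      case s: True
      have "b \<in> K n"
      proof (rule ccontr)
        assume "b \<notin> K n"
        then have "v n < b" using new_props(1)[OF True] Suc.prems(1) by blast
        then show False using c_le_v[OF True] K_le[OF s] Suc.prems(3) by linarith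
      qed
      then show ?thesis using Suc.IH s Suc.prems KS by blast
    next
      case s: False
      have vs: "v n < s" using new_props(1)[OF True Suc.prems(2) s] .
      have b_cases: "b = c n" if "b \<in> K n"
      proof -
        have "b \<le> c n" using K_le[OF that] .
        moreover have "\<not> b < c n"
          using Suc.prems(4)[of "c n"] c_in_K[of n] KS vs c_le_v[OF True] by (meson leD le_less_trans subsetD)
        ultimately show ?thesis by simp
      qed
      consider (1) "Suc n \<in> B" "s = c (Suc n)" |
        (2) j where "Suc n \<notin> B" "bs (Suc n) dvd Suc n" "s = d (Suc n) j" "1 \<le> j" "j \<le> i"
        using Suc.prems(2) s True by (auto split: if_splits)
      then show ?thesis
      proof cases
        case 1
        then have "b \<in> K n" using Suc.prems(1,3) True by auto
        then show ?thesis using b_cases 1 c_Suc_mem(1)[OF True 1(1) c_pos] by simp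
      next
        case 2
        note m = strict_mono_less_eq[OF d_strict[OF True 2(1)]] strict_mono_less[OF d_strict[OF True 2(1)]]
        obtain k where k: "b = d (Suc n) k" "k \<le> i"
          using Suc.prems(1) b_cases 2 True by (auto simp: d_0[symmetric])
        then have kj: "k < j" using Suc.prems(3) 2 m by simp
        then have "d (Suc n) (Suc k) \<in> K (Suc n)" using 2 True by auto
        then have "s \<le> d (Suc n) (Suc k)" using Suc.prems(4) k m by simp
        then have "j = Suc k" using 2 m kj by simp
        then show ?thesis using 2 k digits.ang_dvd[OF d_digits[OF True 2(1)] 2(2)] by (simp add: d_Suc)
      qed
    qed
  next
    case False
    then show ?thesis using Suc.prems by simp
  qed
qed simp

lemma hier_C: "base_hierarchy C"
proof (rule hierI)
  show "C \<noteq> {}" using c_in by blast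
  show "2 \<le> b" if "b \<in> C" for b using that K_ge l2 by (fastforce simp: ouro_succ_def)
  fix b s assume a: "b \<in> C" "s \<in> C" "b < s" "\<And>y. y \<in> C \<Longrightarrow> b < y \<Longrightarrow> s \<le> y"
  let ?n = "l + s"
  have "b \<in> K ?n" "s \<in> K ?n" using a(1-3) by (auto intro: C_le_K)
  then show "b dvd s" using K_dvd a(3,4) K_sub_C by blast
qed

lemma below_c: "l \<le> n \<Longrightarrow> below_next C (v n) (c n)"
  unfolding below_next_def
proof (intro ballI impI)
  fix y assume "l \<le> n" "y \<in> C" "c n < y"
  then show "v n < y" using C_cases[of y n] K_le[of y n] by auto
qed

text \<open>The set \<open>C'\<close> between the stage and the successor covers both the operators
  used during the construction and the final upgrade. The maximum \<open>c n\<close> is the least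
  admissible base: a smaller one gives a value that is too small or that reaches the next
  element.\<close>

lemma up_eq:
  assumes "K n \<subseteq> C'" "C' \<subseteq> C"
  shows "up B C' n = Some (v n)"
  using assms(1)
proof (induction n rule: less_induct)
  case (less n)
  show ?case
  proof (cases "n < l")
    case True
    then show ?thesis by (simp add: up_less[OF hier] v_small)
  next
    case False
    then have ln: "l \<le> n" by simp
    then obtain m where m: "n = Suc m" using l2 by (cases n) auto
    have IH: "up B C' k = Some (v k)" if "k < n" for k
      using less.IH[OF that] K_mono[of k n] less.prems that by fastforce
    have ang: "ango (up B C') (bs n) x n = Some (ang v (bs n) x n)" for x
      using IH bs_le[OF ln] bs2 by (intro ango_ang) auto
    define P where "P = (\<lambda>x. x \<in> C' \<and> (\<exists>w. ango (up B C') (bs n) x n = Some w \<and> v m < w \<and> below_next C' w x))"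
    have "c n \<in> C'" using less.prems c_in_K by blast
    then have Pc: "P (c n)"
      unfolding P_def ang using below_c[OF ln] v_eq[OF ln] v_mono[of m n] m assms(2)
      by (auto simp: below_next_def)
    have least: "c n \<le> x" if "P x" for x
    proof (rule ccontr)
      assume "\<not> c n \<le> x"
      then have xc: "x < c n" by simp
      let ?w = "ang v (bs n) x n"
      from that have x: "x \<in> C'" "v m < ?w" "below_next C' ?w x" unfolding P_def ang by auto
      have no: "?w < y" if "y \<in> K n" "x < y" for y using x(3) that less.prems unfolding below_next_def by blast
      show False
      proof (cases "l \<le> m")
        case False
        then have "n = l" using ln m by simp
        then have "x \<notin> C" using K_ge xc c_small[of n] by (fastforce simp: ouro_succ_def)
        then show False using x(1) assms(2) by blast
      next
        case True
        have "\<not> x < c m"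
        proof
          assume "x < c m"
          then have "?w < c m" using no[of "c m"] c_in_K[of m] K_mono_Suc[of m] m by auto
          then show False using x(2) c_le_v[OF True] by simp
        qed
        then have "c m \<le> x" by simp
        \<comment> \<open>If \<open>n\<close> is a base, the only candidate left is
          \<open>x = c m\<close>. The operator sends the base \<open>n\<close> to \<open>x\<close>,
          which does not exceed \<open>v m\<close>.\<close>
        have nB: "n \<notin> B"
        proof
          assume B: "n \<in> B"
          have "x \<in> K n" using C_cases[of x n] x(1) assms(2) c_le_v[OF ln] xc ln by fastforce
          then have "x \<in> K m" using B m xc True by auto
          then have "x = c m" using K_le \<open>c m \<le> x\<close> by fastforce
          have b: "bs n = n" by (rule bs_mem[OF B])
          have "?w = x"
          proof -
            have "lg n n = 1" by (rule lg_unique) (use ln l2 in auto)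
            then show ?thesis using ang_ge[of n n v x] b ln l2 v_0 v_1 by (simp add: ang_less)
          qed
          then show False using x(2) \<open>x = c m\<close> c_le_v[OF True] by simp
        qed
        have crit: "bs n dvd n"
        proof (rule ccontr)
          assume "\<not> bs n dvd n"
          then have "c n = c m" using c_Suc[OF True] nB m by simp
          then show False using xc \<open>c m \<le> x\<close> by simp
        qed
        have "x \<in> K n" using C_cases[of x n] x(1) assms(2) c_le_v[OF ln] xc ln by fastforce
        \<comment> \<open>For critical \<open>n\<close> a smaller candidate is an iterate before the
          last; its value is the next iterate, which is an element and so not below itself.\<close>
        then have "\<exists>j\<le>i. x = d n j"
        proof (cases "x \<in> K m")
          case True
          then have "x = c m" using K_le \<open>c m \<le> x\<close> by fastforce
          then show ?thesis using m by (auto simp: d_0)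
        next
          case False
          then show ?thesis using \<open>x \<in> K n\<close> m nB \<open>l \<le> m\<close> by (auto split: if_splits)
        qed
        then obtain j where j: "j \<le> i" "x = d n j" by blast
        have "c n = d n i" using c_Suc[OF True] nB m crit by simp
        then have "j \<noteq> i" using xc j by auto
        then have "d n (Suc j) \<in> K n" using j m nB crit True by auto
        moreover have "x < d n (Suc j)"
          using strict_mono_less[OF d_strict[OF True]] nB m j by simp
        ultimately have "?w < d n (Suc j)" by (rule no)
        then show False using j by (simp add: d_Suc)
      qed
    qed
    have "(LEAST x. P x) = c n" using Pc least by (rule Least_equality)
    moreover have "up B C' (n - 1) = Some (v m)" using IH m by simp
    then have "up B C' n = (if \<exists>x. P x then ango (up B C') (bs n) (LEAST x. P x) n else None)"
      using ln unfolding up_upf[OF hier, of C' n] upf_def P_def by (simp add: Let_def)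
    moreover have "\<exists>x. P x" using Pc by blast
    ultimately show ?thesis using ang v_eq[OF ln] by simp
  qed
qed

lemma up_C: "up B C n = Some (v n)"
  by (rule up_eq) (auto simp: K_sub_C[THEN subsetD])

end

section \<open>A lower bound for the length of Goodstein sequences\<close>

text \<open>
  A power \<open>\<omega>\<^bsup>b\<^esup>\<close> is matched by an element \<open>e\<close> of the hierarchy, and the summands of \<open>b\<close> by a descending
  chain of bases below \<open>e\<close> whose multiples by \<open>q + 2\<close> stay below the next base, where \<open>q\<close> matches the
  exponent of the summand. So each level of \<open>dominates\<close> accounts for two exponentials.
\<close>

fun dominates_power :: "(nat \<Rightarrow> ord \<Rightarrow> bool) \<Rightarrow> nat set \<Rightarrow> nat \<Rightarrow> ord list \<Rightarrow> bool" where
  "dominates_power Q C e [] = True"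
| "dominates_power Q C e (a # as) = (\<exists>f\<in>C. \<exists>q. f < e \<and> q + 2 < f \<and> below_next C (f * (q + 2)) f \<and> Q q a \<and> dominates_power Q C f as)"

primrec dominates :: "nat \<Rightarrow> (nat \<Rightarrow> nat set) \<Rightarrow> nat \<Rightarrow> nat \<Rightarrow> ord \<Rightarrow> bool" where
  "dominates 0 Cs s x a = (\<exists>N\<le>x. a = Ord (replicate N (Ord [])))"
| "dominates (Suc k) Cs s x a = (\<exists>es. sorted_wrt (<) es \<and> set es \<subseteq> Cs s \<and> sum_list es \<le> x \<and>
     list_all2 (\<lambda>e b. dominates_power (dominates k Cs s) (Cs s) e (terms b)) es (terms a))"

lemma dominates_power_mono: "dominates_power Q C e as \<Longrightarrow> e \<le> e' \<Longrightarrow> dominates_power Q C e' as"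
  by (cases as) (auto intro: less_le_trans)

lemma dominates_mono: "dominates k Cs s x a \<Longrightarrow> x \<le> x' \<Longrightarrow> dominates k Cs s x' a"
  by (cases k) (auto intro: order_trans)

lemma hier_double: "base_hierarchy B \<Longrightarrow> y \<in> B \<Longrightarrow> e \<in> B \<Longrightarrow> y < e \<Longrightarrow> 2 * y \<le> e"
  by (meson hier_next order_trans)

text \<open>Consecutive elements at least double, by divisibility.\<close>

lemma sum_less:
  assumes "base_hierarchy B" "sorted_wrt (<) es" "set es \<subseteq> B" "e \<in> B" "\<forall>y\<in>set es. y < e"
  shows "sum_list es < e"
  using assms(2-5)
proof (induction es arbitrary: e rule: rev_induct)
  case Nil
  then show ?case using hier_ge2[OF assms(1)] by force
next
  case (snoc y es)
  then have "sum_list es < y" by (simp add: sorted_wrt_append)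
  moreover have "2 * y \<le> e" using snoc.prems hier_double[OF assms(1)] by simp
  ultimately show ?case by simp
qed

context ouro
begin

text \<open>Strictly between \<open>y\<close> and \<open>2 * y\<close> there is neither a base nor a
  critical number. Hence \<open>c\<close> stays constant, and \<open>r\<close> is simply the last
  digit.\<close>

lemma v_plus: "y \<in> B \<Longrightarrow> r < y \<Longrightarrow> v (y + r) = v y + v r"
proof -
  assume y: "y \<in> B" "r < y"
  have ly: "l \<le> y" by (rule hmin_le[OF y(1)])
  have bs: "bs (y + k) = y" if "k < y" for k
  proof (rule base_eqI)
    fix z assume "z \<in> B" "z \<le> y + k"
    then show "z \<le> y" using hier_double[OF hier y(1), of z] that by (cases "y < z") auto
  qed (use y in auto)
  have cy: "k < y \<Longrightarrow> c (y + k) = c y" for k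
  proof (induction k)
    case (Suc k)
    have "y + Suc k \<notin> B"
    proof
      assume "y + Suc k \<in> B"
      then have "2 * y \<le> y + Suc k" by (intro hier_double[OF hier y(1)]) auto
      then show False using Suc.prems by simp
    qed
    moreover have "\<not> y dvd y + Suc k"
    proof
      assume "y dvd y + Suc k"
      then have "y dvd Suc k" using dvd_add_right_iff[of y y "Suc k"] by simp
      then show False using Suc.prems by (auto dest: dvd_imp_le)
    qed
    ultimately show ?case using Suc bs[of "Suc k"] c_Suc[of "y + k"] ly by simp
  qed simp
  interpret digits v y "c y" using digits_c[OF ly] bs_mem[OF y(1)] by simp
  have "v (y + r) = ang v y (c y) (y * 1 + r)" using v_eq[of "y + r"] ly bs[OF y(2)] cy[OF y(2)] by simp
  also have "\<dots> = c y * v 1 + v r" using y b2 by (intro ang_digits) auto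
  finally show ?thesis using v_1 v_mem[OF y(1)] by simp
qed

lemma v_sum: "sorted_wrt (<) es \<Longrightarrow> set es \<subseteq> B \<Longrightarrow> v (sum_list es) = sum_list (map v es)"
proof (induction es rule: rev_induct)
  case (snoc y es)
  have "sum_list es < y" using snoc.prems sum_less[OF hier, of es y] by (simp add: sorted_wrt_append)
  then have "v (y + sum_list es) = v y + v (sum_list es)" using snoc.prems by (intro v_plus) auto
  then show ?case using snoc by (simp add: sorted_wrt_append add.commute)
qed (simp add: v_0)

text \<open>With a coefficient \<open>q\<close> that is a digit and fits below the next base,
  \<open>f * q\<close> is critical, and its iterates form a geometric progression with ratio
  \<open>v q\<close>. So one base with room for \<open>q\<close> multiples becomes a chain of such
  bases.\<close>

lemma crit_coeff:
  assumes "f \<in> B" "2 \<le> q" "q < f" "below_next B (f * q) f"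
  defines "n \<equiv> f * q"
  obtains m where "n = Suc m" "l \<le> m" "n \<notin> B" "bs n = f" "bs n dvd n"
    "\<And>j. d n (Suc j) = d n j * v q" "v n = d n i * v q" "v f \<le> d n 0" "\<And>j. v q < d n j"
proof -
  have lf: "l \<le> f" by (rule hmin_le[OF assms(1)])
  have f2: "2 \<le> f" by (rule hier_ge2[OF hier assms(1)])
  have "f * 2 \<le> n" using assms(2) unfolding n_def by (intro mult_le_mono2)
  then obtain m where m: "n = Suc m" "f \<le> m" using f2 by (cases n) auto
  then have lm: "l \<le> m" using lf by simp
  have nB: "n \<notin> B" using assms(4) m unfolding below_next_def n_def[symmetric] by auto
  have b: "bs n = f"
  proof (rule base_eqI)
    fix y assume "y \<in> B" "y \<le> n"
    then show "y \<le> f" using assms(4) unfolding below_next_def n_def[symmetric] by (meson leD not_le)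
  qed (use assms(1) m in auto)
  have dg: "digits v f (d n j)" for j using d_digits[OF lm] nB b m by simp
  have ds: "d n (Suc j) = d n j * v q" for j
    using digits.ang_digits[OF dg, of q 0] assms(2,3) b v_0 by (simp add: d_Suc n_def)
  have dv: "bs n dvd n" using b by (simp add: n_def)
  have "v n = d n (Suc i)" using v_crit[OF lm] nB dv m by simp
  moreover have "v f \<le> d n 0" using v_mem[OF assms(1)] c_mono[OF m(2)] m by (simp add: d_0)
  moreover have "v q < d n j" for j using digits.v_less[OF dg assms(3)] .
  ultimately show ?thesis using that m(1) lm nB b dv ds by metis
qed

text \<open>The last iterate takes the place of \<open>f\<close>. It keeps the whole coefficient,
  since no element lies between it and the upgrade of the critical number.\<close>

lemma dominates_power_up:
  assumes U: "\<And>q a. Q q a \<Longrightarrow> Q' (v q) a" and mono: "\<And>q q' a. Q' q a \<Longrightarrow> q \<le> q' \<Longrightarrow> Q' q' a"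
  shows "dominates_power Q B e as \<Longrightarrow> e \<in> B \<Longrightarrow> dominates_power Q' C (v e) as"
proof (induction as arbitrary: e)
  case (Cons a as)
  then obtain f q where f: "f \<in> B" "f < e" "q + 2 < f" "below_next B (f * (q + 2)) f" "Q q a" "dominates_power Q B f as"
    by auto
  let ?n = "f * (q + 2)"
  obtain m where m: "?n = Suc m" "l \<le> m" "?n \<notin> B" "bs ?n dvd ?n" "v ?n = d ?n i * v (q + 2)"
    "v f \<le> d ?n 0" "\<And>j. v (q + 2) < d ?n j"
    using crit_coeff[OF f(1) _ f(3,4)] by (metis le_add2)
  have mono_d: "d ?n 0 \<le> d ?n i"
    using strict_mono_less_eq[OF d_strict[OF m(2)]] m(1,3) by simp
  have q2: "v q + 2 \<le> v (q + 2)" by (rule v_add)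
  have ne: "?n < e" using f(4) Cons.prems(2) f(2) unfolding below_next_def by blast
  have "d ?n i \<in> C" using d_in[OF m(2)] m(1,3,4) by simp
  moreover have "d ?n i < v e"
  proof -
    have "d ?n i = d ?n i * 1" by simp
    also have "\<dots> \<le> v ?n" unfolding m(5) using q2 by (intro mult_le_mono) auto
    also have "\<dots> < v e" by (rule v_mono[OF ne])
    finally show ?thesis .
  qed
  moreover have "v (q + 2) - 2 + 2 = v (q + 2)" using q2 by simp
  moreover have "below_next C (d ?n i * v (q + 2)) (d ?n i)"
    using d_next(2)[OF m(2)] m(1,3,4,5) unfolding below_next_def by (metis le_refl)
  moreover have "Q' (v (q + 2) - 2) a" using U[OF f(5)] mono q2 by (metis add_le_imp_le_diff)
  moreover have "dominates_power Q' C (d ?n i) as"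
    using Cons.IH[OF f(6,1)] m(6) mono_d dominates_power_mono order_trans by metis
  ultimately show ?case using m(7)[of i] by (metis dominates_power.simps(2))
qed simp

text \<open>Once the exponent is lowered, every iterate can serve as a base. The iterates with index
  from \<open>g\<close> to \<open>2 * g - 1\<close> represent the \<open>g\<close> copies of the
  power, and each has \<open>g\<close> iterates below it for the \<open>g\<close> copies of the
  lowered summand inside the exponent. The iterates are shared between these two purposes, whence
  only \<open>s div 2\<close> copies per step.\<close>

lemma dominates_power_step:
  assumes U: "\<And>q a. Q q a \<Longrightarrow> Q' (v q) a" and mono: "\<And>q q' a. Q' q a \<Longrightarrow> q \<le> q' \<Longrightarrow> Q' q' a"
    and S: "\<And>q a. Q q a \<Longrightarrow> a \<noteq> Ord [] \<Longrightarrow> Q' (v q - 1) (step s a)"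
    and pos: "\<And>q a. Q q a \<Longrightarrow> a \<noteq> Ord [] \<Longrightarrow> 0 < q"
    and e: "e \<in> B" "dominates_power Q B e (a # as)" and g: "2 * g \<le> Suc i" "g = s div 2"
  obtains ds where "length ds = g" "sorted_wrt (<) ds" "set ds \<subseteq> C" "\<forall>y\<in>set ds. y < v e"
    "\<forall>y\<in>set ds. dominates_power Q' C y (terms (step s (Ord (a # as))))"
proof -
  obtain f q where f: "f \<in> B" "f < e" "q + 2 < f" "below_next B (f * (q + 2)) f" "Q q a" "dominates_power Q B f as"
    using e(2) by auto
  let ?n = "f * (q + 2)"
  obtain m where m: "?n = Suc m" "l \<le> m" "?n \<notin> B" "bs ?n dvd ?n" "v ?n = d ?n i * v (q + 2)"
    "v f \<le> d ?n 0" "\<And>j. v (q + 2) < d ?n j" "\<And>j. d ?n (Suc j) = d ?n j * v (q + 2)"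
    using crit_coeff[OF f(1) _ f(3,4)] by (metis le_add2)
  note sm = strict_mono_less_eq[OF d_strict[OF m(2)], folded m(1), OF m(3)]
    strict_mono_less[OF d_strict[OF m(2)], folded m(1), OF m(3)]
  have q2: "v q + 2 \<le> v (q + 2)" by (rule v_add)
  have ne: "?n < e" using f(4) e(1) f(2) unfolding below_next_def by blast
  have dC: "d ?n j \<in> C" if "j \<le> i" for j using d_in[OF m(2)] m(1,3,4) that by simp
  have gap: "dominates_power Q' C (d ?n j) (replicate k (step s a) @ as)" if "k \<le> j" "j \<le> i" "a \<noteq> Ord [] \<or> k = 0" for j k
    using that
  proof (induction k arbitrary: j)
    case 0
    have "dominates_power Q' C (v f) as" by (rule dominates_power_up[of Q Q', OF U mono f(6,1)])
    moreover have "v f \<le> d ?n j" using m(6) sm(1)[of 0 j] by simp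
    ultimately show ?case using dominates_power_mono by simp
  next
    case (Suc k)
    then obtain j' where j': "j = Suc j'" by (cases j) auto
    let ?q = "v (q + 2) - 3"
    have dpos: "0 < d ?n j'" using m(7)[of j'] by simp
    have "a \<noteq> Ord []" using Suc.prems by simp
    then have "1 + 2 \<le> q + 2" using pos[OF f(5)] by simp
    \<comment> \<open>The multiple by \<open>v (q + 2)\<close> is the next iterate and must be given
      up; the decrease from \<open>v q\<close> to \<open>v q - 1\<close> in \<open>S\<close> pays
      for it.\<close>
    then have q3: "?q + 2 = v (q + 2) - 1" using v_ge[of "q + 2"] by simp
      have "below_next C (d ?n j' * (?q + 2)) (d ?n j')"
        unfolding below_next_def
      proof (intro ballI impI)
        fix y assume "y \<in> C" "d ?n j' < y"
        then have "d ?n (Suc j') \<le> y"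
          using d_next(1)[OF m(2), of j'] m(1,3,4) Suc.prems j' by simp
        moreover have "d ?n j' * (?q + 2) < d ?n (Suc j')"
          unfolding m(8) q3 using dpos q2 by simp
        ultimately show "d ?n j' * (?q + 2) < y" by simp
      qed
      moreover have "?q + 2 < d ?n j'" using m(7)[of j'] q3 by simp
      moreover have "Q' ?q (step s a)"
        by (rule mono[OF S[OF f(5) \<open>a \<noteq> Ord []\<close>]]) (use q2 in simp)
      moreover have "dominates_power Q' C (d ?n j') (replicate k (step s a) @ as)" using Suc j' by simp
      moreover have "d ?n j' < d ?n j" using sm(2) j' by simp
      moreover have "d ?n j' \<in> C" using dC Suc.prems j' by simp
      ultimately show ?case by (simp only: replicate_Suc append_Cons dominates_power.simps) blast
  qed
  let ?ds = "map (d ?n) [g..<2 * g]"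
  have "length ?ds = g" by simp
  moreover have "sorted_wrt (<) ?ds" unfolding sorted_wrt_map using sm(2) by (simp add: sorted_wrt_iff_nth_less)
  moreover have "set ?ds \<subseteq> C" using dC g by auto
  moreover have "\<forall>y\<in>set ?ds. y < v e"
  proof
    fix y assume "y \<in> set ?ds"
    then have "y \<le> d ?n i" using sm(1) g by auto
    also have "\<dots> = d ?n i * 1" by simp
    also have "\<dots> \<le> v ?n" unfolding m(5) using q2 by (intro mult_le_mono) auto
    also have "\<dots> < v e" by (rule v_mono[OF ne])
    finally show "y < v e" .
  qed
  moreover have "\<forall>y\<in>set ?ds. dominates_power Q' C y (terms (step s (Ord (a # as))))"
  proof
    fix y assume "y \<in> set ?ds"
    then obtain j where j: "y = d ?n j" "g \<le> j" "j < 2 * g" by auto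
    then have "j \<le> i" using g by simp
    then show "dominates_power Q' C y (terms (step s (Ord (a # as))))"
      using gap[of g j] gap[of 0 j] j g(2) by auto
  qed
  ultimately show ?thesis by (rule that)
qed

end

section \<open>Goodstein sequences and the descents that they dominate\<close>

primrec hier_seq :: "nat set \<Rightarrow> nat \<Rightarrow> nat set" where
  "hier_seq X 0 = X"
| "hier_seq X (Suc s) = ouro_succ (hier_seq X s) (Suc s)"

text \<open>By \<open>up_C\<close> the upgrade to the Ouroboros successor is everywhere finite and
  given by \<open>upgr\<close>.\<close>

primrec goodstein_seq :: "nat set \<Rightarrow> nat \<Rightarrow> nat \<Rightarrow> nat" where
  "goodstein_seq X m 0 = m"
| "goodstein_seq X m (Suc s) = (if goodstein_seq X m s = 0 then 0 else upgr (hier_seq X s) (Suc s) (goodstein_seq X m s) - 1)"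

primrec upgr_seq :: "nat set \<Rightarrow> nat \<Rightarrow> nat \<Rightarrow> nat" where
  "upgr_seq X 0 x = x"
| "upgr_seq X (Suc s) x = upgr (hier_seq X s) (Suc s) (upgr_seq X s x)"

lemma hier_seq_hier: "base_hierarchy X \<Longrightarrow> base_hierarchy (hier_seq X s)"
proof (induction s)
  case (Suc s)
  then interpret ouro "hier_seq X s" "Suc s" by unfold_locales auto
  show ?case using hier_C by simp
qed simp

lemma hier_seq_ouro: "base_hierarchy X \<Longrightarrow> ouro (hier_seq X s) (Suc s)"
  by unfold_locales (auto simp: hier_seq_hier)

text \<open>The growing minimum is what supplies the finite number at the top of the tower.\<close>

lemma hmin_hier_seq: "base_hierarchy X \<Longrightarrow> hmin (hier_seq X s) = hmin X + s"
  by (induction s) (auto simp: ouro.hmin_C[OF hier_seq_ouro])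

lemma dominates_pos: "base_hierarchy (Cs s) \<Longrightarrow> dominates k Cs s x a \<Longrightarrow> a \<noteq> Ord [] \<Longrightarrow> 0 < x"
proof (cases k)
  case (Suc k')
  assume *: "base_hierarchy (Cs s)" "dominates k Cs s x a" "a \<noteq> Ord []"
  then obtain es where es: "set es \<subseteq> Cs s" "sum_list es \<le> x" "length es = length (terms a)"
    using Suc by (auto dest: list_all2_lengthD)
  have "terms a \<noteq> []" using *(3) by (cases a) auto
  then obtain e es' where e: "es = e # es'" using es(3) by (cases es) auto
  then have "2 \<le> e" using hier_ge2[OF *(1)] es by auto
  then show ?thesis using es e by simp
qed auto

text \<open>The first part is the upgrade alone, the second includes the subtraction of 1. There the
  least base \<open>e\<close> of the sum is traded for bases below \<open>v e\<close>; by
  \<open>sum_less\<close> their sum is less than \<open>v e\<close>, so the subtraction is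
  affordable.\<close>

lemma dominates_step:
  assumes X: "base_hierarchy X"
  shows "dominates k (hier_seq X) s x a \<Longrightarrow> dominates k (hier_seq X) (Suc s) (upgr (hier_seq X s) (Suc s) x) a"
    and "dominates k (hier_seq X) s x a \<Longrightarrow> a \<noteq> Ord [] \<Longrightarrow>
      dominates k (hier_seq X) (Suc s) (upgr (hier_seq X s) (Suc s) x - 1) (step s a)"
proof (induction k arbitrary: x a)
  case 0
  interpret ouro "hier_seq X s" "Suc s" by (rule hier_seq_ouro[OF X])
  {
    case 1
    then show ?case using v_ge[of x] order_trans by auto
  next
    case 2
    then obtain N where N: "N \<le> x" "a = Ord (replicate N (Ord []))" by auto
    then obtain N' where N': "N = Suc N'" using 2 by (cases N) auto
    then have "N' \<le> v x - 1" using N(1) v_ge[of x] by simp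
    then show ?case using N N' by auto
  }
next
  case (Suc k)
  interpret ouro "hier_seq X s" "Suc s" by (rule hier_seq_ouro[OF X])
  let ?Q = "dominates k (hier_seq X) s" and ?Q' = "dominates k (hier_seq X) (Suc s)"
  have C: "hier_seq X (Suc s) = C" by simp
  have up: "dominates_power ?Q' C (v e) as" if "dominates_power ?Q (hier_seq X s) e as" "e \<in> hier_seq X s" for e as
    by (rule dominates_power_up[of ?Q ?Q', OF Suc.IH(1) dominates_mono that])
  have vs: "sorted_wrt (<) (map v es)" "set (map v es) \<subseteq> C" "v (sum_list es) = sum_list (map v es)"
    if "sorted_wrt (<) es" "set es \<subseteq> hier_seq X s" for es
  proof -
    show "sorted_wrt (<) (map v es)" using that(1) v_mono
      by (auto simp: sorted_wrt_map sorted_wrt_iff_nth_less)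
    show "set (map v es) \<subseteq> C" using that(2) v_mem c_in by auto
    show "v (sum_list es) = sum_list (map v es)" by (rule v_sum[OF that])
  qed
  have all2: "list_all2 (\<lambda>e b. dominates_power ?Q' C e (terms b)) (map v es) bs"
    if "list_all2 (\<lambda>e b. dominates_power ?Q (hier_seq X s) e (terms b)) es bs" "set es \<subseteq> hier_seq X s" for es bs
    using that(1,2) up by (induction rule: list_all2_induct) auto
  {
    case 1
    then obtain es where es: "sorted_wrt (<) es" "set es \<subseteq> hier_seq X s" "sum_list es \<le> x"
      "list_all2 (\<lambda>e b. dominates_power ?Q (hier_seq X s) e (terms b)) es (terms a)" by auto
    show ?case
      unfolding dominates.simps C using vs[OF es(1,2)] all2[OF es(4,2)] v_mono_le[OF es(3)]
      by (intro exI[of _ "map v es"]) simp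
  next
    case 2
    then obtain es where es: "sorted_wrt (<) es" "set es \<subseteq> hier_seq X s" "sum_list es \<le> x"
      "list_all2 (\<lambda>e b. dominates_power ?Q (hier_seq X s) e (terms b)) es (terms a)" by auto
    obtain b bs where a: "a = Ord (b # bs)" using 2(2) by (cases a; cases "terms a") auto
    then obtain e es' where e: "es = e # es'" "dominates_power ?Q (hier_seq X s) e (terms b)"
      "list_all2 (\<lambda>e b. dominates_power ?Q (hier_seq X s) e (terms b)) es' bs"
      using es(4) by (auto simp: list_all2_Cons2)
    have es': "sorted_wrt (<) es'" "set es' \<subseteq> hier_seq X s" "e \<in> hier_seq X s" "\<forall>y\<in>set es'. e < y"
      using es(1,2) e(1) by auto
    note V = vs[OF es'(1,2)] all2[OF e(3) es'(2)]
    have le: "v e + sum_list (map v es') \<le> v x"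
      using vs(3)[OF es(1,2)] v_mono_le[OF es(3)] e(1) by simp
    obtain ds where ds: "sorted_wrt (<) ds" "set ds \<subseteq> C" "\<forall>y\<in>set ds. y < v e"
      "list_all2 (\<lambda>e b. dominates_power ?Q' C e (terms b)) ds
        (if b = Ord [] then [] else replicate (s div 2) (step s b))"
    proof (cases b)
      case (Ord as)
      show thesis
      proof (cases as)
        case Nil
        then show thesis using that[of "[]"] Ord by simp
      next
        case (Cons a' as')
        have sp: "dominates_power ?Q (hier_seq X s) e (a' # as')" "2 * (s div 2) \<le> Suc (Suc s)"
          using e(2) Ord Cons by simp_all
        obtain ds where ds: "length ds = s div 2" "sorted_wrt (<) ds" "set ds \<subseteq> C"
          "\<forall>y\<in>set ds. y < v e" "\<forall>y\<in>set ds. dominates_power ?Q' C y (terms (step s (Ord (a' # as'))))"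
        proof (rule dominates_power_step[of ?Q ?Q' s e a' as' "s div 2"])
          show "?Q' (v q) a" if "?Q q a" for q a by (rule Suc.IH(1)[OF that])
          show "?Q' q' a" if "?Q' q a" "q \<le> q'" for q q' a by (rule dominates_mono[OF that])
          show "?Q' (v q - 1) (step s a)" if "?Q q a" "a \<noteq> Ord []" for q a
            by (rule Suc.IH(2)[OF that])
          show "0 < q" if "?Q q a" "a \<noteq> Ord []" for q a
            by (rule dominates_pos[of "hier_seq X" s, OF hier that])
        qed (use es'(3) sp in auto)
        then show thesis using that[of ds] Ord Cons by (simp add: list_all2_conv_all_nth)
      qed
    qed
    have sde: "sum_list ds < v e"
      using ds(1-3) v_mem[OF es'(3)] c_in by (intro sum_less[OF hier_C]) auto
    let ?es = "ds @ map v es'"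
    have "sorted_wrt (<) ?es"
    proof -
      have "y < z" if "y \<in> set ds" "z \<in> set (map v es')" for y z
        using ds(3) that es'(4) v_mono by (auto intro: less_trans)
      then show ?thesis using ds(1) V(1) by (simp add: sorted_wrt_append)
    qed
    moreover have "set ?es \<subseteq> C" using ds(2) V(2) by auto
    moreover have "sum_list ?es \<le> v x - 1" using sde le by simp
    moreover have "list_all2 (\<lambda>e b. dominates_power ?Q' C e (terms b)) ?es (terms (step s a))"
      unfolding a step.simps ord.sel by (rule list_all2_appendI[OF ds(4) V(4)])
    ultimately show ?case unfolding dominates.simps C by blast
  }
qed

lemma dominates_zero: "dominates k Cs s x (Ord [])"
  by (cases k) (auto intro: exI[of _ "[]"])

lemma dominates_run:
  assumes X: "base_hierarchy X" and "dominates k (hier_seq X) s (goodstein_seq X m s) a"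
  shows "dominates k (hier_seq X) (s + t) (goodstein_seq X m (s + t)) (run a [s..<s + t])"
proof (induction t)
  case (Suc t)
  let ?a = "run a [s..<s + t]"
  have r: "run a [s..<s + Suc t] = step (s + t) ?a" by (simp add: run_append)
  show ?case
  proof (cases "?a = Ord []")
    case True
    then show ?thesis unfolding r using dominates_zero by simp
  next
    case False
    have "0 < goodstein_seq X m (s + t)" by (rule dominates_pos[of "hier_seq X", OF hier_seq_hier[OF X] Suc.IH False])
    then show ?thesis unfolding r using dominates_step(2)[OF X Suc.IH False] by simp
  qed
qed (use assms in simp)

lemma goodstein_seq_pos:
  assumes X: "base_hierarchy X" and "dominates k (hier_seq X) s (goodstein_seq X m s) a" "s \<le> u" "run a [s..<u] \<noteq> Ord []"
  shows "goodstein_seq X m u \<noteq> 0"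
  using dominates_run[OF assms(1,2), of "u - s"] dominates_pos[of "hier_seq X" u, OF hier_seq_hier[OF X]] assms(3,4) by fastforce

text \<open>A chain of \<open>k + 1\<close> bases as in condition (ii), recorded by the product of
  its members.\<close>

inductive chain_number :: "nat set \<Rightarrow> nat \<Rightarrow> nat \<Rightarrow> bool" for C :: "nat set" where
  "y \<in> C \<Longrightarrow> chain_number C 0 y"
| "chain_number C k y \<Longrightarrow> f \<in> C \<Longrightarrow> y < f \<Longrightarrow> below_next C (f * y) f \<Longrightarrow> chain_number C (Suc k) (f * y)"

lemma chain_number_ge: "chain_number C k y \<Longrightarrow> base_hierarchy C \<Longrightarrow> hmin C \<le> y"
proof (induction rule: chain_number.induct)
  case (2 k y f)
  have "f * 1 \<le> f * y" using 2 hmin_ge2[of C] by (intro mult_le_mono2) auto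
  then show ?case using hmin_le[OF 2(2)] by linarith
qed (auto intro: hmin_le)

text \<open>A failure of condition (i) that is visible up to \<open>x\<close>.\<close>

definition square_gap :: "nat set \<Rightarrow> nat \<Rightarrow> bool" where
  "square_gap C x \<longleftrightarrow> (\<exists>f\<in>C. below_next C (f\<^sup>2) f \<and> f\<^sup>2 \<le> x)"

context ouro
begin

lemma chain_number_ge2: "chain_number B k y \<Longrightarrow> 2 \<le> y"
  using chain_number_ge[OF _ hier] l2 by fastforce

text \<open>The product \<open>f * y\<close> is critical with digit \<open>y\<close>. Its upgrade is
  the product of the last iterate and \<open>v y\<close>, and the gap after that iterate reaches
  beyond it.\<close>

lemma chain_number_up: "chain_number B k y \<Longrightarrow> chain_number C k (v y)"
proof (induction rule: chain_number.induct)
  case (1 y)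
  then show ?case using v_mem c_in by (auto intro: chain_number.intros)
next
  case (2 k y f)
  let ?n = "f * y"
  obtain m where m: "?n = Suc m" "l \<le> m" "?n \<notin> B" "bs ?n dvd ?n" "v ?n = d ?n i * v y"
    "\<And>j. v y < d ?n j"
    using crit_coeff[OF 2(2) chain_number_ge2[OF 2(1)] 2(3,4)] by metis
  have "d ?n i \<in> C" using d_in[OF m(2)] m(1,3,4) by simp
  moreover have "below_next C (d ?n i * v y) (d ?n i)"
    using d_next(2)[OF m(2)] m(1,3,4,5) unfolding below_next_def by (metis le_refl)
  ultimately show ?case unfolding m(5) using 2(5) m(6) by (intro chain_number.intros)
qed

text \<open>Counterpart of \<open>crit_coeff\<close> for a critical square instead of a multiple:
  each iterate is at least the square of the one before.\<close>

lemma square: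
  assumes "f \<in> B" "below_next B (f\<^sup>2) f"
  defines "n \<equiv> f\<^sup>2"
  obtains m where "n = Suc m" "l \<le> m" "n \<notin> B" "bs n dvd n"
    "\<And>j. (d n j)\<^sup>2 \<le> d n (Suc j)" "v n = d n (Suc i)"
proof -
  have lf: "l \<le> f" by (rule hmin_le[OF assms(1)])
  have f2: "2 \<le> f" by (rule hier_ge2[OF hier assms(1)])
  have "f * 2 \<le> n" using f2 unfolding n_def power2_eq_square by (intro mult_le_mono2)
  then obtain m where m: "n = Suc m" "f \<le> m" using f2 by (cases n) auto
  then have lm: "l \<le> m" using lf by simp
  have nB: "n \<notin> B" using assms(2) m unfolding below_next_def n_def[symmetric] by auto
  have b: "bs n = f"
  proof (rule base_eqI)
    fix y assume "y \<in> B" "y \<le> n"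
    then show "y \<le> f" using assms(2) unfolding below_next_def n_def[symmetric] by (meson leD not_le)
  qed (use assms(1) m in auto)
  have dg: "digits v f (d n j)" for j using d_digits[OF lm] nB b m by simp
  have "(d n j)\<^sup>2 \<le> d n (Suc j)" for j
    using digits.ang_square[OF dg] b by (simp add: d_Suc n_def)
  moreover have dv: "bs n dvd n" using b by (simp add: n_def)
  moreover have "v n = d n (Suc i)" using v_crit[OF lm] nB dv m by simp
  ultimately show ?thesis using that m(1) lm nB by metis
qed

lemma square_gap_up: "square_gap B x \<Longrightarrow> square_gap C (v x)"
proof -
  assume "square_gap B x"
  then obtain f where f: "f \<in> B" "below_next B (f\<^sup>2) f" "f\<^sup>2 \<le> x" by (auto simp: square_gap_def)
  let ?n = "f\<^sup>2"
  obtain m where m: "?n = Suc m" "l \<le> m" "?n \<notin> B" "bs ?n dvd ?n"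
    "\<And>j. (d ?n j)\<^sup>2 \<le> d ?n (Suc j)" "v ?n = d ?n (Suc i)"
    using square[OF f(1,2)] by metis
  have "d ?n i \<in> C" using d_in[OF m(2)] m(1,3,4) by simp
  moreover have "(d ?n i)\<^sup>2 \<le> v ?n" using m(5,6) by simp
  moreover have "v ?n < y" if "y \<in> C" "d ?n i < y" for y
    using d_next(2)[OF m(2), of i y] m(1,3,4) that by simp
  ultimately show "square_gap C (v x)"
    unfolding square_gap_def below_next_def using v_mono_le[OF f(3)] by (meson le_less_trans order_trans)
qed

text \<open>Because the iterates grow at least quadratically, the product of those with index up to
  \<open>k\<close> stays below the next one. So one gap gives chains of any length that
  \<open>i\<close> permits.\<close>

lemma square_gap_chain:
  assumes "square_gap B x" "k < i"
  obtains y where "chain_number C k y" "y < v x"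
proof -
  obtain f where f: "f \<in> B" "below_next B (f\<^sup>2) f" "f\<^sup>2 \<le> x"
    using assms(1) by (auto simp: square_gap_def)
  let ?n = "f\<^sup>2"
  obtain m where m: "?n = Suc m" "l \<le> m" "?n \<notin> B" "bs ?n dvd ?n"
    "\<And>j. (d ?n j)\<^sup>2 \<le> d ?n (Suc j)" "v ?n = d ?n (Suc i)"
    using square[OF f(1,2)] by metis
  note sm = strict_mono_less_eq[OF d_strict[OF m(2)], folded m(1), OF m(3)]
    strict_mono_less[OF d_strict[OF m(2)], folded m(1), OF m(3)]
  have "\<exists>y. chain_number C k y \<and> y < d ?n (Suc k)"
    using assms(2)
  proof (induction k)
    case 0
    have "d ?n 0 \<in> C" using d_in[OF m(2)] m(1,3,4) by simp
    then show ?case using sm(2)[of 0 1] by (auto intro: chain_number.intros)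
  next
    case (Suc k)
    then obtain y where y: "chain_number C k y" "y < d ?n (Suc k)" by auto
    let ?f = "d ?n (Suc k)"
    have "?f * y < ?f * ?f" using y by (intro mult_strict_left_mono) auto
    also have "\<dots> \<le> d ?n (Suc (Suc k))" using m(5) by (simp add: power2_eq_square)
    finally have lt: "?f * y < d ?n (Suc (Suc k))" .
    have "below_next C (?f * y) ?f"
      unfolding below_next_def using d_next(1)[OF m(2), of "Suc k"] m(1,3,4) Suc.prems lt
      by (metis less_imp_le_nat less_le_trans)
    moreover have "?f \<in> C" using d_in[OF m(2)] m(1,3,4) Suc.prems by simp
    ultimately show ?case using y lt by (auto intro: chain_number.intros)
  qed
  then obtain y where "chain_number C k y" "y < d ?n (Suc k)" by blast
  moreover have "d ?n (Suc k) \<le> v x"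
    using sm(1)[of "Suc k" "Suc i"] assms(2) m(6) v_mono_le[OF f(3)] by simp
  ultimately show ?thesis using that by simp
qed

end

text \<open>One upgrade of the chain is spent on new bases. For the product \<open>f * y\<close> the
  last iterate \<open>?e\<close> represents a power of \<omega>; its exponent is again a power of
  \<omega>, represented by the iterate before with a coefficient just below \<open>v y\<close>, to
  which the induction hypothesis applies.\<close>

lemma chain_number_dominates:
  assumes X: "base_hierarchy X"
  shows "chain_number (hier_seq X s) k y \<Longrightarrow> N + 3 \<le> hmin (hier_seq X (Suc s)) \<Longrightarrow>
    dominates k (hier_seq X) (Suc s) (upgr (hier_seq X s) (Suc s) y - 3) (tower (2 * k) N)"
proof (induction rule: chain_number.induct)
  case (1 y)
  interpret ouro "hier_seq X s" "Suc s" by (rule hier_seq_ouro[OF X])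
  have "v y \<in> C" using v_mem[OF 1(1)] c_in by simp
  then have "N + 3 \<le> v y" using hmin_le[of "v y" C] 1(2) by simp
  then show ?case by (auto intro: exI[of _ N])
next
  case (2 k y f)
  interpret ouro "hier_seq X s" "Suc s" by (rule hier_seq_ouro[OF X])
  let ?n = "f * y"
  have y2: "2 \<le> y" "l \<le> y" using chain_number_ge2[OF 2(1)] chain_number_ge[OF 2(1) hier] by auto
  obtain m where m: "?n = Suc m" "l \<le> m" "?n \<notin> hier_seq X s" "bs ?n dvd ?n"
    "v ?n = d ?n (Suc s) * v y" "\<And>j. v y < d ?n j" "\<And>j. d ?n (Suc j) = d ?n j * v y"
    using crit_coeff[OF 2(2) y2(1) 2(3,4)] by metis
  have "v l < v (Suc y)" using y2 by (intro v_mono) simp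
  have "v l = l + 1" using v_mem[OF l_in] c_small[of l] by simp
  then have vy: "3 \<le> v y" using v_mono_le[OF y2(2)] l2 by simp
  let ?e = "d ?n (Suc s)" and ?f = "d ?n s"
  have fC: "?f \<in> C" "?e \<in> C" using d_in[OF m(2)] m(1,3,4) by simp_all
  have ef: "?e = ?f * v y" by (rule m(7))
  have fpos: "3 < ?f" using m(6)[of s] vy by simp
  have "?f < ?e" unfolding ef using fpos vy by simp
  moreover have "v y - 3 + 2 < ?f" using m(6)[of s] vy by simp
  moreover have "below_next C (?f * (v y - 3 + 2)) ?f"
    unfolding below_next_def
  proof (intro ballI impI)
    fix z assume "z \<in> C" "?f < z"
    then have "?e \<le> z" using d_next(1)[OF m(2), of s] m(1,3,4) by simp
    moreover have "?f * (v y - 3 + 2) < ?e"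
      unfolding ef using fpos vy by (intro mult_strict_left_mono) auto
    ultimately show "?f * (v y - 3 + 2) < z" by simp
  qed
  moreover have "dominates k (hier_seq X) (Suc s) (v y - 3) (tower (2 * k) N)" using 2 by simp
  ultimately have "dominates_power (dominates k (hier_seq X) (Suc s)) C ?e [tower (2 * k) N]"
    unfolding dominates_power.simps using fC(1) by blast
  \<comment> \<open>The loss of 3 does not accumulate, since \<open>v ?n\<close> is at least three
    times \<open>?e\<close>.\<close>
  moreover have "?e \<le> v ?n - 3"
  proof -
    have "?e * 3 \<le> ?e * v y" using vy by (intro mult_le_mono2)
    moreover have "3 < ?e" using fpos \<open>?f < ?e\<close> by simp
    ultimately show ?thesis unfolding m(5) by linarith
  qed
  ultimately have "dominates (Suc k) (hier_seq X) (Suc s) (v ?n - 3) (Ord [Ord [tower (2 * k) N]])"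
    unfolding dominates.simps(2) using fC(2) by (intro exI[of _ "[?e]"]) (simp del: dominates_power.simps)
  then show ?case by simp
qed

text \<open>A surplus of \<open>r\<close> in the starting number pays for the subtractions in the
  first \<open>r\<close> steps; upgrading does not diminish a surplus, by
  \<open>v_add\<close>.\<close>

lemma goodstein_seq_ge: "base_hierarchy X \<Longrightarrow> s \<le> r \<Longrightarrow> upgr_seq X s x + (r - s) \<le> goodstein_seq X (x + r) s"
proof (induction s)
  case (Suc s)
  interpret ouro "hier_seq X s" "Suc s" by (rule hier_seq_ouro[OF Suc.prems(1)])
  have IH: "upgr_seq X s x + (r - s) \<le> goodstein_seq X (x + r) s" using Suc by simp
  have "v (upgr_seq X s x) + (r - s) \<le> v (goodstein_seq X (x + r) s)"
    using v_add v_mono_le[OF IH] order_trans by blast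
  moreover have "goodstein_seq X (x + r) s \<noteq> 0" using IH Suc.prems by simp
  ultimately show ?case using Suc.prems by simp
qed simp

lemma goodstein_seq_zero: "goodstein_seq X m s = 0 \<Longrightarrow> s \<le> u \<Longrightarrow> goodstein_seq X m u = 0"
  by (induction u) (auto simp: le_Suc_eq)

lemma chain_number_upgr_seq: "base_hierarchy X \<Longrightarrow> chain_number X k y \<Longrightarrow> chain_number (hier_seq X s) k (upgr_seq X s y)"
  by (induction s) (auto intro: ouro.chain_number_up[OF hier_seq_ouro])

lemma square_gap_upgr_seq: "base_hierarchy X \<Longrightarrow> square_gap X y \<Longrightarrow> square_gap (hier_seq X s) (upgr_seq X s y)"
  by (induction s) (auto intro: ouro.square_gap_up[OF hier_seq_ouro])

text \<open>The successor of the hierarchy with index \<open>t\<close> adds enough iterates to turn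
  a square gap into a chain, as \<open>k \<le> t\<close>; the successor after that turns the chain
  into a tower. By then the minimum exceeds \<open>t\<close>, and the surplus \<open>t + 3\<close>
  has lasted.\<close>

lemma goodstein_seq_dominates:
  assumes X: "base_hierarchy X" and "chain_number X k y \<or> square_gap X y" and "k \<le> t"
  shows "dominates k (hier_seq X) (t + 2) (goodstein_seq X (y + (t + 3)) (t + 2)) (tower (2 * k) t)"
proof -
  let ?m = "y + (t + 3)"
  have N: "t + 3 \<le> hmin (hier_seq X (Suc (t + 1)))"
    using hmin_hier_seq[OF X, of "Suc (t + 1)"] hmin_ge2[OF X] by simp
  interpret A: ouro "hier_seq X t" "Suc t" by (rule hier_seq_ouro[OF X])
  interpret B: ouro "hier_seq X (t + 1)" "Suc (t + 1)" by (rule hier_seq_ouro[OF X])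
  have gt: "upgr_seq X t y + 3 \<le> goodstein_seq X ?m t" using goodstein_seq_ge[OF X, of t "t + 3" y] by simp
  have gt1: "upgr_seq X (t + 1) y + 2 \<le> goodstein_seq X ?m (t + 1)"
    using goodstein_seq_ge[OF X, of "t + 1" "t + 3" y] by simp
  have "\<exists>z. chain_number (hier_seq X (t + 1)) k z \<and> z \<le> goodstein_seq X ?m (t + 1)"
    using assms(2)
  proof
    assume "chain_number X k y"
    then show ?thesis using chain_number_upgr_seq[OF X, of k y "t + 1"] gt1
      by (intro exI[of _ "upgr_seq X (t + 1) y"]) simp
  next
    assume "square_gap X y"
    then obtain z where z: "chain_number (hier_seq X (t + 1)) k z" "z < A.v (upgr_seq X t y)"
      using A.square_gap_chain[OF square_gap_upgr_seq[OF X], of y k] assms(3) by auto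
    have "A.v (upgr_seq X t y) \<le> goodstein_seq X ?m (t + 1)" using gt1 by simp
    then show ?thesis using z by (intro exI[of _ z]) simp
  qed
  then obtain z where z: "chain_number (hier_seq X (t + 1)) k z" "z \<le> goodstein_seq X ?m (t + 1)" by blast
  have "dominates k (hier_seq X) (Suc (t + 1)) (B.v z - 3) (tower (2 * k) t)"
    by (rule chain_number_dominates[OF X z(1) N])
  moreover have "B.v z - 3 \<le> goodstein_seq X ?m (Suc (t + 1))"
    using B.v_mono_le[OF z(2)] gt1 by simp
  ultimately show ?thesis using dominates_mono by fastforce
qed

text \<open>The bases involved are at most \<open>y\<close>, and an element beyond \<open>y\<close>
  lies outside the gaps in question anyway. So agreement up to \<open>y\<close> is enough.\<close>

lemma unbounded_start:
  assumes B: "base_hierarchy B" and "\<nexists>k. k \<ge> 2 \<and> bounded_hierarchy n k B"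
  obtains y where "\<And>X. base_hierarchy X \<Longrightarrow> (\<And>x. x \<le> y \<Longrightarrow> x \<in> X \<longleftrightarrow> x \<in> B) \<Longrightarrow>
    chain_number X (n + 1) y \<or> square_gap X y"
proof -
  \<comment> \<open>With this value (iii) holds, so (i) or (ii) fails.\<close>
  have "\<not> bounded_hierarchy n (max 2 (LEAST b. b \<in> B)) B" using assms(2) by (metis max.cobounded1)
  then have "(\<exists>b\<in>B. \<not> next_base B b \<le> enat (b ^ 2)) \<or>
     (\<exists>c. (\<forall>i\<le>n + 1. c i \<in> B) \<and> (\<forall>i\<le>n. c i < c (i + 1)) \<and>
        (\<forall>i\<le>n + 1. next_base B (c i) > enat (\<Prod>j\<le>i. c j)))"
    unfolding bounded_hierarchy_def by (metis max.cobounded2)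
  then consider
      (1) b where "b \<in> B" "enat (b ^ 2) < next_base B b"
    | (2) c where "\<forall>i\<le>n + 1. c i \<in> B" "\<forall>i\<le>n. c i < c (i + 1)"
        "\<forall>i\<le>n + 1. next_base B (c i) > enat (\<Prod>j\<le>i. c j)"
    unfolding linorder_not_le by blast
  then show ?thesis
  proof cases
    case 1
    have *: "b ^ 2 < y" if "y \<in> B" "b < y" for y
    proof -
      have "(LEAST x. x \<in> B \<and> b < x) \<le> y" using that by (intro Least_le) auto
      moreover have "enat (b ^ 2) < enat (LEAST x. x \<in> B \<and> b < x)"
        using 1 that unfolding next_base_def by (auto split: if_splits)
      ultimately show ?thesis by simp
    qed
    have "b \<le> b ^ 2" by (simp add: power2_eq_square)
    then have "square_gap X (b ^ 2)" if "\<And>x. x \<le> b ^ 2 \<Longrightarrow> x \<in> X \<longleftrightarrow> x \<in> B" for X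
      unfolding square_gap_def below_next_def using that 1(1) * by (intro bexI[of _ b]) (auto simp: not_le[symmetric])
    then show ?thesis using that by blast
  next
    case 2
    define P where "P i = (\<Prod>j\<le>i. c j)" for i
    have PS: "P (Suc i) = c (Suc i) * P i" for i unfolding P_def by (simp add: mult.commute)
    have c2: "2 \<le> c i" if "i \<le> n + 1" for i using hier_ge2[OF B] 2 that by blast
    have nxt: "P i < y" if "i \<le> n + 1" "y \<in> B" "c i < y" for i y
    proof -
      have "(LEAST b. b \<in> B \<and> c i < b) \<le> y" using that by (intro Least_le) auto
      moreover have "enat (P i) < enat (LEAST b. b \<in> B \<and> c i < b)"
        using 2(3) that unfolding P_def next_base_def by (auto split: if_splits)
      ultimately show ?thesis by simp
    qed
    have Pc: "P i < c (Suc i)" if "i \<le> n" for i using nxt[of i "c (Suc i)"] 2 that by simp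
    have P1: "1 \<le> P i" if "i \<le> n + 1" for i
      using that c2 unfolding P_def by (metis (no_types, lifting) One_nat_def Suc_leI atMost_iff gr0I le_trans not_numeral_le_zero prod_zero_iff finite_atMost)
    have cP: "c i \<le> P i" if "i \<le> n + 1" for i
    proof (cases i)
      case (Suc j)
      have "c i * 1 \<le> c i * P j" using P1[of j] that Suc by (intro mult_le_mono2) auto
      then show ?thesis using PS[of j] Suc by simp
    qed (simp add: P_def)
    have PSuc: "P i \<le> P (Suc i)" if "i \<le> n" for i using PS[of i] c2[of "Suc i"] that by simp
    have Pm: "P i \<le> P (n + 1)" if "i \<le> n + 1" for i
      using that
    proof (induction i rule: inc_induct)
      case (step i)
      then show ?case using PSuc[of i] by simp
    qed simp
    have "chain_number X (n + 1) (P (n + 1))" if X: "\<And>x. x \<le> P (n + 1) \<Longrightarrow> x \<in> X \<longleftrightarrow> x \<in> B" for X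
    proof -
      have cX: "c i \<in> X" if "i \<le> n + 1" for i
        using X 2(1) cP[OF that] Pm[OF that] that by auto
      have "i \<le> n + 1 \<Longrightarrow> chain_number X i (P i)" for i
      proof (induction i)
        case 0
        then show ?case using cX[of 0] by (auto simp: P_def intro: chain_number.intros)
      next
        case (Suc i)
        have "below_next X (P (Suc i)) (c (Suc i))"
          unfolding below_next_def
        proof (intro ballI impI)
          fix y assume y: "y \<in> X" "c (Suc i) < y"
          show "P (Suc i) < y"
          proof (rule ccontr)
            assume "\<not> P (Suc i) < y"
            then have "y \<le> P (n + 1)" using Pm[OF Suc.prems] by simp
            then have "y \<in> B" using X y by simp
            then show False using nxt[OF Suc.prems] y \<open>\<not> P (Suc i) < y\<close> by simp
          qed
        qed
        then show ?case unfolding PS using Suc cX[OF Suc.prems] Pc[of i]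
          by (intro chain_number.intros) auto
      qed
      then show ?thesis by simp
    qed
    then show ?thesis using that by blast
  qed
qed

section \<open>Satisfaction in an ultrapower\<close>

instance tm :: countable by countable_datatype
instance st :: countable by countable_datatype
instance fm :: countable by countable_datatype

section \<open>Satisfaction in the natural numbers and names of sets\<close>

primrec tval :: "(nat \<Rightarrow> nat) \<Rightarrow> tm \<Rightarrow> nat" where
  "tval r (Var k) = r k"
| "tval r Zero = 0"
| "tval r One = 1"
| "tval r (Add s t) = tval r s + tval r t"
| "tval r (Mul s t) = tval r s * tval r t"

primrec stval :: "'a \<Rightarrow> (nat \<Rightarrow> 'a) \<Rightarrow> st \<Rightarrow> 'a" where
  "stval N S (SVar k) = S k"
| "stval N S Name = N"

primrec satN :: "nat set \<Rightarrow> fm \<Rightarrow> (nat \<Rightarrow> nat) \<Rightarrow> (nat \<Rightarrow> nat set) \<Rightarrow> bool" where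
  "satN N (Eq s t) r S = (tval r s = tval r t)"
| "satN N (Less s t) r S = (tval r s < tval r t)"
| "satN N (Mem t X) r S = (tval r t \<in> stval N S X)"
| "satN N Fls r S = False"
| "satN N (Imp p q) r S = (satN N p r S \<longrightarrow> satN N q r S)"
| "satN N (Forall p) r S = (\<forall>x. satN N p (case_nat x r) S)"
| "satN N (ForallS p) r S = (\<forall>X. satN N p r (case_nat X S))"

lemma tval_depends: "\<exists>b. \<forall>r r'. (\<forall>k<b. r k = r' k) \<longrightarrow> tval r t = tval r' t"
proof (induction t)
  case (Var k)
  show ?case by (rule exI[of _ "Suc k"]) auto
next
  case (Add s t)
  obtain b where b: "\<forall>r r'. (\<forall>k<b. r k = r' k) \<longrightarrow> tval r s = tval r' s" using Add.IH(1) by (rule exE)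
  obtain c where c: "\<forall>r r'. (\<forall>k<c. r k = r' k) \<longrightarrow> tval r t = tval r' t" using Add.IH(2) by (rule exE)
  have F: "tval r (Add s t) = tval r' (Add s t)" if "\<forall>k<max b c. r k = r' k" for r r'
    using b[rule_format, of r r'] c[rule_format, of r r'] that by simp
  show ?case by (intro exI[of _ "max b c"] allI impI) (rule F)
next
  case (Mul s t)
  obtain b where b: "\<forall>r r'. (\<forall>k<b. r k = r' k) \<longrightarrow> tval r s = tval r' s" using Mul.IH(1) by (rule exE)
  obtain c where c: "\<forall>r r'. (\<forall>k<c. r k = r' k) \<longrightarrow> tval r t = tval r' t" using Mul.IH(2) by (rule exE)
  have F: "tval r (Mul s t) = tval r' (Mul s t)" if "\<forall>k<max b c. r k = r' k" for r r'
    using b[rule_format, of r r'] c[rule_format, of r r'] that by simp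
  show ?case by (intro exI[of _ "max b c"] allI impI) (rule F)
qed auto

lemma tval_depends2:
  "\<exists>b. \<forall>r r'. (\<forall>k<b. r k = r' k) \<longrightarrow> tval r s = tval r' s \<and> tval r t = tval r' t"
proof -
  obtain b where b: "\<forall>r r'. (\<forall>k<b. r k = r' k) \<longrightarrow> tval r s = tval r' s" using tval_depends by (rule exE)
  obtain c where c: "\<forall>r r'. (\<forall>k<c. r k = r' k) \<longrightarrow> tval r t = tval r' t" using tval_depends by (rule exE)
  have F: "tval r s = tval r' s \<and> tval r t = tval r' t" if "\<forall>k<max b c. r k = r' k" for r r'
    using b[rule_format, of r r'] c[rule_format, of r r'] that by simp
  show ?thesis by (intro exI[of _ "max b c"] allI impI) (rule F)
qed

text \<open>Names and codes carry only finite lists of parameters, so the truth of a formula must be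
  recoverable from finitely many values.\<close>

lemma satN_depends:
  "\<exists>b. \<forall>r r' S S'. (\<forall>k<b. r k = r' k) \<longrightarrow> (\<forall>k<b. S k = S' k) \<longrightarrow> satN N p r S = satN N p r' S'"
proof (induction p)
  case (Eq s t)
  obtain b where b: "\<forall>r r'. (\<forall>k<b. r k = r' k) \<longrightarrow> tval r s = tval r' s \<and> tval r t = tval r' t"
    using tval_depends2 by (rule exE)
  have F: "satN N (Eq s t) r S = satN N (Eq s t) r' S'" if "\<forall>k<b. r k = r' k" for r r' S S'
    using b[rule_format, of r r'] that by simp
  show ?case by (intro exI[of _ b] allI impI) (rule F)
next
  case (Less s t)
  obtain b where b: "\<forall>r r'. (\<forall>k<b. r k = r' k) \<longrightarrow> tval r s = tval r' s \<and> tval r t = tval r' t"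
    using tval_depends2 by (rule exE)
  have F: "satN N (Less s t) r S = satN N (Less s t) r' S'" if "\<forall>k<b. r k = r' k" for r r' S S'
    using b[rule_format, of r r'] that by simp
  show ?case by (intro exI[of _ b] allI impI) (rule F)
next
  case (Mem t X)
  obtain b where b: "\<forall>r r'. (\<forall>k<b. r k = r' k) \<longrightarrow> tval r t = tval r' t"
    using tval_depends by (rule exE)
  obtain k where k: "X = SVar k \<or> X = Name" by (cases X) auto
  have F: "satN N (Mem t X) r S = satN N (Mem t X) r' S'"
    if "\<forall>j<max b (Suc k). r j = r' j" "\<forall>j<max b (Suc k). S j = S' j" for r r' S S'
    using b[rule_format, of r r'] that k by auto
  show ?case by (intro exI[of _ "max b (Suc k)"] allI impI) (rule F)
next
  case (Imp p q)
  obtain b where b: "\<forall>r r' S S'. (\<forall>k<b. r k = r' k) \<longrightarrow> (\<forall>k<b. S k = S' k) \<longrightarrow> satN N p r S = satN N p r' S'"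
    using Imp.IH(1) by (rule exE)
  obtain c where c: "\<forall>r r' S S'. (\<forall>k<c. r k = r' k) \<longrightarrow> (\<forall>k<c. S k = S' k) \<longrightarrow> satN N q r S = satN N q r' S'"
    using Imp.IH(2) by (rule exE)
  have F: "satN N (Imp p q) r S = satN N (Imp p q) r' S'"
    if "\<forall>k<max b c. r k = r' k" "\<forall>k<max b c. S k = S' k" for r r' S S'
    using b[rule_format, of r r' S S'] c[rule_format, of r r' S S'] that by simp
  show ?case by (intro exI[of _ "max b c"] allI impI) (rule F)
next
  case (Forall p)
  obtain b where b: "\<forall>r r' S S'. (\<forall>k<b. r k = r' k) \<longrightarrow> (\<forall>k<b. S k = S' k) \<longrightarrow> satN N p r S = satN N p r' S'"
    using Forall.IH by (rule exE)
  have "satN N p (case_nat x r) S = satN N p (case_nat x r') S'"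
    if "\<forall>k<b. r k = r' k" "\<forall>k<b. S k = S' k" for r r' S S' x
    by (rule b[rule_format]) (use that in \<open>auto split: nat.split\<close>)
  note G = this
  have F: "satN N (Forall p) r S = satN N (Forall p) r' S'"
    if "\<forall>k<b. r k = r' k" "\<forall>k<b. S k = S' k" for r r' S S'
    unfolding satN.simps G[OF that] ..
  show ?case by (intro exI[of _ b] allI impI) (rule F)
next
  case (ForallS p)
  obtain b where b: "\<forall>r r' S S'. (\<forall>k<b. r k = r' k) \<longrightarrow> (\<forall>k<b. S k = S' k) \<longrightarrow> satN N p r S = satN N p r' S'"
    using ForallS.IH by (rule exE)
  have "satN N p r (case_nat x S) = satN N p r' (case_nat x S')"
    if "\<forall>k<b. r k = r' k" "\<forall>k<b. S k = S' k" for r r' S S' x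
    by (rule b[rule_format]) (use that in \<open>auto split: nat.split\<close>)
  note G = this
  have F: "satN N (ForallS p) r S = satN N (ForallS p) r' S'"
    if "\<forall>k<b. r k = r' k" "\<forall>k<b. S k = S' k" for r r' S S'
    unfolding satN.simps G[OF that] ..
  show ?case by (intro exI[of _ b] allI impI) (rule F)
qed auto

text \<open>
  Names of the sets of the model: the constant, the value of a fixed operation at a number and at
  sets, and the sets obtained by \<open>\<Delta>\<^sub>1\<close> comprehension from parameters.
\<close>

datatype sname = NmS | Op nat nat "sname list" | Comp fm fm "nat list" "sname list"

definition lenv :: "'a \<Rightarrow> 'a list \<Rightarrow> nat \<Rightarrow> 'a" where "lenv z xs k = (if k < length xs then xs ! k else z)"

lemma lenv_Cons: "lenv z (x # xs) = case_nat x (lenv z xs)"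
  by (auto simp: lenv_def fun_eq_iff split: nat.split)

text \<open>For \<open>Comp\<close> the two definitions of a set agree only within the cut, whereas
  a set of numbers is needed at each \<open>t\<close>. So a number belongs to it if a witness for
  \<open>p\<close> appears no later than the first counterexample to \<open>q\<close>.\<close>

fun ev :: "nat set \<Rightarrow> (nat \<Rightarrow> nat \<Rightarrow> nat set list \<Rightarrow> nat set) \<Rightarrow> sname \<Rightarrow> nat set" where
  "ev N ops NmS = N"
| "ev N ops (Op j p ss) = ops j p (map (ev N ops) ss)"
| "ev N ops (Comp p q ns ss) =
     {x. \<exists>y. satN N p (lenv 0 (y # x # ns)) (lenv {} (map (ev N ops) ss)) \<and>
        (\<forall>z<y. satN N q (lenv 0 (z # x # ns)) (lenv {} (map (ev N ops) ss)))}"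

fun enc :: "sname \<Rightarrow> nat" where
  "enc NmS = 0"
| "enc (Op j p ss) = Suc (prod_encode (0, prod_encode (j, prod_encode (p, list_encode (map enc ss)))))"
| "enc (Comp p q ns ss) =
     Suc (prod_encode (Suc (to_nat (p, q)), prod_encode (list_encode ns, list_encode (map enc ss))))"

lemma map_inj_rec: "(\<And>x y. x \<in> set xs \<Longrightarrow> f x = f y \<Longrightarrow> x = y) \<Longrightarrow> map f xs = map f ys \<Longrightarrow> xs = ys"
proof (induction xs arbitrary: ys)
  case (Cons x xs)
  then obtain y ys' where "ys = y # ys'" by (cases ys) auto
  then show ?case using Cons by auto
qed auto

lemma enc_inj: "enc s = enc s' \<Longrightarrow> s = s'"
proof (induction s arbitrary: s')
  case NmS
  then show ?case by (cases s') auto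
next
  case (Op j p ss)
  then show ?case by (cases s') (auto simp: list_encode_eq intro: map_inj_rec)
next
  case (Comp p q ns ss)
  then show ?case by (cases s') (auto simp: list_encode_eq intro: map_inj_rec)
qed

text \<open>Ultrafilters are the minimal proper filters; lying below \<open>sequentially\<close>
  makes this one nonprincipal.\<close>

lemma ultrafilter_ex:
  "\<exists>F. F \<noteq> bot \<and> F \<le> sequentially \<and> (\<forall>P. eventually P F \<or> eventually (\<lambda>x. \<not> P x) F)"
proof -
  let ?A = "{F. F \<noteq> bot \<and> F \<le> (sequentially :: nat filter)}"
  let ?P = "\<lambda>F G :: nat filter. G \<le> F"
  have "\<exists>m\<in>?A. \<forall>a\<in>?A. ?P m a \<longrightarrow> a = m"
  proof (rule predicate_Zorn)
    show "partial_order_on ?A (relation_of ?P ?A)"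
      by (rule partial_order_on_relation_ofI) auto
    fix C assume "C \<in> Chains (relation_of ?P ?A)"
    then have C: "C \<subseteq> ?A" "\<And>F G. F \<in> C \<Longrightarrow> G \<in> C \<Longrightarrow> F \<le> G \<or> G \<le> F"
      by (auto simp: Chains_def relation_of_def)
    show "\<exists>u\<in>?A. \<forall>a\<in>C. ?P a u"
    proof (cases "C = {}")
      case True
      then show ?thesis using sequentially_bot by (intro bexI[of _ sequentially]) auto
    next
      case False
      have dir: "\<exists>x\<in>C. x \<le> inf F G" if "F \<in> C" "G \<in> C" for F G
        using C(2)[OF that]
      proof
        assume "F \<le> G"
        then have "F \<le> inf F G" by simp
        then show ?thesis using that(1) by (rule rev_bexI[rotated])
      next
        assume "G \<le> F"
        then have "G \<le> inf F G" by simp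
        then show ?thesis using that(2) by (rule rev_bexI[rotated])
      qed
      have "eventually (\<lambda>x. False) (Inf C) \<longleftrightarrow> (\<exists>b\<in>C. eventually (\<lambda>x. False) b)"
        by (rule eventually_Inf_base[OF False dir])
      moreover have "\<not> eventually (\<lambda>x. False) b" if "b \<in> C" for b
        using C(1) that trivial_limit_def[of b] by auto
      ultimately have "\<not> eventually (\<lambda>x. False) (Inf C)" by blast
      then have "Inf C \<noteq> bot" by (simp add: trivial_limit_def)
      moreover have "Inf C \<le> sequentially" using False C(1) by (auto intro: Inf_lower2)
      ultimately show ?thesis by (intro bexI[of _ "Inf C"]) (auto intro: Inf_lower)
    qed
  qed
  then obtain F where F: "F \<noteq> bot" "F \<le> sequentially"
    "\<And>G. G \<noteq> bot \<Longrightarrow> G \<le> sequentially \<Longrightarrow> G \<le> F \<Longrightarrow> G = F" by auto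
  have "eventually (\<lambda>x. \<not> P x) F" if "\<not> eventually P F" for P
  proof -
    let ?G = "inf F (principal {x. \<not> P x})"
    have "?G \<noteq> bot"
      using that by (auto simp: trivial_limit_def eventually_inf_principal)
    moreover have "?G \<le> F" "?G \<le> sequentially" using F(2) by (auto intro: le_infI1)
    ultimately have "?G = F" by (intro F(3))
    moreover have "eventually (\<lambda>x. \<not> P x) ?G" by (simp add: eventually_inf_principal)
    ultimately show ?thesis by simp
  qed
  then show ?thesis using F by blast
qed

section \<open>Truth modulo an ultrafilter\<close>

locale ultra =
  fixes F :: "nat filter"
  assumes F_bot: "F \<noteq> bot" and F_seq: "F \<le> sequentially"
    and F_ultra: "eventually P F \<or> eventually (\<lambda>x. \<not> P x) F"
begin

abbreviation AE :: "(nat \<Rightarrow> bool) \<Rightarrow> bool" where "AE P \<equiv> eventually P F"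

lemma AE_not: "AE (\<lambda>t. \<not> P t) \<longleftrightarrow> \<not> AE P"
  using F_ultra[of P] F_bot eventually_conj[of P F "\<lambda>t. \<not> P t"] by (auto simp: trivial_limit_def)

lemma AE_conj: "AE (\<lambda>t. P t \<and> Q t) \<longleftrightarrow> AE P \<and> AE Q" by (rule eventually_conj_iff)

lemma AE_disj: "AE (\<lambda>t. P t \<or> Q t) \<longleftrightarrow> AE P \<or> AE Q"
proof
  assume a: "AE (\<lambda>t. P t \<or> Q t)"
  show "AE P \<or> AE Q"
  proof (rule ccontr)
    assume "\<not> (AE P \<or> AE Q)"
    then have "AE (\<lambda>t. \<not> P t)" "AE (\<lambda>t. \<not> Q t)" using AE_not[of P] AE_not[of Q] by blast+
    then have "AE (\<lambda>t. False)" using a by eventually_elim blast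
    then show False using F_bot by (simp add: trivial_limit_def)
  qed
next
  assume "AE P \<or> AE Q"
  then show "AE (\<lambda>t. P t \<or> Q t)" by (auto elim: eventually_mono)
qed

lemma AE_imp: "AE (\<lambda>t. P t \<longrightarrow> Q t) \<longleftrightarrow> (AE P \<longrightarrow> AE Q)"
  unfolding imp_conv_disj AE_disj AE_not ..

lemma AE_iff: "AE (\<lambda>t. P t \<longleftrightarrow> Q t) \<longleftrightarrow> (AE P \<longleftrightarrow> AE Q)"
proof -
  have "(\<lambda>t. P t \<longleftrightarrow> Q t) = (\<lambda>t. (P t \<longrightarrow> Q t) \<and> (Q t \<longrightarrow> P t))" by auto
  then have "AE (\<lambda>t. P t \<longleftrightarrow> Q t) \<longleftrightarrow> (AE P \<longrightarrow> AE Q) \<and> (AE Q \<longrightarrow> AE P)"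
    by (simp only: AE_conj AE_imp)
  then show ?thesis by blast
qed

lemma AE_large: "AE (\<lambda>t. N \<le> t)"
  using F_seq eventually_ge_at_top[of N] by (rule filter_leD)

end

lemma tval_subst: "tval r (subst_tm f s) = tval (\<lambda>k. tval r (f k)) s"
  by (induction s) auto

text \<open>The elements are sequences that are not identified modulo the ultrafilter; equality is
  read as equality almost everywhere, which \<open>sat_cong_AE\<close> shows to be a
  congruence.\<close>

locale model = ultra F for F +
  fixes N :: "nat set" and ops :: "nat \<Rightarrow> nat \<Rightarrow> nat set list \<Rightarrow> nat set" and D :: "(nat \<Rightarrow> nat) set"
  assumes D_down: "f \<in> D \<Longrightarrow> AE (\<lambda>t. g t \<le> f t) \<Longrightarrow> g \<in> D"
    and D_const: "(\<lambda>t. c) \<in> D"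
    and D_add: "f \<in> D \<Longrightarrow> g \<in> D \<Longrightarrow> (\<lambda>t. f t + g t) \<in> D"
    and D_mul: "f \<in> D \<Longrightarrow> g \<in> D \<Longrightarrow> (\<lambda>t. f t * g t) \<in> D"
begin

abbreviation EV where "EV \<equiv> ev N ops"

definition Ds :: "(nat \<Rightarrow> sname) set" where "Ds = {s. (\<lambda>t. enc (s t)) \<in> D}"

primrec sat :: "fm \<Rightarrow> (nat \<Rightarrow> nat \<Rightarrow> nat) \<Rightarrow> (nat \<Rightarrow> nat \<Rightarrow> sname) \<Rightarrow> bool" where
  "sat (Eq s u) r S = AE (\<lambda>t. tval (\<lambda>k. r k t) s = tval (\<lambda>k. r k t) u)"
| "sat (Less s u) r S = AE (\<lambda>t. tval (\<lambda>k. r k t) s < tval (\<lambda>k. r k t) u)"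
| "sat (Mem s X) r S = AE (\<lambda>t. tval (\<lambda>k. r k t) s \<in> EV (stval (\<lambda>_. NmS) S X t))"
| "sat Fls r S = False"
| "sat (Imp p q) r S = (sat p r S \<longrightarrow> sat q r S)"
| "sat (Forall p) r S = (\<forall>x\<in>D. sat p (case_nat x r) S)"
| "sat (ForallS p) r S = (\<forall>X\<in>Ds. sat p r (case_nat X S))"

definition envs :: "(nat \<Rightarrow> nat \<Rightarrow> nat) \<Rightarrow> (nat \<Rightarrow> nat \<Rightarrow> sname) \<Rightarrow> bool" where
  "envs r S \<longleftrightarrow> (\<forall>k. r k \<in> D) \<and> (\<forall>k. S k \<in> Ds)"

definition valid :: "fm \<Rightarrow> bool" where "valid p \<longleftrightarrow> (\<forall>r S. envs r S \<longrightarrow> sat p r S)"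

lemma NmS_Ds: "(\<lambda>t. NmS) \<in> Ds" by (simp add: Ds_def D_const)

lemma envs_Cons: "envs r S \<Longrightarrow> x \<in> D \<Longrightarrow> envs (case_nat x r) S"
  by (auto simp: envs_def split: nat.split)

lemma envs_ConsS: "envs r S \<Longrightarrow> X \<in> Ds \<Longrightarrow> envs r (case_nat X S)"
  by (auto simp: envs_def split: nat.split)

lemma tval_D: "(\<And>k. r k \<in> D) \<Longrightarrow> (\<lambda>t. tval (\<lambda>k. r k t) s) \<in> D"
  by (induction s) (auto intro: D_const D_add D_mul)

lemma sat_subst:
  "sat (subst f g p) r S = sat p (\<lambda>k t. tval (\<lambda>j. r j t) (f k)) (\<lambda>k. stval (\<lambda>_. NmS) S (g k))"
proof (induction p arbitrary: f g r S)
  case (Mem s X)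
  have "stval (\<lambda>_. NmS) S (subst_st g X) = stval (\<lambda>_. NmS) (\<lambda>k. stval (\<lambda>_. NmS) S (g k)) X"
    by (cases X) auto
  then show ?case by (simp add: tval_subst)
next
  case (Forall p)
  have "(\<lambda>k t. tval (\<lambda>j. case_nat x r j t) (case_nat (Var 0) (\<lambda>k. subst_tm (\<lambda>l. Var (Suc l)) (f k)) k)) =
        case_nat x (\<lambda>k t. tval (\<lambda>j. r j t) (f k))" for x
    by (auto simp: fun_eq_iff tval_subst split: nat.split)
  then show ?case by (simp add: Forall)
next
  case (ForallS p)
  have *: "stval (\<lambda>_. NmS) (case_nat X S) (subst_st (\<lambda>l. SVar (Suc l)) a) = stval (\<lambda>_. NmS) S a" for X a
    by (cases a) auto
  have "(\<lambda>k. stval (\<lambda>_. NmS) (case_nat X S) (case_nat (SVar 0) (\<lambda>k. subst_st (\<lambda>l. SVar (Suc l)) (g k)) k)) =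
        case_nat X (\<lambda>k. stval (\<lambda>_. NmS) S (g k))" for X
    by (auto simp: fun_eq_iff * split: nat.split)
  then show ?case by (simp add: ForallS)
qed (simp_all add: tval_subst)

lemma sat_inst: "sat (inst p u) r S = sat p (case_nat (\<lambda>t. tval (\<lambda>k. r k t) u) r) S"
proof -
  have "(\<lambda>k t. tval (\<lambda>j. r j t) (case_nat u Var k)) = case_nat (\<lambda>t. tval (\<lambda>k. r k t) u) r"
    by (auto simp: fun_eq_iff split: nat.split)
  then show ?thesis by (simp add: sat_subst)
qed

lemma sat_instS: "sat (instS p X) r S = sat p r (case_nat (stval (\<lambda>_. NmS) S X) S)"
proof -
  have "(\<lambda>k. stval (\<lambda>_. NmS) S (case_nat X SVar k)) = case_nat (stval (\<lambda>_. NmS) S X) S"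
    by (auto simp: fun_eq_iff split: nat.split)
  then show ?thesis by (simp add: sat_subst)
qed

lemma sat_lift: "sat (lift p) (case_nat x r) S = sat p r S" by (simp add: sat_subst)
lemma sat_liftS: "sat (liftS p) r (case_nat X S) = sat p r S" by (simp add: sat_subst)

lemma tval_cong_AE:
  "(\<And>k. AE (\<lambda>t. r k t = r' k t)) \<Longrightarrow> AE (\<lambda>t. tval (\<lambda>k. r k t) s = tval (\<lambda>k. r' k t) s)"
proof (induction s)
  case (Add s u)
  then show ?case using eventually_elim2 by fastforce
next
  case (Mul s u)
  then show ?case using eventually_elim2 by fastforce
qed auto

lemma sat_cong_AE:
  "(\<And>k. AE (\<lambda>t. r k t = r' k t)) \<Longrightarrow> sat p r S = sat p r' S"
proof (induction p arbitrary: r r' S)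
  case (Eq s u)
  note a = tval_cong_AE[of r r' s, OF Eq] tval_cong_AE[of r r' u, OF Eq]
  have "AE (\<lambda>t. (tval (\<lambda>k. r k t) s = tval (\<lambda>k. r k t) u) = (tval (\<lambda>k. r' k t) s = tval (\<lambda>k. r' k t) u))"
    using a by eventually_elim simp
  then show ?case by (simp add: AE_iff)
next
  case (Less s u)
  note a = tval_cong_AE[of r r' s, OF Less] tval_cong_AE[of r r' u, OF Less]
  have "AE (\<lambda>t. (tval (\<lambda>k. r k t) s < tval (\<lambda>k. r k t) u) = (tval (\<lambda>k. r' k t) s < tval (\<lambda>k. r' k t) u))"
    using a by eventually_elim simp
  then show ?case by (simp add: AE_iff)
next
  case (Mem s X)
  note a = tval_cong_AE[of r r' s, OF Mem]
  have "AE (\<lambda>t. (tval (\<lambda>k. r k t) s \<in> EV (stval (\<lambda>_. NmS) S X t)) =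
      (tval (\<lambda>k. r' k t) s \<in> EV (stval (\<lambda>_. NmS) S X t)))"
    using a by eventually_elim simp
  then show ?case by (simp add: AE_iff)
next
  case (Forall p)
  have "sat p (case_nat x r) S = sat p (case_nat x r') S" for x
    by (rule Forall.IH) (use Forall.prems in \<open>auto split: nat.split\<close>)
  then show ?case by simp
next
  case (Imp p q)
  show ?case
    unfolding sat.simps Imp.IH(1)[of r r' S, OF Imp.prems] Imp.IH(2)[of r r' S, OF Imp.prems] ..
next
  case (ForallS p)
  have "sat p r (case_nat X S) = sat p r' (case_nat X S)" for X
    by (rule ForallS.IH) (rule ForallS.prems)
  then show ?case by simp
qed auto

theorem soundness:
  assumes "T \<turnstile> p" and "\<And>q. q \<in> T \<Longrightarrow> valid q"
  shows "valid p"
  using assms(1)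
proof induction
  case (axiom p)
  then show ?case by (rule assms(2))
next
  case (spec p u)
  have "(\<lambda>t. tval (\<lambda>k. r k t) u) \<in> D" if "envs r S" for r S
    using that by (intro tval_D) (auto simp: envs_def)
  then show ?case by (auto simp: valid_def sat_inst)
next
  case (distr p q)
  then show ?case by (simp add: valid_def sat_lift)
next
  case (gen p)
  then show ?case by (simp add: valid_def envs_Cons)
next
  case (specS p X)
  have "stval (\<lambda>_. NmS) S X \<in> Ds" if "envs r S" for r S
    using that NmS_Ds by (cases X) (auto simp: envs_def)
  then show ?case by (auto simp: valid_def sat_instS)
next
  case (distrS p q)
  then show ?case by (simp add: valid_def sat_liftS)
next
  case (genS p)
  then show ?case by (simp add: valid_def envs_ConsS)
next
  case (leibniz s u p)
  have "sat p (case_nat (\<lambda>t. tval (\<lambda>k. r k t) s) r) S = sat p (case_nat (\<lambda>t. tval (\<lambda>k. r k t) u) r) S"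
    if "sat (Eq s u) r S" for r S
    by (rule sat_cong_AE) (use that in \<open>auto split: nat.split\<close>)
  then show ?case by (simp add: valid_def sat_inst)
qed (auto simp: valid_def)

lemma basic_axioms_valid: "q \<in> basic_axioms \<Longrightarrow> valid q"
  unfolding basic_axioms_def Let_def
  by (auto simp: valid_def AE_not[symmetric] AE_imp[symmetric] AE_conj[symmetric] AE_disj[symmetric] less_Suc_eq
      not_less_eq simp del: eventually_const_iff)

text \<open>Witnesses are chosen at each \<open>t\<close> separately. They stay in the cut because
  they lie below the value of a term; nothing would ensure this for an unbounded quantifier.\<close>

lemma Los_bounded:
  "p \<in> bounded_fms \<Longrightarrow> (\<And>k. r k \<in> D) \<Longrightarrow>
    sat p r S \<longleftrightarrow> AE (\<lambda>t. satN N p (\<lambda>k. r k t) (\<lambda>k. EV (S k t)))"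
proof (induction p arbitrary: r rule: bounded_fms.induct)
  case (3 s X)
  have "stval N (\<lambda>k. EV (S k t)) X = EV (stval (\<lambda>_. NmS) S X t)" for t by (cases X) auto
  then show ?case by simp
next
  case (4)
  then show ?case using F_bot by simp
next
  case (5 p q)
  then show ?case by (simp add: AE_imp)
next
  case (6 p s)
  let ?s = "\<lambda>t. tval (\<lambda>k. r k t) s"
  let ?P = "\<lambda>t x. satN N p (case_nat x (\<lambda>k. r k t)) (\<lambda>k. EV (S k t))"
  have sD: "?s \<in> D" using 6(3) by (rule tval_D)
  have c: "(\<lambda>k. case_nat x r k t) = case_nat (x t) (\<lambda>k. r k t)" for x t
    by (auto simp: fun_eq_iff split: nat.split)
  have IH: "sat p (case_nat x r) S \<longleftrightarrow> AE (\<lambda>t. ?P t (x t))" if "x \<in> D" for x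
    unfolding c[symmetric] by (rule 6(2)) (use 6(3) that in \<open>auto split: nat.split\<close>)
  have "(\<forall>x\<in>D. AE (\<lambda>t. x t < ?s t) \<longrightarrow> AE (\<lambda>t. ?P t (x t))) \<longleftrightarrow> AE (\<lambda>t. \<forall>x<?s t. ?P t x)"
  proof
    assume L: "\<forall>x\<in>D. AE (\<lambda>t. x t < ?s t) \<longrightarrow> AE (\<lambda>t. ?P t (x t))"
    show "AE (\<lambda>t. \<forall>x<?s t. ?P t x)"
    proof (rule ccontr)
      assume "\<not> ?thesis"
      then have *: "AE (\<lambda>t. \<exists>x<?s t. \<not> ?P t x)" by (simp add: AE_not[symmetric])
      define x where "x t = (SOME x. x < ?s t \<and> \<not> ?P t x)" for t
      have x: "AE (\<lambda>t. x t < ?s t \<and> \<not> ?P t (x t))"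
        using * by eventually_elim (unfold x_def, rule someI_ex, blast)
      then have "AE (\<lambda>t. x t \<le> ?s t)" by eventually_elim simp
      then have "x \<in> D" using D_down[OF sD] by blast
      then show False using L x by (auto simp: AE_conj AE_not)
    qed
  next
    assume R: "AE (\<lambda>t. \<forall>x<?s t. ?P t x)"
    show "\<forall>x\<in>D. AE (\<lambda>t. x t < ?s t) \<longrightarrow> AE (\<lambda>t. ?P t (x t))"
    proof (intro ballI impI)
      fix x assume "AE (\<lambda>t. x t < ?s t)"
      then show "AE (\<lambda>t. ?P t (x t))" using R by eventually_elim simp
    qed
  qed
  then show ?case using IH by (simp add: tval_subst c)
next
  case (7 p s)
  let ?s = "\<lambda>t. tval (\<lambda>k. r k t) s"
  let ?P = "\<lambda>t x. satN N p (case_nat x (\<lambda>k. r k t)) (\<lambda>k. EV (S k t))"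
  have sD: "?s \<in> D" using 7(3) by (rule tval_D)
  have c: "(\<lambda>k. case_nat x r k t) = case_nat (x t) (\<lambda>k. r k t)" for x t
    by (auto simp: fun_eq_iff split: nat.split)
  have IH: "sat p (case_nat x r) S \<longleftrightarrow> AE (\<lambda>t. ?P t (x t))" if "x \<in> D" for x
    unfolding c[symmetric] by (rule 7(2)) (use 7(3) that in \<open>auto split: nat.split\<close>)
  have "(\<exists>x\<in>D. AE (\<lambda>t. x t < ?s t) \<and> AE (\<lambda>t. ?P t (x t))) \<longleftrightarrow> AE (\<lambda>t. \<exists>x<?s t. ?P t x)"
  proof
    assume "\<exists>x\<in>D. AE (\<lambda>t. x t < ?s t) \<and> AE (\<lambda>t. ?P t (x t))"
    then obtain x where "AE (\<lambda>t. x t < ?s t)" "AE (\<lambda>t. ?P t (x t))" by blast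
    then show "AE (\<lambda>t. \<exists>x<?s t. ?P t x)" by eventually_elim blast
  next
    assume *: "AE (\<lambda>t. \<exists>x<?s t. ?P t x)"
    define x where "x t = (SOME x. x < ?s t \<and> ?P t x)" for t
    have x: "AE (\<lambda>t. x t < ?s t \<and> ?P t (x t))"
      using * by eventually_elim (unfold x_def, rule someI_ex, blast)
    then have "AE (\<lambda>t. x t \<le> ?s t)" by eventually_elim simp
    then have "x \<in> D" using D_down[OF sD] by blast
    then show "\<exists>x\<in>D. AE (\<lambda>t. x t < ?s t) \<and> AE (\<lambda>t. ?P t (x t))" using x by (auto simp: AE_conj)
  qed
  then show ?case using IH by (auto simp: tval_subst c)
qed auto

lemma D_Suc: "f \<in> D \<Longrightarrow> (\<lambda>t. Suc (f t)) \<in> D"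
  using D_add[OF _ D_const[of 1]] by simp

lemma D_le: "f \<in> D \<Longrightarrow> (\<And>t. g t \<le> f t) \<Longrightarrow> g \<in> D"
  by (rule D_down) (auto intro: always_eventually)

lemma triangle_le: "triangle n \<le> n * n"
  by (induction n) auto

lemma D_prod: assumes "f \<in> D" "g \<in> D" shows "(\<lambda>t. prod_encode (f t, g t)) \<in> D"
proof -
  have "(\<lambda>t. (f t + g t) * (f t + g t) + f t) \<in> D" using assms by (intro D_add D_mul)
  moreover have "prod_encode (f t, g t) \<le> (f t + g t) * (f t + g t) + f t" for t
    using triangle_le[of "f t + g t"] by (simp add: prod_encode_def)
  ultimately show ?thesis by (rule D_le)
qed

lemma D_list: "\<forall>f\<in>set fs. f \<in> D \<Longrightarrow> (\<lambda>t. list_encode (map (\<lambda>f. f t) fs)) \<in> D"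
  by (induction fs) (auto intro: D_const D_prod D_Suc)

lemma Ds_list: "\<forall>s\<in>set ss. s \<in> Ds \<Longrightarrow> (\<lambda>t. list_encode (map enc (map (\<lambda>s. s t) ss))) \<in> D"
  by (induction ss) (auto simp: Ds_def intro: D_const D_prod D_Suc)

lemma Ds_Op: "p \<in> D \<Longrightarrow> \<forall>s\<in>set ss. s \<in> Ds \<Longrightarrow> (\<lambda>t. Op j (p t) (map (\<lambda>s. s t) ss)) \<in> Ds"
  using Ds_list[of ss] unfolding Ds_def by (auto intro!: D_Suc D_prod D_const simp: Ds_def)

lemma Ds_Comp:
  "\<forall>f\<in>set ns. f \<in> D \<Longrightarrow> \<forall>s\<in>set ss. s \<in> Ds \<Longrightarrow>
    (\<lambda>t. Comp p q (map (\<lambda>f. f t) ns) (map (\<lambda>s. s t) ss)) \<in> Ds"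
  using Ds_list[of ss] D_list[of ns] unfolding Ds_def by (auto intro!: D_Suc D_prod D_const simp: Ds_def)

lemma lenv_map_upt: "k < b \<Longrightarrow> lenv z (map f [0..<b]) k = f k"
  by (simp add: lenv_def)

text \<open>For an element of the cut, either a witness for \<open>p\<close> or a counterexample to
  \<open>q\<close> lies in the cut, so the comparison in \<open>Comp\<close> is decided
  there.\<close>

lemma Delta1_CA_valid:
  assumes "f \<in> Delta1_CA"
  shows "valid f"
proof -
  obtain p q where f: "f = Imp (Forall (Iff (Exists p) (Forall q)))
      (ExistsS (Forall (Iff (Mem (Var 0) (SVar 0)) (liftS (Exists p)))))"
    and p: "p \<in> bounded_fms" "q \<in> bounded_fms"
    using assms unfolding Delta1_CA_def by auto
  show ?thesis
    unfolding valid_def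
  proof (intro allI impI)
    fix r S assume e: "envs r S"
    show "sat f r S"
    proof (cases "sat (Forall (Iff (Exists p) (Forall q))) r S")
      case True
      then have pq: "(\<exists>y\<in>D. sat p (case_nat y (case_nat x r)) S) \<longleftrightarrow>
        (\<forall>y\<in>D. sat q (case_nat y (case_nat x r)) S)" if "x \<in> D" for x
        using that by auto
      obtain b1 where b1: "\<forall>r r' S S'. (\<forall>k<b1. r k = r' k) \<longrightarrow> (\<forall>k<b1. S k = S' k) \<longrightarrow>
          satN N p r S = satN N p r' S'"
        using satN_depends by metis
      obtain b2 where b2: "\<forall>r r' S S'. (\<forall>k<b2. r k = r' k) \<longrightarrow> (\<forall>k<b2. S k = S' k) \<longrightarrow>
          satN N q r S = satN N q r' S'"
        using satN_depends by metis
      define b where "b = max b1 b2"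
      define X where "X t = Comp p q (map (\<lambda>f. f t) (map r [0..<b])) (map (\<lambda>s. s t) (map S [0..<b]))" for t
      have X: "X \<in> Ds" unfolding X_def using e by (intro Ds_Comp) (auto simp: envs_def)
      have EX: "x \<in> EV (X t) \<longleftrightarrow> (\<exists>y. satN N p (case_nat y (case_nat x (\<lambda>k. r k t))) (\<lambda>k. EV (S k t)) \<and>
        (\<forall>z<y. satN N q (case_nat z (case_nat x (\<lambda>k. r k t))) (\<lambda>k. EV (S k t))))" for x t
      proof -
        have "satN N p (lenv 0 (y # x # map (\<lambda>k. r k t) [0..<b])) (lenv {} (map (\<lambda>k. EV (S k t)) [0..<b])) =
          satN N p (case_nat y (case_nat x (\<lambda>k. r k t))) (\<lambda>k. EV (S k t))" for y
          by (intro b1[rule_format]) (auto simp: lenv_Cons lenv_map_upt b_def split: nat.split)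
        moreover have "satN N q (lenv 0 (y # x # map (\<lambda>k. r k t) [0..<b])) (lenv {} (map (\<lambda>k. EV (S k t)) [0..<b])) =
          satN N q (case_nat y (case_nat x (\<lambda>k. r k t))) (\<lambda>k. EV (S k t))" for y
          by (intro b2[rule_format]) (auto simp: lenv_Cons lenv_map_upt b_def split: nat.split)
        ultimately show ?thesis by (simp add: X_def comp_def)
      qed
      have c: "(\<lambda>k. case_nat y (case_nat x r) k t) = case_nat (y t) (case_nat (x t) (\<lambda>k. r k t))" for x y t
        by (auto simp: fun_eq_iff split: nat.split)
      let ?p = "\<lambda>t x y. satN N p (case_nat y (case_nat x (\<lambda>k. r k t))) (\<lambda>k. EV (S k t))"
      let ?q = "\<lambda>t x y. satN N q (case_nat y (case_nat x (\<lambda>k. r k t))) (\<lambda>k. EV (S k t))"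
      have satp: "sat p (case_nat y (case_nat x r)) S \<longleftrightarrow> AE (\<lambda>t. ?p t (x t) (y t))"
        and satq: "sat q (case_nat y (case_nat x r)) S \<longleftrightarrow> AE (\<lambda>t. ?q t (x t) (y t))"
        if "x \<in> D" "y \<in> D" for x y
        using Los_bounded[OF p(1), of "case_nat y (case_nat x r)" S]
          Los_bounded[OF p(2), of "case_nat y (case_nat x r)" S] that e
        by (auto simp: c envs_def split: nat.split)
      have "AE (\<lambda>t. x t \<in> EV (X t)) \<longleftrightarrow> (\<exists>y\<in>D. sat p (case_nat y (case_nat x r)) S)" if x: "x \<in> D" for x
      proof
        assume "\<exists>y\<in>D. sat p (case_nat y (case_nat x r)) S"
        then obtain y where y: "y \<in> D" "AE (\<lambda>t. ?p t (x t) (y t))" using satp x by blast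
        \<comment> \<open>An earlier counterexample to \<open>q\<close> would lie in the cut, where
          the two definitions agree.\<close>
        have "AE (\<lambda>t. \<forall>z<y t. ?q t (x t) z)"
        proof (rule ccontr)
          assume "\<not> ?thesis"
          then have *: "AE (\<lambda>t. \<exists>z<y t. \<not> ?q t (x t) z)" by (simp add: AE_not[symmetric])
          define z where "z t = (SOME z. z < y t \<and> \<not> ?q t (x t) z)" for t
          have z: "AE (\<lambda>t. z t < y t \<and> \<not> ?q t (x t) (z t))"
            using * by eventually_elim (unfold z_def, rule someI_ex, blast)
          then have "AE (\<lambda>t. z t \<le> y t)" by eventually_elim simp
          then have "z \<in> D" using D_down[OF y(1)] by blast
          then have "AE (\<lambda>t. ?q t (x t) (z t))"
            using satq[OF x] pq[OF x] satp[OF x y(1)] y by blast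
          then show False using z by (auto simp: AE_conj AE_not)
        qed
        then show "AE (\<lambda>t. x t \<in> EV (X t))" using y(2) unfolding EX by eventually_elim blast
      next
        assume A: "AE (\<lambda>t. x t \<in> EV (X t))"
        show "\<exists>y\<in>D. sat p (case_nat y (case_nat x r)) S"
        proof (rule ccontr)
          assume N: "\<not> ?thesis"
          then obtain z where z: "z \<in> D" "\<not> AE (\<lambda>t. ?q t (x t) (z t))"
            using pq[OF x] satq[OF x] by blast
          then have nz: "AE (\<lambda>t. \<not> ?q t (x t) (z t))" by (simp add: AE_not)
          define y where "y t = (SOME y. ?p t (x t) y \<and> (\<forall>z<y. ?q t (x t) z))" for t
          have y: "AE (\<lambda>t. ?p t (x t) (y t) \<and> (\<forall>z<y t. ?q t (x t) z))"
            using A unfolding EX by eventually_elim (unfold y_def, rule someI_ex)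
          \<comment> \<open>The counterexample \<open>z\<close> bounds the witness and thereby
            brings it into the cut.\<close>
          then have "AE (\<lambda>t. y t \<le> z t)" using nz by eventually_elim (meson not_less)
          then have "y \<in> D" using D_down[OF z(1)] by blast
          moreover have "AE (\<lambda>t. ?p t (x t) (y t))" using y by eventually_elim simp
          ultimately show False using N satp[OF x] by blast
        qed
      qed
      then have "\<forall>x\<in>D. sat (Iff (Mem (Var 0) (SVar 0)) (liftS (Exists p))) (case_nat x r) (case_nat X S)"
        using sat_liftS[of "Exists p" _ X S] by simp
      then show ?thesis unfolding f using X by auto
    next
      case False
      then show ?thesis unfolding f by (subst sat.simps(5)) blast
    qed
  qed
qed

end

section \<open>Induction in a cut\<close>

text \<open>Writing the alternation with existential quantifiers and negations only gives all levels
  the same form, so that one notion of witness serves for all of them.\<close>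

primrec alt_sat :: "nat set \<Rightarrow> nat list \<Rightarrow> fm \<Rightarrow> (nat \<Rightarrow> nat) \<Rightarrow> (nat \<Rightarrow> nat set) \<Rightarrow> bool" where
  "alt_sat N [] p r S = satN N p r S"
| "alt_sat N (M # Ms) p r S = (\<exists>y\<le>M. \<not> alt_sat N Ms p (case_nat y r) S)"

definition pcode :: "fm \<Rightarrow> nat list \<Rightarrow> sname list \<Rightarrow> nat" where
  "pcode p ns ss = prod_encode (to_nat p, prod_encode (list_encode ns, list_encode (map enc ss)))"

text \<open>
  \<open>witnesses \<dots> Ms c z\<close>: \<open>z\<close> is a witness for the formula coded by \<open>c\<close>, whose remaining quantifiers are
  bounded by \<open>Ms\<close>. The alternation of quantifiers is absorbed by the negation in \<open>alt_sat\<close>.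
\<close>

definition witnesses :: "nat set \<Rightarrow> (nat \<Rightarrow> nat \<Rightarrow> nat set list \<Rightarrow> nat set) \<Rightarrow> nat list \<Rightarrow> nat \<Rightarrow> nat \<Rightarrow> bool" where
  "witnesses N ops Ms c z \<longleftrightarrow> (\<exists>p ns ss. c = pcode p ns ss \<and>
     \<not> alt_sat N Ms p (lenv 0 (z # ns)) (lenv {} (map (ev N ops) ss)))"

lemma pcode_inj: "pcode p ns ss = pcode p' ns' ss' \<Longrightarrow> p = p' \<and> ns = ns' \<and> ss = ss'"
  unfolding pcode_def by (auto simp: list_encode_eq intro: map_inj_rec enc_inj)

lemma witnesses_pcode:
  "witnesses N ops Ms (pcode p ns ss) z \<longleftrightarrow> \<not> alt_sat N Ms p (lenv 0 (z # ns)) (lenv {} (map (ev N ops) ss))"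
  unfolding witnesses_def using pcode_inj by blast

lemma alt_sat_depends:
  assumes "\<And>r r' S S'. (\<forall>k<b. r k = r' k) \<Longrightarrow> (\<forall>k<b. S k = S' k) \<Longrightarrow> satN N p r S = satN N p r' S'"
  shows "(\<forall>k<b. r k = r' k) \<Longrightarrow> (\<forall>k<b. S k = S' k) \<Longrightarrow> alt_sat N Ms p r S = alt_sat N Ms p r' S'"
proof (induction Ms arbitrary: r r')
  case Nil
  show ?case unfolding alt_sat.simps by (rule assms) (use Nil in auto)
next
  case (Cons M Ms)
  have "alt_sat N Ms p (case_nat y r) S = alt_sat N Ms p (case_nat y r') S'" for y
    by (rule Cons.IH) (use Cons.prems in \<open>auto split: nat.split\<close>)
  then show ?case by simp
qed

definition pr :: "nat \<Rightarrow> nat \<Rightarrow> nat" where "pr x y = (x + y) * (x + y) + x"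

fun sigf :: "nat \<Rightarrow> fm \<Rightarrow> fm" and pif :: "nat \<Rightarrow> fm \<Rightarrow> fm" where
  "sigf 0 p = p"
| "sigf (Suc j) p = Exists (pif j p)"
| "pif 0 p = p"
| "pif (Suc j) p = Forall (sigf j p)"

lemma Sigma0_sigf:
  "(f \<in> Sigma0 j \<longrightarrow> (\<exists>p\<in>bounded_fms. f = sigf j p)) \<and> (f \<in> Pi0 j \<longrightarrow> (\<exists>p\<in>bounded_fms. f = pif j p))"
proof (induction j arbitrary: f)
  case (Suc j)
  show ?case
  proof (intro conjI impI)
    assume "f \<in> Sigma0 (Suc j)"
    then obtain g where "g \<in> Pi0 j" "f = Exists g" by auto
    then show "\<exists>p\<in>bounded_fms. f = sigf (Suc j) p" using Suc[of g] by auto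
  next
    assume "f \<in> Pi0 (Suc j)"
    then obtain g where "g \<in> Sigma0 j" "f = Forall g" by auto
    then show "\<exists>p\<in>bounded_fms. f = pif (Suc j) p" using Suc[of g] by auto
  qed
qed auto

lemma (in model) sat_pif:
  "(sat (pif j p) r S \<longleftrightarrow> \<not> sat (sigf j (Neg p)) r S) \<and> (sat (sigf j p) r S \<longleftrightarrow> \<not> sat (pif j (Neg p)) r S)"
proof (induction j arbitrary: r)
  case (Suc j)
  have "sat (pif j (Neg p)) r S \<longleftrightarrow> \<not> sat (sigf j p) r S" "sat (pif j p) r S \<longleftrightarrow> \<not> sat (sigf j (Neg p)) r S" for r
    using Suc[of r] by blast+
  then show ?case by simp
qed simp

primrec (in model) ssat :: "nat \<Rightarrow> fm \<Rightarrow> (nat \<Rightarrow> nat \<Rightarrow> nat) \<Rightarrow> (nat \<Rightarrow> nat \<Rightarrow> sname) \<Rightarrow> bool" where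
  "ssat 0 p r S = sat p r S"
| "ssat (Suc j) p r S = (\<exists>y\<in>D. \<not> ssat j p (case_nat y r) S)"

lemma (in model) ssat_Neg2: "ssat j (Neg (Neg p)) r S = ssat j p r S"
  by (induction j arbitrary: r) auto

text \<open>Each of the \<open>j\<close> quantifiers contributes a negation, which for odd
  \<open>j\<close> is compensated at the matrix.\<close>

lemma (in model) sat_ssat: "sat (sigf j p) r S = ssat j (if even j then p else Neg p) r S"
proof (induction j arbitrary: p r)
  case (Suc j)
  have "sat (sigf (Suc j) p) r S \<longleftrightarrow> (\<exists>y\<in>D. \<not> sat (sigf j (Neg p)) (case_nat y r) S)"
    using sat_pif[of j p] by simp
  then show ?case unfolding Suc by (simp add: ssat_Neg2)
qed simp

text \<open>The last three assumptions are what the thinning yields for almost all \<open>t\<close>.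
  \<open>k3\<close> makes the gaps cubic, and \<open>Ylow\<close> puts all standard numbers into the
  cut.\<close>

locale cut = ultra F for F +
  fixes N :: "nat set" and ops :: "nat \<Rightarrow> nat \<Rightarrow> nat set list \<Rightarrow> nat set"
    and k :: nat and Y Ms :: "nat \<Rightarrow> nat list"
  assumes k3: "3 \<le> k"
    and Ylen: "AE (\<lambda>t. j < length (Y t))"
    and Ylow: "AE (\<lambda>t. c \<le> Y t ! 0)"
    and Yspaced: "AE (\<lambda>t. spaced k (Y t))"
    and Mslen: "AE (\<lambda>t. length (Ms t) = k)"
    and dec: "AE (\<lambda>t. \<forall>i<k. decides (witnesses N ops (drop (Suc i) (Ms t))) (Ms t ! i) (set (Y t)))"
begin

definition D :: "(nat \<Rightarrow> nat) set" where "D = {f. \<exists>j. AE (\<lambda>t. f t \<le> Y t ! j)}"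

text \<open>For \<open>q = y div 4\<close> the square of \<open>y\<close> is at most
  \<open>20 * (q * q)\<close> as soon as 20 \<le> q, that is, 80 \<le> y.\<close>

lemma cube_ge_square: "80 \<le> (y::nat) \<Longrightarrow> y * y \<le> (y div 4) ^ 3"
proof -
  assume "80 \<le> y"
  define q where "q = y div 4"
  have q: "20 \<le> q" "y \<le> 4 * q + 3" using \<open>80 \<le> y\<close> unfolding q_def by auto
  have "y * y \<le> (4 * q + 3) * (4 * q + 3)" using q(2) by (rule mult_le_mono) (rule q(2))
  also have "\<dots> = 16 * (q * q) + (24 * q + 9)" by (simp add: algebra_simps)
  also have "24 * q + 9 \<le> 4 * (20 * q)" using q by simp
  also have "4 * (20 * q) \<le> 4 * (q * q)" using q(1) by (intro mult_le_mono) auto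
  also have "16 * (q * q) + 4 * (q * q) = 20 * (q * q)" by simp
  also have "\<dots> \<le> q * (q * q)" using q(1) by (rule mult_le_mono1)
  finally show ?thesis by (simp add: q_def power3_eq_cube)
qed

lemma Y_growth: "AE (\<lambda>t. 80 \<le> Y t ! j \<and> Y t ! j * Y t ! j \<le> Y t ! Suc j)"
  using Ylen[of "Suc j"] Ylow[of 80] Yspaced
proof eventually_elim
  case (elim t)
  have "Y t ! 0 \<le> Y t ! j"
    using elim by (cases j) (auto simp: spaced_def sorted_wrt_iff_nth_less intro: less_imp_le)
  then have y: "80 \<le> Y t ! j" using elim by simp
  have "(Y t ! j div 4) ^ 3 \<le> (Y t ! j div 4) ^ k" using k3 y by (intro power_increasing) auto
  moreover have "Y t ! j + (Y t ! j div 4) ^ k \<le> Y t ! Suc j"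
    using elim by (auto simp: spaced_def sorted_wrt_iff_nth_less)
  ultimately show ?case using cube_ge_square[OF y] y by linarith
qed

lemma Y_mono: "i \<le> j \<Longrightarrow> AE (\<lambda>t. Y t ! i \<le> Y t ! j)"
proof (induction j)
  case (Suc j)
  have *: "AE (\<lambda>t. Y t ! j \<le> Y t ! Suc j)"
    using Y_growth[of j]
  proof eventually_elim
    case (elim t)
    then show ?case using le_square[of "Y t ! j"] by linarith
  qed
  show ?case
  proof (cases "i = Suc j")
    case False
    then have "AE (\<lambda>t. Y t ! i \<le> Y t ! j)" using Suc by simp
    then show ?thesis using * by eventually_elim simp
  qed simp
qed simp

lemma D_common:
  assumes "f \<in> D" "g \<in> D"
  obtains j where "AE (\<lambda>t. f t \<le> Y t ! j \<and> g t \<le> Y t ! j)"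
proof -
  obtain i j where "AE (\<lambda>t. f t \<le> Y t ! i)" "AE (\<lambda>t. g t \<le> Y t ! j)" using assms by (auto simp: D_def)
  moreover have "AE (\<lambda>t. Y t ! i \<le> Y t ! max i j)" "AE (\<lambda>t. Y t ! j \<le> Y t ! max i j)"
    by (rule Y_mono, simp)+
  ultimately have "AE (\<lambda>t. f t \<le> Y t ! max i j \<and> g t \<le> Y t ! max i j)" by eventually_elim simp
  then show ?thesis by (rule that)
qed

lemma D_mul0: assumes "f \<in> D" "g \<in> D" shows "(\<lambda>t. f t * g t) \<in> D"
proof -
  obtain j where "AE (\<lambda>t. f t \<le> Y t ! j \<and> g t \<le> Y t ! j)" using D_common[OF assms] .
  then have "AE (\<lambda>t. f t * g t \<le> Y t ! Suc j)"
    using Y_growth[of j]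
  proof eventually_elim
    case (elim t)
    then have "f t * g t \<le> Y t ! j * Y t ! j" by (intro mult_le_mono) auto
    then show ?case using elim by simp
  qed
  then show ?thesis by (auto simp: D_def)
qed

lemma D_add0: assumes "f \<in> D" "g \<in> D" shows "(\<lambda>t. f t + g t) \<in> D"
proof -
  obtain j where "AE (\<lambda>t. f t \<le> Y t ! j \<and> g t \<le> Y t ! j)" using D_common[OF assms] .
  then have "AE (\<lambda>t. f t + g t \<le> Y t ! Suc j)"
    using Y_growth[of j]
  proof eventually_elim
    case (elim t)
    then have "f t + g t \<le> 2 * Y t ! j" by simp
    also have "\<dots> \<le> Y t ! j * Y t ! j" using elim by (intro mult_le_mono1) auto
    finally show ?case using elim by simp
  qed
  then show ?thesis by (auto simp: D_def)
qed

sublocale model F N ops D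
proof
  show "g \<in> D" if f: "f \<in> D" and le: "AE (\<lambda>t. g t \<le> f t)" for f g
  proof -
    obtain j where "AE (\<lambda>t. f t \<le> Y t ! j)" using f by (auto simp: D_def)
    then have "AE (\<lambda>t. g t \<le> Y t ! j)" using le by eventually_elim simp
    then show ?thesis by (auto simp: D_def)
  qed
  show "(\<lambda>t. c) \<in> D" for c using Ylow[of c] by (auto simp: D_def)
qed (fact D_add0, fact D_mul0)

lemma pcode_D:
  assumes "\<And>k. r k \<in> D" "\<And>k. S k \<in> Ds"
  shows "(\<lambda>t. pcode p (map (\<lambda>k. r k t) [0..<b]) (map (\<lambda>k. S k t) [0..<b])) \<in> D"
  using D_list[of "map r [0..<b]"] Ds_list[of "map S [0..<b]"] assms
  unfolding pcode_def by (auto intro!: D_prod D_const simp: comp_def)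

text \<open>A quantifier over the cut is equivalent to one bounded by the corresponding entry of
  \<open>Ms\<close>: all members of \<open>Y\<close> lie below that bound, and by \<open>dec\<close>
  a witness below the bound has a counterpart in the cut.\<close>

lemma ssat_alt_sat:
  assumes "p \<in> bounded_fms" "j \<le> k" "\<And>k. r k \<in> D" "\<And>k. S k \<in> Ds"
  shows "ssat j p r S \<longleftrightarrow> AE (\<lambda>t. alt_sat N (drop (k - j) (Ms t)) p (\<lambda>k. r k t) (\<lambda>k. EV (S k t)))"
  using assms(2,3)
proof (induction j arbitrary: r)
  case 0
  have "AE (\<lambda>t. drop (k - 0) (Ms t) = [])" using Mslen by eventually_elim simp
  then have "AE (\<lambda>t. satN N p (\<lambda>k. r k t) (\<lambda>k. EV (S k t)) \<longleftrightarrow>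
      alt_sat N (drop (k - 0) (Ms t)) p (\<lambda>k. r k t) (\<lambda>k. EV (S k t)))"
    by eventually_elim simp
  then show ?case using Los_bounded[OF assms(1) 0(2)] by (simp add: AE_iff)
next
  case (Suc j)
  let ?Ms = "\<lambda>t. drop (k - j) (Ms t)"
  let ?M = "\<lambda>t. Ms t ! (k - Suc j)"
  let ?P = "\<lambda>t y. \<not> alt_sat N (?Ms t) p (case_nat y (\<lambda>k. r k t)) (\<lambda>k. EV (S k t))"
  have c: "(\<lambda>k. case_nat y r k t) = case_nat (y t) (\<lambda>k. r k t)" for y t
    by (auto simp: fun_eq_iff split: nat.split)
  have IH: "ssat j p (case_nat y r) S \<longleftrightarrow> \<not> AE (\<lambda>t. ?P t (y t))" if "y \<in> D" for y
    using Suc.IH[of "case_nat y r"] Suc.prems that unfolding c AE_not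
    by (auto split: nat.split)
  have "AE (\<lambda>t. drop (k - Suc j) (Ms t) = ?M t # ?Ms t)"
    using Mslen
  proof eventually_elim
    case (elim t)
    have "k - Suc j < length (Ms t)" "Suc (k - Suc j) = k - j" using elim Suc.prems by auto
    then show ?case using Cons_nth_drop_Suc[of "k - Suc j" "Ms t"] by simp
  qed
  then have "AE (\<lambda>t. alt_sat N (drop (k - Suc j) (Ms t)) p (\<lambda>k. r k t) (\<lambda>k. EV (S k t)) \<longleftrightarrow> (\<exists>y\<le>?M t. ?P t y))"
    by eventually_elim simp
  then have alt_sat: "AE (\<lambda>t. alt_sat N (drop (k - Suc j) (Ms t)) p (\<lambda>k. r k t) (\<lambda>k. EV (S k t))) \<longleftrightarrow>
      AE (\<lambda>t. \<exists>y\<le>?M t. ?P t y)"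
    by (simp only: AE_iff)
  have dec': "AE (\<lambda>t. decides (witnesses N ops (?Ms t)) (?M t) (set (Y t)))"
    using dec
  proof eventually_elim
    case (elim t)
    have "k - Suc j < k" "Suc (k - Suc j) = k - j" using Suc.prems by auto
    then show ?case using elim by metis
  qed
  have "(\<exists>y\<in>D. AE (\<lambda>t. ?P t (y t))) \<longleftrightarrow> AE (\<lambda>t. \<exists>y\<le>?M t. ?P t y)"
  proof
    assume "\<exists>y\<in>D. AE (\<lambda>t. ?P t (y t))"
    then obtain y i where y: "AE (\<lambda>t. y t \<le> Y t ! i)" "AE (\<lambda>t. ?P t (y t))" by (auto simp: D_def)
    show "AE (\<lambda>t. \<exists>y\<le>?M t. ?P t y)"
      using y dec' Ylen[of i]
    proof eventually_elim
      case (elim t)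
      then have "Y t ! i \<le> ?M t" unfolding decides_def by simp
      then show ?case using elim by (intro exI[of _ "y t"]) simp
    qed
  next
    assume A: "AE (\<lambda>t. \<exists>y\<le>?M t. ?P t y)"
    obtain b where b: "\<forall>r r' S S'. (\<forall>k<b. r k = r' k) \<longrightarrow> (\<forall>k<b. S k = S' k) \<longrightarrow>
        satN N p r S = satN N p r' S'"
      using satN_depends[of N p] by (rule exE)
    define ns where "ns t = map (\<lambda>k. r k t) [0..<b]" for t
    define ss where "ss t = map (\<lambda>k. S k t) [0..<b]" for t
    have w: "witnesses N ops L (pcode p (ns t) (ss t)) z \<longleftrightarrow>
        \<not> alt_sat N L p (case_nat z (\<lambda>k. r k t)) (\<lambda>k. EV (S k t))" for t L z
    proof -
      have "alt_sat N L p (lenv 0 (z # ns t)) (lenv {} (map EV (ss t))) =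
          alt_sat N L p (case_nat z (\<lambda>k. r k t)) (\<lambda>k. EV (S k t))"
        by (rule alt_sat_depends[of b], rule b[rule_format])
          (auto simp: lenv_Cons ns_def ss_def comp_def lenv_map_upt split: nat.split)
      then show ?thesis by (simp add: witnesses_pcode)
    qed
    have "(\<lambda>t. pcode p (ns t) (ss t)) \<in> D"
      unfolding ns_def ss_def by (rule pcode_D[OF Suc.prems(2) assms(4)])
    then obtain i where i: "AE (\<lambda>t. pcode p (ns t) (ss t) \<le> Y t ! i)" by (auto simp: D_def)
    \<comment> \<open>One member beyond the code of the parameters absorbs the division by 8 in
      \<open>decides\<close>; the next one bounds the witness.\<close>
    have ex: "AE (\<lambda>t. \<exists>z. z \<le> Y t ! Suc (Suc i) \<and> ?P t z)"
      using i A dec' Ylen[of "Suc (Suc i)"] Y_growth[of i] Yspaced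
    proof eventually_elim
      case (elim t)
      have "8 * Y t ! i \<le> Y t ! i * Y t ! i" using elim by (intro mult_le_mono1) simp
      then have "8 * Y t ! i \<le> Y t ! Suc i" using elim by linarith
      then have "Y t ! i \<le> Y t ! Suc i div 8" using div_le_mono[of "8 * Y t ! i" _ 8] by simp
      then have p8: "pcode p (ns t) (ss t) \<le> Y t ! Suc i div 8" using elim by linarith
      have lt: "Y t ! Suc i < Y t ! Suc (Suc i)"
        using elim by (auto simp: spaced_def sorted_wrt_iff_nth_less)
      have "\<exists>z\<le>?M t. witnesses N ops (?Ms t) (pcode p (ns t) (ss t)) z" using elim w by simp
      then have "\<exists>z\<le>Y t ! Suc (Suc i). witnesses N ops (?Ms t) (pcode p (ns t) (ss t)) z"
        using elim(3,4) lt p8 unfolding decides_def by (meson Suc_lessD nth_mem)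
      then show ?case using w by simp
    qed
    define y where "y t = (SOME z. z \<le> Y t ! Suc (Suc i) \<and> ?P t z)" for t
    have y: "AE (\<lambda>t. y t \<le> Y t ! Suc (Suc i) \<and> ?P t (y t))"
      using ex by eventually_elim (unfold y_def, rule someI_ex)
    then have "y \<in> D" unfolding D_def by (auto simp: AE_conj)
    then show "\<exists>y\<in>D. AE (\<lambda>t. ?P t (y t))" using y by (auto simp: AE_conj)
  qed
  then show ?case unfolding alt_sat using IH by auto
qed

text \<open>
  By \<open>ssat_alt_sat\<close>, the \<open>\<Sigma>\<^sub>j\<close> formulas with \<open>j \<le> k\<close> define internal properties.
\<close>

definition internal :: "((nat \<Rightarrow> nat) \<Rightarrow> bool) \<Rightarrow> bool" where
  "internal P \<longleftrightarrow> (\<exists>Q. \<forall>x\<in>D. P x \<longleftrightarrow> AE (\<lambda>t. Q t (x t)))"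

lemma internalI: "(\<And>x. x \<in> D \<Longrightarrow> P x \<longleftrightarrow> AE (\<lambda>t. Q t (x t))) \<Longrightarrow> internal P"
  unfolding internal_def by blast

lemma internal_sat:
  assumes "f \<in> Sigma0 j" "j \<le> k" "envs r S"
  shows "internal (\<lambda>x. sat f (case_nat x r) S)"
proof -
  obtain p where p: "p \<in> bounded_fms" "f = sigf j p" using Sigma0_sigf[of f j] assms(1) by blast
  let ?p = "if even j then p else Neg p"
  have bp: "?p \<in> bounded_fms" using p by (auto intro: bounded_fms.intros)
  have c: "(\<lambda>k. case_nat y r k t) = case_nat (y t) (\<lambda>k. r k t)" for y t
    by (auto simp: fun_eq_iff split: nat.split)
  have "sat f (case_nat x r) S \<longleftrightarrow>
      AE (\<lambda>t. alt_sat N (drop (k - j) (Ms t)) ?p (case_nat (x t) (\<lambda>k. r k t)) (\<lambda>k. EV (S k t)))" if "x \<in> D" for x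
    unfolding p(2) sat_ssat c[symmetric]
    by (rule ssat_alt_sat[OF bp assms(2)]) (use assms(3) that in \<open>auto simp: envs_def split: nat.split\<close>)
  then show ?thesis by (rule internalI)
qed

text \<open>The minimum is taken at each \<open>t\<close> separately; it lies in the cut because it
  is at most \<open>x\<close>.\<close>

lemma internal_least:
  assumes "internal P" "x \<in> D" "P x"
  obtains y where "y \<in> D" "AE (\<lambda>t. y t \<le> x t)" "P y" "\<And>z. z \<in> D \<Longrightarrow> AE (\<lambda>t. z t < y t) \<Longrightarrow> \<not> P z"
proof -
  obtain Q where Q: "\<And>x. x \<in> D \<Longrightarrow> P x \<longleftrightarrow> AE (\<lambda>t. Q t (x t))"
    using assms(1) unfolding internal_def by blast
  define y where "y t = (LEAST z. Q t z)" for t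
  have Qx: "AE (\<lambda>t. Q t (x t))" using Q assms by blast
  then have yx: "AE (\<lambda>t. y t \<le> x t)" by eventually_elim (auto simp: y_def intro: Least_le)
  have yD: "y \<in> D" by (rule D_down[OF assms(2) yx])
  have "AE (\<lambda>t. Q t (y t))" using Qx by eventually_elim (auto simp: y_def intro: LeastI)
  then have Py: "P y" using Q yD by blast
  have "\<not> P z" if "z \<in> D" "AE (\<lambda>t. z t < y t)" for z
  proof
    assume "P z"
    then have "AE (\<lambda>t. Q t (z t))" using Q that by blast
    then have "AE (\<lambda>t. False)" using that(2) by eventually_elim (auto simp: y_def dest: not_less_Least)
    then show False using F_bot by (simp add: trivial_limit_def)
  qed
  then show ?thesis using that yD yx Py by blast
qed

lemma internal_Not: "internal P \<Longrightarrow> internal (\<lambda>x. \<not> P x)"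
proof -
  assume "internal P"
  then obtain Q where Q: "\<And>x. x \<in> D \<Longrightarrow> P x \<longleftrightarrow> AE (\<lambda>t. Q t (x t))"
    unfolding internal_def by blast
  then have "\<not> P x \<longleftrightarrow> AE (\<lambda>t. \<not> Q t (x t))" if "x \<in> D" for x using that by (simp add: AE_not)
  then show ?thesis by (rule internalI)
qed

lemma internal_induct:
  assumes "internal P" "P (\<lambda>t. 0)" "\<And>x. x \<in> D \<Longrightarrow> P x \<Longrightarrow> P (\<lambda>t. x t + 1)"
    and "\<And>x y. x \<in> D \<Longrightarrow> y \<in> D \<Longrightarrow> AE (\<lambda>t. x t = y t) \<Longrightarrow> P x \<Longrightarrow> P y"
    and "x \<in> D"
  shows "P x"
proof (rule ccontr)
  assume "\<not> P x"
  then obtain y where y: "y \<in> D" "\<not> P y" "\<And>z. z \<in> D \<Longrightarrow> AE (\<lambda>t. z t < y t) \<Longrightarrow> P z"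
    using internal_least[OF internal_Not[OF assms(1)] assms(5)] by metis
  define z where "z t = y t - 1" for t
  have zD: "z \<in> D" using y(1) by (rule D_le) (simp add: z_def)
  have "\<not> AE (\<lambda>t. y t = 0)"
  proof
    assume "AE (\<lambda>t. y t = 0)"
    then have "AE (\<lambda>t. 0 = y t)" by eventually_elim simp
    then show False using assms(4)[OF D_const[of 0] y(1) _ assms(2)] y(2) by simp
  qed
  then have n0: "AE (\<lambda>t. y t \<noteq> 0)" by (simp only: AE_not simp_thms)
  then have "AE (\<lambda>t. z t < y t)" by eventually_elim (simp add: z_def)
  then have "P (\<lambda>t. z t + 1)" using y(3)[OF zD] assms(3)[OF zD] by blast
  moreover have "AE (\<lambda>t. z t + 1 = y t)" using n0 by eventually_elim (simp add: z_def)
  ultimately show False using assms(4)[OF D_add[OF zD D_const[of 1]] y(1)] y(2) by blast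
qed

lemma IND_valid:
  assumes "f \<in> IND (Sigma0 j)" "j \<le> k"
  shows "valid f"
proof -
  obtain p where p: "p \<in> Sigma0 j" "f = Imp (Conj (inst p Zero)
      (Forall (Imp p (subst (case_nat (Add (Var 0) One) (\<lambda>k. Var (Suc k))) SVar p)))) (Forall p)"
    using assms(1) unfolding IND_def by blast
  show ?thesis
    unfolding valid_def
  proof (intro allI impI)
    fix r S assume e: "envs r S"
    have s: "sat (subst (case_nat (Add (Var 0) One) (\<lambda>k. Var (Suc k))) SVar p) (case_nat x r) S =
        sat p (case_nat (\<lambda>t. x t + 1) r) S" for x
    proof -
      have "(\<lambda>k t. tval (\<lambda>j. case_nat x r j t) (case_nat (Add (Var 0) One) (\<lambda>k. Var (Suc k)) k)) =
          case_nat (\<lambda>t. x t + 1) r" by (auto simp: fun_eq_iff split: nat.split)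
      then show ?thesis by (simp add: sat_subst)
    qed
    have "sat p (case_nat x r) S"
      if zero: "sat p (case_nat (\<lambda>t. 0) r) S" and step: "\<forall>x\<in>D. sat p (case_nat x r) S \<longrightarrow> sat p (case_nat (\<lambda>t. x t + 1) r) S"
        and "x \<in> D" for x
    proof (rule internal_induct[OF internal_sat[OF p(1) assms(2) e] _ _ _ that(3)])
      show "sat p (case_nat (\<lambda>t. 0) r) S" by (rule zero)
      show "sat p (case_nat (\<lambda>t. x t + 1) r) S" if "x \<in> D" "sat p (case_nat x r) S" for x
        using step that by blast
      fix x y assume xy: "AE (\<lambda>t. x t = y t)" "sat p (case_nat x r) S"
      have "AE (\<lambda>t. case_nat x r k t = case_nat y r k t)" for k
        using xy(1) by (cases k) simp_all
      from sat_cong_AE[of "case_nat x r" "case_nat y r" p S, OF this] xy(2)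
      show "sat p (case_nat y r) S" by simp
    qed
    moreover have "sat (inst p Zero) r S = sat p (case_nat (\<lambda>t. 0) r) S" by (simp add: sat_inst)
    ultimately show "sat f r S" unfolding p(2) sat.simps s by blast
  qed
qed

text \<open>Makes induction and least elements available for properties that are projections of a
  named set, without writing formulas for them.\<close>

lemma internal_Sigma1:
  assumes "s \<in> Ds"
  shows "internal (\<lambda>x. \<exists>y\<in>D. AE (\<lambda>t. pr (x t) (y t) \<in> EV (s t)))"
proof -
  \<comment> \<open>Variable 1 is the argument, variable 0 the witness, and the term is the pairing
    function applied to them.\<close>
  let ?f = "Exists (Mem (Add (Mul (Add (Var 1) (Var 0)) (Add (Var 1) (Var 0))) (Var 1)) (SVar 0))"
  have "?f \<in> Sigma0 1" by (auto intro: bounded_fms.intros)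
  moreover have "envs (\<lambda>k t. 0) (case_nat s (\<lambda>k t. NmS))"
    using assms D_const[of 0] NmS_Ds by (auto simp: envs_def split: nat.split)
  ultimately have "internal (\<lambda>x. sat ?f (case_nat x (\<lambda>k t. 0)) (case_nat s (\<lambda>k t. NmS)))"
    using k3 by (intro internal_sat[where j = 1]) auto
  then show ?thesis by (simp add: pr_def)
qed

end

section \<open>Pointwise evaluation of formulas\<close>

text \<open>This and the predicates after it say at a single \<open>t\<close> what the formulas of
  similar name say in the model.\<close>

definition p_min :: "(nat \<Rightarrow> bool) \<Rightarrow> nat \<Rightarrow> bool" where
  "p_min P b \<longleftrightarrow> P b \<and> (\<forall>y. P y \<longrightarrow> b \<le> y)"
definition p_max :: "(nat \<Rightarrow> bool) \<Rightarrow> nat \<Rightarrow> bool" where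
  "p_max P b \<longleftrightarrow> P b \<and> (\<forall>y. P y \<longrightarrow> y \<le> b)"
definition p_base :: "(nat \<Rightarrow> bool) \<Rightarrow> nat \<Rightarrow> nat \<Rightarrow> bool" where
  "p_base P n b \<longleftrightarrow> p_max (\<lambda>y. P y \<and> y \<le> n) b \<or> (n < b \<and> p_min P b)"
definition p_next :: "(nat \<Rightarrow> bool) \<Rightarrow> nat \<Rightarrow> nat \<Rightarrow> bool" where
  "p_next P v c \<longleftrightarrow> (\<forall>y. P y \<and> c < y \<longrightarrow> v < y)"
definition p_crit :: "(nat \<Rightarrow> bool) \<Rightarrow> nat \<Rightarrow> bool" where
  "p_crit P n \<longleftrightarrow> (\<exists>b. p_base P n b \<and> (\<exists>z. n = b * z))"
definition p_dec :: "nat \<Rightarrow> nat \<Rightarrow> nat \<Rightarrow> nat \<Rightarrow> nat \<Rightarrow> bool" where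
  "p_dec b m e a r \<longleftrightarrow> (\<exists>p q. p = b ^ e \<and> q = b ^ (e + 1) \<and>
     m = p * a + r \<and> p \<le> m \<and> m < q \<and> 0 < a \<and> a < b \<and> r < p)"

text \<open>The term that the binder notation produces for a variable bound at depth
  \<open>i\<close>.\<close>

definition nv :: "nat \<Rightarrow> TM" where "nv i = (\<lambda>d. Var (d - i - 1))"
definition svr :: "nat \<Rightarrow> ST" where "svr i = (\<lambda>s. SVar (s - i - 1))"

definition stk :: "'a list \<Rightarrow> (nat \<Rightarrow> 'a) \<Rightarrow> nat \<Rightarrow> 'a" where
  "stk es r k = (if k < length es then es ! (length es - 1 - k) else r (k - length es))"

lemma stk_snoc: "stk (es @ [y]) r = case_nat y (stk es r)"
  by (auto simp: stk_def fun_eq_iff nth_append split: nat.split)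

locale penv = model +
  fixes r0 :: "nat \<Rightarrow> nat \<Rightarrow> nat" and S0 :: "nat \<Rightarrow> nat \<Rightarrow> sname"
  assumes envs0: "envs r0 S0"
begin

text \<open>
  \<open>es\<close> and \<open>ss\<close> are the values of the bound variables in scope, the innermost last. A term, set or
  formula denotes if its value remains the same below further quantifiers.
\<close>

definition hold :: "(nat \<Rightarrow> nat) list \<Rightarrow> (nat \<Rightarrow> sname) list \<Rightarrow> FM \<Rightarrow> bool" where
  "hold es ss A = sat (A (length es) (length ss)) (stk es r0) (stk ss S0)"

definition den :: "(nat \<Rightarrow> nat) list \<Rightarrow> TM \<Rightarrow> (nat \<Rightarrow> nat) \<Rightarrow> bool" where
  "den es x a \<longleftrightarrow> a \<in> D \<and>
    (\<forall>zs t. tval (\<lambda>k. stk (es @ zs) r0 k t) (x (length (es @ zs))) = a t)"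

definition dens :: "(nat \<Rightarrow> sname) list \<Rightarrow> ST \<Rightarrow> (nat \<Rightarrow> sname) \<Rightarrow> bool" where
  "dens ss X s \<longleftrightarrow> s \<in> Ds \<and>
    (\<forall>ws. stval (\<lambda>_. NmS) (stk (ss @ ws) S0) (X (length (ss @ ws))) = s)"

definition fden :: "(nat \<Rightarrow> nat) list \<Rightarrow> (nat \<Rightarrow> sname) list \<Rightarrow> FM \<Rightarrow> (nat \<Rightarrow> bool) \<Rightarrow> bool" where
  "fden es ss A P \<longleftrightarrow> (\<forall>zs ws. hold (es @ zs) (ss @ ws) A \<longleftrightarrow> AE P)"

definition cden :: "(nat \<Rightarrow> nat) list \<Rightarrow> (nat \<Rightarrow> sname) list \<Rightarrow> (TM \<Rightarrow> FM) \<Rightarrow> (nat \<Rightarrow> nat \<Rightarrow> bool) \<Rightarrow> bool" where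
  "cden es ss A Q \<longleftrightarrow> (\<forall>zs ws x a. den (es @ zs) x a \<longrightarrow> fden (es @ zs) (ss @ ws) (A x) (\<lambda>t. Q t (a t)))"

lemma hold_all: "hold es ss (all A) \<longleftrightarrow> (\<forall>y\<in>D. hold (es @ [y]) ss (A (nv (length es))))"
  by (simp add: hold_def all_def nv_def stk_snoc)

lemma hold_neg: "hold es ss (\<^bold>\<not> A) \<longleftrightarrow> \<not> hold es ss A" by (simp add: hold_def neg_def)
lemma hold_conj: "hold es ss (A \<^bold>\<and> B) \<longleftrightarrow> hold es ss A \<and> hold es ss B" by (simp add: hold_def conj_def)
lemma hold_disj: "hold es ss (A \<^bold>\<or> B) \<longleftrightarrow> hold es ss A \<or> hold es ss B" by (auto simp: hold_def disj_def)
lemma hold_imp: "hold es ss (A \<^bold>\<longrightarrow> B) \<longleftrightarrow> (hold es ss A \<longrightarrow> hold es ss B)" by (simp add: hold_def imp_def)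
lemma hold_iff: "hold es ss (A \<^bold>\<longleftrightarrow> B) \<longleftrightarrow> (hold es ss A \<longleftrightarrow> hold es ss B)" by (auto simp: hold_def iff_def)
lemma hold_ex: "hold es ss (ex A) \<longleftrightarrow> (\<exists>y\<in>D. hold (es @ [y]) ss (A (nv (length es))))"
  by (simp add: ex_def hold_neg hold_all)
lemma hold_allS: "hold es ss (allS A) \<longleftrightarrow> (\<forall>X\<in>Ds. hold es (ss @ [X]) (A (svr (length ss))))"
  by (simp add: hold_def allS_def svr_def stk_snoc)
lemma hold_exS: "hold es ss (exS A) \<longleftrightarrow> (\<exists>X\<in>Ds. hold es (ss @ [X]) (A (svr (length ss))))"
  by (simp add: exS_def hold_neg hold_allS)

lemmas holds = hold_all hold_neg hold_conj hold_disj hold_imp hold_iff hold_ex hold_allS hold_exS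

lemma den_D: "den es x a \<Longrightarrow> a \<in> D" by (simp add: den_def)
lemma den_mono: "den es x a \<Longrightarrow> den (es @ zs) x a" by (simp only: den_def append_assoc) blast
lemma dens_mono: "dens ss X s \<Longrightarrow> dens (ss @ ws) X s" by (simp only: dens_def append_assoc) blast
lemma cden_mono: "cden es ss A P \<Longrightarrow> cden (es @ zs) (ss @ ws) A P" by (simp only: cden_def append_assoc) blast

lemma stk_nth: "i < length es \<Longrightarrow> stk (es @ zs) r (length (es @ zs) - i - 1) = es ! i"
  by (auto simp: stk_def nth_append)

lemma den_nv: "i < length es \<Longrightarrow> es ! i \<in> D \<Longrightarrow> den es (nv i) (es ! i)"
  unfolding den_def nv_def using stk_nth[of i es _ r0] by simp

lemma den_nv_last: "y \<in> D \<Longrightarrow> den (es @ [y]) (nv (length es)) y"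
  using den_nv[of "length es" "es @ [y]"] by simp

lemma dens_svr: "i < length ss \<Longrightarrow> ss ! i \<in> Ds \<Longrightarrow> dens ss (svr i) (ss ! i)"
  unfolding dens_def svr_def using stk_nth[of i ss _ S0] by simp

lemma dens_svr_last: "X \<in> Ds \<Longrightarrow> dens (ss @ [X]) (svr (length ss)) X"
  using dens_svr[of "length ss" "ss @ [X]"] by simp

lemma den_add: "den es x a \<Longrightarrow> den es y b \<Longrightarrow> den es (x \<^bold>+ y) (\<lambda>t. a t + b t)"
  unfolding den_def add_def by (auto intro: D_add)
lemma den_mul: "den es x a \<Longrightarrow> den es y b \<Longrightarrow> den es (x \<^bold>* y) (\<lambda>t. a t * b t)"
  unfolding den_def mul_def by (auto intro: D_mul)
lemma den_zero: "den es \<^bold>0 (\<lambda>t. 0)" unfolding den_def zero_def by (auto intro: D_const)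
lemma den_one: "den es \<^bold>1 (\<lambda>t. 1)" unfolding den_def one_def using D_const[of 1] by simp
lemma den_pair: "den es x a \<Longrightarrow> den es y b \<Longrightarrow> den es (pair x y) (\<lambda>t. (a t + b t) * (a t + b t) + a t)"
  unfolding pair_def by (intro den_add den_mul)

lemmas dens_tm = den_add den_zero den_one den_mul

lemma fden_eq: "den es x a \<Longrightarrow> den es y b \<Longrightarrow> fden es ss (x \<^bold>= y) (\<lambda>t. a t = b t)"
  unfolding fden_def hold_def eq_def den_def by simp
lemma fden_less: "den es x a \<Longrightarrow> den es y b \<Longrightarrow> fden es ss (x \<^bold>< y) (\<lambda>t. a t < b t)"
  unfolding fden_def hold_def less_def den_def by simp
lemma fden_conj: "fden es ss A P \<Longrightarrow> fden es ss B Q \<Longrightarrow> fden es ss (A \<^bold>\<and> B) (\<lambda>t. P t \<and> Q t)"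
  unfolding fden_def by (simp add: holds AE_conj)
lemma fden_disj: "fden es ss A P \<Longrightarrow> fden es ss B Q \<Longrightarrow> fden es ss (A \<^bold>\<or> B) (\<lambda>t. P t \<or> Q t)"
  unfolding fden_def by (simp add: holds AE_disj)
lemma fden_imp: "fden es ss A P \<Longrightarrow> fden es ss B Q \<Longrightarrow> fden es ss (A \<^bold>\<longrightarrow> B) (\<lambda>t. P t \<longrightarrow> Q t)"
  unfolding fden_def by (simp add: holds AE_imp)
lemma fden_leq: "den es x a \<Longrightarrow> den es y b \<Longrightarrow> fden es ss (x \<^bold>\<le> y) (\<lambda>t. a t \<le> b t)"
  unfolding leq_def using fden_disj[OF fden_less fden_eq, of es x a y b x a y b ss] by (simp add: le_less)

lemma fden_rel1: "dens ss X s \<Longrightarrow> den es x a \<Longrightarrow> fden es ss (rel1 X x) (\<lambda>t. a t \<in> EV (s t))"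
  unfolding fden_def hold_def rel1_def den_def dens_def by simp
lemma fden_rel2: "dens ss X s \<Longrightarrow> den es x a \<Longrightarrow> den es y b \<Longrightarrow>
    fden es ss (rel2 X x y) (\<lambda>t. pr (a t) (b t) \<in> EV (s t))"
  unfolding rel2_def pr_def by (intro fden_rel1 den_pair)

lemma cdenI:
  "(\<And>zs ws x a. den (es @ zs) x a \<Longrightarrow> fden (es @ zs) (ss @ ws) (A x) (\<lambda>t. Q t (a t))) \<Longrightarrow> cden es ss A Q"
  unfolding cden_def by blast

lemma cdenD: "cden es ss A Q \<Longrightarrow> den es x a \<Longrightarrow> fden es ss (A x) (\<lambda>t. Q t (a t))"
  unfolding cden_def by (metis append_Nil2)

lemma cden_hold: "cden es ss A Q \<Longrightarrow> y \<in> D \<Longrightarrow>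
    hold (es @ zs @ [y]) (ss @ ws) (A (nv (length (es @ zs)))) \<longleftrightarrow> AE (\<lambda>t. Q t (y t))"
proof -
  assume "cden es ss A Q" "y \<in> D"
  then have "fden (es @ zs @ [y]) (ss @ ws) (A (nv (length (es @ zs)))) (\<lambda>t. Q t (y t))"
    using den_nv_last[of y "es @ zs"] unfolding cden_def append_assoc by blast
  then have "hold ((es @ zs @ [y]) @ []) ((ss @ ws) @ []) (A (nv (length (es @ zs)))) \<longleftrightarrow> AE (\<lambda>t. Q t (y t))"
    unfolding fden_def by blast
  then show ?thesis by simp
qed

text \<open>The substitute for pointwise evaluation of unbounded quantifiers: it works whenever an
  element of the cut bounds some witness.\<close>

lemma AE_ex_bounded:
  assumes "h \<in> D" "AE (\<lambda>t. (\<exists>y. Q t y) \<longrightarrow> (\<exists>y\<le>h t. Q t y))"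
  shows "(\<exists>y\<in>D. AE (\<lambda>t. Q t (y t))) \<longleftrightarrow> AE (\<lambda>t. \<exists>y. Q t y)"
proof
  assume "\<exists>y\<in>D. AE (\<lambda>t. Q t (y t))"
  then obtain y where "AE (\<lambda>t. Q t (y t))" by blast
  then show "AE (\<lambda>t. \<exists>y. Q t y)" by eventually_elim blast
next
  assume A: "AE (\<lambda>t. \<exists>y. Q t y)"
  define y where "y t = (SOME y. y \<le> h t \<and> Q t y)" for t
  have "AE (\<lambda>t. \<exists>y. y \<le> h t \<and> Q t y)" using A assms(2) by eventually_elim blast
  then have y: "AE (\<lambda>t. y t \<le> h t \<and> Q t (y t))"
    by eventually_elim (unfold y_def, rule someI_ex)
  then have "AE (\<lambda>t. y t \<le> h t)" "AE (\<lambda>t. Q t (y t))" by (simp_all add: AE_conj)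
  then show "\<exists>y\<in>D. AE (\<lambda>t. Q t (y t))" using D_down[OF assms(1)] by blast
qed

lemma fden_ex:
  assumes "h \<in> D" "cden es ss A Q" "AE (\<lambda>t. (\<exists>y. Q t y) \<longrightarrow> (\<exists>y\<le>h t. Q t y))"
  shows "fden es ss (ex A) (\<lambda>t. \<exists>y. Q t y)"
  unfolding fden_def hold_ex
  using cden_hold[OF assms(2)] AE_ex_bounded[OF assms(1,3)] by simp

lemma fden_all:
  assumes "h \<in> D" "cden es ss A Q" "AE (\<lambda>t. (\<exists>y. \<not> Q t y) \<longrightarrow> (\<exists>y\<le>h t. \<not> Q t y))"
  shows "fden es ss (all A) (\<lambda>t. \<forall>y. Q t y)"
proof -
  have "(\<forall>y\<in>D. AE (\<lambda>t. Q t (y t))) \<longleftrightarrow> \<not> (\<exists>y\<in>D. AE (\<lambda>t. \<not> Q t (y t)))" by (simp add: AE_not)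
  also have "\<dots> \<longleftrightarrow> AE (\<lambda>t. \<forall>y. Q t y)"
    unfolding AE_ex_bounded[OF assms(1,3)] AE_not[symmetric] by simp
  finally show ?thesis
    unfolding fden_def hold_all using cden_hold[OF assms(2)] by simp
qed

lemma fden_cong: "fden es ss A P \<Longrightarrow> AE (\<lambda>t. P t \<longleftrightarrow> Q t) \<Longrightarrow> fden es ss A Q"
  unfolding fden_def by (simp add: AE_iff)

lemma cden_cong: "cden es ss A P \<Longrightarrow> (\<And>a. a \<in> D \<Longrightarrow> AE (\<lambda>t. P t (a t) \<longleftrightarrow> Q t (a t))) \<Longrightarrow> cden es ss A Q"
proof (rule cdenI)
  fix zs ws x a
  assume c: "cden es ss A P" and AE: "\<And>a. a \<in> D \<Longrightarrow> AE (\<lambda>t. P t (a t) \<longleftrightarrow> Q t (a t))"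
    and x: "den (es @ zs) x a"
  show "fden (es @ zs) (ss @ ws) (A x) (\<lambda>t. Q t (a t))"
    by (rule fden_cong[OF cdenD[OF cden_mono[OF c] x] AE[OF den_D[OF x]]])
qed

lemma fden_min:
  assumes "cden es ss B P" "den es b \<beta>"
  shows "fden es ss (is_min B b) (\<lambda>t. p_min (P t) (\<beta> t))"
  unfolding is_min_def p_min_def
  by (intro fden_conj cdenD[OF assms] fden_all[OF den_D[OF assms(2)]] cdenI fden_imp
      cdenD[OF cden_mono[OF assms(1)]] fden_leq den_mono[OF assms(2)])
    (auto intro: always_eventually less_imp_le simp: not_le)

lemma fden_max:
  assumes "cden es ss B P" "den es b \<beta>" "h \<in> D" "AE (\<lambda>t. \<forall>y. P t y \<longrightarrow> y \<le> h t)"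
  shows "fden es ss (is_max B b) (\<lambda>t. p_max (P t) (\<beta> t))"
  unfolding is_max_def p_max_def
  by (intro fden_conj cdenD[OF assms(1,2)] fden_all[OF assms(3)] cdenI fden_imp
      cdenD[OF cden_mono[OF assms(1)]] fden_leq den_mono[OF assms(2)])
    (use assms(4) in \<open>auto elim!: eventually_mono\<close>)

lemma fden_base:
  assumes "cden es ss B P" "den es n \<nu>" "den es b \<beta>"
  shows "fden es ss (is_base B n b) (\<lambda>t. p_base (P t) (\<nu> t) (\<beta> t))"
  unfolding is_base_def p_base_def
  by (intro fden_disj fden_conj fden_max[OF _ assms(3) den_D[OF assms(2)]] fden_less fden_min assms
      cdenI cdenD[OF cden_mono[OF assms(1)]] fden_leq den_mono[OF assms(2)])
    (auto intro: always_eventually)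

lemma fden_next:
  assumes "cden es ss C P" "den es v \<nu>" "den es c \<gamma>"
  shows "fden es ss (less_next C v c) (\<lambda>t. p_next (P t) (\<nu> t) (\<gamma> t))"
  unfolding less_next_def p_next_def
  by (intro fden_all[OF den_D[OF assms(2)]] cdenI fden_imp fden_conj
      cdenD[OF cden_mono[OF assms(1)]] fden_less den_mono[OF assms(2)] den_mono[OF assms(3)])
    (auto intro: always_eventually simp: not_less)

lemma fden_dvds:
  assumes "den es x a" "den es y b"
  shows "fden es ss (x \<^bold>| y) (\<lambda>t. \<exists>z. b t = a t * z)"
  unfolding dvds_def
proof (intro fden_ex[OF den_D[OF assms(2)]] cdenI fden_eq den_mul den_mono[OF assms(2)] den_mono[OF assms(1)])
  \<comment> \<open>For \<open>m = 0\<close> any factor will do and 0 is taken; otherwise a factor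
    is at most the product.\<close>
  have "\<exists>z\<le>n. n = m * z" if "n = m * z" for n m z :: nat
  proof (cases m)
    case 0
    then show ?thesis using that by (intro exI[of _ 0]) simp
  next
    case (Suc k)
    then show ?thesis using that by (intro exI[of _ z]) simp
  qed
  then show "AE (\<lambda>t. (\<exists>z. b t = a t * z) \<longrightarrow> (\<exists>z\<le>b t. b t = a t * z))"
    by (intro always_eventually) blast
qed

lemma fden_crit:
  assumes "cden es ss B P" "den es n \<nu>" "h \<in> D" "AE (\<lambda>t. \<forall>y. p_min (P t) y \<longrightarrow> y \<le> h t)"
  shows "fden es ss (critical B n) (\<lambda>t. p_crit (P t) (\<nu> t))"
  unfolding critical_def p_crit_def
proof (intro fden_ex[OF D_add[OF den_D[OF assms(2)] assms(3)]] cdenI fden_conj)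
  show "fden (es @ zs) (ss @ ws) (is_base B n x) (\<lambda>t. p_base (P t) (\<nu> t) (a t))"
    if "den (es @ zs) x a" for zs ws x a
    by (intro fden_base cden_mono[OF assms(1)] den_mono[OF assms(2)] that)
  show "fden (es @ zs) (ss @ ws) (x \<^bold>| n) (\<lambda>t. \<exists>z. \<nu> t = a t * z)"
    if "den (es @ zs) x a" for zs ws x a
    by (intro fden_dvds den_mono[OF assms(2)] that)
  show "AE (\<lambda>t. (\<exists>y. p_base (P t) (\<nu> t) y \<and> (\<exists>z. \<nu> t = y * z)) \<longrightarrow>
      (\<exists>y\<le>\<nu> t + h t. p_base (P t) (\<nu> t) y \<and> (\<exists>z. \<nu> t = y * z)))"
    using assms(4)
  proof eventually_elim
    case (elim t)
    have "y \<le> \<nu> t + h t" if "p_base (P t) (\<nu> t) y" for y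
      using that elim unfolding p_base_def p_max_def by (auto intro: trans_le_add1 trans_le_add2)
    then show ?case by blast
  qed
qed

end

section \<open>Growth bounds\<close>

text \<open>
  The cut is closed under each \<open>fgrow j\<close>, so it contains whatever these functions bound.
\<close>

primrec fgrow :: "nat \<Rightarrow> nat \<Rightarrow> nat" where
  "fgrow 0 x = (x + 2) * (x + 2)"
| "fgrow (Suc j) x = (fgrow j ^^ (x + 1)) x"

lemma fgrow_props: "x < fgrow j x \<and> (x \<le> y \<longrightarrow> fgrow j x \<le> fgrow j y)"
proof (induction j arbitrary: x y)
  case 0
  have "(x + 2) * (x + 2) \<le> (y + 2) * (y + 2)" if "x \<le> y"
    using that by (intro mult_le_mono) auto
  then show ?case by simp
next
  case (Suc j)
  have ge: "x \<le> (fgrow j ^^ n) x" for n x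
    by (induction n) (auto intro: order_trans less_imp_le[OF Suc[THEN conjunct1]])
  have mono: "(fgrow j ^^ n) x \<le> (fgrow j ^^ n) y" if "x \<le> y" for n x y
    using that Suc by (induction n) auto
  have "x < fgrow (Suc j) x"
    using ge[of x x] Suc[of "(fgrow j ^^ x) x"] by (auto intro: le_less_trans)
  moreover have "fgrow (Suc j) x \<le> fgrow (Suc j) y" if "x \<le> y"
  proof -
    have "(fgrow j ^^ (x + 1)) x \<le> (fgrow j ^^ (x + 1)) y" by (rule mono[OF that])
    also have "\<dots> \<le> (fgrow j ^^ (y - x)) ((fgrow j ^^ (x + 1)) y)" by (rule ge)
    also have "\<dots> = (fgrow j ^^ ((y - x) + (x + 1))) y" by (simp only: funpow_add comp_apply)
    also have "(y - x) + (x + 1) = y + 1" using that by simp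
    finally show ?thesis by simp
  qed
  ultimately show ?case by blast
qed

declare fgrow.simps [simp del]

lemma fgrow_less: "x < fgrow j x" using fgrow_props by blast
lemma fgrow_mono: "x \<le> y \<Longrightarrow> fgrow j x \<le> fgrow j y" using fgrow_props by blast

lemma fgrow_iter_ge: "x \<le> (fgrow j ^^ n) x"
  by (induction n) (auto intro: order_trans less_imp_le[OF fgrow_less])

lemma fgrow_iter_mono: assumes "n \<le> m" "x \<le> y" shows "(fgrow j ^^ n) x \<le> (fgrow j ^^ m) y"
proof -
  have "(fgrow j ^^ n) x \<le> (fgrow j ^^ n) y" using assms(2) by (induction n) (auto intro: fgrow_mono)
  also have "\<dots> \<le> (fgrow j ^^ (m - n)) ((fgrow j ^^ n) y)" by (rule fgrow_iter_ge)
  also have "\<dots> = (fgrow j ^^ (m - n + n)) y" by (simp only: funpow_add comp_apply)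
  finally show ?thesis using assms(1) by simp
qed

lemma fgrow_iter_le: "n \<le> x + 1 \<Longrightarrow> (fgrow j ^^ n) x \<le> fgrow (Suc j) x"
  unfolding fgrow.simps by (rule fgrow_iter_mono) auto

lemma fgrow_le_Suc: "fgrow j x \<le> fgrow (Suc j) x" using fgrow_iter_le[of 1 x j] by simp

lemma fgrow_level: "i \<le> j \<Longrightarrow> fgrow i x \<le> fgrow j x"
  by (rule lift_Suc_mono_le[of "\<lambda>j. fgrow j x"]) (rule fgrow_le_Suc)

lemma fgrow_twice: "1 \<le> x \<Longrightarrow> fgrow j (fgrow j x) \<le> fgrow (Suc j) x"
  using fgrow_iter_le[of 2 x j] by (simp add: numeral_2_eq_2)

lemma power_le_fgrow: assumes "c \<le> y" "e \<le> y" shows "c ^ e \<le> fgrow 1 y"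
proof -
  have "c ^ e \<le> (fgrow 0 ^^ e) y \<or> (e = 0 \<and> y = 0)"
  proof (induction e)
    case 0
    then show ?case by (cases y) auto
  next
    case (Suc e)
    let ?z = "(fgrow 0 ^^ e) y"
    have "c ^ e \<le> ?z + 2" using Suc by auto
    moreover have "c \<le> ?z + 2" using assms(1) fgrow_iter_ge[of y e 0] by linarith
    ultimately have "c * c ^ e \<le> (?z + 2) * (?z + 2)" by (intro mult_le_mono)
    then have "c ^ Suc e \<le> fgrow 0 ?z" by (simp only: power_Suc fgrow.simps(1)[of ?z])
    then show ?case by simp
  qed
  then show ?thesis
  proof
    assume "c ^ e \<le> (fgrow 0 ^^ e) y"
    also have "\<dots> \<le> fgrow 1 y" using fgrow_iter_le[of e y 0] assms(2) by simp
    finally show ?thesis .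
  next
    assume "e = 0 \<and> y = 0"
    then show ?thesis using fgrow_less[of 0 1] by simp
  qed
qed

lemma psi_le_fgrow:
  assumes "c \<le> y" "e \<le> y" "a \<le> y" "r \<le> y"
  shows "c ^ e * a + r \<le> fgrow 2 y"
proof (cases "y = 0")
  case False
  let ?z = "fgrow 1 y"
  have "c ^ e \<le> ?z" by (rule power_le_fgrow[OF assms(1,2)])
  moreover have "y < ?z" by (rule fgrow_less)
  ultimately have "c ^ e * a + r \<le> ?z * ?z + ?z" using assms by (intro add_mono mult_le_mono) auto
  also have "\<dots> \<le> fgrow 0 ?z" by (simp add: fgrow.simps(1) algebra_simps)
  also have "\<dots> \<le> fgrow 1 ?z" using fgrow_le_Suc[of 0] by simp
  also have "\<dots> \<le> fgrow 2 y" using fgrow_twice[of y 1] False by (simp add: numeral_2_eq_2)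
  finally show ?thesis .
qed (use assms in simp)

text \<open>All recursive calls are at smaller arguments and are combined by one application of
  \<open>psi_le_fgrow\<close>, so \<open>m\<close> iterations of \<open>fgrow 2\<close>
  suffice.\<close>

lemma ango_bound:
  assumes "\<And>x w. x < b \<Longrightarrow> x \<le> m \<Longrightarrow> u x = Some w \<Longrightarrow> w \<le> X" "c \<le> X" "ango u b c m = Some w"
  shows "w \<le> (fgrow 2 ^^ m) X"
  using assms(1,3)
proof (induction m arbitrary: w rule: less_induct)
  case (less m)
  show ?case
  proof (cases "m < b")
    case True
    then have "w \<le> X" using less.prems by (auto simp: ango_less)
    then show ?thesis using fgrow_iter_ge[of X m 2] by linarith
  next
    case False
    then have b2: "2 \<le> b" "b \<le> m" using less.prems(2) by (auto simp: ango.simps[of u b c m] split: if_splits)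
    note d = lg_props[OF b2] lg_decomp[OF b2]
    obtain e a r where w: "ango u b c (lg b m) = Some e" "u (m div b ^ lg b m) = Some a"
      "ango u b c (m mod b ^ lg b m) = Some r" "w = c ^ e * a + r"
      using less.prems(2) False b2 by (auto simp: ango.simps[of u b c m] split: option.splits)
    obtain m' where m': "m = Suc m'" using b2 by (cases m) auto
    let ?y = "(fgrow 2 ^^ m') X"
    have "e \<le> (fgrow 2 ^^ lg b m) X" by (rule less.IH[OF _ _ w(1)]) (use d less.prems(1) in auto)
    also have "\<dots> \<le> ?y" using d m' by (intro fgrow_iter_mono) auto
    finally have "e \<le> ?y" .
    have "r \<le> (fgrow 2 ^^ (m mod b ^ lg b m)) X" by (rule less.IH[OF _ _ w(3)]) (use d less.prems(1) in auto)
    also have "\<dots> \<le> ?y" using d m' by (intro fgrow_iter_mono) auto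
    finally have "r \<le> ?y" .
    have "a \<le> X" using less.prems(1)[OF _ _ w(2)] d b2 by auto
    then have "a \<le> ?y" "c \<le> ?y" using fgrow_iter_ge[of X m' 2] assms(2) by linarith+
    then show ?thesis using psi_le_fgrow[of c ?y e a r] \<open>e \<le> ?y\<close> \<open>r \<le> ?y\<close> w(4) m' by simp
  qed
qed

lemma ang_bound:
  assumes "\<And>x. x < b \<Longrightarrow> v x \<le> X" "c \<le> X" "2 \<le> b"
  shows "ang v b c m \<le> (fgrow 2 ^^ m) X"
  by (rule ango_bound[of b m "\<lambda>x. Some (v x)" X c]) (use assms ango_ang[of b "\<lambda>x. Some (v x)" v] in auto)

lemma up_Some:
  assumes "base_hierarchy B" "up B C n = Some w" "hmin B \<le> n"
  obtains x c where "up B C (n - 1) = Some x" "c \<in> C" "ango (up B C) (base B n) c n = Some w"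
    "x < w" "below_next C w c"
    "\<And>y z. y \<in> C \<Longrightarrow> ango (up B C) (base B n) y n = Some z \<Longrightarrow> x < z \<Longrightarrow> below_next C z y \<Longrightarrow> c \<le> y"
proof -
  obtain x where x: "up B C (n - 1) = Some x"
    using assms up_upf[OF assms(1), of C n] by (auto simp: upf_def split: option.splits)
  define P where "P = (\<lambda>c. c \<in> C \<and> (\<exists>w. ango (up B C) (base B n) c n = Some w \<and> x < w \<and> below_next C w c))"
  have "up B C n = (if \<exists>c. P c then ango (up B C) (base B n) (LEAST c. P c) n else None)"
    using x assms(3) unfolding up_upf[OF assms(1), of C n] upf_def P_def by (simp add: Let_def)
  then have ex: "\<exists>c. P c" and w: "ango (up B C) (base B n) (LEAST c. P c) n = Some w"
    using assms(2) by (auto split: if_splits)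
  have "P (LEAST c. P c)" using ex by (rule LeastI_ex)
  moreover have "(LEAST c. P c) \<le> y" if "P y" for y using that by (rule Least_le)
  ultimately show ?thesis using that[of x "LEAST c. P c"] x w unfolding P_def by force
qed

text \<open>The new base is at most \<open>M\<close>, so one more argument costs up to
  \<open>j\<close> applications of \<open>fgrow 2\<close>, which are a single one of
  \<open>fgrow 3\<close>.\<close>

lemma up_bound:
  assumes B: "base_hierarchy B" and M: "\<And>c. c \<in> C \<Longrightarrow> c \<le> M"
  shows "up B C j = Some w \<Longrightarrow> j \<le> J \<Longrightarrow> w \<le> (fgrow 3 ^^ Suc j) (M + J + 1)"
proof (induction j arbitrary: w rule: less_induct)
  case (less j)
  show ?case
  proof (cases "j < hmin B")
    case True
    then have "w = j" using less.prems up_less[OF B] by simp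
    then show ?thesis using less.prems fgrow_iter_ge[of "M + J + 1" "Suc j" 3] by linarith
  next
    case False
    then have j: "hmin B \<le> j" by simp
    obtain x c where c: "c \<in> C" "ango (up B C) (base B j) c j = Some w"
      using up_Some[OF B less.prems(1) j] by metis
    let ?X = "(fgrow 3 ^^ j) (M + J + 1)"
    have X: "M + J + 1 \<le> ?X" by (rule fgrow_iter_ge)
    have bj: "base B j \<le> j" by (rule base_le[OF hmin_in[OF hier_ne[OF B]] j])
    have "w \<le> (fgrow 2 ^^ j) ?X"
    proof (rule ango_bound[OF _ _ c(2)])
      fix y z assume y: "y < base B j" "up B C y = Some z"
      have "z \<le> (fgrow 3 ^^ Suc y) (M + J + 1)" by (rule less.IH) (use y bj less.prems in auto)
      also have "\<dots> \<le> ?X" using y bj by (intro fgrow_iter_mono) auto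
      finally show "z \<le> ?X" .
    qed (use M[OF c(1)] X in linarith)
    also have "\<dots> \<le> fgrow (Suc 2) ?X" using X less.prems(2) by (intro fgrow_iter_le) linarith
    finally show ?thesis by (simp add: numeral_3_eq_3 numeral_2_eq_2)
  qed
qed

context ouro
begin

text \<open>A stage applies the operator up to \<open>i\<close> times, each time within
  \<open>fgrow 3\<close>; together this is within \<open>fgrow 4\<close>, and the upgrade itself
  then within \<open>fgrow 5\<close>.\<close>

lemma stage_pair_bound:
  assumes "Z = l + 2 + i + J"
  shows "n \<le> J \<Longrightarrow> c n \<le> (fgrow 5 ^^ Suc n) Z \<and> v n \<le> (fgrow 5 ^^ Suc n) Z"
proof (induction n rule: less_induct)
  case (less n)
  show ?case
  proof (cases "n \<le> l")
    case True
    then have "c n \<le> Z" "v n \<le> Z" using v_mem[OF l_in] c_small[of l] v_small[of n] c_small[of n] assms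
      by (cases "n = l"; simp)+
    then show ?thesis using fgrow_iter_ge[of Z "Suc n" 5] by linarith
  next
    case False
    then obtain m where m: "n = Suc m" "l \<le> m" by (cases n) auto
    let ?X = "(fgrow 5 ^^ n) Z"
    have X: "Z \<le> ?X" by (rule fgrow_iter_ge)
    have cm: "c m \<le> ?X" using less.IH[of m] less.prems m by simp
    have vm: "v x \<le> ?X" if "x \<le> m" for x
    proof -
      have "v x \<le> (fgrow 5 ^^ Suc x) Z" using less.IH[of x] that less.prems m by simp
      also have "\<dots> \<le> ?X" using that m by (intro fgrow_iter_mono) auto
      finally show ?thesis .
    qed
    have ab: "ang v (bs m) x y \<le> fgrow 3 X'" if "?X \<le> X'" "x \<le> X'" "y \<le> n" for x y X'
    proof -
      have "ang v (bs m) x y \<le> (fgrow 2 ^^ y) X'"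
      proof (rule ang_bound)
        fix z assume "z < bs m"
        then have "v z \<le> ?X" using vm[of z] bs_le[OF m(2)] by simp
        then show "v z \<le> X'" using that by simp
      qed (use that bs2 in auto)
      also have "\<dots> \<le> fgrow (Suc 2) X'" using that X less.prems assms by (intro fgrow_iter_le) linarith
      finally show ?thesis by (simp add: numeral_3_eq_3 numeral_2_eq_2)
    qed
    have X1: "1 \<le> ?X" "i \<le> ?X" using X assms by linarith+
    have up34: "fgrow 3 (fgrow 3 ?X) \<le> fgrow 5 ?X"
      using fgrow_twice[OF X1(1), of 3] fgrow_le_Suc[of 4 ?X] by (simp add: eval_nat_numeral)
    have up3: "fgrow 3 ?X \<le> fgrow 5 ?X" using fgrow_level[of 3 5 ?X] by simp
    have goal: "c n \<le> fgrow 5 ?X \<and> v n \<le> fgrow 5 ?X"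
    proof (cases "n \<in> B")
      case True
      let ?w = "ang v (bs m) (c m) m"
      have w: "?w \<le> fgrow 3 ?X" using ab[of ?X "c m" m] cm m by simp
      have "c n \<le> ?w + c m"
      proof -
        define a where "a = (LEAST a. ?w < c m * a)"
        have cn: "c n = c m * a" using c_Suc[OF m(2)] True m(1) by (simp add: a_def)
        show ?thesis
        proof (cases a)
          case (Suc a')
          have "\<not> ?w < c m * a'" using not_less_Least[of a' "\<lambda>a. ?w < c m * a"] Suc by (simp add: a_def)
          then show ?thesis using cn Suc by simp
        qed (simp add: cn)
      qed
      also have "\<dots> \<le> fgrow 3 ?X + fgrow 3 ?X" using w cm fgrow_less[of ?X 3] by linarith
      also have "\<dots> \<le> fgrow 0 (fgrow 3 ?X)" unfolding fgrow.simps(1)[of "fgrow 3 ?X"] by (simp add: algebra_simps)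
      also have "\<dots> \<le> fgrow 3 (fgrow 3 ?X)" by (rule fgrow_level) simp
      also note up34
      finally have "c n \<le> fgrow 5 ?X" .
      then show ?thesis using v_mem[OF True] by simp
    next
      case False
      have b: "bs n = bs m" using bs_Suc[OF m(2)] False m(1) by simp
      show ?thesis
      proof (cases "bs n dvd n")
        case True
        have dj: "d n j \<le> (fgrow 3 ^^ j) ?X" for j
        proof (induction j)
          case 0
          then show ?case using cm m(1) by (simp add: d_0)
        next
          case (Suc j)
          then show ?case using ab[of "(fgrow 3 ^^ j) ?X" "d n j" n] fgrow_iter_ge[of ?X j 3] b by (simp add: d_Suc)
        qed
        have F4: "(fgrow 3 ^^ i) ?X \<le> fgrow 4 ?X" using fgrow_iter_le[of i ?X 3] X1 by (simp add: eval_nat_numeral)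
        have "c n = d n i" using c_Suc[OF m(2)] False True m(1) by simp
        then have "c n \<le> fgrow 4 ?X" using dj[of i] F4 by simp
        moreover have "fgrow 4 ?X \<le> fgrow 5 ?X" by (rule fgrow_level) simp
        moreover have "v n \<le> fgrow 3 (fgrow 4 ?X)"
          using v_crit[OF m(2)] False True m(1) dj[of "Suc i"] fgrow_mono[OF F4, of 3] by simp
        moreover have "fgrow 3 (fgrow 4 ?X) \<le> fgrow 4 (fgrow 4 ?X)" by (rule fgrow_level) simp
        moreover have "fgrow 4 (fgrow 4 ?X) \<le> fgrow 5 ?X" using fgrow_twice[OF X1(1), of 4] by (simp add: eval_nat_numeral)
        ultimately show ?thesis by linarith
      next
        case nc: False
        then have "c n = c m" using c_Suc[OF m(2)] False m(1) by simp
        moreover have "v n = ang v (bs m) (c m) n" using v_eq[of n] m b calculation by simp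
        ultimately show ?thesis using ab[of ?X "c m" n] cm up3 fgrow_less[of ?X 5] by linarith
      qed
    qed
    then show ?thesis by simp
  qed
qed

lemma c_bound: "c n \<le> fgrow 6 (l + 2 + i + n)" and v_bound: "v n \<le> fgrow 6 (l + 2 + i + n)"
proof -
  have "(fgrow 5 ^^ Suc n) (l + 2 + i + n) \<le> fgrow (Suc 5) (l + 2 + i + n)" by (intro fgrow_iter_le) simp
  then show "c n \<le> fgrow 6 (l + 2 + i + n)" "v n \<le> fgrow 6 (l + 2 + i + n)"
    using stage_pair_bound[OF HOL.refl, of n n] by (simp_all add: eval_nat_numeral)
qed

end

section \<open>The recursion equations\<close>

lemma p_minI: "P b \<Longrightarrow> (\<And>y. P y \<Longrightarrow> b \<le> y) \<Longrightarrow> p_min P x \<longleftrightarrow> x = b"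
  unfolding p_min_def by (auto intro: le_antisym)

lemma p_maxI: "P b \<Longrightarrow> (\<And>y. P y \<Longrightarrow> y \<le> b) \<Longrightarrow> p_max P x \<longleftrightarrow> x = b"
  unfolding p_max_def by (auto intro: le_antisym)

lemma p_min_hmin: "B \<noteq> {} \<Longrightarrow> p_min (\<lambda>y. y \<in> B) b \<longleftrightarrow> b = hmin B"
  by (rule p_minI) (auto intro: hmin_in hmin_le)

lemma p_max_stage_iff: "ouro B i \<Longrightarrow> p_max (\<lambda>y. y \<in> stage B i n) x \<longleftrightarrow> x = stage_max B i n"
  by (rule p_maxI) (auto intro: ouro.K_le ouro.c_in_K)

lemma p_base_base: assumes "B \<noteq> {}" shows "p_base (\<lambda>y. y \<in> B) n b \<longleftrightarrow> b = base B n"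
proof (cases "hmin B \<le> n")
  case True
  have *: "base B n \<in> B" "base B n \<le> n" "\<And>y. y \<in> B \<Longrightarrow> y \<le> n \<Longrightarrow> y \<le> base B n"
    using base_in[OF hmin_in[OF assms]] base_le[OF hmin_in[OF assms] True] base_greatest by simp_all
  show ?thesis
  proof
    assume "p_base (\<lambda>y. y \<in> B) n b"
    then have "p_max (\<lambda>y. y \<in> B \<and> y \<le> n) b" using p_min_hmin[OF assms] True by (auto simp: p_base_def)
    then show "b = base B n" using * unfolding p_max_def by (meson le_antisym)
  qed (use * in \<open>auto simp: p_base_def p_max_def\<close>)
next
  case False
  then have no: "\<not> (y \<in> B \<and> y \<le> n)" for y using hmin_le[of y B] by auto
  then have "base B n = hmin B" unfolding base_def by auto
  then show ?thesis using no False p_min_hmin[OF assms] by (auto simp: p_base_def p_max_def)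
qed

lemma p_dec_iff:
  assumes "b \<le> m"
  shows "p_dec b m e a r \<longleftrightarrow> 2 \<le> b \<and> e = lg b m \<and> a = m div b ^ e \<and> r = m mod b ^ e"
proof
  assume p: "p_dec b m e a r"
  then have b2: "2 \<le> b" unfolding p_dec_def by auto
  have "m = b ^ e * a + r" "0 < a" "a < b" "r < b ^ e" using p unfolding p_dec_def by auto
  then show "2 \<le> b \<and> e = lg b m \<and> a = m div b ^ e \<and> r = m mod b ^ e"
    using lg_decomp_unique[OF b2] b2 by metis
next
  assume a: "2 \<le> b \<and> e = lg b m \<and> a = m div b ^ e \<and> r = m mod b ^ e"
  then have b2: "2 \<le> b" by simp
  show "p_dec b m e a r"
    unfolding p_dec_def using a lg_props[OF b2 assms] lg_decomp[OF b2 assms] by (metis Suc_eq_plus1)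
qed

lemma p_dec_less: "b \<le> m \<Longrightarrow> p_dec b m e a r \<Longrightarrow> e < m \<and> a < b \<and> r < m"
  using p_dec_iff[of b m e a r] lg_props[of b m] lg_decomp[of b m] by auto

text \<open>The right hand side copies the clause for \<open>A\<close> in \<open>is_upgrade\<close>,
  quantifier by quantifier; \<open>up_equation\<close> does the same for \<open>U\<close>.\<close>

lemma ango_equation:
  "ango u b c m = Some v \<longleftrightarrow> (m < b \<and> u m = Some v) \<or>
    (b \<le> m \<and> (\<exists>e a r e' a' r' p. p_dec b m e a r \<and> ango u b c e = Some e' \<and> u a = Some a' \<and>
      ango u b c r = Some r' \<and> p = c ^ e' \<and> v = p * a' + r'))"
proof (cases "m < b")
  case False
  then have m: "b \<le> m" by simp
  show ?thesis
  proof (cases "2 \<le> b")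
    case True
    have "ango u b c m = Some v \<longleftrightarrow> (\<exists>e' a' r'. ango u b c (lg b m) = Some e' \<and> u (m div b ^ lg b m) = Some a' \<and>
      ango u b c (m mod b ^ lg b m) = Some r' \<and> v = c ^ e' * a' + r')"
      using False True by (subst ango.simps) (auto split: option.splits)
    then show ?thesis using p_dec_iff[OF m] m True by auto
  next
    case b: False
    then have "ango u b c m = None" using False by (subst ango.simps) simp
    then show ?thesis using False b p_dec_iff[OF m] by simp
  qed
qed (simp add: ango_less)

lemma up_equation:
  assumes B: "base_hierarchy B"
  shows "up B C n = Some v \<longleftrightarrow> (n < hmin B \<and> v = n) \<or>
    (hmin B \<le> n \<and> (\<exists>b n' x. b = base B n \<and> n = n' + 1 \<and> up B C n' = Some x \<and>
      (\<exists>c. p_min (\<lambda>c. c \<in> C \<and> (\<exists>w. ango (up B C) b c n = Some w \<and> x < w \<and> below_next C w c)) c \<and>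
        ango (up B C) b c n = Some v)))"
proof (cases "n < hmin B")
  case True
  then show ?thesis using up_less[OF B] by auto
next
  case False
  then have n: "hmin B \<le> n" by simp
  then obtain n' where n': "n = n' + 1" using hmin_ge2[OF B] by (metis Suc_eq_plus1 not_numeral_le_zero old.nat.exhaust le_trans)
  show ?thesis
  proof
    assume "up B C n = Some v"
    from up_Some[OF B this n] obtain x c where *: "up B C (n - 1) = Some x" "c \<in> C"
      "ango (up B C) (base B n) c n = Some v" "x < v" "below_next C v c"
      "\<And>y z. y \<in> C \<Longrightarrow> ango (up B C) (base B n) y n = Some z \<Longrightarrow> x < z \<Longrightarrow> below_next C z y \<Longrightarrow> c \<le> y"
      by blast
    have "p_min (\<lambda>c. c \<in> C \<and> (\<exists>w. ango (up B C) (base B n) c n = Some w \<and> x < w \<and> below_next C w c)) c"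
      unfolding p_min_def using * by blast
    then show "(n < hmin B \<and> v = n) \<or>
      (hmin B \<le> n \<and> (\<exists>b n' x. b = base B n \<and> n = n' + 1 \<and> up B C n' = Some x \<and>
      (\<exists>c. p_min (\<lambda>c. c \<in> C \<and> (\<exists>w. ango (up B C) b c n = Some w \<and> x < w \<and> below_next C w c)) c \<and>
        ango (up B C) b c n = Some v)))"
      using * n n' by auto
  next
    assume "(n < hmin B \<and> v = n) \<or>
      (hmin B \<le> n \<and> (\<exists>b n' x. b = base B n \<and> n = n' + 1 \<and> up B C n' = Some x \<and>
      (\<exists>c. p_min (\<lambda>c. c \<in> C \<and> (\<exists>w. ango (up B C) b c n = Some w \<and> x < w \<and> below_next C w c)) c \<and>
        ango (up B C) b c n = Some v)))"
    then obtain x c where x: "up B C (n - 1) = Some x" and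
      c: "p_min (\<lambda>c. c \<in> C \<and> (\<exists>w. ango (up B C) (base B n) c n = Some w \<and> x < w \<and> below_next C w c)) c"
      "ango (up B C) (base B n) c n = Some v"
      using n by auto
    define P where "P = (\<lambda>c. c \<in> C \<and> (\<exists>w. ango (up B C) (base B n) c n = Some w \<and> x < w \<and> below_next C w c))"
    have "p_min P c" using c(1) by (simp add: P_def)
    then have "(LEAST c. P c) = c" "\<exists>c. P c" by (auto simp: p_min_def intro: Least_equality)
    moreover have "up B C n = (if \<exists>c. P c then ango (up B C) (base B n) (LEAST c. P c) n else None)"
      using x n unfolding up_upf[OF B, of C n] upf_def P_def by (simp add: Let_def)
    ultimately show "up B C n = Some v" using c(2) by simp
  qed
qed

text \<open>The equation for \<open>D\<close> in \<open>is_ouroboros_construction\<close> has to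
  hold at all \<open>n\<close>, also where the stage does not consult \<open>D\<close>. Hence the
  iteration is defined with the partial operators of the preceding stage.\<close>

definition dopt :: "nat set \<Rightarrow> nat \<Rightarrow> nat \<Rightarrow> nat \<Rightarrow> nat option" where
  "dopt B i n j = (if hmin B < n then
     ((\<lambda>y. case y of None \<Rightarrow> None | Some d \<Rightarrow> ango (up B (stage B i (n - 1))) (base B n) d n) ^^ j)
       (Some (stage_max B i (n - 1))) else None)"

lemma dopt_equation:
  "dopt B i n j = Some x \<longleftrightarrow> hmin B < n \<and> ((j = 0 \<and> x = stage_max B i (n - 1)) \<or>
     (\<exists>j' x'. j = j' + 1 \<and> dopt B i n j' = Some x' \<and>
        ango (up B (stage B i (n - 1))) (base B n) x' n = Some x))"
  by (cases j) (auto simp: dopt_def split: option.splits)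

context ouro
begin

lemma dopt_d:
  assumes "l \<le> n" "Suc n \<notin> B"
  shows "dopt B i (Suc n) j = Some (d (Suc n) j)"
proof (induction j)
  case 0
  then show ?case using assms by (simp add: dopt_def d_0)
next
  case (Suc j)
  have "ango (up B (K n)) (bs n) x m = Some (ang v (bs n) x m)" for x m
  proof (rule ango_ang[OF _ bs2])
    fix y assume "y < bs n"
    then have "y \<le> n" using bs_le[OF assms(1)] by simp
    then show "up B (K n) y = Some (v y)" by (intro up_eq K_mono K_sub_C)
  qed
  then have "ango (up B (K n)) (bs (Suc n)) (d (Suc n) j) (Suc n) = Some (d (Suc n) (Suc j))"
    using bs_Suc[OF assms] by (simp add: d_Suc)
  then show ?case using Suc assms by (simp add: dopt_def)
qed

lemma K_equation:
  "x \<in> K n \<longleftrightarrow> (n \<le> l \<and> x = l + 1) \<or>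
     (l < n \<and> (\<exists>n'. n = n' + 1 \<and> (x \<in> K n' \<or>
       (n \<in> B \<and> (\<exists>b x' w a. b = bs n' \<and> x' = c n' \<and> ango (up B (K n')) b x' n' = Some w \<and>
          p_min (\<lambda>a. w < x' * a) a \<and> x = x' * a)) \<or>
       (n \<notin> B \<and> bs n dvd n \<and> (\<exists>j. 1 \<le> j \<and> j \<le> i \<and> dopt B i n j = Some x)))))"
proof (cases "n \<le> l")
  case True
  then show ?thesis by (simp add: K_small)
next
  case False
  then obtain n' where n': "n = Suc n'" "l \<le> n'" by (cases n) auto
  have an: "ango (up B (K n')) (bs n') x' n' = Some (ang v (bs n') x' n')" for x'
  proof (rule ango_ang[OF _ bs2])
    fix y assume "y < bs n'"
    then have "y \<le> n'" using bs_le[OF n'(2)] by simp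
    then show "up B (K n') y = Some (v y)" by (intro up_eq K_mono K_sub_C)
  qed
  have least: "p_min (\<lambda>a. w < c n' * a) a \<longleftrightarrow> a = (LEAST a. w < c n' * a)" for w a
  proof -
    have "1 * Suc w \<le> c n' * Suc w" using c_pos[of n'] by (intro mult_le_mono1) simp
    then have "w < c n' * Suc w" by simp
    then have "w < c n' * (LEAST a. w < c n' * a)" by (rule LeastI)
    moreover have "(LEAST a. w < c n' * a) \<le> y" if "w < c n' * y" for y using that by (rule Least_le)
    ultimately show ?thesis unfolding p_min_def by (metis le_antisym)
  qed
  have mem: "(\<exists>b x' w a. b = bs n' \<and> x' = c n' \<and> ango (up B (K n')) b x' n' = Some w \<and>
      p_min (\<lambda>a. w < x' * a) a \<and> x = x' * a) \<longleftrightarrow> x = c n" if "n \<in> B"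
    using an c_Suc[OF n'(2)] that n'(1) by (simp add: least)
  have crit: "(\<exists>j. 1 \<le> j \<and> j \<le> i \<and> dopt B i n j = Some x) \<longleftrightarrow> x \<in> d n ` {1..i}" if "n \<notin> B"
    using dopt_d[OF n'(2)] that n'(1) by auto
  have "x \<in> K n \<longleftrightarrow> x \<in> K n' \<or> (n \<in> B \<and> x = c n) \<or> (n \<notin> B \<and> bs n dvd n \<and> x \<in> d n ` {1..i})"
    using n' by auto
  then show ?thesis using mem crit n' False by auto
qed

text \<open>Whatever is added after stage \<open>n\<close> exceeds \<open>v n\<close>, hence
  \<open>n\<close>. This bounds the quantifier over stages in \<open>is_ouroboros\<close> within the
  cut.\<close>

lemma C_bounded_stage: "x \<in> C \<longleftrightarrow> (\<exists>n\<le>l + x. x \<in> K n)"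
proof
  assume "x \<in> C"
  then have "x \<in> K (l + x)" by (intro C_le_K) auto
  then show "\<exists>n\<le>l + x. x \<in> K n" by blast
qed (use K_sub_C in blast)

end

section \<open>Codes for the sets of the construction\<close>

text \<open>The sum is recovered first: the code lies between the square of \<open>x + y\<close> and
  the next square.\<close>

lemma pr_inj: "pr x y = pr x' y' \<longleftrightarrow> x = x' \<and> y = y'"
proof -
  have *: "x + y = x' + y'" if "pr x y = pr x' y'" for x y x' y'
  proof -
    have lt: "pr x y < pr x' y'" if "x + y < x' + y'" for x y x' y'
    proof -
      have "pr x y < (x + y + 1) * (x + y + 1)" by (simp add: pr_def algebra_simps)
      also have "\<dots> \<le> (x' + y') * (x' + y')" using that by (intro mult_le_mono) auto
      finally show ?thesis by (simp add: pr_def)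
    qed
    show ?thesis using lt[of x y x' y'] lt[of x' y' x y] that by (metis less_irrefl linorder_neqE_nat)
  qed
  show ?thesis
  proof
    assume a: "pr x y = pr x' y'"
    then have "x + y = x' + y'" by (rule *)
    then show "x = x' \<and> y = y'" using a by (simp add: pr_def)
  qed simp
qed

definition g2 :: "(nat \<Rightarrow> nat \<Rightarrow> bool) \<Rightarrow> nat set" where "g2 P = {pr x y | x y. P x y}"
definition g3 where "g3 P = g2 (\<lambda>x w. \<exists>y z. w = pr y z \<and> P x y z)"
definition g4 where "g4 P = g3 (\<lambda>x y w. \<exists>z u. w = pr z u \<and> P x y z u)"
definition g5 where "g5 P = g4 (\<lambda>x y z w. \<exists>u v. w = pr u v \<and> P x y z u v)"

lemma in_g2: "pr x y \<in> g2 P \<longleftrightarrow> P x y" by (auto simp: g2_def pr_inj)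
lemma in_g3: "pr x (pr y z) \<in> g3 P \<longleftrightarrow> P x y z" by (auto simp: g3_def in_g2 pr_inj)
lemma in_g4: "pr x (pr y (pr z u)) \<in> g4 P \<longleftrightarrow> P x y z u" by (auto simp: g4_def in_g3 pr_inj)
lemma in_g5: "pr x (pr y (pr z (pr u v))) \<in> g5 P \<longleftrightarrow> P x y z u v" by (auto simp: g5_def in_g4 pr_inj)

lemmas in_g = in_g2 in_g3 in_g4 in_g5

text \<open>
  The set defined by \<open>\<beta>\<close> in the model is a base hierarchy only up to the cut, so it is truncated
  before the first failure.
\<close>

definition hier_part :: "nat set \<Rightarrow> nat set" where
  "hier_part X = {x \<in> X. \<forall>y\<in>X. \<forall>z\<in>X. y < z \<and> z \<le> x \<and> (\<forall>w\<in>X. y < w \<longrightarrow> z \<le> w) \<longrightarrow> y dvd z}"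

definition repair :: "nat set \<Rightarrow> nat set" where
  "repair X = (if hier_part X \<noteq> {} \<and> 0 \<notin> X \<and> 1 \<notin> X then hier_part X else {2})"

lemma repair_hier: "base_hierarchy (repair X)"
proof (cases "hier_part X \<noteq> {} \<and> 0 \<notin> X \<and> 1 \<notin> X")
  case True
  have "base_hierarchy (hier_part X)"
  proof (rule hierI)
    show "2 \<le> b" if "b \<in> hier_part X" for b
    proof -
      have "b \<noteq> 0" "b \<noteq> 1" using True that unfolding hier_part_def by (metis (lifting) mem_Collect_eq)+
      then show ?thesis by simp
    qed
    fix b s assume bs: "b \<in> hier_part X" "s \<in> hier_part X" "b < s" "\<And>y. y \<in> hier_part X \<Longrightarrow> b < y \<Longrightarrow> s \<le> y"
    have "s \<le> w" if "w \<in> X" "b < w" for w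
    proof (rule ccontr)
      assume "\<not> s \<le> w"
      then have "w \<in> hier_part X" using bs(2) that(1) unfolding hier_part_def by auto
      then show False using bs(4)[of w] that \<open>\<not> s \<le> w\<close> by blast
    qed
    then show "b dvd s" using bs(1-3) unfolding hier_part_def by auto
  qed (use True in simp)
  then show ?thesis using True by (simp add: repair_def)
next
  case False
  have "base_hierarchy {2}" by (rule hierI) auto
  then show ?thesis unfolding repair_def if_not_P[OF False] .
qed

text \<open>Packing all arguments except \<open>m\<close> into a witness makes the existence of a
  disagreement at \<open>m\<close> a projection of a named set, to which
  \<open>internal_Sigma1\<close> applies.\<close>

definition disagreement :: "nat set list \<Rightarrow> nat \<Rightarrow> nat \<Rightarrow> bool" where
  "disagreement Xs m w \<longleftrightarrow> (\<exists>b c v. w = pr b (pr c v) \<and>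
     ((pr b (pr c (pr m v)) \<in> Xs ! 0) \<noteq> (pr b (pr c (pr m v)) \<in> Xs ! 1) \<or>
      (pr m v \<in> Xs ! 2) \<noteq> (pr m v \<in> Xs ! 3)))"

text \<open>
  Operations 0 to 2 are \<open>E\<close>, \<open>H\<close> and \<open>G\<close> of \<open>goodstein_termination\<close>; 3 to 6 are \<open>K\<close>, \<open>U\<close>, \<open>A\<close> and \<open>D\<close> of
  the construction of the successor of \<open>B\<^sub>p\<close>; 7 and 8 give the upgrade to that successor. Operation 9
  serves to prove uniqueness of the upgrade by induction, and those from 10 on closure of the cut
  under \<open>fgrow j\<close>.
\<close>

definition gops :: "nat \<Rightarrow> nat \<Rightarrow> nat set list \<Rightarrow> nat set" where
  "gops j p Xs = (let X = repair (Xs ! 0); B = hier_seq X p; i = Suc p in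
     if j = 0 then g3 (\<lambda>b e v. v = b ^ e)
     else if j = 1 then g2 (\<lambda>i x. x \<in> hier_seq X i)
     else if j = 2 then g3 (\<lambda>m i v. v = goodstein_seq X m i)
     else if j = 3 then g2 (\<lambda>n x. x \<in> stage B i n)
     else if j = 4 then g3 (\<lambda>n m v. up B (stage B i n) m = Some v)
     else if j = 5 then g5 (\<lambda>n b c m v. ango (up B (stage B i n)) b c m = Some v)
     else if j = 6 then g3 (\<lambda>n j x. dopt B i n j = Some x)
     else if j = 7 then g2 (\<lambda>m v. up B (ouro_succ B i) m = Some v)
     else if j = 8 then g4 (\<lambda>b c m v. ango (up B (ouro_succ B i)) b c m = Some v)
     else if j = 9 then g2 (disagreement Xs)
     else g2 (\<lambda>n y. y = (fgrow (j - 10) ^^ n) p))"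

section \<open>The upgrade operator in the cut\<close>

lemma up_ge: "base_hierarchy B \<Longrightarrow> up B C n = Some w \<Longrightarrow> n \<le> w"
proof (induction n arbitrary: w)
  case (Suc n)
  show ?case
  proof (cases "Suc n < hmin B")
    case True
    then show ?thesis using Suc.prems up_less by simp
  next
    case False
    then obtain x where "up B C n = Some x" "x < w"
      using up_Some[OF Suc.prems(1,2)] by (metis diff_Suc_1 not_less)
    then show ?thesis using Suc.IH[OF Suc.prems(1)] by fastforce
  qed
qed simp

lemma ango_pos:
  assumes "\<And>x w. x < b \<Longrightarrow> u x = Some w \<Longrightarrow> x \<le> w" "1 \<le> c"
  shows "1 \<le> m \<Longrightarrow> ango u b c m = Some w \<Longrightarrow> 1 \<le> w"
proof -
  assume m: "1 \<le> m" and w: "ango u b c m = Some w"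
  show ?thesis
  proof (cases "m < b")
    case True
    then show ?thesis using assms(1)[of m w] w m by (simp add: ango_less)
  next
    case False
    then obtain e a r e' a' r' where *: "p_dec b m e a r" "u a = Some a'" "w = c ^ e' * a' + r'"
      using w ango_equation[of u b c m w] by auto
    then have "a < b" "0 < a" by (auto simp: p_dec_def)
    then have "1 \<le> a'" using assms(1)[OF _ *(2)] by simp
    moreover have "1 \<le> c ^ e'" using assms(2) by simp
    ultimately have "1 * 1 \<le> c ^ e' * a'" by (intro mult_le_mono)
    then show ?thesis using *(3) by linarith
  qed
qed

text \<open>Bounds the new base by the value, so that quantifiers over new bases stay in the
  cut.\<close>

lemma ango_ge_base:
  assumes "\<And>x w. x < b \<Longrightarrow> u x = Some w \<Longrightarrow> x \<le> w" "b \<le> m" "ango u b c m = Some w"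
  shows "c \<le> w"
proof (cases "c = 0")
  case False
  obtain e a r e' a' r' where *: "p_dec b m e a r" "u a = Some a'" "ango u b c e = Some e'" "w = c ^ e' * a' + r'"
    using assms(2,3) ango_equation[of u b c m w] by auto
  have d: "2 \<le> b" "e = lg b m" using *(1) p_dec_iff[OF assms(2)] by auto
  have "a < b" "0 < a" using *(1) by (auto simp: p_dec_def)
  then have "1 \<le> a'" using assms(1)[OF _ *(2)] by simp
  moreover have "1 \<le> e'" using ango_pos[OF assms(1) _ _ *(3)] False lg_props[OF d(1) assms(2)] d(2) by simp
  then have "c \<le> c ^ e'" using False by (simp add: self_le_power)
  ultimately have "c * 1 \<le> c ^ e' * a'" by (intro mult_le_mono)
  then show ?thesis using *(4) by simp
qed simp

context penv
begin

text \<open>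
  The counterparts of \<open>fden\<close> and \<open>cden\<close> for formulas that need not be decided pointwise.
\<close>

definition mf :: "(nat \<Rightarrow> nat) list \<Rightarrow> (nat \<Rightarrow> sname) list \<Rightarrow> FM \<Rightarrow> bool \<Rightarrow> bool" where
  "mf es ss A \<phi> \<longleftrightarrow> (\<forall>zs ws. hold (es @ zs) (ss @ ws) A \<longleftrightarrow> \<phi>)"
definition mc1 where
  "mc1 es ss A \<Phi> \<longleftrightarrow> (\<forall>zs ws x a. den (es @ zs) x a \<longrightarrow> mf (es @ zs) (ss @ ws) (A x) (\<Phi> a))"
definition mc2 where
  "mc2 es ss A \<Phi> \<longleftrightarrow> (\<forall>zs ws x a y b. den (es @ zs) x a \<longrightarrow> den (es @ zs) y b \<longrightarrow>
     mf (es @ zs) (ss @ ws) (A x y) (\<Phi> a b))"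
definition mc4 where
  "mc4 es ss A \<Phi> \<longleftrightarrow> (\<forall>zs ws x a y b z c w d. den (es @ zs) x a \<longrightarrow> den (es @ zs) y b \<longrightarrow> den (es @ zs) z c \<longrightarrow>
     den (es @ zs) w d \<longrightarrow> mf (es @ zs) (ss @ ws) (A x y z w) (\<Phi> a b c d))"
definition cexp where
  "cexp es ss E \<longleftrightarrow> (\<forall>zs ws x a y b z c. den (es @ zs) x a \<longrightarrow> den (es @ zs) y b \<longrightarrow> den (es @ zs) z c \<longrightarrow>
     fden (es @ zs) (ss @ ws) (E x y z) (\<lambda>t. c t = a t ^ b t))"

lemma mc1_mono: "mc1 es ss A \<Phi> \<Longrightarrow> mc1 (es @ zs) (ss @ ws) A \<Phi>" by (simp only: mc1_def append_assoc) blast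
lemma mc2_mono: "mc2 es ss A \<Phi> \<Longrightarrow> mc2 (es @ zs) (ss @ ws) A \<Phi>" by (simp only: mc2_def append_assoc) blast
lemma mc4_mono: "mc4 es ss A \<Phi> \<Longrightarrow> mc4 (es @ zs) (ss @ ws) A \<Phi>" by (simp only: mc4_def append_assoc) blast
lemma cexp_mono: "cexp es ss E \<Longrightarrow> cexp (es @ zs) (ss @ ws) E" by (simp only: cexp_def append_assoc) blast

lemma mc1I: "(\<And>zs ws x a. den (es @ zs) x a \<Longrightarrow> mf (es @ zs) (ss @ ws) (A x) (\<Phi> a)) \<Longrightarrow> mc1 es ss A \<Phi>"
  unfolding mc1_def by blast
lemma mc1D: "mc1 es ss A \<Phi> \<Longrightarrow> den es x a \<Longrightarrow> mf es ss (A x) (\<Phi> a)"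
  unfolding mc1_def by (drule HOL.spec[of _ "[]"], drule HOL.spec[of _ "[]"]) simp
lemma mc2D: "mc2 es ss A \<Phi> \<Longrightarrow> den es x a \<Longrightarrow> den es y b \<Longrightarrow> mf es ss (A x y) (\<Phi> a b)"
  unfolding mc2_def by (drule HOL.spec[of _ "[]"], drule HOL.spec[of _ "[]"]) simp
lemma mc4D: "mc4 es ss A \<Phi> \<Longrightarrow> den es x a \<Longrightarrow> den es y b \<Longrightarrow> den es z c \<Longrightarrow> den es w d \<Longrightarrow>
    mf es ss (A x y z w) (\<Phi> a b c d)"
  unfolding mc4_def by (drule HOL.spec[of _ "[]"], drule HOL.spec[of _ "[]"]) simp
lemma cexpD: "cexp es ss E \<Longrightarrow> den es x a \<Longrightarrow> den es y b \<Longrightarrow> den es z c \<Longrightarrow>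
    fden es ss (E x y z) (\<lambda>t. c t = a t ^ b t)"
  unfolding cexp_def by (drule HOL.spec[of _ "[]"], drule HOL.spec[of _ "[]"]) simp

lemma mf_fden: "fden es ss A P \<Longrightarrow> mf es ss A (AE P)" by (simp add: mf_def fden_def)
lemma mf_conj: "mf es ss A P \<Longrightarrow> mf es ss B Q \<Longrightarrow> mf es ss (A \<^bold>\<and> B) (P \<and> Q)" by (simp add: mf_def holds)
lemma mf_disj: "mf es ss A P \<Longrightarrow> mf es ss B Q \<Longrightarrow> mf es ss (A \<^bold>\<or> B) (P \<or> Q)" by (simp add: mf_def holds)
lemma mf_imp: "mf es ss A P \<Longrightarrow> mf es ss B Q \<Longrightarrow> mf es ss (A \<^bold>\<longrightarrow> B) (P \<longrightarrow> Q)" by (simp add: mf_def holds)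
lemma mf_iff: "mf es ss A P \<Longrightarrow> mf es ss B Q \<Longrightarrow> mf es ss (A \<^bold>\<longleftrightarrow> B) (P \<longleftrightarrow> Q)" by (simp add: mf_def holds)
lemma mf_neg: "mf es ss A P \<Longrightarrow> mf es ss (\<^bold>\<not> A) (\<not> P)" by (simp add: mf_def holds)

lemma mc1_hold: "mc1 es ss A \<Phi> \<Longrightarrow> y \<in> D \<Longrightarrow>
    hold (es @ zs @ [y]) (ss @ ws) (A (nv (length (es @ zs)))) \<longleftrightarrow> \<Phi> y"
proof -
  assume "mc1 es ss A \<Phi>" "y \<in> D"
  then have "mf (es @ zs @ [y]) (ss @ ws) (A (nv (length (es @ zs)))) (\<Phi> y)"
    using den_nv_last[of y "es @ zs"] unfolding mc1_def append_assoc by blast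
  then have "hold ((es @ zs @ [y]) @ []) ((ss @ ws) @ []) (A (nv (length (es @ zs)))) \<longleftrightarrow> \<Phi> y"
    unfolding mf_def by blast
  then show ?thesis by simp
qed

lemma mf_all: "mc1 es ss A \<Phi> \<Longrightarrow> mf es ss (all A) (\<forall>y\<in>D. \<Phi> y)"
  unfolding mf_def hold_all using mc1_hold by simp
lemma mf_ex: "mc1 es ss A \<Phi> \<Longrightarrow> mf es ss (ex A) (\<exists>y\<in>D. \<Phi> y)"
  unfolding mf_def hold_ex using mc1_hold by simp
lemma mf_hold: "mf es ss A \<phi> \<Longrightarrow> hold es ss A \<longleftrightarrow> \<phi>"
  unfolding mf_def by (drule HOL.spec[of _ "[]"], drule HOL.spec[of _ "[]"]) simp
lemma mf_min: assumes P: "mc1 es ss P \<Phi>" and b: "den es b \<beta>"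
  shows "mf es ss (is_min P b) (\<Phi> \<beta> \<and> (\<forall>y\<in>D. \<Phi> y \<longrightarrow> AE (\<lambda>t. \<beta> t \<le> y t)))"
  unfolding is_min_def
  by (intro mf_conj mc1D[OF P b] mf_all mc1I mf_imp mc1D[OF mc1_mono[OF P]]
      mf_fden[OF fden_leq[OF den_mono[OF b]]])

text \<open>The meaning of \<open>is_upgrade\<close> in the model. The relations \<open>U\<close>
  and \<open>A\<close> remain arbitrary, because \<open>upgrade\<close> quantifies over all sets of
  the model.\<close>

definition UPG :: "(nat \<Rightarrow> nat set) \<Rightarrow> (nat \<Rightarrow> nat set) \<Rightarrow> ((nat \<Rightarrow> nat) \<Rightarrow> (nat \<Rightarrow> nat) \<Rightarrow> bool) \<Rightarrow>
    ((nat \<Rightarrow> nat) \<Rightarrow> (nat \<Rightarrow> nat) \<Rightarrow> (nat \<Rightarrow> nat) \<Rightarrow> (nat \<Rightarrow> nat) \<Rightarrow> bool) \<Rightarrow> bool" where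
  "UPG B C U A \<longleftrightarrow>
    (\<forall>b\<in>D. \<forall>c\<in>D. \<forall>m\<in>D. \<forall>v\<in>D. A b c m v \<longleftrightarrow>
       (AE (\<lambda>t. m t < b t) \<and> U m v) \<or>
       (AE (\<lambda>t. b t \<le> m t) \<and> (\<exists>e\<in>D. \<exists>a\<in>D. \<exists>r\<in>D. \<exists>e'\<in>D. \<exists>a'\<in>D. \<exists>r'\<in>D. \<exists>p\<in>D.
          AE (\<lambda>t. p_dec (b t) (m t) (e t) (a t) (r t)) \<and> A b c e e' \<and> U a a' \<and> A b c r r' \<and>
          AE (\<lambda>t. p t = c t ^ e' t) \<and> AE (\<lambda>t. v t = p t * a' t + r' t)))) \<and>
    (\<forall>n\<in>D. \<forall>v\<in>D. U n v \<longleftrightarrow>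
       ((\<forall>b\<in>D. AE (\<lambda>t. p_min (\<lambda>y. y \<in> B t) (b t)) \<longrightarrow> AE (\<lambda>t. n t < b t)) \<and> AE (\<lambda>t. v t = n t)) \<or>
       ((\<exists>b\<in>D. AE (\<lambda>t. p_min (\<lambda>y. y \<in> B t) (b t)) \<and> AE (\<lambda>t. b t \<le> n t)) \<and>
        (\<exists>b\<in>D. \<exists>n'\<in>D. \<exists>u\<in>D. AE (\<lambda>t. p_base (\<lambda>y. y \<in> B t) (n t) (b t)) \<and>
           AE (\<lambda>t. n t = n' t + 1) \<and> U n' u \<and>
           (\<exists>c\<in>D.
             ((AE (\<lambda>t. c t \<in> C t) \<and> (\<exists>w\<in>D. A b c n w \<and> AE (\<lambda>t. u t < w t) \<and>
                  AE (\<lambda>t. p_next (\<lambda>y. y \<in> C t) (w t) (c t)))) \<and>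
              (\<forall>y\<in>D. (AE (\<lambda>t. y t \<in> C t) \<and> (\<exists>w\<in>D. A b y n w \<and> AE (\<lambda>t. u t < w t) \<and>
                  AE (\<lambda>t. p_next (\<lambda>y. y \<in> C t) (w t) (y t)))) \<longrightarrow> AE (\<lambda>t. c t \<le> y t))) \<and>
             A b c n v))))"

lemma fden_dec:
  assumes E: "cexp es ss E"
    and d: "den es b \<beta>" "den es m \<mu>" "den es e \<epsilon>" "den es a \<alpha>" "den es r \<rho>"
  shows "fden es ss (decomposition E b m e a r) (\<lambda>t. p_dec (\<beta> t) (\<mu> t) (\<epsilon> t) (\<alpha> t) (\<rho> t))"
  unfolding decomposition_def p_dec_def
proof (rule fden_ex[OF den_D[OF d(2)]])
  let ?h = "\<lambda>t. \<mu> t * \<beta> t"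
  have h: "?h \<in> D" using d by (intro D_mul den_D)
  let ?Q = "\<lambda>t p q. p = \<beta> t ^ \<epsilon> t \<and> q = \<beta> t ^ (\<epsilon> t + 1) \<and> \<mu> t = p * \<alpha> t + \<rho> t \<and>
    p \<le> \<mu> t \<and> \<mu> t < q \<and> 0 < \<alpha> t \<and> \<alpha> t < \<beta> t \<and> \<rho> t < p"
  have bd: "q \<le> \<mu> t * \<beta> t" if "?Q t p q" for t p q
  proof -
    have "q = \<beta> t ^ \<epsilon> t * \<beta> t" using that by (simp add: mult.commute)
    then show ?thesis using that by (metis mult_le_mono1)
  qed
  show "AE (\<lambda>t. (\<exists>p. \<exists>q. ?Q t p q) \<longrightarrow> (\<exists>p\<le>\<mu> t. \<exists>q. ?Q t p q))"
    by (rule always_eventually) blast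
  show "cden es ss (\<lambda>p. \<^bold>\<exists>q. E b e p \<^bold>\<and> E b (e \<^bold>+ \<^bold>1) q \<^bold>\<and> m \<^bold>= p \<^bold>* a \<^bold>+ r \<^bold>\<and> p \<^bold>\<le> m \<^bold>\<and> m \<^bold>< q \<^bold>\<and>
      \<^bold>0 \<^bold>< a \<^bold>\<and> a \<^bold>< b \<^bold>\<and> r \<^bold>< p) (\<lambda>t p. \<exists>q. ?Q t p q)"
  proof (rule cdenI, rule fden_ex[OF h])
    fix zs ws x \<pi> assume x: "den (es @ zs) x \<pi>"
    show "AE (\<lambda>t. (\<exists>q. ?Q t (\<pi> t) q) \<longrightarrow> (\<exists>q\<le>?h t. ?Q t (\<pi> t) q))"
      using bd by (intro always_eventually) blast
    note dm = d[THEN den_mono]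
    show "cden (es @ zs) (ss @ ws) (\<lambda>q. E b e x \<^bold>\<and> E b (e \<^bold>+ \<^bold>1) q \<^bold>\<and> m \<^bold>= x \<^bold>* a \<^bold>+ r \<^bold>\<and> x \<^bold>\<le> m \<^bold>\<and> m \<^bold>< q \<^bold>\<and>
      \<^bold>0 \<^bold>< a \<^bold>\<and> a \<^bold>< b \<^bold>\<and> r \<^bold>< x) (\<lambda>t q. ?Q t (\<pi> t) q)"
      by (rule cdenI)
        (intro fden_conj cexpD[OF cexp_mono[OF cexp_mono[OF E]]] fden_eq fden_leq fden_less dens_tm
          dm dm[THEN den_mono] den_mono[OF x] | assumption)+
  qed
qed

lemma mf_upgrade:
  assumes B: "cden es ss B (\<lambda>t y. y \<in> Bt t)" and C: "cden es ss C (\<lambda>t y. y \<in> Ct t)"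
    and E: "cexp es ss E" and U: "mc2 es ss U U'" and A: "mc4 es ss A A'"
  shows "mf es ss (is_upgrade E B C U A) (UPG Bt Ct U' A')"
  unfolding is_upgrade_def UPG_def
  by (insert assms, (assumption |
      rule mf_conj mf_disj mf_all mf_ex mf_imp mf_iff mc1I mf_min mc2D[of _ _ U U'] mc4D[of _ _ A A']
        mf_fden[OF fden_dec] mf_fden[OF fden_base[of _ _ B "\<lambda>t y. y \<in> Bt t"]]
        mf_fden[OF fden_min[of _ _ B "\<lambda>t y. y \<in> Bt t"]] mf_fden[OF fden_next[of _ _ C "\<lambda>t y. y \<in> Ct t"]]
        mf_fden[OF cdenD[of _ _ C "\<lambda>t y. y \<in> Ct t"]] mf_fden[OF cexpD[of _ _ E]]
        mf_fden[OF fden_leq] mf_fden[OF fden_less] mf_fden[OF fden_eq] dens_tm |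
      rule den_mono cden_mono mc2_mono mc4_mono cexp_mono)+)

end

lemma bex_regroup:
  assumes "\<And>b x c. b \<in> D \<Longrightarrow> x \<in> D \<Longrightarrow> c \<in> D \<Longrightarrow> L b x c \<longleftrightarrow> M b x c"
  shows "(P \<or> (\<exists>b\<in>D. \<exists>n\<in>D. \<exists>x\<in>D. \<exists>c\<in>D. H \<and> B b \<and> N n \<and> U n x \<and> M b x c \<and> A b c)) \<longleftrightarrow>
    (P \<or> (H \<and> (\<exists>b\<in>D. \<exists>n\<in>D. \<exists>x\<in>D. B b \<and> N n \<and> U n x \<and> (\<exists>c\<in>D. L b x c \<and> A b c))))"
  using assms by (auto simp: Bex_def)

context penv
begin

lemma AE_obtain:
  assumes "AE (\<lambda>t. \<exists>y. Q t y)" "h \<in> D" "AE (\<lambda>t. \<forall>y. Q t y \<longrightarrow> y \<le> h t)"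
  obtains y where "y \<in> D" "AE (\<lambda>t. Q t (y t))"
proof -
  have "AE (\<lambda>t. (\<exists>y. Q t y) \<longrightarrow> (\<exists>y\<le>h t. Q t y))" using assms(3) by eventually_elim blast
  then show ?thesis using AE_ex_bounded[OF assms(2), of Q] assms(1) that by blast
qed

text \<open>The equations hold at each \<open>t\<close>. What has to be shown is that the numbers
  they quantify over can be chosen in the cut, with bounds from \<open>bd\<close> and from closure
  under the growth functions.\<close>

lemma UPG_intended:
  assumes hB: "\<And>t. base_hierarchy (B t)" and hm: "(\<lambda>t. hmin (B t)) \<in> D"
    and bd: "\<And>m. m \<in> D \<Longrightarrow> \<exists>h\<in>D. AE (\<lambda>t. \<forall>x\<le>m t. \<forall>w. up (B t) (C t) x = Some w \<longrightarrow> w \<le> h t)"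
    and FsD: "\<And>j x. x \<in> D \<Longrightarrow> (\<lambda>t. fgrow j (x t)) \<in> D"
  shows "UPG B C (\<lambda>a b. AE (\<lambda>t. up (B t) (C t) (a t) = Some (b t)))
    (\<lambda>b c m v. AE (\<lambda>t. ango (up (B t) (C t)) (b t) (c t) (m t) = Some (v t)))"
proof -
  let ?u = "\<lambda>t. up (B t) (C t)"
  let ?A = "\<lambda>t b c m v. ango (?u t) b c m = Some v"
  have bound: "\<exists>h\<in>D. AE (\<lambda>t. m t \<le> h t \<and> (\<forall>x\<le>m t. \<forall>w. (?u t x = Some w \<longrightarrow> w \<le> h t) \<and>
      (?A t (b t) (c t) x w \<longrightarrow> w \<le> h t \<and> c t ^ w \<le> h t)))"
    if D: "b \<in> D" "c \<in> D" "m \<in> D" for b c m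
  proof -
    obtain h0 where h0: "h0 \<in> D" "AE (\<lambda>t. \<forall>x\<le>m t. \<forall>w. ?u t x = Some w \<longrightarrow> w \<le> h0 t)"
      using bd[OF D(3)] by blast
    define X where "X t = h0 t + c t + m t" for t
    define h where "h t = fgrow 1 (fgrow 3 (X t) + c t)" for t
    have XD: "X \<in> D" unfolding X_def using h0(1) D by (intro D_add)
    have "h \<in> D" unfolding h_def using XD D by (intro FsD D_add)
    moreover have "AE (\<lambda>t. m t \<le> h t \<and> (\<forall>x\<le>m t. \<forall>w. (?u t x = Some w \<longrightarrow> w \<le> h t) \<and>
      (?A t (b t) (c t) x w \<longrightarrow> w \<le> h t \<and> c t ^ w \<le> h t)))"
      using h0(2)
    proof eventually_elim
      case (elim t)
      have Xh: "X t < fgrow 3 (X t)" "fgrow 3 (X t) + c t < h t" unfolding h_def by (rule fgrow_less)+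
      have *: "w \<le> fgrow 3 (X t)" if "x \<le> m t" "?A t (b t) (c t) x w" for x w
      proof -
        have "w \<le> (fgrow 2 ^^ x) (X t)"
        proof (rule ango_bound[OF _ _ that(2)])
          fix y z assume "y \<le> x" "?u t y = Some z"
          then have "y \<le> m t" using that(1) by simp
          then have "z \<le> h0 t" using elim \<open>?u t y = Some z\<close> by blast
          then show "z \<le> X t" by (simp add: X_def)
        qed (simp add: X_def)
        also have "\<dots> \<le> fgrow (Suc 2) (X t)" using that(1) by (intro fgrow_iter_le) (simp add: X_def)
        finally show ?thesis by (simp add: numeral_3_eq_3 numeral_2_eq_2)
      qed
      have "c t ^ w \<le> h t" if "w \<le> fgrow 3 (X t)" for w
        unfolding h_def using that by (intro power_le_fgrow) auto
      moreover have "m t \<le> h t" "w \<le> h t" if "w \<le> h0 t" for w using Xh that by (simp_all add: X_def)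
      moreover have "m t \<le> h t" using Xh by (simp add: X_def)
      ultimately show ?case using * elim Xh by (meson add_leD1 le_trans less_imp_le)
    qed
    ultimately show ?thesis by blast
  qed
  have part1: "AE (\<lambda>t. ?A t (b t) (c t) (m t) (v t)) \<longleftrightarrow>
       (AE (\<lambda>t. m t < b t) \<and> AE (\<lambda>t. ?u t (m t) = Some (v t))) \<or>
       (AE (\<lambda>t. b t \<le> m t) \<and> (\<exists>e\<in>D. \<exists>a\<in>D. \<exists>r\<in>D. \<exists>e'\<in>D. \<exists>a'\<in>D. \<exists>r'\<in>D. \<exists>p\<in>D.
          AE (\<lambda>t. p_dec (b t) (m t) (e t) (a t) (r t)) \<and> AE (\<lambda>t. ?A t (b t) (c t) (e t) (e' t)) \<and>
          AE (\<lambda>t. ?u t (a t) = Some (a' t)) \<and> AE (\<lambda>t. ?A t (b t) (c t) (r t) (r' t)) \<and>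
          AE (\<lambda>t. p t = c t ^ e' t) \<and> AE (\<lambda>t. v t = p t * a' t + r' t)))"
    if D: "b \<in> D" "c \<in> D" "m \<in> D" "v \<in> D" for b c m v
  proof -
    let ?P = "\<lambda>t e a r e' a' r' p. b t \<le> m t \<and> p_dec (b t) (m t) e a r \<and> ?A t (b t) (c t) e e' \<and>
      ?u t a = Some a' \<and> ?A t (b t) (c t) r r' \<and> p = c t ^ e' \<and> v t = p * a' + r'"
    obtain h where h: "h \<in> D" "AE (\<lambda>t. m t \<le> h t \<and> (\<forall>x\<le>m t. \<forall>w. (?u t x = Some w \<longrightarrow> w \<le> h t) \<and>
      (?A t (b t) (c t) x w \<longrightarrow> w \<le> h t \<and> c t ^ w \<le> h t)))" using bound[OF D(1-3)] by blast
    \<comment> \<open>A common bound for all seven numbers, so that they can be pulled out of the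
      quantifiers one after the other.\<close>
    have BD: "AE (\<lambda>t. \<forall>e a r e' a' r' p. ?P t e a r e' a' r' p \<longrightarrow>
        e \<le> h t \<and> a \<le> h t \<and> r \<le> h t \<and> e' \<le> h t \<and> a' \<le> h t \<and> r' \<le> h t \<and> p \<le> h t)"
      using h(2)
    proof eventually_elim
      case (elim t)
      show ?case
      proof (intro allI impI)
        fix e a r e' a' r' p assume P: "?P t e a r e' a' r' p"
        then have l: "e < m t" "a < b t" "r < m t" "b t \<le> m t" using p_dec_less by blast+
        then have l': "e \<le> m t" "a \<le> m t" "r \<le> m t" by auto
        then have "e' \<le> h t \<and> c t ^ e' \<le> h t" "a' \<le> h t" "r' \<le> h t" using elim P by blast+
        then show "e \<le> h t \<and> a \<le> h t \<and> r \<le> h t \<and> e' \<le> h t \<and> a' \<le> h t \<and> r' \<le> h t \<and> p \<le> h t"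
          using l' elim P by auto
      qed
    qed
    have "(\<exists>e\<in>D. \<exists>a\<in>D. \<exists>r\<in>D. \<exists>e'\<in>D. \<exists>a'\<in>D. \<exists>r'\<in>D. \<exists>p\<in>D.
        AE (\<lambda>t. ?P t (e t) (a t) (r t) (e' t) (a' t) (r' t) (p t)))"
      if *: "AE (\<lambda>t. \<exists>e a r e' a' r' p. ?P t e a r e' a' r' p)"
    proof -
      obtain e where e: "e \<in> D" "AE (\<lambda>t. \<exists>a r e' a' r' p. ?P t (e t) a r e' a' r' p)"
        using AE_obtain[OF * h(1) eventually_mono[OF BD]] by blast
      obtain a where a: "a \<in> D" "AE (\<lambda>t. \<exists>r e' a' r' p. ?P t (e t) (a t) r e' a' r' p)"
        using AE_obtain[OF e(2) h(1) eventually_mono[OF BD]] by blast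
      obtain r where r: "r \<in> D" "AE (\<lambda>t. \<exists>e' a' r' p. ?P t (e t) (a t) (r t) e' a' r' p)"
        using AE_obtain[OF a(2) h(1) eventually_mono[OF BD]] by blast
      obtain e' where e': "e' \<in> D" "AE (\<lambda>t. \<exists>a' r' p. ?P t (e t) (a t) (r t) (e' t) a' r' p)"
        using AE_obtain[OF r(2) h(1) eventually_mono[OF BD]] by blast
      obtain a' where a': "a' \<in> D" "AE (\<lambda>t. \<exists>r' p. ?P t (e t) (a t) (r t) (e' t) (a' t) r' p)"
        using AE_obtain[OF e'(2) h(1) eventually_mono[OF BD]] by blast
      obtain r' where r': "r' \<in> D" "AE (\<lambda>t. \<exists>p. ?P t (e t) (a t) (r t) (e' t) (a' t) (r' t) p)"
        using AE_obtain[OF a'(2) h(1) eventually_mono[OF BD]] by blast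
      obtain p where p: "p \<in> D" "AE (\<lambda>t. ?P t (e t) (a t) (r t) (e' t) (a' t) (r' t) (p t))"
        using AE_obtain[OF r'(2) h(1) eventually_mono[OF BD]] by blast
      show ?thesis using e(1) a(1) r(1) e'(1) a'(1) r'(1) p by blast
    qed
    moreover have "AE (\<lambda>t. \<exists>e a r e' a' r' p. ?P t e a r e' a' r' p)"
      if "AE (\<lambda>t. ?P t (e t) (a t) (r t) (e' t) (a' t) (r' t) (p t))" for e a r e' a' r' p
      using that by (rule eventually_mono) blast
    ultimately have ex: "AE (\<lambda>t. \<exists>e a r e' a' r' p. ?P t e a r e' a' r' p) \<longleftrightarrow>
      (\<exists>e\<in>D. \<exists>a\<in>D. \<exists>r\<in>D. \<exists>e'\<in>D. \<exists>a'\<in>D. \<exists>r'\<in>D. \<exists>p\<in>D.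
        AE (\<lambda>t. ?P t (e t) (a t) (r t) (e' t) (a' t) (r' t) (p t)))" by blast
    have "?A t (b t) (c t) (m t) (v t) \<longleftrightarrow> (m t < b t \<and> ?u t (m t) = Some (v t)) \<or>
        (\<exists>e a r e' a' r' p. ?P t e a r e' a' r' p)" for t
      unfolding ango_equation[of "?u t" "b t" "c t" "m t" "v t"] by blast
    then show ?thesis by (simp only: AE_disj AE_conj ex) blast
  qed
  have bn: "p_next (\<lambda>y. y \<in> X) w y = below_next X w y" for X w y
    unfolding p_next_def below_next_def by blast
  have part2: "AE (\<lambda>t. ?u t (n t) = Some (v t)) \<longleftrightarrow>
       ((\<forall>b\<in>D. AE (\<lambda>t. p_min (\<lambda>y. y \<in> B t) (b t)) \<longrightarrow> AE (\<lambda>t. n t < b t)) \<and> AE (\<lambda>t. v t = n t)) \<or>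
       ((\<exists>b\<in>D. AE (\<lambda>t. p_min (\<lambda>y. y \<in> B t) (b t)) \<and> AE (\<lambda>t. b t \<le> n t)) \<and>
        (\<exists>b\<in>D. \<exists>n'\<in>D. \<exists>x\<in>D. AE (\<lambda>t. p_base (\<lambda>y. y \<in> B t) (n t) (b t)) \<and>
           AE (\<lambda>t. n t = n' t + 1) \<and> AE (\<lambda>t. ?u t (n' t) = Some (x t)) \<and>
           (\<exists>c\<in>D.
             ((AE (\<lambda>t. c t \<in> C t) \<and> (\<exists>w\<in>D. AE (\<lambda>t. ?A t (b t) (c t) (n t) (w t)) \<and> AE (\<lambda>t. x t < w t) \<and>
                  AE (\<lambda>t. p_next (\<lambda>y. y \<in> C t) (w t) (c t)))) \<and>
              (\<forall>y\<in>D. (AE (\<lambda>t. y t \<in> C t) \<and> (\<exists>w\<in>D. AE (\<lambda>t. ?A t (b t) (y t) (n t) (w t)) \<and> AE (\<lambda>t. x t < w t) \<and>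
                  AE (\<lambda>t. p_next (\<lambda>y. y \<in> C t) (w t) (y t)))) \<longrightarrow> AE (\<lambda>t. c t \<le> y t))) \<and>
             AE (\<lambda>t. ?A t (b t) (c t) (n t) (v t)))))"
    if D: "n \<in> D" "v \<in> D" for n v
  proof -
    have p_min_Bt: "p_min (\<lambda>y. y \<in> B t) b \<longleftrightarrow> b = hmin (B t)" for t b
      by (rule p_min_hmin[OF hier_ne[OF hB]])
    have p_base_Bt: "p_base (\<lambda>y. y \<in> B t) m b \<longleftrightarrow> b = base (B t) m" for t m b
      by (rule p_base_base[OF hier_ne[OF hB]])
    have d1: "(\<forall>b\<in>D. AE (\<lambda>t. p_min (\<lambda>y. y \<in> B t) (b t)) \<longrightarrow> AE (\<lambda>t. n t < b t)) \<longleftrightarrow> AE (\<lambda>t. n t < hmin (B t))"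
    proof
      assume "AE (\<lambda>t. n t < hmin (B t))"
      then show "\<forall>b\<in>D. AE (\<lambda>t. p_min (\<lambda>y. y \<in> B t) (b t)) \<longrightarrow> AE (\<lambda>t. n t < b t)"
        unfolding p_min_Bt by (auto elim: eventually_elim2)
    qed (use hm in \<open>auto simp: p_min_Bt\<close>)
    have d2: "(\<exists>b\<in>D. AE (\<lambda>t. p_min (\<lambda>y. y \<in> B t) (b t)) \<and> AE (\<lambda>t. b t \<le> n t)) \<longleftrightarrow> AE (\<lambda>t. hmin (B t) \<le> n t)"
    proof
      assume "\<exists>b\<in>D. AE (\<lambda>t. p_min (\<lambda>y. y \<in> B t) (b t)) \<and> AE (\<lambda>t. b t \<le> n t)"
      then show "AE (\<lambda>t. hmin (B t) \<le> n t)" unfolding p_min_Bt by (auto elim: eventually_elim2)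
    next
      assume "AE (\<lambda>t. hmin (B t) \<le> n t)"
      then show "\<exists>b\<in>D. AE (\<lambda>t. p_min (\<lambda>y. y \<in> B t) (b t)) \<and> AE (\<lambda>t. b t \<le> n t)"
        unfolding p_min_Bt using hm by (intro bexI[of _ "\<lambda>t. hmin (B t)"]) simp_all
    qed
    let ?Pc = "\<lambda>t b x c. c \<in> C t \<and> (\<exists>w. ?A t b c (n t) w \<and> x < w \<and> below_next (C t) w c)"
    have cond: "(AE (\<lambda>t. y t \<in> C t) \<and> (\<exists>w\<in>D. AE (\<lambda>t. ?A t (b t) (y t) (n t) (w t)) \<and> AE (\<lambda>t. x t < w t) \<and>
        AE (\<lambda>t. p_next (\<lambda>y. y \<in> C t) (w t) (y t)))) \<longleftrightarrow> AE (\<lambda>t. ?Pc t (b t) (x t) (y t))"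
      if bxy: "b \<in> D" "x \<in> D" "y \<in> D" for b x y
    proof -
      obtain h where h: "h \<in> D" "AE (\<lambda>t. n t \<le> h t \<and> (\<forall>x\<le>n t. \<forall>w. (?u t x = Some w \<longrightarrow> w \<le> h t) \<and>
        (?A t (b t) (y t) x w \<longrightarrow> w \<le> h t \<and> y t ^ w \<le> h t)))" using bound[OF bxy(1,3) D(1)] by blast
      have "AE (\<lambda>t. (\<exists>w. ?A t (b t) (y t) (n t) w \<and> x t < w \<and> below_next (C t) w (y t)) \<longrightarrow>
        (\<exists>w\<le>h t. ?A t (b t) (y t) (n t) w \<and> x t < w \<and> below_next (C t) w (y t)))"
        using h(2) by eventually_elim blast
      from AE_ex_bounded[OF h(1) this] show ?thesis by (simp add: AE_conj bn)
    qed
    have cmin: "((AE (\<lambda>t. c t \<in> C t) \<and> (\<exists>w\<in>D. AE (\<lambda>t. ?A t (b t) (c t) (n t) (w t)) \<and> AE (\<lambda>t. x t < w t) \<and>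
                  AE (\<lambda>t. p_next (\<lambda>y. y \<in> C t) (w t) (c t)))) \<and>
              (\<forall>y\<in>D. (AE (\<lambda>t. y t \<in> C t) \<and> (\<exists>w\<in>D. AE (\<lambda>t. ?A t (b t) (y t) (n t) (w t)) \<and> AE (\<lambda>t. x t < w t) \<and>
                  AE (\<lambda>t. p_next (\<lambda>y. y \<in> C t) (w t) (y t)))) \<longrightarrow> AE (\<lambda>t. c t \<le> y t))) \<longleftrightarrow>
        AE (\<lambda>t. p_min (?Pc t (b t) (x t)) (c t))"
      if bxc: "b \<in> D" "x \<in> D" "c \<in> D" for b x c
    proof -
      have "(\<forall>y\<in>D. AE (\<lambda>t. ?Pc t (b t) (x t) (y t)) \<longrightarrow> AE (\<lambda>t. c t \<le> y t)) \<longleftrightarrow>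
          AE (\<lambda>t. \<forall>y. ?Pc t (b t) (x t) y \<longrightarrow> c t \<le> y)"
      proof
        assume L: "\<forall>y\<in>D. AE (\<lambda>t. ?Pc t (b t) (x t) (y t)) \<longrightarrow> AE (\<lambda>t. c t \<le> y t)"
        show "AE (\<lambda>t. \<forall>y. ?Pc t (b t) (x t) y \<longrightarrow> c t \<le> y)"
        proof (rule ccontr)
          assume "\<not> ?thesis"
          then have "AE (\<lambda>t. \<exists>y. ?Pc t (b t) (x t) y \<and> y < c t)"
            unfolding AE_not[symmetric] by (rule eventually_mono) (auto simp: not_le)
          then obtain y where y: "y \<in> D" "AE (\<lambda>t. ?Pc t (b t) (x t) (y t) \<and> y t < c t)"
            using AE_obtain[OF _ bxc(3), of "\<lambda>t y. ?Pc t (b t) (x t) y \<and> y < c t"] by (auto intro: always_eventually)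
          then have "AE (\<lambda>t. ?Pc t (b t) (x t) (y t))" "AE (\<lambda>t. y t < c t)"
            unfolding AE_conj[of "\<lambda>t. ?Pc t (b t) (x t) (y t)"] by blast+
          then have "AE (\<lambda>t. c t \<le> y t)" "AE (\<lambda>t. y t < c t)" using L y(1) by blast+
          then have "AE (\<lambda>t. False)" by eventually_elim simp
          then show False using F_bot by (simp add: trivial_limit_def)
        qed
      next
        assume R: "AE (\<lambda>t. \<forall>y. ?Pc t (b t) (x t) y \<longrightarrow> c t \<le> y)"
        show "\<forall>y\<in>D. AE (\<lambda>t. ?Pc t (b t) (x t) (y t)) \<longrightarrow> AE (\<lambda>t. c t \<le> y t)"
        proof (intro ballI impI)
          fix y assume "AE (\<lambda>t. ?Pc t (b t) (x t) (y t))"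
          then show "AE (\<lambda>t. c t \<le> y t)" using R by eventually_elim blast
        qed
      qed
      then show ?thesis unfolding p_min_def using cond[OF bxc] cond[OF bxc(1,2)]
        AE_conj[of "\<lambda>t. ?Pc t (b t) (x t) (c t)" "\<lambda>t. \<forall>y. ?Pc t (b t) (x t) y \<longrightarrow> c t \<le> y"] by blast
    qed
    let ?R = "\<lambda>t b n' x c. hmin (B t) \<le> n t \<and> b = base (B t) (n t) \<and> n t = n' + 1 \<and> ?u t n' = Some x \<and>
      p_min (?Pc t b x) c \<and> ?A t b c (n t) (v t)"
    have eq: "?u t (n t) = Some (v t) \<longleftrightarrow> (n t < hmin (B t) \<and> v t = n t) \<or> (\<exists>b n' x c. ?R t b n' x c)" for t
      unfolding up_equation[OF hB, of t "C t" "n t" "v t"] by blast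
    obtain h where h: "h \<in> D" "AE (\<lambda>t. \<forall>x\<le>n t. \<forall>w. ?u t x = Some w \<longrightarrow> w \<le> h t)"
      using bd[OF D(1)] by blast
    \<comment> \<open>The previous value is bounded by \<open>h\<close>, and the new base by the
      result \<open>v\<close>.\<close>
    have BD: "AE (\<lambda>t. \<forall>b n' x c. ?R t b n' x c \<longrightarrow> b \<le> n t \<and> n' \<le> n t \<and> x \<le> h t \<and> c \<le> v t)"
      using h(2)
    proof eventually_elim
      case (elim t)
      show ?case
      proof (intro allI impI)
        fix b n' x c assume R: "?R t b n' x c"
        then have b: "b \<le> n t" using base_le[OF hmin_in[OF hier_ne[OF hB[of t]]], of "n t"] by simp
        have "c \<le> v t"
          by (rule ango_ge_base[of b "?u t" "n t" c "v t"]) (use up_ge[OF hB] b R in auto)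
        moreover have n': "n' \<le> n t" "?u t n' = Some x" using R by auto
        moreover have "x \<le> h t" using elim n' by blast
        ultimately show "b \<le> n t \<and> n' \<le> n t \<and> x \<le> h t \<and> c \<le> v t" using b by blast
      qed
    qed
    have ex: "AE (\<lambda>t. \<exists>b n' x c. ?R t b n' x c) \<longleftrightarrow>
      (\<exists>b\<in>D. \<exists>n'\<in>D. \<exists>x\<in>D. \<exists>c\<in>D. AE (\<lambda>t. ?R t (b t) (n' t) (x t) (c t)))"
    proof
      assume *: "AE (\<lambda>t. \<exists>b n' x c. ?R t b n' x c)"
      obtain b where b: "b \<in> D" "AE (\<lambda>t. \<exists>n' x c. ?R t (b t) n' x c)"
        using AE_obtain[OF * D(1) eventually_mono[OF BD]] by blast
      obtain n' where n': "n' \<in> D" "AE (\<lambda>t. \<exists>x c. ?R t (b t) (n' t) x c)"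
        using AE_obtain[OF b(2) D(1) eventually_mono[OF BD]] by blast
      obtain x where x: "x \<in> D" "AE (\<lambda>t. \<exists>c. ?R t (b t) (n' t) (x t) c)"
        using AE_obtain[OF n'(2) h(1) eventually_mono[OF BD]] by blast
      obtain c where c: "c \<in> D" "AE (\<lambda>t. ?R t (b t) (n' t) (x t) (c t))"
        using AE_obtain[OF x(2) D(2) eventually_mono[OF BD]] by blast
      show "\<exists>b\<in>D. \<exists>n'\<in>D. \<exists>x\<in>D. \<exists>c\<in>D. AE (\<lambda>t. ?R t (b t) (n' t) (x t) (c t))"
        using b(1) n'(1) x(1) c by blast
    next
      assume "\<exists>b\<in>D. \<exists>n'\<in>D. \<exists>x\<in>D. \<exists>c\<in>D. AE (\<lambda>t. ?R t (b t) (n' t) (x t) (c t))"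
      then obtain b n' x c where "AE (\<lambda>t. ?R t (b t) (n' t) (x t) (c t))" by blast
      then show "AE (\<lambda>t. \<exists>b n' x c. ?R t b n' x c)" by (rule eventually_mono) blast
    qed
    have RAE: "AE (\<lambda>t. ?R t (b t) (n' t) (x t) (c t)) \<longleftrightarrow> AE (\<lambda>t. hmin (B t) \<le> n t) \<and>
        AE (\<lambda>t. b t = base (B t) (n t)) \<and> AE (\<lambda>t. n t = n' t + 1) \<and> AE (\<lambda>t. ?u t (n' t) = Some (x t)) \<and>
        AE (\<lambda>t. p_min (?Pc t (b t) (x t)) (c t)) \<and> AE (\<lambda>t. ?A t (b t) (c t) (n t) (v t))" for b n' x c
      by (simp only: AE_conj)
    have AEeq: "AE (\<lambda>t. ?u t (n t) = Some (v t)) \<longleftrightarrow> (AE (\<lambda>t. n t < hmin (B t)) \<and> AE (\<lambda>t. v t = n t)) \<or>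
      (\<exists>b\<in>D. \<exists>n'\<in>D. \<exists>x\<in>D. \<exists>c\<in>D. AE (\<lambda>t. ?R t (b t) (n' t) (x t) (c t)))"
      unfolding eq AE_disj ex unfolding AE_conj[of "\<lambda>t. n t < hmin (B t)"] ..
    show ?thesis
      unfolding AEeq d1 d2 p_base_Bt RAE by (rule bex_regroup[OF cmin])
  qed
  show ?thesis
    unfolding UPG_def by (intro conjI ballI; (rule part1 | rule part2); assumption)
qed

end

locale gcut = cut F N gops k Y Ms for F N k Y Ms +
  fixes r0 :: "nat \<Rightarrow> nat \<Rightarrow> nat" and S0 :: "nat \<Rightarrow> nat \<Rightarrow> sname"
  assumes e0: "envs r0 S0"
begin

sublocale penv F N gops D r0 S0
  by unfold_locales (rule e0)

text \<open>Induction on the number of iterations within the cut; the operations from 10 on make the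
  graph of the iteration a set of the model.\<close>

lemma D_iter:
  assumes "\<And>x. x \<in> D \<Longrightarrow> (\<lambda>t. fgrow j (x t)) \<in> D" "n \<in> D" "x \<in> D"
  shows "(\<lambda>t. (fgrow j ^^ n t) (x t)) \<in> D"
proof -
  define s where "s t = Op (10 + j) (x t) []" for t
  have s: "s \<in> Ds" using Ds_Op[OF assms(3), of "[]" "10 + j"] by (simp add: s_def[abs_def])
  have EVs: "EV (s t) = g2 (\<lambda>n y. y = (fgrow j ^^ n) (x t))" for t
    by (simp add: s_def gops_def Let_def)
  let ?P = "\<lambda>n. \<exists>y\<in>D. AE (\<lambda>t. pr (n t) (y t) \<in> EV (s t))"
  have "?P n"
  proof (rule internal_induct[OF internal_Sigma1[OF s] _ _ _ assms(2)])
    show "?P (\<lambda>t. 0)" using assms(3) by (intro bexI[of _ x]) (auto simp: EVs in_g)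
    fix n
    {
      assume "?P n"
      then obtain y where "y \<in> D" "AE (\<lambda>t. y t = (fgrow j ^^ n t) (x t))" by (auto simp: EVs in_g)
      then show "?P (\<lambda>t. n t + 1)" using assms(1)
        by (intro bexI[of _ "\<lambda>t. fgrow j (y t)"]) (auto simp: EVs in_g elim: eventually_mono)
    next
      fix m assume *: "AE (\<lambda>t. n t = m t)" "?P n"
      then obtain y where y: "y \<in> D" "AE (\<lambda>t. pr (n t) (y t) \<in> EV (s t))" by blast
      have "AE (\<lambda>t. pr (m t) (y t) \<in> EV (s t))" using *(1) y(2) by eventually_elim simp
      then show "?P m" using y(1) by blast
    }
  qed
  then obtain y where y: "y \<in> D" "AE (\<lambda>t. y t = (fgrow j ^^ n t) (x t))" by (auto simp: EVs in_g)
  have "AE (\<lambda>t. (fgrow j ^^ n t) (x t) \<le> y t)" using y(2) by eventually_elim simp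
  then show ?thesis by (rule D_down[OF y(1)])
qed

lemma D_fgrow: "x \<in> D \<Longrightarrow> (\<lambda>t. fgrow j (x t)) \<in> D"
proof (induction j arbitrary: x)
  case 0
  then show ?case unfolding fgrow.simps by (intro D_mul D_add D_const)
next
  case (Suc j)
  have "(\<lambda>t. (fgrow j ^^ (x t + 1)) (x t)) \<in> D"
    by (rule D_iter) (use Suc D_Suc in auto)
  then show ?case unfolding fgrow.simps .
qed

lemma pr_ge: "x \<le> pr x y" "y \<le> pr x y"
proof -
  have "x + y \<le> (x + y) * (x + y)" by (rule le_square)
  then show "x \<le> pr x y" "y \<le> pr x y" unfolding pr_def by linarith+
qed

lemma D_pr: "x \<in> D \<Longrightarrow> y \<in> D \<Longrightarrow> (\<lambda>t. pr (x t) (y t)) \<in> D"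
  unfolding pr_def by (intro D_add D_mul)

text \<open>
  Operation 9 makes the places of disagreement a set of the model, so there is a least one.
\<close>

lemma UPG_unique:
  assumes s: "U1 \<in> Ds" "U2 \<in> Ds" "A1 \<in> Ds" "A2 \<in> Ds"
    and hB: "\<And>t. base_hierarchy (B t)"
  defines "mU \<equiv> \<lambda>U a b. AE (\<lambda>t. pr (a t) (b t) \<in> EV (U t))"
    and "mA \<equiv> \<lambda>A b c m v. AE (\<lambda>t. pr (b t) (pr (c t) (pr (m t) (v t))) \<in> EV (A t))"
  assumes UP: "UPG B C (mU U1) (mA A1)" "UPG B C (mU U2) (mA A2)"
    and mv: "m0 \<in> D" "v0 \<in> D"
  shows "mU U1 m0 v0 \<longleftrightarrow> mU U2 m0 v0"
proof (rule ccontr)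
  assume neq: "mU U1 m0 v0 \<noteq> mU U2 m0 v0"
  define s where "s t = Op 9 0 (map (\<lambda>s. s t) [A1, A2, U1, U2])" for t
  have sD: "s \<in> Ds" unfolding s_def by (rule Ds_Op) (use s D_const in auto)
  have EVs: "EV (s t) = g2 (disagreement [EV (A1 t), EV (A2 t), EV (U1 t), EV (U2 t)])" for t
    by (simp add: s_def gops_def Let_def)
  let ?P = "\<lambda>m. \<exists>y\<in>D. AE (\<lambda>t. pr (m t) (y t) \<in> EV (s t))"
  have P_iff: "?P m \<longleftrightarrow> (\<exists>b\<in>D. \<exists>c\<in>D. \<exists>v\<in>D. mA A1 b c m v \<noteq> mA A2 b c m v \<or> mU U1 m v \<noteq> mU U2 m v)"
    if m: "m \<in> D" for m
  proof -
    let ?Q = "\<lambda>t b c v. (pr b (pr c (pr (m t) v)) \<in> EV (A1 t)) \<noteq> (pr b (pr c (pr (m t) v)) \<in> EV (A2 t)) \<or>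
        (pr (m t) v \<in> EV (U1 t)) \<noteq> (pr (m t) v \<in> EV (U2 t))"
    have QAE: "AE (\<lambda>t. ?Q t (b t) (c t) (v t)) \<longleftrightarrow> mA A1 b c m v \<noteq> mA A2 b c m v \<or> mU U1 m v \<noteq> mU U2 m v" for b c v
      unfolding mA_def mU_def AE_disj AE_not AE_iff ..
    show ?thesis
    proof
      assume "?P m"
      then obtain y where y: "y \<in> D" "AE (\<lambda>t. \<exists>b c v. y t = pr b (pr c v) \<and> ?Q t b c v)"
        by (auto simp: EVs in_g disagreement_def)
      have BD: "AE (\<lambda>t. \<forall>b c v. y t = pr b (pr c v) \<and> ?Q t b c v \<longrightarrow> b \<le> y t \<and> c \<le> y t \<and> v \<le> y t)"
        by (rule always_eventually) (auto intro: pr_ge order_trans[OF _ pr_ge(2)])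
      obtain b where b: "b \<in> D" "AE (\<lambda>t. \<exists>c v. y t = pr (b t) (pr c v) \<and> ?Q t (b t) c v)"
        using AE_obtain[OF y(2,1) eventually_mono[OF BD]] by blast
      obtain c where c: "c \<in> D" "AE (\<lambda>t. \<exists>v. y t = pr (b t) (pr (c t) v) \<and> ?Q t (b t) (c t) v)"
        using AE_obtain[OF b(2) y(1) eventually_mono[OF BD]] by blast
      obtain v where v: "v \<in> D" "AE (\<lambda>t. y t = pr (b t) (pr (c t) (v t)) \<and> ?Q t (b t) (c t) (v t))"
        using AE_obtain[OF c(2) y(1) eventually_mono[OF BD]] by blast
      have "AE (\<lambda>t. ?Q t (b t) (c t) (v t))" using v(2) by (rule eventually_mono) blast
      then show "\<exists>b\<in>D. \<exists>c\<in>D. \<exists>v\<in>D. mA A1 b c m v \<noteq> mA A2 b c m v \<or> mU U1 m v \<noteq> mU U2 m v"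
        using QAE b(1) c(1) v(1) by blast
    next
      assume "\<exists>b\<in>D. \<exists>c\<in>D. \<exists>v\<in>D. mA A1 b c m v \<noteq> mA A2 b c m v \<or> mU U1 m v \<noteq> mU U2 m v"
      then obtain b c v where D: "b \<in> D" "c \<in> D" "v \<in> D" and Q: "AE (\<lambda>t. ?Q t (b t) (c t) (v t))"
        using QAE by blast
      have "AE (\<lambda>t. pr (m t) (pr (b t) (pr (c t) (v t))) \<in> EV (s t))"
        using Q by (rule eventually_mono) (auto simp: EVs in_g disagreement_def pr_inj)
      then show "?P m" using D by (intro bexI[of _ "\<lambda>t. pr (b t) (pr (c t) (v t))"]) (auto intro: D_pr)
    qed
  qed
  have P0: "?P m0" using P_iff[OF mv(1)] neq mv D_const[of 0] by blast
  obtain m where m: "m \<in> D" "?P m" "\<And>z. z \<in> D \<Longrightarrow> AE (\<lambda>t. z t < m t) \<Longrightarrow> \<not> ?P z"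
  proof -
    note L = internal_least[of ?P m0, OF internal_Sigma1[OF sD] mv(1) P0]
    show thesis by (rule L, rule that)
  qed
  have agA: "mA A1 b c z v \<longleftrightarrow> mA A2 b c z v" if "z \<in> D" "AE (\<lambda>t. z t < m t)" "b \<in> D" "c \<in> D" "v \<in> D" for z b c v
    using m(3)[OF that(1,2)] P_iff[OF that(1)] that by blast
  have agU: "mU U1 z v \<longleftrightarrow> mU U2 z v" if "z \<in> D" "AE (\<lambda>t. z t < m t)" "v \<in> D" for z v
    using m(3)[OF that(1,2)] P_iff[OF that(1)] that D_const[of 0] by blast
  note eqA = UP(1)[unfolded UPG_def, THEN conjunct1, rule_format] UP(2)[unfolded UPG_def, THEN conjunct1, rule_format]
  note eqU = UP(1)[unfolded UPG_def, THEN conjunct2, rule_format] UP(2)[unfolded UPG_def, THEN conjunct2, rule_format]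
  \<comment> \<open>The order matters at the least disagreement \<open>m\<close>. For
    \<open>b \<le> m\<close> the relation \<open>A\<close> refers to smaller arguments only. Then
    \<open>U\<close> follows, which uses \<open>A\<close> with the base of \<open>m\<close>, and
    finally \<open>A\<close> for \<open>b > m\<close>, where it is \<open>U\<close>.\<close>
  have S1: "mA A1 b c m v \<longleftrightarrow> mA A2 b c m v" if D: "b \<in> D" "c \<in> D" "v \<in> D" and bm: "AE (\<lambda>t. b t \<le> m t)" for b c v
  proof -
    have nlt: "\<not> AE (\<lambda>t. m t < b t)"
      using bm unfolding AE_not[symmetric] by (rule eventually_mono) simp
    have key: "(mA A1 b c e e' \<and> mU U1 a a' \<and> mA A1 b c r r') \<longleftrightarrow> (mA A2 b c e e' \<and> mU U2 a a' \<and> mA A2 b c r r')"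
      if "AE (\<lambda>t. p_dec (b t) (m t) (e t) (a t) (r t))" "e \<in> D" "a \<in> D" "r \<in> D" "e' \<in> D" "a' \<in> D" "r' \<in> D"
      for e a r e' a' r'
    proof -
      have "AE (\<lambda>t. e t < m t \<and> a t < m t \<and> r t < m t)"
        using that(1) bm by eventually_elim (meson p_dec_less less_le_trans)
      then have "AE (\<lambda>t. e t < m t)" "AE (\<lambda>t. a t < m t)" "AE (\<lambda>t. r t < m t)" by (auto simp: AE_conj)
      then show ?thesis using agA agU that D by blast
    qed
    show ?thesis
      unfolding eqA(1)[OF D(1,2) m(1) D(3)] eqA(2)[OF D(1,2) m(1) D(3)]
      by (rule disj_cong[OF _ conj_cong[OF HOL.refl]], use nlt in blast, intro bex_cong HOL.refl, use key in blast)
  qed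
  have S2: "mU U1 m v \<longleftrightarrow> mU U2 m v" if v: "v \<in> D" for v
  proof -
    have key: "(mU U1 n' u \<and> (\<exists>c\<in>D.
             ((AE (\<lambda>t. c t \<in> C t) \<and> (\<exists>w\<in>D. mA A1 b c m w \<and> AE (\<lambda>t. u t < w t) \<and>
                  AE (\<lambda>t. p_next (\<lambda>y. y \<in> C t) (w t) (c t)))) \<and>
              (\<forall>y\<in>D. (AE (\<lambda>t. y t \<in> C t) \<and> (\<exists>w\<in>D. mA A1 b y m w \<and> AE (\<lambda>t. u t < w t) \<and>
                  AE (\<lambda>t. p_next (\<lambda>y. y \<in> C t) (w t) (y t)))) \<longrightarrow> AE (\<lambda>t. c t \<le> y t))) \<and>
             mA A1 b c m v)) \<longleftrightarrow>
        (mU U2 n' u \<and> (\<exists>c\<in>D.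
             ((AE (\<lambda>t. c t \<in> C t) \<and> (\<exists>w\<in>D. mA A2 b c m w \<and> AE (\<lambda>t. u t < w t) \<and>
                  AE (\<lambda>t. p_next (\<lambda>y. y \<in> C t) (w t) (c t)))) \<and>
              (\<forall>y\<in>D. (AE (\<lambda>t. y t \<in> C t) \<and> (\<exists>w\<in>D. mA A2 b y m w \<and> AE (\<lambda>t. u t < w t) \<and>
                  AE (\<lambda>t. p_next (\<lambda>y. y \<in> C t) (w t) (y t)))) \<longrightarrow> AE (\<lambda>t. c t \<le> y t))) \<and>
             mA A2 b c m v))"
      if a: "AE (\<lambda>t. hmin (B t) \<le> m t)" "AE (\<lambda>t. p_base (\<lambda>y. y \<in> B t) (m t) (b t))"
        "AE (\<lambda>t. m t = n' t + 1)" "b \<in> D" "n' \<in> D" "u \<in> D" for b n' u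
    proof -
      have bm: "AE (\<lambda>t. b t \<le> m t)"
        using a(1,2)
      proof eventually_elim
        case (elim t)
        then show ?case using p_base_base[OF hier_ne[OF hB[of t]]] base_le[OF hmin_in[OF hier_ne[OF hB[of t]]]]
          by simp
      qed
      have "AE (\<lambda>t. n' t < m t)" using a(3) by (rule eventually_mono) simp
      then have "mU U1 n' u \<longleftrightarrow> mU U2 n' u" using agU a by blast
      moreover have "mA A1 b c m w \<longleftrightarrow> mA A2 b c m w" if "c \<in> D" "w \<in> D" for c w
        using S1[OF a(4) that bm] .
      ultimately show ?thesis using v by (simp cong: bex_cong ball_cong)
    qed
    have hm: "AE (\<lambda>t. hmin (B t) \<le> m t)"
      if ex: "\<exists>b\<in>D. AE (\<lambda>t. p_min (\<lambda>y. y \<in> B t) (b t)) \<and> AE (\<lambda>t. b t \<le> m t)"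
    proof -
      obtain b where "AE (\<lambda>t. p_min (\<lambda>y. y \<in> B t) (b t))" "AE (\<lambda>t. b t \<le> m t)" using ex by blast
      then show ?thesis
        by eventually_elim (use p_min_hmin[OF hier_ne[OF hB]] in simp)
    qed
    show ?thesis
      unfolding eqU(1)[OF m(1) v] eqU(2)[OF m(1) v]
      by (rule disj_cong[OF HOL.refl conj_cong[OF HOL.refl]], intro bex_cong HOL.refl, use key hm in blast)
  qed
  have S3: "mA A1 b c m v \<longleftrightarrow> mA A2 b c m v" if D: "b \<in> D" "c \<in> D" "v \<in> D" for b c v
  proof (cases "AE (\<lambda>t. b t \<le> m t)")
    case False
    then show ?thesis
      unfolding eqA(1)[OF D(1,2) m(1) D(3)] eqA(2)[OF D(1,2) m(1) D(3)] using S2[OF D(3)] by blast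
  qed (rule S1[OF D])
  show False using m(2) P_iff[OF m(1)] S2 S3 by blast
qed

end

section \<open>The Ouroboros successor in the cut\<close>

context penv
begin

lemma fden_rel3: "dens ss X s \<Longrightarrow> den es x a \<Longrightarrow> den es y b \<Longrightarrow> den es z c \<Longrightarrow>
    fden es ss (rel3 X x y z) (\<lambda>t. pr (a t) (pr (b t) (c t)) \<in> EV (s t))"
  using fden_rel2[of ss X s es x a "pair y z"] den_pair[of es y b z c] by (simp add: rel3_def pr_def)
lemma fden_rel4: "dens ss X s \<Longrightarrow> den es x a \<Longrightarrow> den es y b \<Longrightarrow> den es z c \<Longrightarrow> den es w d \<Longrightarrow>
    fden es ss (rel4 X x y z w) (\<lambda>t. pr (a t) (pr (b t) (pr (c t) (d t))) \<in> EV (s t))"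
  using fden_rel3[of ss X s es x a y b "pair z w"] den_pair[of es z c w d] by (simp add: rel4_def pr_def)
lemma fden_rel5: "dens ss X s \<Longrightarrow> den es x a \<Longrightarrow> den es y b \<Longrightarrow> den es z c \<Longrightarrow> den es w d \<Longrightarrow> den es u f \<Longrightarrow>
    fden es ss (rel5 X x y z w u) (\<lambda>t. pr (a t) (pr (b t) (pr (c t) (pr (d t) (f t)))) \<in> EV (s t))"
  using fden_rel4[of ss X s es x a y b z c "pair w u"] den_pair[of es w d u f] by (simp add: rel5_def pr_def)

end

context gcut
begin

context
  fixes e :: "nat \<Rightarrow> sname" and p :: "nat \<Rightarrow> nat"
  assumes eD: "e \<in> Ds" and pD: "p \<in> D" and hminD: "(\<lambda>t. hmin (repair (EV (e t)))) \<in> D"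
begin

definition X where "X t = repair (EV (e t))"
definition Bt where "Bt t = hier_seq (X t) (p t)"
definition it where "it t = Suc (p t)"
definition op where "op j = (\<lambda>t. Op j (p t) [e t])"

lemma op_Ds: "op j \<in> Ds" using Ds_Op[OF pD, of "[e]" j] eD by (simp add: op_def)

lemma hier_X: "base_hierarchy (X t)" unfolding X_def by (rule repair_hier)
lemma ouro_t: "ouro (Bt t) (it t)" unfolding Bt_def it_def by (rule hier_seq_ouro[OF hier_X])
lemma hier_Bt: "base_hierarchy (Bt t)" unfolding Bt_def by (rule hier_seq_hier[OF hier_X])
lemma Bt_ne: "Bt t \<noteq> {}" by (rule hier_ne[OF hier_Bt])
lemma oub_t: "ouro_succ (Bt t) (it t) = hier_seq (X t) (Suc (p t))" by (simp add: Bt_def it_def)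

lemma EV_op:
  "EV (op 3 t) = g2 (\<lambda>n x. x \<in> stage (Bt t) (it t) n)"
  "EV (op 4 t) = g3 (\<lambda>n m v. up (Bt t) (stage (Bt t) (it t) n) m = Some v)"
  "EV (op 5 t) = g5 (\<lambda>n b c m v. ango (up (Bt t) (stage (Bt t) (it t) n)) b c m = Some v)"
  "EV (op 6 t) = g3 (\<lambda>n j x. dopt (Bt t) (it t) n j = Some x)"
  "EV (op 7 t) = g2 (\<lambda>m v. up (Bt t) (ouro_succ (Bt t) (it t)) m = Some v)"
  "EV (op 8 t) = g4 (\<lambda>b c m v. ango (up (Bt t) (ouro_succ (Bt t) (it t))) b c m = Some v)"
  by (simp_all add: op_def gops_def Let_def Bt_def it_def X_def)

lemma it_D: "it \<in> D" unfolding it_def by (rule D_Suc[OF pD])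
lemma hmin_Bt_D: "(\<lambda>t. hmin (Bt t)) \<in> D"
  unfolding Bt_def hmin_hier_seq[OF hier_X] using hminD pD by (intro D_add) (simp_all add: X_def)

lemma stage_max_D: "n \<in> D \<Longrightarrow> (\<lambda>t. stage_max (Bt t) (it t) (n t)) \<in> D"
  and upgr_D: "n \<in> D \<Longrightarrow> (\<lambda>t. upgr (Bt t) (it t) (n t)) \<in> D"
proof -
  assume n: "n \<in> D"
  have b: "(\<lambda>t. fgrow 6 (hmin (Bt t) + 2 + it t + n t)) \<in> D"
    using n hmin_Bt_D it_D by (intro D_fgrow D_add D_const)
  show "(\<lambda>t. stage_max (Bt t) (it t) (n t)) \<in> D" by (rule D_le[OF b ouro.c_bound[OF ouro_t]])
  show "(\<lambda>t. upgr (Bt t) (it t) (n t)) \<in> D" by (rule D_le[OF b ouro.v_bound[OF ouro_t]])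
qed

lemma p_min_Bt: "p_min (\<lambda>y. y \<in> Bt t) b \<longleftrightarrow> b = hmin (Bt t)" by (rule p_min_hmin[OF Bt_ne])
lemma p_base_Bt: "p_base (\<lambda>y. y \<in> Bt t) m b \<longleftrightarrow> b = base (Bt t) m" by (rule p_base_base[OF Bt_ne])
lemma p_max_stage: "p_max (\<lambda>y. y \<in> stage (Bt t) (it t) n) x \<longleftrightarrow> x = stage_max (Bt t) (it t) n" by (rule p_max_stage_iff[OF ouro_t])

lemma base_le_n: "hmin (Bt t) \<le> n \<Longrightarrow> base (Bt t) n \<le> n" by (rule ouro.bs_le[OF ouro_t])

text \<open>A stage has a largest element, which lies in the cut, so \<open>up_bound\<close>
  supplies the bounds.\<close>

lemma UPG_K:
  assumes n: "n \<in> D"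
  shows "UPG Bt (\<lambda>t. stage (Bt t) (it t) (n t))
    (\<lambda>a b. AE (\<lambda>t. up (Bt t) (stage (Bt t) (it t) (n t)) (a t) = Some (b t)))
    (\<lambda>b c m v. AE (\<lambda>t. ango (up (Bt t) (stage (Bt t) (it t) (n t))) (b t) (c t) (m t) = Some (v t)))"
proof (rule UPG_intended[OF hier_Bt hmin_Bt_D _ D_fgrow])
  fix m assume m: "m \<in> D"
  let ?h = "\<lambda>t. fgrow 4 (stage_max (Bt t) (it t) (n t) + m t + 1)"
  have "?h \<in> D" using stage_max_D[OF n] m by (intro D_fgrow D_add D_const)
  moreover have "w \<le> ?h t" if "x \<le> m t" "up (Bt t) (stage (Bt t) (it t) (n t)) x = Some w" for t x w
  proof -
    have "w \<le> (fgrow 3 ^^ Suc x) (stage_max (Bt t) (it t) (n t) + m t + 1)"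
      by (rule up_bound[OF hier_Bt ouro.K_le[OF ouro_t] that(2,1)])
    also have "\<dots> \<le> fgrow (Suc 3) (stage_max (Bt t) (it t) (n t) + m t + 1)" using that(1) by (intro fgrow_iter_le) simp
    finally show ?thesis by (simp add: eval_nat_numeral)
  qed
  ultimately show "\<exists>h\<in>D. AE (\<lambda>t. \<forall>x\<le>m t. \<forall>w. up (Bt t) (stage (Bt t) (it t) (n t)) x = Some w \<longrightarrow> w \<le> h t)"
    by (intro bexI[of _ ?h] always_eventually) auto
qed

text \<open>Here the upgrade itself is the bound: it is total and increasing, and its values lie in
  the cut by \<open>upgr_D\<close>.\<close>

lemma UPG_C:
  "UPG Bt (\<lambda>t. ouro_succ (Bt t) (it t)) (\<lambda>a b. AE (\<lambda>t. up (Bt t) (ouro_succ (Bt t) (it t)) (a t) = Some (b t)))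
    (\<lambda>b c m v. AE (\<lambda>t. ango (up (Bt t) (ouro_succ (Bt t) (it t))) (b t) (c t) (m t) = Some (v t)))"
proof (rule UPG_intended[OF hier_Bt hmin_Bt_D _ D_fgrow])
  fix m assume m: "m \<in> D"
  show "\<exists>h\<in>D. AE (\<lambda>t. \<forall>x\<le>m t. \<forall>w. up (Bt t) (ouro_succ (Bt t) (it t)) x = Some w \<longrightarrow> w \<le> h t)"
    using upgr_D[OF m] ouro.v_mono_le[OF ouro_t] ouro.up_C[OF ouro_t]
    by (intro bexI[of _ "\<lambda>t. upgr (Bt t) (it t) (m t)"] always_eventually) auto
qed

text \<open>
  \<open>RD\<close> and \<open>RK\<close> are the right hand sides of the equations for \<open>D\<close> and \<open>K\<close> with quantifiers over the cut.
\<close>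

definition RD where
  "RD n j x \<longleftrightarrow> (\<exists>n'\<in>D. \<exists>l\<in>D. AE (\<lambda>t. n t = n' t + 1) \<and> AE (\<lambda>t. p_min (\<lambda>y. y \<in> Bt t) (l t)) \<and>
     AE (\<lambda>t. l t < n t) \<and>
     ((AE (\<lambda>t. j t = 0) \<and> AE (\<lambda>t. p_max (\<lambda>y. y \<in> stage (Bt t) (it t) (n' t)) (x t))) \<or>
      (\<exists>j'\<in>D. \<exists>x'\<in>D. \<exists>b\<in>D. AE (\<lambda>t. j t = j' t + 1) \<and> AE (\<lambda>t. dopt (Bt t) (it t) (n t) (j' t) = Some (x' t)) \<and>
         AE (\<lambda>t. p_base (\<lambda>y. y \<in> Bt t) (n t) (b t)) \<and>
         AE (\<lambda>t. ango (up (Bt t) (stage (Bt t) (it t) (n' t))) (b t) (x' t) (n t) = Some (x t)))))"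

lemma dopt_RD:
  assumes D: "n \<in> D" "j \<in> D" "x \<in> D"
  shows "AE (\<lambda>t. dopt (Bt t) (it t) (n t) (j t) = Some (x t)) \<longleftrightarrow> RD n j x"
proof
  assume "RD n j x"
  then obtain n' l where 1: "AE (\<lambda>t. n t = n' t + 1)" "AE (\<lambda>t. p_min (\<lambda>y. y \<in> Bt t) (l t))" "AE (\<lambda>t. l t < n t)"
    and 2: "(AE (\<lambda>t. j t = 0) \<and> AE (\<lambda>t. p_max (\<lambda>y. y \<in> stage (Bt t) (it t) (n' t)) (x t))) \<or>
      (\<exists>j'\<in>D. \<exists>x'\<in>D. \<exists>b\<in>D. AE (\<lambda>t. j t = j' t + 1) \<and> AE (\<lambda>t. dopt (Bt t) (it t) (n t) (j' t) = Some (x' t)) \<and>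
         AE (\<lambda>t. p_base (\<lambda>y. y \<in> Bt t) (n t) (b t)) \<and>
         AE (\<lambda>t. ango (up (Bt t) (stage (Bt t) (it t) (n' t))) (b t) (x' t) (n t) = Some (x t)))"
    unfolding RD_def by blast
  from 2 show "AE (\<lambda>t. dopt (Bt t) (it t) (n t) (j t) = Some (x t))"
  proof (elim disjE conjE bexE)
    assume "AE (\<lambda>t. j t = 0)" "AE (\<lambda>t. p_max (\<lambda>y. y \<in> stage (Bt t) (it t) (n' t)) (x t))"
    then show ?thesis using 1
    proof eventually_elim
      case (elim t)
      then show ?case
        unfolding dopt_equation[of "Bt t" "it t" "n t" "j t" "x t"] by (auto simp: p_min_Bt p_max_stage)
    qed
  next
    fix j' x' b
    assume "AE (\<lambda>t. j t = j' t + 1)" "AE (\<lambda>t. dopt (Bt t) (it t) (n t) (j' t) = Some (x' t))"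
      "AE (\<lambda>t. p_base (\<lambda>y. y \<in> Bt t) (n t) (b t))"
      "AE (\<lambda>t. ango (up (Bt t) (stage (Bt t) (it t) (n' t))) (b t) (x' t) (n t) = Some (x t))"
    then show ?thesis using 1
    proof eventually_elim
      case (elim t)
      then show ?case
        unfolding dopt_equation[of "Bt t" "it t" "n t" "j t" "x t"] by (auto simp: p_min_Bt p_base_Bt)
    qed
  qed
next
  let ?P = "\<lambda>t j' x'. hmin (Bt t) < n t \<and> j t = j' + 1 \<and> dopt (Bt t) (it t) (n t) j' = Some x' \<and>
     ango (up (Bt t) (stage (Bt t) (it t) (n t - 1))) (base (Bt t) (n t)) x' (n t) = Some (x t)"
  assume "AE (\<lambda>t. dopt (Bt t) (it t) (n t) (j t) = Some (x t))"
  then have A: "AE (\<lambda>t. hmin (Bt t) < n t)" and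
    B: "AE (\<lambda>t. (j t = 0 \<and> x t = stage_max (Bt t) (it t) (n t - 1)) \<or> (\<exists>j' x'. ?P t j' x'))"
    by (auto simp: dopt_equation[of _ _ _ "j _"] elim!: eventually_mono)
  define n' where "n' t = n t - 1" for t
  have n': "n' \<in> D" using D(1) by (rule D_le) (simp add: n'_def)
  have nn: "AE (\<lambda>t. n t = n' t + 1)" using A by (rule eventually_mono) (simp add: n'_def)
  have "(AE (\<lambda>t. j t = 0) \<and> AE (\<lambda>t. p_max (\<lambda>y. y \<in> stage (Bt t) (it t) (n' t)) (x t))) \<or>
      (\<exists>j'\<in>D. \<exists>x'\<in>D. \<exists>b\<in>D. AE (\<lambda>t. j t = j' t + 1) \<and> AE (\<lambda>t. dopt (Bt t) (it t) (n t) (j' t) = Some (x' t)) \<and>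
         AE (\<lambda>t. p_base (\<lambda>y. y \<in> Bt t) (n t) (b t)) \<and>
         AE (\<lambda>t. ango (up (Bt t) (stage (Bt t) (it t) (n' t))) (b t) (x' t) (n t) = Some (x t)))"
    using B[unfolded AE_disj]
  proof
    assume "AE (\<lambda>t. j t = 0 \<and> x t = stage_max (Bt t) (it t) (n t - 1))"
    then show ?thesis unfolding p_max_stage n'_def by (auto simp: AE_conj)
  next
    assume ex: "AE (\<lambda>t. \<exists>j' x'. ?P t j' x')"
    \<comment> \<open>The previous iterate is at most the present one by
      \<open>ango_ge_base\<close>, so it is in the cut.\<close>
    have BD: "AE (\<lambda>t. \<forall>j' x'. ?P t j' x' \<longrightarrow> j' \<le> j t \<and> x' \<le> x t)"
    proof (intro always_eventually allI impI)
      fix t j' x' assume P: "?P t j' x'"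
      have "x' \<le> x t"
        by (rule ango_ge_base[of "base (Bt t) (n t)" "up (Bt t) (stage (Bt t) (it t) (n t - 1))" "n t"])
          (use P base_le_n[of t "n t"] up_ge[OF hier_Bt] in auto)
      then show "j' \<le> j t \<and> x' \<le> x t" using P by simp
    qed
    obtain j' where j': "j' \<in> D" "AE (\<lambda>t. \<exists>x'. ?P t (j' t) x')"
      using AE_obtain[OF ex D(2) eventually_mono[OF BD]] by blast
    obtain x' where x': "x' \<in> D" "AE (\<lambda>t. ?P t (j' t) (x' t))"
      using AE_obtain[OF j'(2) D(3) eventually_mono[OF BD]] by blast
    define b where "b t = base (Bt t) (n t)" for t
    have "AE (\<lambda>t. b t \<le> n t)" using A by (rule eventually_mono) (simp add: b_def base_le_n)
    then have "b \<in> D" by (rule D_down[OF D(1)])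
    moreover have "AE (\<lambda>t. j t = j' t + 1)" "AE (\<lambda>t. dopt (Bt t) (it t) (n t) (j' t) = Some (x' t))"
      "AE (\<lambda>t. p_base (\<lambda>y. y \<in> Bt t) (n t) (b t))"
      "AE (\<lambda>t. ango (up (Bt t) (stage (Bt t) (it t) (n' t))) (b t) (x' t) (n t) = Some (x t))"
      using x'(2) by (auto simp: p_base_Bt b_def n'_def elim!: eventually_mono)
    ultimately show ?thesis using j'(1) x'(1) by blast
  qed
  then show "RD n j x" unfolding RD_def using n' nn A hmin_Bt_D
    by (intro bexI[of _ n'] bexI[of _ "\<lambda>t. hmin (Bt t)"]) (auto simp: p_min_Bt)
qed

definition RK where
  "RK n x \<longleftrightarrow> (\<exists>l\<in>D. AE (\<lambda>t. p_min (\<lambda>y. y \<in> Bt t) (l t)) \<and>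
     ((AE (\<lambda>t. n t \<le> l t) \<and> AE (\<lambda>t. x t = l t + 1)) \<or>
      (AE (\<lambda>t. l t < n t) \<and> (\<exists>n'\<in>D. AE (\<lambda>t. n t = n' t + 1) \<and>
        (AE (\<lambda>t. x t \<in> stage (Bt t) (it t) (n' t)) \<or>
         (AE (\<lambda>t. n t \<in> Bt t) \<and> (\<exists>b\<in>D. \<exists>c\<in>D. \<exists>w\<in>D. \<exists>a\<in>D. AE (\<lambda>t. p_base (\<lambda>y. y \<in> Bt t) (n' t) (b t)) \<and>
            AE (\<lambda>t. p_max (\<lambda>y. y \<in> stage (Bt t) (it t) (n' t)) (c t)) \<and>
            AE (\<lambda>t. ango (up (Bt t) (stage (Bt t) (it t) (n' t))) (b t) (c t) (n' t) = Some (w t)) \<and>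
            AE (\<lambda>t. p_min (\<lambda>a. w t < c t * a) (a t)) \<and> AE (\<lambda>t. x t = c t * a t))) \<or>
         (\<not> AE (\<lambda>t. n t \<in> Bt t) \<and> AE (\<lambda>t. p_crit (\<lambda>y. y \<in> Bt t) (n t)) \<and>
           (\<exists>j\<in>D. AE (\<lambda>t. 1 \<le> j t) \<and> AE (\<lambda>t. j t \<le> it t) \<and>
              AE (\<lambda>t. dopt (Bt t) (it t) (n t) (j t) = Some (x t)))))))))"

lemma p_crit_Bt: "p_crit (\<lambda>y. y \<in> Bt t) n \<longleftrightarrow> base (Bt t) n dvd n"
  by (auto simp: p_crit_def p_base_Bt dvd_def)

lemma stage_RK:
  assumes D: "n \<in> D" "x \<in> D"
  shows "AE (\<lambda>t. x t \<in> stage (Bt t) (it t) (n t)) \<longleftrightarrow> RK n x"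
proof
  assume "RK n x"
  then obtain l where l: "AE (\<lambda>t. p_min (\<lambda>y. y \<in> Bt t) (l t))" and
    "(AE (\<lambda>t. n t \<le> l t) \<and> AE (\<lambda>t. x t = l t + 1)) \<or>
      (AE (\<lambda>t. l t < n t) \<and> (\<exists>n'\<in>D. AE (\<lambda>t. n t = n' t + 1) \<and>
        (AE (\<lambda>t. x t \<in> stage (Bt t) (it t) (n' t)) \<or>
         (AE (\<lambda>t. n t \<in> Bt t) \<and> (\<exists>b\<in>D. \<exists>c\<in>D. \<exists>w\<in>D. \<exists>a\<in>D. AE (\<lambda>t. p_base (\<lambda>y. y \<in> Bt t) (n' t) (b t)) \<and>
            AE (\<lambda>t. p_max (\<lambda>y. y \<in> stage (Bt t) (it t) (n' t)) (c t)) \<and>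
            AE (\<lambda>t. ango (up (Bt t) (stage (Bt t) (it t) (n' t))) (b t) (c t) (n' t) = Some (w t)) \<and>
            AE (\<lambda>t. p_min (\<lambda>a. w t < c t * a) (a t)) \<and> AE (\<lambda>t. x t = c t * a t))) \<or>
         (\<not> AE (\<lambda>t. n t \<in> Bt t) \<and> AE (\<lambda>t. p_crit (\<lambda>y. y \<in> Bt t) (n t)) \<and>
           (\<exists>j\<in>D. AE (\<lambda>t. 1 \<le> j t) \<and> AE (\<lambda>t. j t \<le> it t) \<and>
              AE (\<lambda>t. dopt (Bt t) (it t) (n t) (j t) = Some (x t))))))) "
    unfolding RK_def by blast
  then show "AE (\<lambda>t. x t \<in> stage (Bt t) (it t) (n t))"
  proof (elim disjE conjE bexE)
    assume "AE (\<lambda>t. n t \<le> l t)" "AE (\<lambda>t. x t = l t + 1)"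
    then show ?thesis using l
      by eventually_elim (simp add: p_min_Bt ouro.K_equation[OF ouro_t, of _ _ "n _"])
  next
    fix n' assume "AE (\<lambda>t. l t < n t)" "AE (\<lambda>t. n t = n' t + 1)" "AE (\<lambda>t. x t \<in> stage (Bt t) (it t) (n' t))"
    then show ?thesis
    proof eventually_elim
      case (elim t)
      then have "x t \<in> stage (Bt t) (it t) (Suc (n' t))" using ouro.K_mono_Suc[OF ouro_t] by blast
      then show ?case using elim(2) by simp
    qed
  next
    fix n' b c w a
    assume "AE (\<lambda>t. l t < n t)" "AE (\<lambda>t. n t = n' t + 1)" "AE (\<lambda>t. n t \<in> Bt t)"
      "AE (\<lambda>t. p_base (\<lambda>y. y \<in> Bt t) (n' t) (b t))"
      "AE (\<lambda>t. p_max (\<lambda>y. y \<in> stage (Bt t) (it t) (n' t)) (c t))"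
      "AE (\<lambda>t. ango (up (Bt t) (stage (Bt t) (it t) (n' t))) (b t) (c t) (n' t) = Some (w t))"
      "AE (\<lambda>t. p_min (\<lambda>a. w t < c t * a) (a t))" "AE (\<lambda>t. x t = c t * a t)"
    then show ?thesis using l
    proof eventually_elim
      case (elim t)
      show ?case
        unfolding ouro.K_equation[OF ouro_t, of "x t" t "n t"]
        by (rule disjI2, rule conjI, use elim in \<open>simp add: p_min_Bt\<close>, rule exI[of _ "n' t"], rule conjI, use elim in simp,
            rule disjI2, rule disjI1, intro conjI exI[of _ "b t"] exI[of _ "c t"] exI[of _ "w t"] exI[of _ "a t"])
          (use elim in \<open>simp_all only: p_base_Bt p_max_stage\<close>)
    qed
  next
    fix n' j
    assume "\<not> AE (\<lambda>t. n t \<in> Bt t)"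
    then have "AE (\<lambda>t. n t \<notin> Bt t)" by (simp only: AE_not simp_thms)
    moreover assume "AE (\<lambda>t. l t < n t)" "AE (\<lambda>t. n t = n' t + 1)"
      "AE (\<lambda>t. p_crit (\<lambda>y. y \<in> Bt t) (n t))" "AE (\<lambda>t. 1 \<le> j t)" "AE (\<lambda>t. j t \<le> it t)"
      "AE (\<lambda>t. dopt (Bt t) (it t) (n t) (j t) = Some (x t))"
    ultimately show ?thesis using l
    proof eventually_elim
      case (elim t)
      show ?case
        unfolding ouro.K_equation[OF ouro_t, of "x t" t "n t"]
        by (rule disjI2, rule conjI, use elim in \<open>simp add: p_min_Bt\<close>, rule exI[of _ "n' t"], rule conjI, use elim in simp,
            rule disjI2, rule disjI2, intro conjI exI[of _ "j t"])
          (use elim in \<open>simp_all add: p_crit_Bt\<close>)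
    qed
  qed
next
  assume A: "AE (\<lambda>t. x t \<in> stage (Bt t) (it t) (n t))"
  let ?l = "\<lambda>t. hmin (Bt t)"
  define n' where "n' t = n t - 1" for t
  have n': "n' \<in> D" using D(1) by (rule D_le) (simp add: n'_def)
  let ?P = "\<lambda>t w a. n t \<in> Bt t \<and> ango (up (Bt t) (stage (Bt t) (it t) (n' t))) (base (Bt t) (n' t)) (stage_max (Bt t) (it t) (n' t)) (n' t) = Some w \<and>
     p_min (\<lambda>a. w < stage_max (Bt t) (it t) (n' t) * a) a \<and> x t = stage_max (Bt t) (it t) (n' t) * a"
  let ?Q = "\<lambda>t j. n t \<notin> Bt t \<and> base (Bt t) (n t) dvd n t \<and> 1 \<le> j \<and> j \<le> it t \<and> dopt (Bt t) (it t) (n t) j = Some (x t)"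
  have "AE (\<lambda>t. (n t \<le> ?l t \<and> x t = ?l t + 1) \<or>
     (?l t < n t \<and> n t = n' t + 1 \<and> x t \<in> stage (Bt t) (it t) (n' t)) \<or>
     (?l t < n t \<and> n t = n' t + 1 \<and> (\<exists>w a. ?P t w a)) \<or> (?l t < n t \<and> n t = n' t + 1 \<and> (\<exists>j. ?Q t j)))"
    using A
  proof eventually_elim
    case (elim t)
    then show ?case
      unfolding ouro.K_equation[OF ouro_t, of "x t" t "n t"] n'_def by auto
  qed
  then consider (1) "AE (\<lambda>t. n t \<le> ?l t)" "AE (\<lambda>t. x t = ?l t + 1)"
    | (2) "AE (\<lambda>t. ?l t < n t)" "AE (\<lambda>t. n t = n' t + 1)" "AE (\<lambda>t. x t \<in> stage (Bt t) (it t) (n' t))"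
    | (3) "AE (\<lambda>t. ?l t < n t)" "AE (\<lambda>t. n t = n' t + 1)" "AE (\<lambda>t. \<exists>w a. ?P t w a)"
    | (4) "AE (\<lambda>t. ?l t < n t)" "AE (\<lambda>t. n t = n' t + 1)" "AE (\<lambda>t. \<exists>j. ?Q t j)"
    unfolding AE_disj AE_conj by blast
  then show "RK n x"
  proof cases
    case 1
    then show ?thesis unfolding RK_def using hmin_Bt_D by (intro bexI[of _ ?l]) (auto simp: p_min_Bt)
  next
    case 2
    then show ?thesis unfolding RK_def using hmin_Bt_D n' by (intro bexI[of _ ?l]) (auto simp: p_min_Bt)
  next
    case 3
    have BD: "AE (\<lambda>t. \<forall>w a. ?P t w a \<longrightarrow> w \<le> x t \<and> a \<le> x t)"
    proof (intro always_eventually allI impI)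
      fix t w a assume P: "?P t w a"
      then have "w < x t" by (auto simp: p_min_def)
      have "1 * a \<le> stage_max (Bt t) (it t) (n' t) * a"
        using ouro.c_pos[OF ouro_t, of t "n' t"] by (intro mult_le_mono1) simp
      then show "w \<le> x t \<and> a \<le> x t" using P \<open>w < x t\<close> by simp
    qed
    obtain w where w: "w \<in> D" "AE (\<lambda>t. \<exists>a. ?P t (w t) a)"
      using AE_obtain[OF 3(3) D(2) eventually_mono[OF BD]] by blast
    obtain a where a: "a \<in> D" "AE (\<lambda>t. ?P t (w t) (a t))"
      using AE_obtain[OF w(2) D(2) eventually_mono[OF BD]] by blast
    define b where "b t = base (Bt t) (n' t)" for t
    have "AE (\<lambda>t. b t \<le> n' t)" using 3(1,2) by eventually_elim (simp add: b_def base_le_n)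
    then have b: "b \<in> D" by (rule D_down[OF n'])
    define c where "c t = stage_max (Bt t) (it t) (n' t)" for t
    have c: "c \<in> D" unfolding c_def by (rule stage_max_D[OF n'])
    have "AE (\<lambda>t. n t \<in> Bt t)" "AE (\<lambda>t. p_base (\<lambda>y. y \<in> Bt t) (n' t) (b t))"
      "AE (\<lambda>t. p_max (\<lambda>y. y \<in> stage (Bt t) (it t) (n' t)) (c t))"
      "AE (\<lambda>t. ango (up (Bt t) (stage (Bt t) (it t) (n' t))) (b t) (c t) (n' t) = Some (w t))"
      "AE (\<lambda>t. p_min (\<lambda>a. w t < c t * a) (a t))" "AE (\<lambda>t. x t = c t * a t)"
      using a(2) by (auto simp: p_base_Bt p_max_stage b_def c_def elim!: eventually_mono)
    then have "AE (\<lambda>t. n t \<in> Bt t) \<and> (\<exists>b\<in>D. \<exists>c\<in>D. \<exists>w\<in>D. \<exists>a\<in>D. AE (\<lambda>t. p_base (\<lambda>y. y \<in> Bt t) (n' t) (b t)) \<and>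
            AE (\<lambda>t. p_max (\<lambda>y. y \<in> stage (Bt t) (it t) (n' t)) (c t)) \<and>
            AE (\<lambda>t. ango (up (Bt t) (stage (Bt t) (it t) (n' t))) (b t) (c t) (n' t) = Some (w t)) \<and>
            AE (\<lambda>t. p_min (\<lambda>a. w t < c t * a) (a t)) \<and> AE (\<lambda>t. x t = c t * a t))"
      using b c w(1) a(1) by blast
    then show ?thesis unfolding RK_def
      apply -
      apply (rule bexI[of _ ?l], rule conjI, simp add: p_min_Bt, rule disjI2, rule conjI, rule 3(1), rule bexI[of _ n'],
        rule conjI, rule 3(2), rule disjI2, rule disjI1, assumption, rule n', rule hmin_Bt_D)
      done
  next
    case 4
    obtain j where j: "j \<in> D" "AE (\<lambda>t. ?Q t (j t))"
      using AE_obtain[OF 4(3) it_D] by (auto intro: always_eventually)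
    have "AE (\<lambda>t. n t \<notin> Bt t)" "AE (\<lambda>t. p_crit (\<lambda>y. y \<in> Bt t) (n t))" "AE (\<lambda>t. 1 \<le> j t)" "AE (\<lambda>t. j t \<le> it t)"
      "AE (\<lambda>t. dopt (Bt t) (it t) (n t) (j t) = Some (x t))"
      using j(2) by (auto simp: p_crit_Bt elim!: eventually_mono)
    then have "\<not> AE (\<lambda>t. n t \<in> Bt t) \<and> AE (\<lambda>t. p_crit (\<lambda>y. y \<in> Bt t) (n t)) \<and>
           (\<exists>j\<in>D. AE (\<lambda>t. 1 \<le> j t) \<and> AE (\<lambda>t. j t \<le> it t) \<and>
              AE (\<lambda>t. dopt (Bt t) (it t) (n t) (j t) = Some (x t)))"
      using j(1) unfolding AE_not by blast
    then show ?thesis unfolding RK_def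
      apply -
      apply (rule bexI[of _ ?l], rule conjI, simp add: p_min_Bt, rule disjI2, rule conjI, rule 4(1), rule bexI[of _ n'],
        rule conjI, rule 4(2), rule disjI2, rule disjI2, assumption, rule n', rule hmin_Bt_D)
      done
  qed
qed


lemma fden_K: "dens ss K (op 3) \<Longrightarrow> den es n \<nu> \<Longrightarrow> den es x \<xi> \<Longrightarrow>
    fden es ss (rel2 K n x) (\<lambda>t. \<xi> t \<in> stage (Bt t) (it t) (\<nu> t))"
  using fden_rel2[of ss K "op 3" es n \<nu> x \<xi>] by (simp add: EV_op in_g)

lemma fden_U: "dens ss U (op 4) \<Longrightarrow> den es n \<nu> \<Longrightarrow> den es x \<xi> \<Longrightarrow> den es y \<upsilon> \<Longrightarrow>
    fden es ss (rel3 U n x y) (\<lambda>t. up (Bt t) (stage (Bt t) (it t) (\<nu> t)) (\<xi> t) = Some (\<upsilon> t))"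
  using fden_rel3[of ss U "op 4" es n \<nu> x \<xi> y \<upsilon>] by (simp add: EV_op in_g)

lemma fden_A: "dens ss A (op 5) \<Longrightarrow> den es n \<nu> \<Longrightarrow> den es b \<beta> \<Longrightarrow> den es c \<gamma> \<Longrightarrow> den es x \<xi> \<Longrightarrow> den es y \<upsilon> \<Longrightarrow>
    fden es ss (rel5 A n b c x y)
      (\<lambda>t. ango (up (Bt t) (stage (Bt t) (it t) (\<nu> t))) (\<beta> t) (\<gamma> t) (\<xi> t) = Some (\<upsilon> t))"
  using fden_rel5[of ss A "op 5" es n \<nu> b \<beta> c \<gamma> x \<xi> y \<upsilon>] by (simp add: EV_op in_g)

lemma fden_D: "dens ss D' (op 6) \<Longrightarrow> den es n \<nu> \<Longrightarrow> den es x \<xi> \<Longrightarrow> den es y \<upsilon> \<Longrightarrow>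
    fden es ss (rel3 D' n x y) (\<lambda>t. dopt (Bt t) (it t) (\<nu> t) (\<xi> t) = Some (\<upsilon> t))"
  using fden_rel3[of ss D' "op 6" es n \<nu> x \<xi> y \<upsilon>] by (simp add: EV_op in_g)

lemma cden_K: "dens ss K (op 3) \<Longrightarrow> den es n \<nu> \<Longrightarrow>
    cden es ss (rel2 K n) (\<lambda>t y. y \<in> stage (Bt t) (it t) (\<nu> t))"
  by (rule cdenI) (rule fden_K[OF dens_mono den_mono])

lemma fden_max_K: "dens ss K (op 3) \<Longrightarrow> den es n \<nu> \<Longrightarrow> den es x \<xi> \<Longrightarrow>
    fden es ss (is_max (rel2 K n) x) (\<lambda>t. p_max (\<lambda>y. y \<in> stage (Bt t) (it t) (\<nu> t)) (\<xi> t))"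
  by (rule fden_max[OF cden_K _ stage_max_D[OF den_D]]) (auto intro: always_eventually ouro.K_le[OF ouro_t])

lemma fden_min_mult: "den es w \<omega> \<Longrightarrow> den es c \<gamma> \<Longrightarrow> den es a \<alpha> \<Longrightarrow>
    fden es ss (is_min (\<lambda>a. w \<^bold>< c \<^bold>* a) a) (\<lambda>t. p_min (\<lambda>a. \<omega> t < \<gamma> t * a) (\<alpha> t))"
  by (rule fden_min, rule cdenI, rule fden_less) (auto intro: den_mono den_mul)

lemma fden_crit_Bt: "cden es ss B (\<lambda>t y. y \<in> Bt t) \<Longrightarrow> den es n \<nu> \<Longrightarrow>
    fden es ss (critical B n) (\<lambda>t. p_crit (\<lambda>y. y \<in> Bt t) (\<nu> t))"
  by (rule fden_crit[OF _ _ hmin_Bt_D]) (auto simp: p_min_Bt intro: always_eventually)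

lemma construction_hold:
  assumes B: "cden es ss B (\<lambda>t y. y \<in> Bt t)" and i: "den es i it" and E: "cexp es ss E"
    and d: "dens ss K (op 3)" "dens ss U (op 4)" "dens ss A (op 5)" "dens ss D' (op 6)"
  shows "hold es ss (is_ouroboros_construction E B i (rel2 K) (rel3 U) (rel5 A) (rel3 D'))"
proof -
  have 1: "mf es ss (\<^bold>\<forall>n. is_upgrade E B (rel2 K n) (rel3 U n) (rel5 A n))
    (\<forall>n\<in>D. UPG Bt (\<lambda>t. stage (Bt t) (it t) (n t))
      (\<lambda>a b. AE (\<lambda>t. up (Bt t) (stage (Bt t) (it t) (n t)) (a t) = Some (b t)))
      (\<lambda>b c m v. AE (\<lambda>t. ango (up (Bt t) (stage (Bt t) (it t) (n t))) (b t) (c t) (m t) = Some (v t))))"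
  proof (rule mf_all, rule mc1I, rule mf_upgrade)
    fix zs ws x a
    assume x: "den (es @ zs) x a"
    show "cden (es @ zs) (ss @ ws) B (\<lambda>t y. y \<in> Bt t)" by (rule cden_mono[OF B])
    show "cden (es @ zs) (ss @ ws) (rel2 K x) (\<lambda>t y. y \<in> stage (Bt t) (it t) (a t))"
      by (rule cden_K[OF dens_mono[OF d(1)] x])
    show "cexp (es @ zs) (ss @ ws) E" by (rule cexp_mono[OF E])
    show "mc2 (es @ zs) (ss @ ws) (rel3 U x)
      (\<lambda>aa b. AE (\<lambda>t. up (Bt t) (stage (Bt t) (it t) (a t)) (aa t) = Some (b t)))"
      unfolding mc2_def
      by (intro allI impI mf_fden fden_U dens_mono[OF dens_mono[OF d(2)]] den_mono[OF x])
    show "mc4 (es @ zs) (ss @ ws) (rel5 A x)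
      (\<lambda>b c m v. AE (\<lambda>t. ango (up (Bt t) (stage (Bt t) (it t) (a t))) (b t) (c t) (m t) = Some (v t)))"
      unfolding mc4_def
      by (intro allI impI mf_fden fden_A dens_mono[OF dens_mono[OF d(3)]] den_mono[OF x])
  qed
  have 2: "mf es ss (\<^bold>\<forall>n j x. rel3 D' n j x \<^bold>\<longleftrightarrow> (\<^bold>\<exists>n' l. n \<^bold>= n' \<^bold>+ \<^bold>1 \<^bold>\<and> is_min B l \<^bold>\<and> l \<^bold>< n \<^bold>\<and>
        ((j \<^bold>= \<^bold>0 \<^bold>\<and> is_max (rel2 K n') x) \<^bold>\<or>
         (\<^bold>\<exists>j' x' b. j \<^bold>= j' \<^bold>+ \<^bold>1 \<^bold>\<and> rel3 D' n j' x' \<^bold>\<and> is_base B n b \<^bold>\<and> rel5 A n' b x' n x))))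
    (\<forall>n\<in>D. \<forall>j\<in>D. \<forall>x\<in>D. AE (\<lambda>t. dopt (Bt t) (it t) (n t) (j t) = Some (x t)) \<longleftrightarrow> RD n j x)"
    unfolding RD_def
    by (insert assms, (assumption |
      rule mf_conj mf_disj mf_all mf_ex mf_iff mc1I mf_fden[OF fden_max_K] mf_fden[OF fden_D] mf_fden[OF fden_A]
        mf_fden[OF fden_base[of _ _ B "\<lambda>t y. y \<in> Bt t"]] mf_fden[OF fden_min[of _ _ B "\<lambda>t y. y \<in> Bt t"]]
        mf_fden[OF fden_less] mf_fden[OF fden_eq] dens_tm |
      rule den_mono dens_mono cden_mono)+)
  have 3: "mf es ss (\<^bold>\<forall>n x. rel2 K n x \<^bold>\<longleftrightarrow> (\<^bold>\<exists>l. is_min B l \<^bold>\<and>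
        ((n \<^bold>\<le> l \<^bold>\<and> x \<^bold>= l \<^bold>+ \<^bold>1) \<^bold>\<or>
         (l \<^bold>< n \<^bold>\<and> (\<^bold>\<exists>n'. n \<^bold>= n' \<^bold>+ \<^bold>1 \<^bold>\<and>
           (rel2 K n' x \<^bold>\<or>
            (B n \<^bold>\<and> (\<^bold>\<exists>b c w a. is_base B n' b \<^bold>\<and> is_max (rel2 K n') c \<^bold>\<and> rel5 A n' b c n' w \<^bold>\<and>
                is_min (\<lambda>a. w \<^bold>< c \<^bold>* a) a \<^bold>\<and> x \<^bold>= c \<^bold>* a)) \<^bold>\<or>
            (\<^bold>\<not> B n \<^bold>\<and> critical B n \<^bold>\<and> (\<^bold>\<exists>j. \<^bold>1 \<^bold>\<le> j \<^bold>\<and> j \<^bold>\<le> i \<^bold>\<and> rel3 D' n j x))))))))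
    (\<forall>n\<in>D. \<forall>x\<in>D. AE (\<lambda>t. x t \<in> stage (Bt t) (it t) (n t)) \<longleftrightarrow> RK n x)"
    unfolding RK_def
    by (insert assms, (assumption |
      rule mf_conj mf_disj mf_all mf_ex mf_iff mf_neg mc1I mf_fden[OF fden_min_mult] mf_fden[OF fden_max_K] mf_fden[OF fden_D] mf_fden[OF fden_A]
        mf_fden[OF fden_K] mf_fden[OF fden_crit_Bt] mf_fden[OF cdenD[of _ _ B "\<lambda>t y. y \<in> Bt t"]]
        mf_fden[OF fden_base[of _ _ B "\<lambda>t y. y \<in> Bt t"]] mf_fden[OF fden_min[of _ _ B "\<lambda>t y. y \<in> Bt t"]]
        mf_fden[OF fden_leq] mf_fden[OF fden_less] mf_fden[OF fden_eq] dens_tm |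
      rule den_mono dens_mono cden_mono)+)
  show ?thesis
    unfolding is_ouroboros_construction_def hold_conj mf_hold[OF 1] mf_hold[OF 2] mf_hold[OF 3]
    using UPG_K dopt_RD stage_RK by blast
qed

text \<open>Operations 3 to 6 witness the four set quantifiers, in this order. The union over all
  stages is evaluated pointwise with the bound from \<open>C_bounded_stage\<close>.\<close>

lemma ouroboros_hold:
  assumes B: "cden es ss B (\<lambda>t y. y \<in> Bt t)" and i: "den es i it" and E: "cexp es ss E"
    and C: "cden es ss C (\<lambda>t y. y \<in> ouro_succ (Bt t) (it t))"
  shows "hold es ss (is_ouroboros E B i C)"
proof -
  have final: "hold es ss' (\<^bold>\<forall>x. C x \<^bold>\<longleftrightarrow> (\<^bold>\<exists>n. rel2 K n x))"
    if C: "cden es ss' C (\<lambda>t y. y \<in> ouro_succ (Bt t) (it t))" and K: "dens ss' K (op 3)" for ss' K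
  proof -
    have "mf es ss' (\<^bold>\<forall>x. C x \<^bold>\<longleftrightarrow> (\<^bold>\<exists>n. rel2 K n x))
      (\<forall>x\<in>D. AE (\<lambda>t. x t \<in> ouro_succ (Bt t) (it t)) \<longleftrightarrow> (\<exists>n\<in>D. AE (\<lambda>t. x t \<in> stage (Bt t) (it t) (n t))))"
      by (insert that, (assumption | rule mf_all mf_iff mf_ex mc1I mf_fden[OF fden_K]
          mf_fden[OF cdenD[of _ _ C "\<lambda>t y. y \<in> ouro_succ (Bt t) (it t)"]] |
        rule den_mono dens_mono cden_mono)+)
    moreover have "AE (\<lambda>t. x t \<in> ouro_succ (Bt t) (it t)) \<longleftrightarrow> (\<exists>n\<in>D. AE (\<lambda>t. x t \<in> stage (Bt t) (it t) (n t)))"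
      if x: "x \<in> D" for x
    proof -
      have "(\<exists>n. x t \<in> stage (Bt t) (it t) n) \<longleftrightarrow> x t \<in> ouro_succ (Bt t) (it t)" for t
        unfolding ouro.C_bounded_stage[OF ouro_t, of "x t" t]
        using ouro.K_sub_C[OF ouro_t] ouro.C_bounded_stage[OF ouro_t] by blast
      moreover have "AE (\<lambda>t. (\<exists>n. x t \<in> stage (Bt t) (it t) n) \<longrightarrow>
          (\<exists>n\<le>hmin (Bt t) + x t. x t \<in> stage (Bt t) (it t) n))"
        unfolding calculation using ouro.C_bounded_stage[OF ouro_t] by (intro always_eventually) blast
      ultimately show ?thesis using AE_ex_bounded[OF D_add[OF hmin_Bt_D x], of "\<lambda>t n. x t \<in> stage (Bt t) (it t) n"] by simp
    qed
    ultimately show ?thesis using mf_hold by blast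
  qed
  let ?ss = "(((ss @ [op 3]) @ [op 4]) @ [op 5]) @ [op 6]"
  have d: "dens ?ss (svr (length ss)) (op 3)" "dens ?ss (svr (length (ss @ [op 3]))) (op 4)"
    "dens ?ss (svr (length ((ss @ [op 3]) @ [op 4]))) (op 5)"
    "dens ?ss (svr (length (((ss @ [op 3]) @ [op 4]) @ [op 5]))) (op 6)"
    by (intro dens_mono dens_svr_last op_Ds)+
  have m: "cden es ?ss B (\<lambda>t y. y \<in> Bt t)" "cden es ?ss C (\<lambda>t y. y \<in> ouro_succ (Bt t) (it t))" "cexp es ?ss E"
    using cden_mono[OF B, of "[]"] cden_mono[OF C, of "[]"] cexp_mono[OF E, of "[]"] by simp_all
  show ?thesis
    unfolding is_ouroboros_def hold_exS hold_conj
    by (rule bexI[OF _ op_Ds[of 3]], rule bexI[OF _ op_Ds[of 4]], rule bexI[OF _ op_Ds[of 5]],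
        rule bexI[OF _ op_Ds[of 6]], rule conjI[OF construction_hold[OF m(1) i m(3) d] final[OF m(2) d(1)]])
qed

text \<open>Operations 7 and 8 are witnesses if the value is right; conversely, any other witnesses
  give the same value by \<open>UPG_unique\<close>.\<close>

lemma upgrade_mf:
  assumes B: "cden es ss B (\<lambda>t y. y \<in> Bt t)" and C: "cden es ss C (\<lambda>t y. y \<in> ouro_succ (Bt t) (it t))"
    and E: "cexp es ss E" and n: "den es n \<nu>" and v: "den es v \<xi>"
  shows "mf es ss (upgrade E B C n v) (AE (\<lambda>t. upgr (Bt t) (it t) (\<nu> t) = \<xi> t))"
  unfolding mf_def
proof (intro allI)
  fix zs ws
  let ?es = "es @ zs" and ?ss = "ss @ ws"
  let ?mU = "\<lambda>U a b. AE (\<lambda>t. pr (a t) (b t) \<in> EV (U t))"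
  let ?mA = "\<lambda>A b c m v. AE (\<lambda>t. pr (b t) (pr (c t) (pr (m t) (v t))) \<in> EV (A t))"
  let ?UPG = "UPG Bt (\<lambda>t. ouro_succ (Bt t) (it t))"
  have in_mf: "mf ?es ((?ss @ [U]) @ [A]) (is_upgrade E B C (rel2 (svr (length ?ss))) (rel4 (svr (length (?ss @ [U])))) \<^bold>\<and>
      rel2 (svr (length ?ss)) n v) (?UPG (?mU U) (?mA A) \<and> ?mU U \<nu> \<xi>)"
    if s: "U \<in> Ds" "A \<in> Ds" for U A
  proof -
    have U: "dens ((?ss @ [U]) @ [A]) (svr (length ?ss)) U" by (intro dens_mono dens_svr_last s)
    have A: "dens ((?ss @ [U]) @ [A]) (svr (length (?ss @ [U]))) A" by (intro dens_svr_last s)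
    have B': "cden ?es ((?ss @ [U]) @ [A]) B (\<lambda>t y. y \<in> Bt t)"
      "cden ?es ((?ss @ [U]) @ [A]) C (\<lambda>t y. y \<in> ouro_succ (Bt t) (it t))" "cexp ?es ((?ss @ [U]) @ [A]) E"
      using cden_mono[OF B] cden_mono[OF C] cexp_mono[OF E] by simp_all
    have mU: "mc2 ?es ((?ss @ [U]) @ [A]) (rel2 (svr (length ?ss))) (?mU U)"
      unfolding mc2_def by (intro allI impI mf_fden fden_rel2 dens_mono[OF U])
    have mA: "mc4 ?es ((?ss @ [U]) @ [A]) (rel4 (svr (length (?ss @ [U])))) (?mA A)"
      unfolding mc4_def by (intro allI impI mf_fden fden_rel4 dens_mono[OF A])
    show ?thesis
      by (rule mf_conj[OF mf_upgrade[OF B' mU mA] mf_fden[OF fden_rel2[OF U den_mono[OF n] den_mono[OF v]]]])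
  qed
  have UP: "?UPG (?mU (op 7)) (?mA (op 8))" using UPG_C by (simp add: EV_op in_g)
  have val: "?mU (op 7) \<nu> \<xi> \<longleftrightarrow> AE (\<lambda>t. upgr (Bt t) (it t) (\<nu> t) = \<xi> t)"
    using ouro.up_C[OF ouro_t] by (simp add: EV_op in_g)
  have "hold ?es ?ss (upgrade E B C n v) \<longleftrightarrow> (\<exists>U\<in>Ds. \<exists>A\<in>Ds. ?UPG (?mU U) (?mA A) \<and> ?mU U \<nu> \<xi>)"
    unfolding upgrade_def hold_exS
    by (intro bex_cong HOL.refl) (rule mf_hold[OF in_mf])
  also have "\<dots> \<longleftrightarrow> ?mU (op 7) \<nu> \<xi>"
  proof
    assume "\<exists>U\<in>Ds. \<exists>A\<in>Ds. ?UPG (?mU U) (?mA A) \<and> ?mU U \<nu> \<xi>"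
    then obtain U A where *: "U \<in> Ds" "A \<in> Ds" "?UPG (?mU U) (?mA A)" "?mU U \<nu> \<xi>" by blast
    show "?mU (op 7) \<nu> \<xi>"
      using UPG_unique[OF *(1) op_Ds *(2) op_Ds hier_Bt *(3) UP den_D[OF n] den_D[OF v]] *(4) by blast
  next
    assume "?mU (op 7) \<nu> \<xi>"
    then show "\<exists>U\<in>Ds. \<exists>A\<in>Ds. ?UPG (?mU U) (?mA A) \<and> ?mU U \<nu> \<xi>"
      using UP op_Ds by (intro bexI[of _ "op 7"] bexI[of _ "op 8"] conjI)
  qed
  finally show "hold ?es ?ss (upgrade E B C n v) \<longleftrightarrow> AE (\<lambda>t. upgr (Bt t) (it t) (\<nu> t) = \<xi> t)"
    unfolding val .
qed

end

end

section \<open>The Goodstein process in the cut\<close>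

context penv
begin

lemma stk_Nil: "stk [] r = r" by (simp add: stk_def fun_eq_iff)

lemma hierarchy_mf:
  assumes B: "cden es ss B (\<lambda>t y. y \<in> H t)"
  shows "mf es ss (hierarchy B)
    ((\<exists>b\<in>D. AE (\<lambda>t. b t \<in> H t)) \<and> \<not> AE (\<lambda>t. 0 \<in> H t) \<and> \<not> AE (\<lambda>t. 1 \<in> H t) \<and>
     (\<forall>b\<in>D. AE (\<lambda>t. b t \<in> H t) \<longrightarrow>
       (\<forall>s\<in>D. AE (\<lambda>t. p_min (\<lambda>y. y \<in> H t \<and> b t < y) (s t)) \<longrightarrow> AE (\<lambda>t. \<exists>z. s t = b t * z))))"
proof -
  have nxt: "mf es' ss' (is_min (\<lambda>y. B y \<^bold>\<and> b \<^bold>< y) s) (AE (\<lambda>t. p_min (\<lambda>y. y \<in> H t \<and> \<beta> t < y) (\<sigma> t)))"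
    if c: "cden es' ss' B (\<lambda>t y. y \<in> H t)" and b: "den es' b \<beta>" and s: "den es' s \<sigma>" for es' ss' b \<beta> s \<sigma>
    by (rule mf_fden, rule fden_min[OF _ s], rule cdenI, rule fden_conj[OF cdenD[OF cden_mono[OF c]] fden_less[OF den_mono[OF b]]])
  show ?thesis
    unfolding hierarchy_def
    by (insert assms, (assumption | rule mf_conj mf_all mf_ex mf_imp mf_neg mc1I nxt mf_fden[OF fden_dvds]
        mf_fden[OF cdenD[of _ _ B "\<lambda>t y. y \<in> H t"]] dens_tm |
      rule den_mono cden_mono)+)
qed

text \<open>\<open>Name\<close> denotes the same true hierarchy at every \<open>t\<close>, so the
  pointwise facts carry over.\<close>

lemma hierarchy_Name:
  assumes N: "base_hierarchy N"
  shows "sat (hierarchy (rel1 (\<lambda>s. Name)) 0 0) r0 S0"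
proof -
  have d: "dens ss (\<lambda>s. Name) (\<lambda>t. NmS)" for ss using NmS_Ds by (simp add: dens_def)
  have "cden [] [] (rel1 (\<lambda>s. Name)) (\<lambda>t y. y \<in> N)"
  proof (rule cdenI)
    fix zs ws x a assume "den ([] @ zs) x a"
    from fden_rel1[OF d this] show "fden ([] @ zs) ([] @ ws) (rel1 (\<lambda>s. Name) x) (\<lambda>t. a t \<in> N)" by simp
  qed
  note h = mf_hold[OF hierarchy_mf[OF this]]
  have "hold [] [] (hierarchy (rel1 (\<lambda>s. Name)))"
    unfolding h
  proof (intro conjI ballI impI)
    show "\<exists>b\<in>D. AE (\<lambda>t. b t \<in> N)"
      using hmin_in[OF hier_ne[OF N]] by (intro bexI[OF _ D_const[of "hmin N"]]) simp
    show "\<not> AE (\<lambda>t. 0 \<in> N)" "\<not> AE (\<lambda>t. 1 \<in> N)"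
      using N F_bot by (simp_all add: base_hierarchy_def eventually_const_iff)
    fix b s assume "AE (\<lambda>t. b t \<in> N)" "AE (\<lambda>t. p_min (\<lambda>y. y \<in> N \<and> b t < y) (s t))"
    then show "AE (\<lambda>t. \<exists>z. s t = b t * z)"
    proof eventually_elim
      case (elim t)
      then have st: "s t \<in> N" "b t < s t" "\<And>y. y \<in> N \<Longrightarrow> b t < y \<Longrightarrow> s t \<le> y" by (auto simp: p_min_def)
      obtain s' where "s' \<in> N" "b t < s'" "b t dvd s'" "\<And>y. y \<in> N \<Longrightarrow> b t < y \<Longrightarrow> s' \<le> y"
        using hier_next[OF N elim(1) st(1,2)] by blast
      then have "b t dvd s t" using st by (metis le_antisym)
      then show ?case by (simp add: dvd_def)
    qed
  qed
  then show ?thesis by (simp add: hold_def stk_Nil)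
qed

text \<open>The parameters are shifted past the variables in scope, so they keep their values under
  any number of quantifiers.\<close>

lemma class_of_hold:
  assumes "den es x a"
  shows "hold es ss (class_of \<beta> x) \<longleftrightarrow> sat \<beta> (case_nat a r0) S0"
proof -
  have 1: "(\<lambda>k t. tval (\<lambda>k. stk es r0 k t) (case_nat (x (length es)) (\<lambda>k. Var (k + length es)) k)) = case_nat a r0"
  proof
    fix k show "(\<lambda>t. tval (\<lambda>k. stk es r0 k t) (case_nat (x (length es)) (\<lambda>k. Var (k + length es)) k)) = case_nat a r0 k"
    proof (cases k)
      case 0
      have "\<forall>t. tval (\<lambda>k. stk (es @ []) r0 k t) (x (length (es @ []))) = a t" using assms unfolding den_def by blast
      then show ?thesis using 0 by simp
    qed (simp add: stk_def)
  qed
  have 2: "(\<lambda>k. stval (\<lambda>_. NmS) (stk ss S0) (SVar (k + length ss))) = S0" by (simp add: stk_def)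
  show ?thesis unfolding hold_def class_of_def sat_subst 1 2 ..
qed

end

context gcut
begin

context
  fixes e :: "nat \<Rightarrow> sname" and \<beta> :: fm
  assumes eD: "e \<in> Ds" and hminD: "(\<lambda>t. hmin (repair (EV (e t)))) \<in> D"
    and cls: "cden [] [] (class_of \<beta>) (\<lambda>t y. y \<in> repair (EV (e t)))"
begin

abbreviation "Xe \<equiv> \<lambda>t. repair (EV (e t))"

definition "eE = (\<lambda>t::nat. Op 0 0 [])"
definition "eH = (\<lambda>t. Op 1 0 [e t])"
definition "eG = (\<lambda>t. Op 2 0 [e t])"

lemma ops_Ds: "eE \<in> Ds" "eH \<in> Ds" "eG \<in> Ds"
  unfolding eE_def eH_def eG_def
  using Ds_Op[OF D_const, of "[]" 0 0] Ds_Op[OF D_const, of "[e]" 1 0] Ds_Op[OF D_const, of "[e]" 2 0] eD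
  by simp_all

lemma EV_ops:
  "EV (eE t) = g3 (\<lambda>b e v. v = b ^ e)"
  "EV (eH t) = g2 (\<lambda>i x. x \<in> hier_seq (Xe t) i)"
  "EV (eG t) = g3 (\<lambda>m i v. v = goodstein_seq (Xe t) m i)"
  by (simp_all add: eE_def eH_def eG_def gops_def Let_def)

lemma fden_E: "dens ss E eE \<Longrightarrow> den es x a \<Longrightarrow> den es y b \<Longrightarrow> den es z c \<Longrightarrow>
    fden es ss (rel3 E x y z) (\<lambda>t. c t = a t ^ b t)"
  using fden_rel3[of ss E eE es x a y b z c] by (simp add: EV_ops in_g)

lemma fden_H: "dens ss H eH \<Longrightarrow> den es i \<iota> \<Longrightarrow> den es x a \<Longrightarrow>
    fden es ss (rel2 H i x) (\<lambda>t. a t \<in> hier_seq (Xe t) (\<iota> t))"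
  using fden_rel2[of ss H eH es i \<iota> x a] by (simp add: EV_ops in_g)

lemma fden_G: "dens ss G eG \<Longrightarrow> den es x a \<Longrightarrow> den es y b \<Longrightarrow> den es z c \<Longrightarrow>
    fden es ss (rel3 G x y z) (\<lambda>t. c t = goodstein_seq (Xe t) (a t) (b t))"
  using fden_rel3[of ss G eG es x a y b z c] by (simp add: EV_ops in_g)

lemma cexp_E: "dens ss E eE \<Longrightarrow> cexp es ss (rel3 E)"
  unfolding cexp_def by (intro allI impI fden_E dens_mono)

lemma cden_H: "dens ss H eH \<Longrightarrow> den es i \<iota> \<Longrightarrow> cden es ss (rel2 H i) (\<lambda>t y. y \<in> hier_seq (Xe t) (\<iota> t))"
  by (rule cdenI) (rule fden_H[OF dens_mono den_mono])

lemma hier_Xe: "base_hierarchy (Xe t)" by (rule repair_hier)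

lemma exp_hold:
  assumes d: "dens ss E eE"
  shows "hold es ss (is_exp (rel3 E))"
proof -
  have 1: "mf es ss (is_exp (rel3 E)) (\<forall>b\<in>D. \<forall>e\<in>D. \<forall>v\<in>D. AE (\<lambda>t. v t = b t ^ e t) \<longleftrightarrow>
      (AE (\<lambda>t. e t = 0) \<and> AE (\<lambda>t. v t = 1)) \<or>
      (\<exists>e'\<in>D. \<exists>v'\<in>D. AE (\<lambda>t. e t = e' t + 1) \<and> AE (\<lambda>t. v' t = b t ^ e' t) \<and> AE (\<lambda>t. v t = v' t * b t)))"
    unfolding is_exp_def
    by (insert d, (assumption | rule mf_conj mf_disj mf_all mf_ex mf_iff mc1I mf_fden[OF fden_E] mf_fden[OF fden_eq] dens_tm |
        rule den_mono dens_mono)+)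
  have 2: "AE (\<lambda>t. v t = b t ^ e t) \<longleftrightarrow> (AE (\<lambda>t. e t = 0) \<and> AE (\<lambda>t. v t = 1)) \<or>
      (\<exists>e'\<in>D. \<exists>v'\<in>D. AE (\<lambda>t. e t = e' t + 1) \<and> AE (\<lambda>t. v' t = b t ^ e' t) \<and> AE (\<lambda>t. v t = v' t * b t))"
    (is "_ \<longleftrightarrow> ?A \<or> ?B") if D: "b \<in> D" "e \<in> D" "v \<in> D" for b e v
  proof
    assume v: "AE (\<lambda>t. v t = b t ^ e t)"
    have "AE (\<lambda>t. e t = 0 \<or> 0 < e t)" by (intro always_eventually) auto
    then consider "AE (\<lambda>t. e t = 0)" | "AE (\<lambda>t. 0 < e t)" unfolding AE_disj by blast
    then show "?A \<or> ?B"
    proof cases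
      case 1
      moreover have "AE (\<lambda>t. v t = 1)" using v 1 by eventually_elim simp
      ultimately show ?thesis by blast
    next
      case 2
      define e' where "e' t = e t - 1" for t
      define v' where "v' t = b t ^ e' t" for t
      have "e' \<in> D" using D(2) by (rule D_le) (simp add: e'_def)
      \<comment> \<open>The summand 1 covers the base 0, for which \<open>v\<close> is 0 while
        \<open>v'\<close> may be 0 to the power 0.\<close>
      moreover have "AE (\<lambda>t. v' t \<le> v t + 1)"
        using v 2
      proof eventually_elim
        case (elim t)
        show ?case
        proof (cases "b t = 0")
          case True
          then show ?thesis by (cases "e' t") (simp_all add: v'_def)
        next
          case False
          have "v t = v' t * b t" using elim by (cases "e t") (simp_all add: v'_def e'_def mult.commute)
          moreover have "v' t * 1 \<le> v' t * b t" using False by (intro mult_le_mono2) simp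
          ultimately show ?thesis by linarith
        qed
      qed
      then have "v' \<in> D" by (rule D_down[OF D_add[OF D(3) D_const]])
      moreover have "AE (\<lambda>t. e t = e' t + 1)" "AE (\<lambda>t. v' t = b t ^ e' t)"
        using 2 by (auto simp: e'_def v'_def elim!: eventually_mono)
      moreover have "AE (\<lambda>t. v t = v' t * b t)" using v \<open>AE (\<lambda>t. e t = e' t + 1)\<close>
        by eventually_elim (simp add: v'_def mult.commute)
      ultimately show ?thesis by blast
    qed
  next
    assume "?A \<or> ?B"
    then show "AE (\<lambda>t. v t = b t ^ e t)"
    proof (elim disjE conjE bexE)
      assume "AE (\<lambda>t. e t = 0)" "AE (\<lambda>t. v t = 1)"
      then show ?thesis by eventually_elim simp
    next
      fix e' v' assume "AE (\<lambda>t. e t = e' t + 1)" "AE (\<lambda>t. v' t = b t ^ e' t)" "AE (\<lambda>t. v t = v' t * b t)"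
      then show ?thesis by eventually_elim (simp add: mult.commute)
    qed
  qed
  show ?thesis unfolding mf_hold[OF 1] using 2 by blast
qed

lemma hierarchy_sequence_hold:
  assumes d: "dens ss E eE" "dens ss H eH"
  shows "hold [] ss (is_hierarchy_sequence (rel3 E) (class_of \<beta>) (rel2 H))"
proof -
  have c: "cden [] ss (class_of \<beta>) (\<lambda>t y. y \<in> Xe t)" using cden_mono[OF cls, of "[]" ss] by simp
  have 1: "mf [] ss (\<^bold>\<forall>x. rel2 H \<^bold>0 x \<^bold>\<longleftrightarrow> class_of \<beta> x)
     (\<forall>x\<in>D. AE (\<lambda>t. x t \<in> hier_seq (Xe t) 0) \<longleftrightarrow> AE (\<lambda>t. x t \<in> Xe t))"
    by (insert d c, (assumption | rule mf_all mf_iff mc1I mf_fden[OF fden_H] 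
        mf_fden[OF cdenD[of _ _ "class_of \<beta>" "\<lambda>t y. y \<in> Xe t"]] dens_tm | rule den_mono dens_mono cden_mono)+)
  have "hold ([] @ [p]) ss (is_ouroboros (rel3 E) (rel2 H (nv 0)) (nv 0 \<^bold>+ \<^bold>1) (rel2 H (nv 0 \<^bold>+ \<^bold>1)))"
    if p: "p \<in> D" for p
  proof -
    have n: "den ([] @ [p]) (nv 0) p" using den_nv_last[OF p, of "[]"] by simp
    have n1: "den ([] @ [p]) (nv 0 \<^bold>+ \<^bold>1) (\<lambda>t. p t + 1)" by (intro dens_tm n)
    show ?thesis
    proof (rule ouroboros_hold[OF eD p hminD])
      show "cden ([] @ [p]) ss (rel2 H (nv 0)) (\<lambda>t y. y \<in> Bt e p t)"
        using cden_H[OF d(2) n] unfolding Bt_def[OF eD p hminD] X_def[OF eD p hminD] .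
      show "den ([] @ [p]) (nv 0 \<^bold>+ \<^bold>1) (it p)"
        using n1 unfolding it_def[OF eD p hminD] by simp
      show "cexp ([] @ [p]) ss (rel3 E)" by (rule cexp_E[OF d(1)])
      show "cden ([] @ [p]) ss (rel2 H (nv 0 \<^bold>+ \<^bold>1)) (\<lambda>t y. y \<in> ouro_succ (Bt e p t) (it p t))"
        using cden_H[OF d(2) n1] unfolding oub_t[OF eD p hminD] X_def[OF eD p hminD] by simp
    qed
  qed
  then show ?thesis
    unfolding is_hierarchy_sequence_def hold_conj mf_hold[OF 1] by (simp add: hold_all)
qed

lemma upgrade_step:
  assumes d: "dens ss E eE" "dens ss H eH" and i: "den es i \<iota>" and g: "den es g \<gamma>" and v: "den es v \<xi>"
  shows "mf es ss (upgrade (rel3 E) (rel2 H i) (rel2 H (i \<^bold>+ \<^bold>1)) g v)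
    (AE (\<lambda>t. upgr (hier_seq (Xe t) (\<iota> t)) (Suc (\<iota> t)) (\<gamma> t) = \<xi> t))"
proof -
  note p = eD den_D[OF i] hminD
  have i1: "den es (i \<^bold>+ \<^bold>1) (\<lambda>t. \<iota> t + 1)" by (intro dens_tm i)
  have "mf es ss (upgrade (rel3 E) (rel2 H i) (rel2 H (i \<^bold>+ \<^bold>1)) g v) (AE (\<lambda>t. upgr (Bt e \<iota> t) (it \<iota> t) (\<gamma> t) = \<xi> t))"
  proof (rule upgrade_mf[OF p _ _ cexp_E[OF d(1)] g v])
    show "cden es ss (rel2 H i) (\<lambda>t y. y \<in> Bt e \<iota> t)"
      using cden_H[OF d(2) i] unfolding Bt_def[OF p] X_def[OF p] .
    show "cden es ss (rel2 H (i \<^bold>+ \<^bold>1)) (\<lambda>t y. y \<in> ouro_succ (Bt e \<iota> t) (it \<iota> t))"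
      using cden_H[OF d(2) i1] unfolding oub_t[OF p] X_def[OF p] by simp
  qed
  then show ?thesis unfolding Bt_def[OF p] X_def[OF p] it_def[OF p] .
qed

lemma goodstein_hold:
  assumes d: "dens ss E eE" "dens ss H eH" "dens ss G eG"
  shows "hold es ss (is_goodstein (rel3 E) (rel2 H) (rel3 G))"
proof -
  let ?v = "\<lambda>t i g. upgr (hier_seq (Xe t) i) (Suc i) g"
  have 1: "mf es ss (is_goodstein (rel3 E) (rel2 H) (rel3 G))
     (\<forall>m\<in>D. \<forall>i\<in>D. \<forall>v\<in>D. AE (\<lambda>t. v t = goodstein_seq (Xe t) (m t) (i t)) \<longleftrightarrow>
        (AE (\<lambda>t. i t = 0) \<and> AE (\<lambda>t. v t = m t)) \<or>
        (\<exists>i'\<in>D. \<exists>g\<in>D. AE (\<lambda>t. i t = i' t + 1) \<and> AE (\<lambda>t. g t = goodstein_seq (Xe t) (m t) (i' t)) \<and>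
          ((AE (\<lambda>t. 0 < g t) \<and> AE (\<lambda>t. ?v t (i' t) (g t) = v t + 1)) \<or> (AE (\<lambda>t. g t = 0) \<and> AE (\<lambda>t. v t = 0)))))"
    unfolding is_goodstein_def
    by (insert d, (assumption | rule mf_conj mf_disj mf_all mf_ex mf_iff mc1I mf_fden[OF fden_G] upgrade_step
          mf_fden[OF fden_eq] mf_fden[OF fden_less] dens_tm |
        rule den_mono dens_mono)+)
  have ge: "x \<le> ?v t i x" for t i x by (rule ouro.v_ge[OF hier_seq_ouro[OF hier_Xe]])
  have 2: "AE (\<lambda>t. v t = goodstein_seq (Xe t) (m t) (i t)) \<longleftrightarrow>
        (AE (\<lambda>t. i t = 0) \<and> AE (\<lambda>t. v t = m t)) \<or>
        (\<exists>i'\<in>D. \<exists>g\<in>D. AE (\<lambda>t. i t = i' t + 1) \<and> AE (\<lambda>t. g t = goodstein_seq (Xe t) (m t) (i' t)) \<and>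
          ((AE (\<lambda>t. 0 < g t) \<and> AE (\<lambda>t. ?v t (i' t) (g t) = v t + 1)) \<or> (AE (\<lambda>t. g t = 0) \<and> AE (\<lambda>t. v t = 0))))"
    (is "_ \<longleftrightarrow> ?A \<or> ?B") if D: "m \<in> D" "i \<in> D" "v \<in> D" for m i v
  proof
    assume v: "AE (\<lambda>t. v t = goodstein_seq (Xe t) (m t) (i t))"
    have "AE (\<lambda>t. i t = 0 \<or> 0 < i t)" by (intro always_eventually) auto
    then consider "AE (\<lambda>t. i t = 0)" | "AE (\<lambda>t. 0 < i t)" unfolding AE_disj by blast
    then show "?A \<or> ?B"
    proof cases
      case 1
      moreover have "AE (\<lambda>t. v t = m t)" using v 1 by eventually_elim simp
      ultimately show ?thesis by blast
    next
      case 2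
      define i' where "i' t = i t - 1" for t
      define g where "g t = goodstein_seq (Xe t) (m t) (i' t)" for t
      have i': "i' \<in> D" using D(2) by (rule D_le) (simp add: i'_def)
      have ii: "AE (\<lambda>t. i t = i' t + 1)" using 2 by (auto simp: i'_def elim!: eventually_mono)
      have cs: "AE (\<lambda>t. (0 < g t \<and> ?v t (i' t) (g t) = v t + 1) \<or> (g t = 0 \<and> v t = 0))"
        using v ii
      proof eventually_elim
        case (elim t)
        then show ?case using ge[of "g t" t "i' t"] by (auto simp: g_def)
      qed
      \<comment> \<open>Upgrading does not decrease a number, so the preceding term is controlled by
        the present one and lies in the cut.\<close>
      have "AE (\<lambda>t. g t \<le> v t + 1)" using cs
      proof eventually_elim
        case (elim t)
        then show ?case using ge[of "g t" t "i' t"] by auto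
      qed
      then have g: "g \<in> D" by (rule D_down[OF D_add[OF D(3) D_const]])
      have "AE (\<lambda>t. g t = goodstein_seq (Xe t) (m t) (i' t))" by (intro always_eventually) (simp add: g_def)
      then show ?thesis using i' g ii cs unfolding AE_disj AE_conj by blast
    qed
  next
    assume "?A \<or> ?B"
    then show "AE (\<lambda>t. v t = goodstein_seq (Xe t) (m t) (i t))"
    proof (elim disjE conjE bexE)
      assume "AE (\<lambda>t. i t = 0)" "AE (\<lambda>t. v t = m t)"
      then show ?thesis by eventually_elim simp
    next
      fix i' g assume "AE (\<lambda>t. i t = i' t + 1)" "AE (\<lambda>t. g t = goodstein_seq (Xe t) (m t) (i' t))"
        "AE (\<lambda>t. 0 < g t)" "AE (\<lambda>t. ?v t (i' t) (g t) = v t + 1)"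
      then show ?thesis by eventually_elim simp
    next
      fix i' g assume "AE (\<lambda>t. i t = i' t + 1)" "AE (\<lambda>t. g t = goodstein_seq (Xe t) (m t) (i' t))"
        "AE (\<lambda>t. g t = 0)" "AE (\<lambda>t. v t = 0)"
      then show ?thesis by eventually_elim simp
    qed
  qed
  show ?thesis unfolding mf_hold[OF 1] using 2 by blast
qed

text \<open>The quantified sets \<open>E\<close>, \<open>H\<close> and \<open>G\<close> are
  instantiated with operations 0 to 2, for which the premises hold.\<close>

lemma termination_goodstein_seq:
  assumes T: "sat (goodstein_termination \<beta>) r0 S0" and m: "m \<in> D"
  shows "\<exists>i\<in>D. AE (\<lambda>t. goodstein_seq (Xe t) (m t) (i t) = 0)"
proof -
  let ?E = "svr 0" and ?H = "svr 1" and ?G = "svr 2" and ?ss = "[eE, eH, eG]"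
  have "hold [] [] (\<^bold>\<forall>\<^sub>S E H G. is_exp (rel3 E) \<^bold>\<and> is_hierarchy_sequence (rel3 E) (class_of \<beta>) (rel2 H) \<^bold>\<and>
        is_goodstein (rel3 E) (rel2 H) (rel3 G) \<^bold>\<longrightarrow> (\<^bold>\<forall>m. \<^bold>\<exists>i. rel3 G m i \<^bold>0))"
    using T unfolding goodstein_termination_def hold_def by (simp add: stk_Nil)
  then have imp: "hold [] ?ss (is_exp (rel3 ?E) \<^bold>\<and> is_hierarchy_sequence (rel3 ?E) (class_of \<beta>) (rel2 ?H) \<^bold>\<and>
        is_goodstein (rel3 ?E) (rel2 ?H) (rel3 ?G) \<^bold>\<longrightarrow> (\<^bold>\<forall>m. \<^bold>\<exists>i. rel3 ?G m i \<^bold>0))"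
    unfolding hold_allS using ops_Ds by (auto simp: numeral_2_eq_2)
  have d: "dens ?ss ?E eE" "dens ?ss ?H eH" "dens ?ss ?G eG"
    using dens_svr[of 0 ?ss] dens_svr[of 1 ?ss] dens_svr[of 2 ?ss] ops_Ds by simp_all
  have 1: "hold [] ?ss (\<^bold>\<forall>m. \<^bold>\<exists>i. rel3 ?G m i \<^bold>0)"
    using imp exp_hold[OF d(1)] hierarchy_sequence_hold[OF d(1,2)] goodstein_hold[OF d]
    unfolding hold_imp hold_conj by blast
  have "mf [] ?ss (\<^bold>\<forall>m. \<^bold>\<exists>i. rel3 ?G m i \<^bold>0) (\<forall>m\<in>D. \<exists>i\<in>D. AE (\<lambda>t. 0 = goodstein_seq (Xe t) (m t) (i t)))"
    by (insert d, (assumption | rule mf_all mf_ex mc1I mf_fden[OF fden_G] dens_tm | rule den_mono dens_mono)+)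
  then show ?thesis using mf_hold 1 m by (simp add: eq_commute[of 0])
qed

end

end

context gcut
begin

lemma AE_False: "\<not> AE (\<lambda>t. False)" using F_bot by (simp add: eventually_const_iff)

lemma AE_const: "AE (\<lambda>t. P) \<longleftrightarrow> P" using F_bot by (simp add: eventually_const_iff)

text \<open>
  The set that \<open>\<beta>\<close> defines satisfies the divisibility condition throughout the cut, so that
  \<open>repair\<close> changes it only above the cut.
\<close>

lemma defined_hierarchy:
  assumes B: "base_hierarchy B"
    and num: "\<And>k. sat \<beta> (case_nat (\<lambda>t. k) r0) S0 \<longleftrightarrow> k \<in> B"
    and set: "sat ((\<^bold>\<exists>\<^sub>S X. \<^bold>\<forall>x. rel1 X x \<^bold>\<longleftrightarrow> class_of \<beta> x) 0 0) r0 S0"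
    and hier: "sat (hierarchy (class_of \<beta>) 0 0) r0 S0"
  obtains e where "e \<in> Ds" "(\<lambda>t. hmin (repair (EV (e t)))) \<in> D"
    "cden [] [] (class_of \<beta>) (\<lambda>t y. y \<in> repair (EV (e t)))"
    "\<And>y. AE (\<lambda>t. \<forall>x\<le>y. x \<in> repair (EV (e t)) \<longleftrightarrow> x \<in> B)"
proof -
  have "hold [] [] (\<^bold>\<exists>\<^sub>S X. \<^bold>\<forall>x. rel1 X x \<^bold>\<longleftrightarrow> class_of \<beta> x)"
    using set unfolding hold_def by (simp add: stk_Nil)
  then obtain e where e: "e \<in> Ds"
    "hold [] [e] (\<^bold>\<forall>x. rel1 (svr 0) x \<^bold>\<longleftrightarrow> class_of \<beta> x)"
    unfolding hold_exS by auto
  have eq: "sat \<beta> (case_nat y r0) S0 \<longleftrightarrow> AE (\<lambda>t. y t \<in> EV (e t))" if y: "y \<in> D" for y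
  proof -
    have "hold [y] [e] (rel1 (svr 0) (nv 0)) \<longleftrightarrow> hold [y] [e] (class_of \<beta> (nv 0))"
      using e(2) y unfolding hold_all hold_iff by simp
    moreover have n: "den [y] (nv 0) y" and "dens [e] (svr 0) e"
      using den_nv[of 0 "[y]"] dens_svr[of 0 "[e]"] y e(1) by simp_all
    then have "hold [y] [e] (rel1 (svr 0) (nv 0)) \<longleftrightarrow> AE (\<lambda>t. y t \<in> EV (e t))"
      using fden_rel1[of "[e]" "svr 0" e "[y]" "nv 0" y] mf_hold[OF mf_fden] by blast
    ultimately show ?thesis using class_of_hold[OF n] by blast
  qed
  define H where "H t = EV (e t)" for t
  have c: "cden [] [] (class_of \<beta>) (\<lambda>t y. y \<in> H t)"
  proof (rule cdenI)
    fix zs ws x a assume x: "den ([] @ zs) x a"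
    show "fden ([] @ zs) ([] @ ws) (class_of \<beta> x) (\<lambda>t. a t \<in> H t)"
      unfolding fden_def H_def using class_of_hold[OF den_mono[OF x]] eq[OF den_D[OF x]] by blast
  qed
  have dvd: "AE (\<lambda>t. \<exists>z. s t = b t * z)"
    if "b \<in> D" "s \<in> D" "AE (\<lambda>t. b t \<in> H t)" "AE (\<lambda>t. p_min (\<lambda>y. y \<in> H t \<and> b t < y) (s t))" for b s
  proof -
    have "hold [] [] (hierarchy (class_of \<beta>))" using hier unfolding hold_def by (simp add: stk_Nil)
    then show ?thesis unfolding mf_hold[OF hierarchy_mf[OF c]] using that by blast
  qed
  have std: "AE (\<lambda>t. k \<in> H t \<longleftrightarrow> k \<in> B)" for k
    using num[of k] eq[OF D_const[of k]] unfolding AE_iff AE_const H_def by blast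
  let ?b = "hmin B"
  have b: "?b \<in> B" by (rule hmin_in[OF hier_ne[OF B]])
  have "AE (\<lambda>t. \<forall>k\<in>{..?b}. k \<in> H t \<longleftrightarrow> k \<in> B)" by (rule eventually_ball_finite) (use std in auto)
  moreover have "AE (\<lambda>t. 1 \<in> H t \<longleftrightarrow> 1 \<in> B)" by (rule std)
  \<comment> \<open>The minimum of \<open>B\<close> is standard, so for almost all \<open>t\<close>
    it survives the truncation and the default hierarchy of \<open>repair\<close> is
    avoided.\<close>
  ultimately have fx: "AE (\<lambda>t. repair (H t) = hier_part (H t))"
  proof eventually_elim
    case (elim t)
    have "?b \<in> hier_part (H t)"
      unfolding hier_part_def
    proof (intro CollectI conjI ballI impI)
      show "?b \<in> H t" using elim b by simp
      fix y z assume "y \<in> H t" "y < z \<and> z \<le> ?b \<and> (\<forall>w\<in>H t. y < w \<longrightarrow> z \<le> w)"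
      then have "y \<in> B" "y < ?b" using elim by auto
      then show "y dvd z" using hmin_le[of y B] by simp
    qed
    moreover have "0 \<notin> H t" "1 \<notin> H t" using elim B by (auto simp: base_hierarchy_def)
    ultimately show ?case unfolding repair_def by auto
  qed
  have agree: "AE (\<lambda>t. x t \<in> H t \<longleftrightarrow> x t \<in> repair (H t))" if x: "x \<in> D" for x
    unfolding AE_iff
  proof
    assume "AE (\<lambda>t. x t \<in> repair (H t))"
    then show "AE (\<lambda>t. x t \<in> H t)" using fx by eventually_elim (auto simp: hier_part_def)
  next
    assume xH: "AE (\<lambda>t. x t \<in> H t)"
    show "AE (\<lambda>t. x t \<in> repair (H t))"
    proof (rule ccontr)
      assume "\<not> ?thesis"
      then have "AE (\<lambda>t. x t \<notin> repair (H t))" unfolding AE_not .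
      then have "AE (\<lambda>t. \<exists>y z. y \<in> H t \<and> p_min (\<lambda>w. w \<in> H t \<and> y < w) z \<and> z \<le> x t \<and> \<not> y dvd z)"
        using fx xH
      proof eventually_elim
        case (elim t)
        then obtain y z where "y \<in> H t" "z \<in> H t" "y < z" "z \<le> x t" "\<forall>w\<in>H t. y < w \<longrightarrow> z \<le> w" "\<not> y dvd z"
          by (auto simp: hier_part_def)
        then show ?case by (intro exI[of _ y] exI[of _ z]) (auto simp: p_min_def)
      qed
      then obtain y where y: "y \<in> D" "AE (\<lambda>t. \<exists>z. y t \<in> H t \<and> p_min (\<lambda>w. w \<in> H t \<and> y t < w) z \<and> z \<le> x t \<and> \<not> y t dvd z)"
        by (rule AE_obtain[OF _ x]) (auto simp: p_min_def intro!: always_eventually)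
      from y(2) obtain z where z: "z \<in> D" "AE (\<lambda>t. y t \<in> H t \<and> p_min (\<lambda>w. w \<in> H t \<and> y t < w) (z t) \<and> z t \<le> x t \<and> \<not> y t dvd z t)"
        by (rule AE_obtain[OF _ x]) (auto intro!: always_eventually)
      have "AE (\<lambda>t. y t \<in> H t)" "AE (\<lambda>t. p_min (\<lambda>w. w \<in> H t \<and> y t < w) (z t))"
        using z(2) by (auto elim!: eventually_mono)
      from dvd[OF y(1) z(1) this] z(2) have "AE (\<lambda>t. False)" by eventually_elim (auto simp: dvd_def)
      then show False using AE_False by blast
    qed
  qed
  have std': "AE (\<lambda>t. k \<in> repair (H t) \<longleftrightarrow> k \<in> B)" for k
    using std[of k] agree[OF D_const[of k]] by eventually_elim simp
  show ?thesis
  proof (rule that[OF e(1)])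
    have "AE (\<lambda>t. hmin (repair (H t)) \<le> ?b)" using std'[of ?b] by eventually_elim (simp add: b hmin_le)
    then show "(\<lambda>t. hmin (repair (EV (e t)))) \<in> D" unfolding H_def by (rule D_down[OF D_const])
    show "cden [] [] (class_of \<beta>) (\<lambda>t y. y \<in> repair (EV (e t)))"
      using cden_cong[OF c agree] unfolding H_def .
    show "AE (\<lambda>t. \<forall>x\<le>y. x \<in> repair (EV (e t)) \<longleftrightarrow> x \<in> B)" for y
    proof -
      have "AE (\<lambda>t. \<forall>x\<in>{..y}. x \<in> repair (EV (e t)) \<longleftrightarrow> x \<in> B)"
        by (rule eventually_ball_finite) (use std' in \<open>auto simp: H_def\<close>)
      then show ?thesis by (simp add: Ball_def)
    qed
  qed
qed

end

lemma tval_num [simp]: "tval r (num k) = k" by (induction k) auto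

lemma (in model) naming_valid:
  assumes N: "base_hierarchy N" and q: "q \<in> naming N"
  shows "valid q"
  unfolding valid_def
proof (intro allI impI)
  fix r S assume "envs r S"
  then interpret penv F N ops D r S by unfold_locales
  consider k where "k \<in> N" "q = Mem (num k) Name" | k where "k \<notin> N" "q = Neg (Mem (num k) Name)"
    | "q = hierarchy (rel1 (\<lambda>s. Name)) 0 0" using q unfolding naming_def by blast
  then show "sat q r S"
    by cases (use hierarchy_Name[OF N] F_bot in \<open>auto simp: eventually_const_iff\<close>)
qed

theorem theorem8p10:
  fixes n :: nat and B\<^sub>0 :: "nat set" and T :: "fm set" and \<beta> :: fm
  assumes "n > 0"
    and "base_hierarchy B\<^sub>0"
    and "\<nexists>k. k \<ge> 2 \<and> bounded_hierarchy n k B\<^sub>0"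
    and "T = RCA0 \<union> IND (Sigma0 (2 * n + 2)) \<union> naming B\<^sub>0"
    and "defines_hierarchy T \<beta> B\<^sub>0"
  shows "\<not> T \<turnstile> goodstein_termination \<beta>"
proof
  assume prov: "T \<turnstile> goodstein_termination \<beta>"
  obtain y where y: "\<And>X. base_hierarchy X \<Longrightarrow> (\<And>x. x \<le> y \<Longrightarrow> x \<in> X \<longleftrightarrow> x \<in> B\<^sub>0) \<Longrightarrow>
      chain_number X (n + 1) y \<or> square_gap X y"
    using unbounded_start[OF assms(2,3)] by blast
  \<comment> \<open>Two exponentials for each of the \<open>n + 1\<close> bases above the least one
    of the chain, and one for each quantifier of the induction formulas.\<close>
  define k where "k = 2 * (n + 1)"
  define a where "a t = tower k t" for t
  define s where "s t = t + 2" for t :: nat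
  \<comment> \<open>The least end point, so that the ordinal is still nonzero at all earlier
    indices.\<close>
  define e where "e t = (LEAST e. s t \<le> e \<and> run (a t) [s t..<e] = Ord [])" for t
  have e: "s t \<le> e t \<and> run (a t) [s t..<e t] = Ord []" for t
    unfolding e_def by (rule LeastI_ex) (use run_terminates[of "s t" "a t"] in auto)
  have less_e: "run (a t) [s t..<u] \<noteq> Ord []" if "s t \<le> u" "u < e t" for t u
    using not_less_Least[of u "\<lambda>e. s t \<le> e \<and> run (a t) [s t..<e] = Ord []"] that unfolding e_def by blast
  \<comment> \<open>From \<open>t = 62\<close> on all indices are at least 64, as the thinning
    requires.\<close>
  have "\<forall>t. \<exists>Y Ms. 62 \<le> t \<longrightarrow> length Ms = k \<and> set Y \<subseteq> {s t..<e t} \<and> t \<le> length Y \<and> spaced k Y \<and>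
      (\<forall>i<k. decides (witnesses B\<^sub>0 gops (drop (Suc i) Ms)) (Ms ! i) (set Y))"
  proof
    fix t
    show "\<exists>Y Ms. 62 \<le> t \<longrightarrow> length Ms = k \<and> set Y \<subseteq> {s t..<e t} \<and> t \<le> length Y \<and> spaced k Y \<and>
      (\<forall>i<k. decides (witnesses B\<^sub>0 gops (drop (Suc i) Ms)) (Ms ! i) (set Y))"
    proof (cases "62 \<le> t")
      case True
      then show ?thesis
        using thin_tower[OF spaced_upt[of "s t" "e t"], of k t "witnesses B\<^sub>0 gops" "[]"] e[of t]
        by (auto simp: a_def s_def)
    qed simp
  qed
  then obtain Y Ms where YM: "\<And>t. 62 \<le> t \<Longrightarrow> length (Ms t) = k \<and> set (Y t) \<subseteq> {s t..<e t} \<and>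
      t \<le> length (Y t) \<and> spaced k (Y t) \<and>
      (\<forall>i<k. decides (witnesses B\<^sub>0 gops (drop (Suc i) (Ms t))) (Ms t ! i) (set (Y t)))"
    by metis
  have Y: "length (Ms t) = k" "set (Y t) \<subseteq> {s t..<e t}" "t \<le> length (Y t)" "spaced k (Y t)"
      "\<forall>i<k. decides (witnesses B\<^sub>0 gops (drop (Suc i) (Ms t))) (Ms t ! i) (set (Y t))" if "62 \<le> t" for t
    using YM[OF that] by blast+
  obtain F :: "nat filter" where F: "F \<noteq> bot" "F \<le> sequentially" "\<And>P. eventually P F \<or> eventually (\<lambda>t. \<not> P t) F"
    using ultrafilter_ex by blast
  interpret ultra F by unfold_locales (use F in auto)
  have Yn: "s t \<le> Y t ! j \<and> Y t ! j < e t" if "62 + j < t" for t j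
  proof -
    have "Y t ! j \<in> set (Y t)" using Y(3)[of t] that by simp
    then show ?thesis using Y(2)[of t] that by auto
  qed
  interpret cut F B\<^sub>0 gops k Y Ms
  proof
    show "3 \<le> k" using assms(1) by (simp add: k_def)
    show "AE (\<lambda>t. j < length (Y t))" for j
      using AE_large[of "63 + j"]
    proof eventually_elim
      case (elim t)
      then show ?case using Y(3)[of t] by simp
    qed
    show "AE (\<lambda>t. c \<le> Y t ! 0)" for c
      using AE_large[of "63 + c"]
    proof eventually_elim
      case (elim t)
      then show ?case using Yn[of 0 t] by (simp add: s_def)
    qed
    show "AE (\<lambda>t. spaced k (Y t))" using AE_large[of 62] Y(4) by (rule eventually_mono)
    show "AE (\<lambda>t. length (Ms t) = k)" using AE_large[of 62] Y(1) by (rule eventually_mono)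
    show "AE (\<lambda>t. \<forall>i<k. decides (witnesses B\<^sub>0 gops (drop (Suc i) (Ms t))) (Ms t ! i) (set (Y t)))"
      using AE_large[of 62] Y(5) by (rule eventually_mono)
  qed
  let ?r0 = "\<lambda>k t. 0" and ?S0 = "\<lambda>k t. NmS"
  have env: "envs ?r0 ?S0" unfolding envs_def using D_const NmS_Ds by simp
  interpret gcut F B\<^sub>0 k Y Ms ?r0 ?S0 by unfold_locales (rule env)
  have valid: "valid p" if "T \<turnstile> p" for p
  proof (rule soundness[OF that])
    fix q assume "q \<in> T"
    then show "valid q"
      unfolding assms(4) RCA0_def
    proof (elim UnE)
      show "valid q" if "q \<in> IND (Sigma0 1)" by (rule IND_valid[OF that]) (use k3 in simp)
      show "valid q" if "q \<in> IND (Sigma0 (2 * n + 2))" by (rule IND_valid[OF that]) (simp add: k_def)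
    qed (fact basic_axioms_valid Delta1_CA_valid naming_valid[OF assms(2)])+
  qed
  then have sat: "sat p ?r0 ?S0" if "T \<turnstile> p" for p using that env unfolding valid_def by blast
  have num: "sat \<beta> (case_nat (\<lambda>t. k) ?r0) ?S0 \<longleftrightarrow> k \<in> B\<^sub>0" for k
    using sat[of "inst \<beta> (num k)"] sat[of "Neg (inst \<beta> (num k))"] assms(5)
    unfolding defines_hierarchy_def by (auto simp: sat_inst)
  have set: "sat ((\<^bold>\<exists>\<^sub>S X. \<^bold>\<forall>x. rel1 X x \<^bold>\<longleftrightarrow> class_of \<beta> x) 0 0) ?r0 ?S0"
    and hier: "sat (hierarchy (class_of \<beta>) 0 0) ?r0 ?S0"
    by (rule sat, use assms(5) in \<open>simp add: defines_hierarchy_def\<close>)+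
  obtain g where g: "g \<in> Ds" "(\<lambda>t. hmin (repair (EV (g t)))) \<in> D"
    "cden [] [] (class_of \<beta>) (\<lambda>t y. y \<in> repair (EV (g t)))"
    and agree: "\<And>y. AE (\<lambda>t. \<forall>x\<le>y. x \<in> repair (EV (g t)) \<longleftrightarrow> x \<in> B\<^sub>0)"
    by (rule defined_hierarchy[OF assms(2) num set hier]) (rule that; assumption)
  have "AE (\<lambda>t. t \<le> Y t ! 0)" using AE_large[of 63]
  proof eventually_elim
    case (elim t)
    then show ?case using Yn[of 0 t] by (simp add: s_def)
  qed
  \<comment> \<open>The starting number is nonstandard but in the cut, since every index of the
    descent exceeds \<open>t\<close>.\<close>
  then have "(\<lambda>t. t) \<in> D" unfolding D_def by blast
  then have "(\<lambda>t. y + (t + 3)) \<in> D" by (intro D_add D_const)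
  then obtain i where i: "i \<in> D" "AE (\<lambda>t. goodstein_seq (repair (EV (g t))) (y + (t + 3)) (i t) = 0)"
    using termination_goodstein_seq[OF g sat[OF prov]] by blast
  then obtain j where "AE (\<lambda>t. i t \<le> Y t ! j)" unfolding D_def by blast
  moreover note i(2) agree[of y] AE_large[of "63 + j + n"]
  ultimately have "AE (\<lambda>t. False)"
  proof eventually_elim
    case (elim t)
    let ?X = "repair (EV (g t))" and ?u = "Y t ! j"
    have X: "base_hierarchy ?X" by (rule repair_hier)
    have u: "s t \<le> ?u" "?u < e t" using Yn[of j t] elim(4) by auto
    have "dominates (n + 1) (hier_seq ?X) (s t) (goodstein_seq ?X (y + (t + 3)) (s t)) (a t)"
      unfolding s_def a_def k_def
      by (rule goodstein_seq_dominates[OF X y[OF X]]) (use elim in auto)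
    then have "goodstein_seq ?X (y + (t + 3)) ?u \<noteq> 0" using goodstein_seq_pos[OF X _ u(1) less_e[OF u]] by blast
    then show ?case using goodstein_seq_zero[OF elim(2,1)] by simp
  qed
  then show False by (rule notE[OF AE_False])
qed

end
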